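(* Let $C\in\mathbb{C}\hat W$ be an admissible element and let $\mathfrak{D}_C=(\mathcal{D}-\phi)+\rho(C)\in\mathsf{A}\otimes\mathcal{C}$. Then there is an algebra homomorphism $$\zeta_C\colon Z(\mathsf{A})\to Z\hat W$$ (where $Z(\mathsf{A})$ is the centre of $\mathsf{A}$ and $Z\hat W$ is the centre of $\mathbb{C}\hat W$) such that for every $z\in Z(\mathsf{A})$ there exists $a\in\mathsf{A}\otimes\mathcal{C}$ satisfying $$z\otimes 1=\rho(\zeta_C(z))+\mathfrak{D}_C\,a+a\,\mathfrak{D}_C .$$
   Context: Setting. $(E,B)$ is a Euclidean space of dimension $n$ affording the reflection representation of a finite (real) reflection group $W\subset\mathsf{O}(E,B)$. $R\subset E^*$ is the root system, $R^\vee\subset E$ the dual root system with $\langle\alpha,\alpha^\vee\rangle=2$, where $\langle-,-\rangle\colon E^*\times E\to\mathbb{R}$ is the natural pairing; $s_\alpha(y)=y-\langle\alpha,y\rangle\alpha^\vee$. A positive system $R_+$ (with simple roots $\Delta$) is fixed, and $c\colon R_+\to\mathbb{C}$, $\alpha\mapsto c_\alpha$, is a $W$-invariant parameter function. Put $\mathfrak{h}=E_{\mathbb{C}}$, $\mathfrak{h}^*=E^*_{\mathbb{C}}$. Fix an orthonormal basis $y_1,\dots,y_n$ of $E$ and let $x_1,\dots,x_n$ be the dual basis of $E^*$. Rational Cherednik algebra $\mathsf{H}$: the quotient of the smash product $T(\mathfrak{h}^*\oplus\mathfrak{h})\#W$ by $[x,x']=0=[y,y']$ and $[y,x]=\langle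 x,y\rangle+\sum_{\alpha>0}c_\alpha\langle\alpha,y\rangle\langle x,\alpha^\vee\rangle s_\alpha$ for $x,x'\in\mathfrak{h}^*$, $y,y'\in\mathfrak{h}$. Dunkl angular momentum algebra $\mathsf{A}$: the associative subalgebra of $\mathsf{H}$ generated by $W$ and the elements $M_{ij}=x_iy_j-x_jy_i$, $1\le i<j\le n$. $\mathfrak{sl}(2)$-triple: $H=\tfrac12\sum_i(x_iy_i+y_ix_i)$, $X=-\tfrac12\sum_ix_i^2$, $Y=\tfrac12\sum_iy_i^2$, and Casimir $\Omega_{\mathfrak{sl}(2)}=H^2+2(XY+YX)$. $Z=\sum_{\alpha>0}c_\alpha s_\alpha\in\mathbb{C}W$ and $\phi=\tfrac12(2Z+n-2)$. Clifford algebra: $\mathcal{C}_{\mathbb{R}}$ is the real algebra generated by $E$ with relations $yy'+y'y=2B(y,y')$; $c_i\in\mathcal{C}_{\mathbb R}$ is the image of $y_i$, so $c_ic_j+c_jc_i=2\delta_{ij}$; $\mathcal{C}=\mathcal{C}_{\mathbb{R}}\otimes\mathbb{C}$. Let $\varepsilon$ be the automorphism of $\mathcal{C}_{\mathbb R}$ that is $-1$ on $E$, ${}^t$ the anti-automorphism that is the identity on $E$, and $\eta^*=\varepsilon(\eta^t)$. The group $\mathsf{Pin}$ consists of invertible $\eta\in\mathcal{C}_{\mathbb R}$ with $\varepsilon(\eta)y\eta^{-1}\in E$ for all $y\in E$ and $(\eta^*\eta)^2=1$; $p\colon\mathsf{Pin}\to\mathsf{O}(E,B)$, $p(\eta)y=\varepsilon(\eta)y\eta^{-1}$,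 is a double cover with kernel $\{\pm1\}$. $\tilde W=p^{-1}(W)$; write $\theta=-1\in\tilde W$. The star operation on $\mathbb{C}\tilde W$ is the anti-linear extension of the restriction of $*$ to $\tilde W$. Let $w_0\in W$ be the longest element and $(-1)_{\mathfrak{h}}=-\mathrm{Id}\in\mathrm{End}(\mathfrak{h})$. If $w_0\ne(-1)_{\mathfrak h}$ set $\hat W=\tilde W$; if $w_0=(-1)_{\mathfrak h}$ set $\hat W=\tilde W\times C_2$, the generator of $C_2$ being also denoted $(-1)_{\mathfrak h}$. $\rho\colon\mathbb{C}\hat W\to\mathsf{A}\otimes\mathcal{C}$ is the algebra homomorphism with $\rho(\tilde w)=p(\tilde w)\otimes\tilde w$ for $\tilde w\in\tilde W$ ($\tilde w$ in the second factor viewed in $\mathcal{C}$), and, when $w_0=(-1)_{\mathfrak h}$, $\rho((-1)_{\mathfrak h})=(-1)_{\mathfrak h}\otimes1=w_0\otimes 1$. The star operation is extended by $(-1)_{\mathfrak h}^*=(-1)_{\mathfrak h}$. $C\in\mathbb{C}\hat W$ is called admissible if $C$ is central in $\mathbb{C}\hat W$ and $C^*=C$. The AMA-Dirac element is $\mathcal{D}=\sum_{i<j}M_{ij}\otimes c_ic_j\in\mathsf{A}\otimes\mathcal{C}$; elements $a\in\mathsf{A}$ are identified with $a\otimes1$. Description of the centre used in the paper: $Z(\mathsf{A})=\mathcal{R}[\Omega_{\mathfrak{sl}(2)}]$, the polynomial ring in $\Omega_{\mathfrak{sl}(2)}$ with coefficients in $\mathcal{R}=\mathbb{C}[(-1)_{\mathfrak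 h}]$ if $w_0=(-1)_{\mathfrak h}$, and $\mathcal{R}=\mathbb{C}$ otherwise. *)

theory Defs
  imports "HOL-Analysis.Analysis" "HOL-Algebra.QuotRing" "HOL-Algebra.Module"
begin

section \<open>Associative unital algebras over a field\<close>

text \<open>
  A (not necessarily commutative) associative unital algebra over a field \<open>'k\<close> is carried by the
  record type \<open>('k, 'a) module\<close>, i.e. a ring together with a scalar multiplication.
\<close>

subsection \<open>Monoid algebras: free algebras and group algebras\<close>

definition monoid_alg :: "('m, 'x) monoid_scheme \<Rightarrow> ('k::field, 'm \<Rightarrow> 'k) module" where
  "monoid_alg M =
    \<lparr>carrier = {f. finite {x. f x \<noteq> 0} \<and> {x. f x \<noteq> 0} \<subseteq> carrier M},
     mult = (\<lambda>f g x. \<Sum>(u, v) \<in> {(u, v). f u \<noteq> 0 \<and> g v \<noteq> 0 \<and> u \<otimes>\<^bsub>M\<^esub> v = x}. f u * g v),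
     one = (\<lambda>x. if x = \<one>\<^bsub>M\<^esub> then 1 else 0),
     zero = (\<lambda>x. 0),
     add = (\<lambda>f g x. f x + g x),
     smult = (\<lambda>k f x. k * f x)\<rparr>"

definition single :: "'m \<Rightarrow> 'm \<Rightarrow> 'k::field" where
  "single m = (\<lambda>x. if x = m then 1 else 0)"

definition free_monoid :: "'g set \<Rightarrow> 'g list monoid" where
  "free_monoid S = \<lparr>carrier = lists S, mult = (@), one = []\<rparr>"

definition free_alg :: "'g set \<Rightarrow> ('k::field, 'g list \<Rightarrow> 'k) module" where
  "free_alg S = monoid_alg (free_monoid S)"

definition gen :: "'g \<Rightarrow> 'g list \<Rightarrow> 'k::field" where
  "gen g = single [g]"

subsection \<open>Quotients, tensor products, complexification\<close>

definition alg_quot :: "('k, 'a) module \<Rightarrow> 'a set \<Rightarrow> ('k, 'a set) module" where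
  "alg_quot F S =
    (let J = Idl\<^bsub>F\<^esub> S; Q = F Quot J in
     \<lparr>carrier = carrier Q, mult = mult Q, one = one Q, zero = zero Q, add = add Q,
      smult = (\<lambda>k X. \<Union>f\<in>X. J +>\<^bsub>F\<^esub> (k \<odot>\<^bsub>F\<^esub> f))\<rparr>)"

definition alg_cls :: "('k, 'a) module \<Rightarrow> 'a set \<Rightarrow> 'a \<Rightarrow> 'a set" where
  "alg_cls F S f = (Idl\<^bsub>F\<^esub> S) +>\<^bsub>F\<^esub> f"

text \<open>
  The tensor product is the quotient of the free vector space on \<open>A \<times> B\<close> by the bilinearity
  relations. The free vector space is made an algebra by \<open>(a, b) (a', b') = (a a', b b')\<close>; the
  span of the bilinearity relations is then a two-sided ideal, so that it may be replaced by the
  ideal generated.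
\<close>

definition tensor_free ::
    "('k::field, 'a) module \<Rightarrow> ('k, 'b) module \<Rightarrow> ('k, 'a \<times> 'b \<Rightarrow> 'k) module" where
  "tensor_free A B = monoid_alg (A \<times>\<times> B)"

definition bilinear_rels ::
    "('k::field, 'a) module \<Rightarrow> ('k, 'b) module \<Rightarrow> ('a \<times> 'b \<Rightarrow> 'k) set" where
  "bilinear_rels A B = (let F = tensor_free A B in
     {single (a \<oplus>\<^bsub>A\<^esub> a', b) \<ominus>\<^bsub>F\<^esub> (single (a, b) \<oplus>\<^bsub>F\<^esub> single (a', b)) | a a' b.
        a \<in> carrier A \<and> a' \<in> carrier A \<and> b \<in> carrier B}
   \<union> {single (a, b \<oplus>\<^bsub>B\<^esub> b') \<ominus>\<^bsub>F\<^esub> (single (a, b) \<oplus>\<^bsub>F\<^esub> single (a, b')) | a b b'.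
        a \<in> carrier A \<and> b \<in> carrier B \<and> b' \<in> carrier B}
   \<union> {single (k \<odot>\<^bsub>A\<^esub> a, b) \<ominus>\<^bsub>F\<^esub> (k \<odot>\<^bsub>F\<^esub> single (a, b)) | k a b.
        a \<in> carrier A \<and> b \<in> carrier B}
   \<union> {single (a, k \<odot>\<^bsub>B\<^esub> b) \<ominus>\<^bsub>F\<^esub> (k \<odot>\<^bsub>F\<^esub> single (a, b)) | k a b.
        a \<in> carrier A \<and> b \<in> carrier B})"

definition tensor_alg ::
    "('k::field, 'a) module \<Rightarrow> ('k, 'b) module \<Rightarrow> ('k, ('a \<times> 'b \<Rightarrow> 'k) set) module" where
  "tensor_alg A B = alg_quot (tensor_free A B) (bilinear_rels A B)"

definition tens ::
    "('k::field, 'a) module \<Rightarrow> ('k, 'b) module \<Rightarrow> 'a \<Rightarrow> 'b \<Rightarrow> ('a \<times> 'b \<Rightarrow> 'k) set" where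
  "tens A B a b = alg_cls (tensor_free A B) (bilinear_rels A B) (single (a, b))"

text \<open>The pair \<open>(a, b)\<close> stands for \<open>a \<otimes> 1 + b \<otimes> \<i>\<close>.\<close>

definition complexify :: "(real, 'a) module \<Rightarrow> (complex, 'a \<times> 'a) module" where
  "complexify A =
    \<lparr>carrier = carrier A \<times> carrier A,
     mult = (\<lambda>(a, b) (a', b'). ((a \<otimes>\<^bsub>A\<^esub> a') \<ominus>\<^bsub>A\<^esub> (b \<otimes>\<^bsub>A\<^esub> b'), (a \<otimes>\<^bsub>A\<^esub> b') \<oplus>\<^bsub>A\<^esub> (b \<otimes>\<^bsub>A\<^esub> a'))),
     one = (\<one>\<^bsub>A\<^esub>, \<zero>\<^bsub>A\<^esub>),
     zero = (\<zero>\<^bsub>A\<^esub>, \<zero>\<^bsub>A\<^esub>),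
     add = (\<lambda>(a, b) (a', b'). (a \<oplus>\<^bsub>A\<^esub> a', b \<oplus>\<^bsub>A\<^esub> b')),
     smult = (\<lambda>k (a, b). ((Re k \<odot>\<^bsub>A\<^esub> a) \<ominus>\<^bsub>A\<^esub> (Im k \<odot>\<^bsub>A\<^esub> b), (Re k \<odot>\<^bsub>A\<^esub> b) \<oplus>\<^bsub>A\<^esub> (Im k \<odot>\<^bsub>A\<^esub> a)))\<rparr>"

definition cx_incl :: "(real, 'a) module \<Rightarrow> 'a \<Rightarrow> 'a \<times> 'a" where
  "cx_incl A a = (a, \<zero>\<^bsub>A\<^esub>)"

subsection \<open>Subalgebras, centre, homomorphisms\<close>

definition is_subalg :: "('k, 'a) module \<Rightarrow> 'a set \<Rightarrow> bool" where
  "is_subalg A T \<longleftrightarrow> T \<subseteq> carrier A \<and> \<one>\<^bsub>A\<^esub> \<in> T \<and>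
     (\<forall>a\<in>T. \<forall>b\<in>T. a \<oplus>\<^bsub>A\<^esub> b \<in> T \<and> a \<otimes>\<^bsub>A\<^esub> b \<in> T) \<and> (\<forall>k. \<forall>a\<in>T. k \<odot>\<^bsub>A\<^esub> a \<in> T)"

definition subalg_gen :: "('k, 'a) module \<Rightarrow> 'a set \<Rightarrow> 'a set" where
  "subalg_gen A S = \<Inter>{T. is_subalg A T \<and> S \<subseteq> T}"

definition centre :: "('a, 'x) ring_scheme \<Rightarrow> 'a set" where
  "centre A = {z \<in> carrier A. \<forall>a \<in> carrier A. z \<otimes>\<^bsub>A\<^esub> a = a \<otimes>\<^bsub>A\<^esub> z}"

definition centre_alg :: "('k, 'a) module \<Rightarrow> ('k, 'a) module" where
  "centre_alg A = A\<lparr>carrier := centre A\<rparr>"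

definition alg_hom :: "('k, 'a) module \<Rightarrow> ('k, 'b) module \<Rightarrow> ('a \<Rightarrow> 'b) set" where
  "alg_hom A B =
    {h \<in> ring_hom A B. \<forall>k. \<forall>a \<in> carrier A. h (k \<odot>\<^bsub>A\<^esub> a) = k \<odot>\<^bsub>B\<^esub> h a}"

section \<open>Root systems and reflection groups\<close>

text \<open>
  \<open>E\<close> is a type \<open>'e\<close> of class \<open>euclidean_space\<close> with \<open>B\<close> its inner product, and \<open>E\<^sup>*\<close> is the type
  \<open>'e \<Rightarrow>\<^sub>L real\<close> of (automatically bounded) linear functionals, so that \<open>\<langle>x, y\<rangle>\<close> is application.
\<close>

definition riesz :: "('e::euclidean_space \<Rightarrow>\<^sub>L real) \<Rightarrow> 'e" where
  "riesz \<alpha> = (\<Sum>b\<in>Basis. blinfun_apply \<alpha> b *\<^sub>R b)"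

text \<open>The only \<open>\<alpha>\<^sup>\<or>\<close> with \<open>\<langle>\<alpha>, \<alpha>\<^sup>\<or>\<rangle> = 2\<close> for which \<open>s\<^sub>\<alpha>\<close> is orthogonal.\<close>

definition coroot :: "('e::euclidean_space \<Rightarrow>\<^sub>L real) \<Rightarrow> 'e" where
  "coroot \<alpha> = (2 / (riesz \<alpha> \<bullet> riesz \<alpha>)) *\<^sub>R riesz \<alpha>"

definition refl :: "('e::euclidean_space \<Rightarrow>\<^sub>L real) \<Rightarrow> 'e \<Rightarrow> 'e" where
  "refl \<alpha> y = y - blinfun_apply \<alpha> y *\<^sub>R coroot \<alpha>"

definition dual_act :: "('e::euclidean_space \<Rightarrow> 'e) \<Rightarrow> ('e \<Rightarrow>\<^sub>L real) \<Rightarrow> 'e \<Rightarrow>\<^sub>L real" where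
  "dual_act w x = Blinfun (\<lambda>v. blinfun_apply x (inv_into UNIV w v))"

definition root_system :: "('e::euclidean_space \<Rightarrow>\<^sub>L real) set \<Rightarrow> bool" where
  "root_system R \<longleftrightarrow> finite R \<and> 0 \<notin> R \<and>
     (\<forall>\<alpha>\<in>R. \<forall>\<beta>\<in>R. dual_act (refl \<alpha>) \<beta> \<in> R) \<and>
     (\<forall>\<alpha>\<in>R. \<forall>t. t *\<^sub>R \<alpha> \<in> R \<longrightarrow> t = 1 \<or> t = -1)"

definition nonneg_comb :: "('e::euclidean_space \<Rightarrow>\<^sub>L real) set \<Rightarrow> ('e \<Rightarrow>\<^sub>L real) \<Rightarrow> bool" where
  "nonneg_comb D \<beta> \<longleftrightarrow> (\<exists>t. (\<forall>\<delta>\<in>D. 0 \<le> t \<delta>) \<and> \<beta> = (\<Sum>\<delta>\<in>D. t \<delta> *\<^sub>R \<delta>))"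

definition positive_system ::
    "('e::euclidean_space \<Rightarrow>\<^sub>L real) set \<Rightarrow> ('e \<Rightarrow>\<^sub>L real) set \<Rightarrow> ('e \<Rightarrow>\<^sub>L real) set \<Rightarrow> bool" where
  "positive_system R Rp D \<longleftrightarrow> D \<subseteq> R \<and> independent D \<and>
     Rp = {\<beta> \<in> R. nonneg_comb D \<beta>} \<and> (\<forall>\<beta>\<in>R. \<beta> \<in> Rp \<or> - \<beta> \<in> Rp)"

inductive_set reflection_group :: "('e::euclidean_space \<Rightarrow>\<^sub>L real) set \<Rightarrow> ('e \<Rightarrow> 'e) set"
  for R where
  id: "id \<in> reflection_group R"
| refl: "\<alpha> \<in> R \<Longrightarrow> w \<in> reflection_group R \<Longrightarrow> refl \<alpha> \<circ> w \<in> reflection_group R"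

definition word_length :: "('e::euclidean_space \<Rightarrow>\<^sub>L real) set \<Rightarrow> ('e \<Rightarrow> 'e) \<Rightarrow> nat" where
  "word_length D w = (LEAST k. \<exists>\<alpha>s. length \<alpha>s = k \<and> set \<alpha>s \<subseteq> D \<and> foldr (\<circ>) (map refl \<alpha>s) id = w)"

definition longest_element ::
    "('e::euclidean_space \<Rightarrow>\<^sub>L real) set \<Rightarrow> ('e \<Rightarrow>\<^sub>L real) set \<Rightarrow> 'e \<Rightarrow> 'e" where
  "longest_element R D =
    (THE w. w \<in> reflection_group R \<and> (\<forall>v \<in> reflection_group R. word_length D v \<le> word_length D w))"

text \<open>
  A function on \<open>R\<^sub>+\<close> is invariant if it is the restriction of a \<open>W\<close>-invariant function on \<open>R\<close>
  (recall that \<open>- \<alpha>\<close> is in the orbit of \<open>\<alpha>\<close>).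
\<close>

definition W_invariant ::
    "('e::euclidean_space \<Rightarrow>\<^sub>L real) set \<Rightarrow> ('e \<Rightarrow>\<^sub>L real) set \<Rightarrow> (('e \<Rightarrow>\<^sub>L real) \<Rightarrow> complex) \<Rightarrow> bool" where
  "W_invariant R Rp c \<longleftrightarrow>
    (\<forall>w \<in> reflection_group R. \<forall>\<alpha> \<in> Rp. dual_act w \<alpha> \<in> Rp \<longrightarrow> c (dual_act w \<alpha>) = c \<alpha>)"

definition orthonormal_basis :: "(nat \<Rightarrow> 'e::euclidean_space) \<Rightarrow> bool" where
  "orthonormal_basis y \<longleftrightarrow>
    (\<forall>i \<in> {1..DIM('e)}. \<forall>j \<in> {1..DIM('e)}. y i \<bullet> y j = (if i = j then 1 else 0))"

definition dual_basis ::
    "(nat \<Rightarrow> 'e::euclidean_space) \<Rightarrow> (nat \<Rightarrow> 'e \<Rightarrow>\<^sub>L real) \<Rightarrow> bool" where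
  "dual_basis y x \<longleftrightarrow>
    (\<forall>i \<in> {1..DIM('e)}. \<forall>j \<in> {1..DIM('e)}. blinfun_apply (x i) (y j) = (if i = j then 1 else 0))"

section \<open>The rational Cherednik algebra and the Dunkl angular momentum algebra\<close>

text \<open>
  The tensor algebra of the complexification of a real vector space \<open>V\<close> is the free complex
  algebra on the set \<open>V\<close> modulo the \<open>\<real>\<close>-linear relations of \<open>V\<close>. The smash product with \<open>W\<close> adds
  the generators \<open>w \<in> W\<close>, the multiplication table of \<open>W\<close> and \<open>w v = w(v) w\<close>. All defining relations
  are complex bilinear in the vectors, so it suffices to impose them for vectors of \<open>E\<^sup>*\<close> and \<open>E\<close>.
\<close>

datatype ('x, 'y, 'w) xyw_gen = GX 'x | GY 'y | GW 'w

type_synonym 'e cher_gen = "('e \<Rightarrow>\<^sub>L real, 'e, 'e \<Rightarrow> 'e) xyw_gen"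

definition cher_free ::
    "('e::euclidean_space \<Rightarrow>\<^sub>L real) set \<Rightarrow> (complex, 'e cher_gen list \<Rightarrow> complex) module" where
  "cher_free R = free_alg (range GX \<union> range GY \<union> GW ` reflection_group R)"

definition linear_rels ::
    "('e::euclidean_space \<Rightarrow>\<^sub>L real) set \<Rightarrow> ('e cher_gen list \<Rightarrow> complex) set" where
  "linear_rels R = (let F = cher_free R in
     {gen (GX (x + x')) \<ominus>\<^bsub>F\<^esub> (gen (GX x) \<oplus>\<^bsub>F\<^esub> gen (GX x')) | x x'. True}
   \<union> {gen (GX (r *\<^sub>R x)) \<ominus>\<^bsub>F\<^esub> (complex_of_real r \<odot>\<^bsub>F\<^esub> gen (GX x)) | r x. True}
   \<union> {gen (GY (y + y')) \<ominus>\<^bsub>F\<^esub> (gen (GY y) \<oplus>\<^bsub>F\<^esub> gen (GY y')) | y y'. True}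
   \<union> {gen (GY (r *\<^sub>R y)) \<ominus>\<^bsub>F\<^esub> (complex_of_real r \<odot>\<^bsub>F\<^esub> gen (GY y)) | r y. True})"

definition smash_rels ::
    "('e::euclidean_space \<Rightarrow>\<^sub>L real) set \<Rightarrow> ('e cher_gen list \<Rightarrow> complex) set" where
  "smash_rels R = (let F = cher_free R; W = reflection_group R in
     {gen (GW id) \<ominus>\<^bsub>F\<^esub> \<one>\<^bsub>F\<^esub>}
   \<union> {(gen (GW w) \<otimes>\<^bsub>F\<^esub> gen (GW w')) \<ominus>\<^bsub>F\<^esub> gen (GW (w \<circ> w')) | w w'. w \<in> W \<and> w' \<in> W}
   \<union> {(gen (GW w) \<otimes>\<^bsub>F\<^esub> gen (GX x)) \<ominus>\<^bsub>F\<^esub> (gen (GX (dual_act w x)) \<otimes>\<^bsub>F\<^esub> gen (GW w)) | w x. w \<in> W}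
   \<union> {(gen (GW w) \<otimes>\<^bsub>F\<^esub> gen (GY y)) \<ominus>\<^bsub>F\<^esub> (gen (GY (w y)) \<otimes>\<^bsub>F\<^esub> gen (GW w)) | w y. w \<in> W})"

definition commutator :: "('a, 'x) ring_scheme \<Rightarrow> 'a \<Rightarrow> 'a \<Rightarrow> 'a" where
  "commutator A a b = (a \<otimes>\<^bsub>A\<^esub> b) \<ominus>\<^bsub>A\<^esub> (b \<otimes>\<^bsub>A\<^esub> a)"

definition commutation_rels ::
    "('e::euclidean_space \<Rightarrow>\<^sub>L real) set \<Rightarrow> ('e \<Rightarrow>\<^sub>L real) set \<Rightarrow> (('e \<Rightarrow>\<^sub>L real) \<Rightarrow> complex)
      \<Rightarrow> ('e cher_gen list \<Rightarrow> complex) set" where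
  "commutation_rels R Rp c = (let F = cher_free R in
     {commutator F (gen (GX x)) (gen (GX x')) | x x'. True}
   \<union> {commutator F (gen (GY y)) (gen (GY y')) | y y'. True}
   \<union> {commutator F (gen (GY y)) (gen (GX x)) \<ominus>\<^bsub>F\<^esub>
        ((complex_of_real (blinfun_apply x y) \<odot>\<^bsub>F\<^esub> \<one>\<^bsub>F\<^esub>) \<oplus>\<^bsub>F\<^esub>
         (\<Oplus>\<^bsub>F\<^esub>\<alpha>\<in>Rp. (c \<alpha> * complex_of_real (blinfun_apply \<alpha> y * blinfun_apply x (coroot \<alpha>)))
             \<odot>\<^bsub>F\<^esub> gen (GW (refl \<alpha>)))) | x y. True})"

definition cher_rels ::
    "('e::euclidean_space \<Rightarrow>\<^sub>L real) set \<Rightarrow> ('e \<Rightarrow>\<^sub>L real) set \<Rightarrow> (('e \<Rightarrow>\<^sub>L real) \<Rightarrow> complex)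
      \<Rightarrow> ('e cher_gen list \<Rightarrow> complex) set" where
  "cher_rels R Rp c = linear_rels R \<union> smash_rels R \<union> commutation_rels R Rp c"

type_synonym 'e cher = "('e cher_gen list \<Rightarrow> complex) set"

definition Cherednik ::
    "('e::euclidean_space \<Rightarrow>\<^sub>L real) set \<Rightarrow> ('e \<Rightarrow>\<^sub>L real) set \<Rightarrow> (('e \<Rightarrow>\<^sub>L real) \<Rightarrow> complex)
      \<Rightarrow> (complex, 'e cher) module" where
  "Cherednik R Rp c = alg_quot (cher_free R) (cher_rels R Rp c)"

definition cher_elt ::
    "('e::euclidean_space \<Rightarrow>\<^sub>L real) set \<Rightarrow> ('e \<Rightarrow>\<^sub>L real) set \<Rightarrow> (('e \<Rightarrow>\<^sub>L real) \<Rightarrow> complex)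
      \<Rightarrow> 'e cher_gen \<Rightarrow> 'e cher" where
  "cher_elt R Rp c g = alg_cls (cher_free R) (cher_rels R Rp c) (gen g)"

definition M_elt ::
    "('e::euclidean_space \<Rightarrow>\<^sub>L real) set \<Rightarrow> ('e \<Rightarrow>\<^sub>L real) set \<Rightarrow> (('e \<Rightarrow>\<^sub>L real) \<Rightarrow> complex)
      \<Rightarrow> (nat \<Rightarrow> 'e) \<Rightarrow> (nat \<Rightarrow> 'e \<Rightarrow>\<^sub>L real) \<Rightarrow> nat \<Rightarrow> nat \<Rightarrow> 'e cher" where
  "M_elt R Rp c y x i j = (let H = Cherednik R Rp c; g = cher_elt R Rp c in
     (g (GX (x i)) \<otimes>\<^bsub>H\<^esub> g (GY (y j))) \<ominus>\<^bsub>H\<^esub> (g (GX (x j)) \<otimes>\<^bsub>H\<^esub> g (GY (y i))))"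

definition DAMA ::
    "('e::euclidean_space \<Rightarrow>\<^sub>L real) set \<Rightarrow> ('e \<Rightarrow>\<^sub>L real) set \<Rightarrow> (('e \<Rightarrow>\<^sub>L real) \<Rightarrow> complex)
      \<Rightarrow> (nat \<Rightarrow> 'e) \<Rightarrow> (nat \<Rightarrow> 'e \<Rightarrow>\<^sub>L real) \<Rightarrow> (complex, 'e cher) module" where
  "DAMA R Rp c y x = (Cherednik R Rp c)\<lparr>carrier := subalg_gen (Cherednik R Rp c)
     ((\<lambda>w. cher_elt R Rp c (GW w)) ` reflection_group R
      \<union> {M_elt R Rp c y x i j | i j. 1 \<le> i \<and> i < j \<and> j \<le> DIM('e)})\<rparr>"

definition Omega_sl2 ::
    "('e::euclidean_space \<Rightarrow>\<^sub>L real) set \<Rightarrow> ('e \<Rightarrow>\<^sub>L real) set \<Rightarrow> (('e \<Rightarrow>\<^sub>L real) \<Rightarrow> complex)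
      \<Rightarrow> (nat \<Rightarrow> 'e) \<Rightarrow> (nat \<Rightarrow> 'e \<Rightarrow>\<^sub>L real) \<Rightarrow> 'e cher" where
  "Omega_sl2 R Rp c y x =
    (let A = Cherednik R Rp c;
         X' = (\<lambda>i. cher_elt R Rp c (GX (x i)));
         Y' = (\<lambda>i. cher_elt R Rp c (GY (y i)));
         H = (1/2) \<odot>\<^bsub>A\<^esub> (\<Oplus>\<^bsub>A\<^esub>i\<in>{1..DIM('e)}. (X' i \<otimes>\<^bsub>A\<^esub> Y' i) \<oplus>\<^bsub>A\<^esub> (Y' i \<otimes>\<^bsub>A\<^esub> X' i));
         X = (-1/2) \<odot>\<^bsub>A\<^esub> (\<Oplus>\<^bsub>A\<^esub>i\<in>{1..DIM('e)}. X' i \<otimes>\<^bsub>A\<^esub> X' i);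
         Y = (1/2) \<odot>\<^bsub>A\<^esub> (\<Oplus>\<^bsub>A\<^esub>i\<in>{1..DIM('e)}. Y' i \<otimes>\<^bsub>A\<^esub> Y' i)
     in (H \<otimes>\<^bsub>A\<^esub> H) \<oplus>\<^bsub>A\<^esub> (2 \<odot>\<^bsub>A\<^esub> ((X \<otimes>\<^bsub>A\<^esub> Y) \<oplus>\<^bsub>A\<^esub> (Y \<otimes>\<^bsub>A\<^esub> X))))"

definition phi_elt ::
    "('e::euclidean_space \<Rightarrow>\<^sub>L real) set \<Rightarrow> ('e \<Rightarrow>\<^sub>L real) set \<Rightarrow> (('e \<Rightarrow>\<^sub>L real) \<Rightarrow> complex)
      \<Rightarrow> 'e cher" where
  "phi_elt R Rp c =
    (let A = Cherednik R Rp c;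
         Z = (\<Oplus>\<^bsub>A\<^esub>\<alpha>\<in>Rp. c \<alpha> \<odot>\<^bsub>A\<^esub> cher_elt R Rp c (GW (refl \<alpha>)))
     in (1/2) \<odot>\<^bsub>A\<^esub> ((2 \<odot>\<^bsub>A\<^esub> Z) \<oplus>\<^bsub>A\<^esub> ((of_nat DIM('e) - 2) \<odot>\<^bsub>A\<^esub> \<one>\<^bsub>A\<^esub>)))"

section \<open>The Clifford algebra and the Pin cover\<close>

definition cliff_free :: "(real, 'e::euclidean_space list \<Rightarrow> real) module" where
  "cliff_free = free_alg UNIV"

definition cliff_rels :: "('e::euclidean_space list \<Rightarrow> real) set" where
  "cliff_rels = (let F = cliff_free in
     {gen (y + y') \<ominus>\<^bsub>F\<^esub> (gen y \<oplus>\<^bsub>F\<^esub> gen y') | y y'. True}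
   \<union> {gen (r *\<^sub>R y) \<ominus>\<^bsub>F\<^esub> (r \<odot>\<^bsub>F\<^esub> gen y) | r y. True}
   \<union> {((gen y \<otimes>\<^bsub>F\<^esub> gen y') \<oplus>\<^bsub>F\<^esub> (gen y' \<otimes>\<^bsub>F\<^esub> gen y)) \<ominus>\<^bsub>F\<^esub> ((2 * (y \<bullet> y')) \<odot>\<^bsub>F\<^esub> \<one>\<^bsub>F\<^esub>) | y y'. True})"

type_synonym 'e cliff = "('e list \<Rightarrow> real) set"

definition Cliff_real :: "(real, 'e::euclidean_space cliff) module" where
  "Cliff_real = alg_quot cliff_free cliff_rels"

definition cliff_vec :: "'e::euclidean_space \<Rightarrow> 'e cliff" where
  "cliff_vec y = alg_cls cliff_free cliff_rels (gen y)"

definition Cliff :: "(complex, 'e::euclidean_space cliff \<times> 'e cliff) module" where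
  "Cliff = complexify Cliff_real"

text \<open>
  On the free algebra, multiplying a word of length \<open>k\<close> by \<open>(-1)\<^sup>k\<close> is the automorphism with value
  \<open>-1\<close> on the generators, and reversing words is the anti-automorphism fixing the generators. Both
  preserve the ideal of relations; the maps induced on cosets are given by taking images.
\<close>

definition cliff_eps :: "'e::euclidean_space cliff \<Rightarrow> 'e cliff" where
  "cliff_eps \<eta> = (\<lambda>f u. (-1) ^ length u * f u) ` \<eta>"

definition cliff_transp :: "'e::euclidean_space cliff \<Rightarrow> 'e cliff" where
  "cliff_transp \<eta> = (\<lambda>f u. f (rev u)) ` \<eta>"

definition cliff_star :: "'e::euclidean_space cliff \<Rightarrow> 'e cliff" where
  "cliff_star \<eta> = cliff_eps (cliff_transp \<eta>)"

definition twisted_conj :: "'e::euclidean_space cliff \<Rightarrow> 'e \<Rightarrow> 'e cliff" where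
  "twisted_conj \<eta> y = cliff_eps \<eta> \<otimes>\<^bsub>Cliff_real\<^esub> cliff_vec y \<otimes>\<^bsub>Cliff_real\<^esub> (inv\<^bsub>Cliff_real\<^esub> \<eta>)"

definition Pin :: "'e::euclidean_space cliff set" where
  "Pin = {\<eta> \<in> Units Cliff_real. (\<forall>y. twisted_conj \<eta> y \<in> range cliff_vec) \<and>
     (cliff_star \<eta> \<otimes>\<^bsub>Cliff_real\<^esub> \<eta>) [^]\<^bsub>Cliff_real\<^esub> (2::nat) = \<one>\<^bsub>Cliff_real\<^esub>}"

definition pin_proj :: "'e::euclidean_space cliff \<Rightarrow> 'e \<Rightarrow> 'e" where
  "pin_proj \<eta> y = (THE v. cliff_vec v = twisted_conj \<eta> y)"

definition W_tilde :: "('e::euclidean_space \<Rightarrow>\<^sub>L real) set \<Rightarrow> 'e cliff monoid" where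
  "W_tilde R = \<lparr>carrier = {\<eta> \<in> Pin. pin_proj \<eta> \<in> reflection_group R},
     mult = mult Cliff_real, one = one Cliff_real\<rparr>"

text \<open>
  \<open>C\<^sub>2\<close> is realised as \<open>{id, -id}\<close> acting on \<open>E\<close>, so that its generator is \<open>uminus\<close>. If the longest
  element is not \<open>-id\<close>, then \<open>W_hat\<close> is the product of \<open>W_tilde\<close> with the trivial group, which
  stands for \<open>W_tilde\<close> itself.
\<close>

definition W_hat ::
    "('e::euclidean_space \<Rightarrow>\<^sub>L real) set \<Rightarrow> ('e \<Rightarrow>\<^sub>L real) set \<Rightarrow> ('e cliff \<times> ('e \<Rightarrow> 'e)) monoid" where
  "W_hat R D = W_tilde R \<times>\<times>
     \<lparr>carrier = (if longest_element R D = uminus then {id, uminus} else {id}),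
      mult = (\<circ>), one = id\<rparr>"

type_synonym 'e what_elt = "'e cliff \<times> ('e \<Rightarrow> 'e) \<Rightarrow> complex"

definition CW_hat ::
    "('e::euclidean_space \<Rightarrow>\<^sub>L real) set \<Rightarrow> ('e \<Rightarrow>\<^sub>L real) set \<Rightarrow> (complex, 'e what_elt) module" where
  "CW_hat R D = monoid_alg (W_hat R D)"

definition CW_star :: "'e::euclidean_space what_elt \<Rightarrow> 'e what_elt" where
  "CW_star f = (\<lambda>h. \<Sum>(\<eta>, s) \<in> {(\<eta>, s). f (\<eta>, s) \<noteq> 0 \<and> (cliff_star \<eta>, s) = h}. cnj (f (\<eta>, s)))"

definition admissible ::
    "('e::euclidean_space \<Rightarrow>\<^sub>L real) set \<Rightarrow> ('e \<Rightarrow>\<^sub>L real) set \<Rightarrow> 'e what_elt \<Rightarrow> bool" where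
  "admissible R D C \<longleftrightarrow> C \<in> centre (CW_hat R D) \<and> CW_star C = C"

section \<open>The Dirac elements\<close>

type_synonym 'e dirac = "('e cher \<times> ('e cliff \<times> 'e cliff) \<Rightarrow> complex) set"

definition A_Cliff ::
    "('e::euclidean_space \<Rightarrow>\<^sub>L real) set \<Rightarrow> ('e \<Rightarrow>\<^sub>L real) set \<Rightarrow> (('e \<Rightarrow>\<^sub>L real) \<Rightarrow> complex)
      \<Rightarrow> (nat \<Rightarrow> 'e) \<Rightarrow> (nat \<Rightarrow> 'e \<Rightarrow>\<^sub>L real) \<Rightarrow> (complex, 'e dirac) module" where
  "A_Cliff R Rp c y x = tensor_alg (DAMA R Rp c y x) Cliff"

definition pure ::
    "('e::euclidean_space \<Rightarrow>\<^sub>L real) set \<Rightarrow> ('e \<Rightarrow>\<^sub>L real) set \<Rightarrow> (('e \<Rightarrow>\<^sub>L real) \<Rightarrow> complex)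
      \<Rightarrow> (nat \<Rightarrow> 'e) \<Rightarrow> (nat \<Rightarrow> 'e \<Rightarrow>\<^sub>L real) \<Rightarrow> 'e cher \<Rightarrow> 'e cliff \<times> 'e cliff \<Rightarrow> 'e dirac" where
  "pure R Rp c y x a \<eta> = tens (DAMA R Rp c y x) Cliff a \<eta>"

text \<open>
  On group elements, \<open>(\<eta>, s)\<close> with \<open>s = \<plusminus>id\<close> is sent to \<open>p(\<eta>) s \<otimes> \<eta>\<close>; in particular the generator
  \<open>(1, uminus)\<close> of \<open>C\<^sub>2\<close> is sent to \<open>(-id) \<otimes> 1\<close>.
\<close>

definition rho ::
    "('e::euclidean_space \<Rightarrow>\<^sub>L real) set \<Rightarrow> ('e \<Rightarrow>\<^sub>L real) set \<Rightarrow> (('e \<Rightarrow>\<^sub>L real) \<Rightarrow> complex)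
      \<Rightarrow> (nat \<Rightarrow> 'e) \<Rightarrow> (nat \<Rightarrow> 'e \<Rightarrow>\<^sub>L real) \<Rightarrow> 'e what_elt \<Rightarrow> 'e dirac" where
  "rho R Rp c y x f = (let T = A_Cliff R Rp c y x in
     (\<Oplus>\<^bsub>T\<^esub>g \<in> {g. f g \<noteq> 0}. f g \<odot>\<^bsub>T\<^esub>
        pure R Rp c y x (cher_elt R Rp c (GW (pin_proj (fst g) \<circ> snd g))) (cx_incl Cliff_real (fst g))))"

definition AMA_Dirac ::
    "('e::euclidean_space \<Rightarrow>\<^sub>L real) set \<Rightarrow> ('e \<Rightarrow>\<^sub>L real) set \<Rightarrow> (('e \<Rightarrow>\<^sub>L real) \<Rightarrow> complex)
      \<Rightarrow> (nat \<Rightarrow> 'e) \<Rightarrow> (nat \<Rightarrow> 'e \<Rightarrow>\<^sub>L real) \<Rightarrow> 'e dirac" where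
  "AMA_Dirac R Rp c y x = (let T = A_Cliff R Rp c y x; e = (\<lambda>i. cx_incl Cliff_real (cliff_vec (y i))) in
     (\<Oplus>\<^bsub>T\<^esub>k \<in> {(i, j). 1 \<le> i \<and> i < j \<and> j \<le> DIM('e)}.
        pure R Rp c y x (M_elt R Rp c y x (fst k) (snd k)) (e (fst k) \<otimes>\<^bsub>Cliff\<^esub> e (snd k))))"

definition Dirac_C ::
    "('e::euclidean_space \<Rightarrow>\<^sub>L real) set \<Rightarrow> ('e \<Rightarrow>\<^sub>L real) set \<Rightarrow> (('e \<Rightarrow>\<^sub>L real) \<Rightarrow> complex)
      \<Rightarrow> (nat \<Rightarrow> 'e) \<Rightarrow> (nat \<Rightarrow> 'e \<Rightarrow>\<^sub>L real) \<Rightarrow> 'e what_elt \<Rightarrow> 'e dirac" where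
  "Dirac_C R Rp c y x C = (let T = A_Cliff R Rp c y x in
     (AMA_Dirac R Rp c y x \<ominus>\<^bsub>T\<^esub> pure R Rp c y x (phi_elt R Rp c) \<one>\<^bsub>Cliff\<^esub>) \<oplus>\<^bsub>T\<^esub> rho R Rp c y x C)"

text \<open>
  The description of the centre of the Dunkl angular momentum algebra as generated by \<open>\<Omega>\<close> over the
  scalars, together with \<open>-id\<close> if this is the longest element of \<open>W\<close>. It can fail for
  \<open>dim E = 2\<close>: all rotations in \<open>W\<close> then commute with \<open>M\<^sub>1\<^sub>2\<close>, so that e.g. for \<open>W\<close> of type
  \<open>A\<^sub>2\<close> the sum of the two rotations of order 3 is a further central element.
\<close>

definition centre_description ::
    "('e::euclidean_space \<Rightarrow>\<^sub>L real) set \<Rightarrow> ('e \<Rightarrow>\<^sub>L real) set \<Rightarrow> ('e \<Rightarrow>\<^sub>L real) set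
      \<Rightarrow> (('e \<Rightarrow>\<^sub>L real) \<Rightarrow> complex) \<Rightarrow> (nat \<Rightarrow> 'e) \<Rightarrow> (nat \<Rightarrow> 'e \<Rightarrow>\<^sub>L real) \<Rightarrow> bool" where
  "centre_description R Rp D c y x \<longleftrightarrow>
    centre (DAMA R Rp c y x) = subalg_gen (Cherednik R Rp c)
      (insert (Omega_sl2 R Rp c y x)
        (if longest_element R D = uminus then {cher_elt R Rp c (GW uminus)} else {}))"

end

theory Submission
 imports Defs "HOL-Library.Function_Algebras" "HOL-Computational_Algebra.Polynomial"
begin

text \<open>
  The Dunkl operators, together with left multiplications by vectors in the Clifford algebra, act
  faithfully on polynomial functions, so identities can be checked on operators. Put
  X = sum x_i c_i and Y = sum y_i c_i. Then D - phi = [X, Y]/2 + 1 up to the sign conventions, and the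
  osp(1|2) relations give (D - phi)^2 = Omega + 1. Since rho(C) commutes with D - phi, completing the
  square turns Omega into rho(C^2 - 1) modulo anticommutators with D - phi + rho(C). The elements
  congruent to some rho(k) in this sense, with k central, are closed under sums and products.

  It remains to know the centre of A. The leading symbol of a central element is invariant under
  rotations, shears and scalings of the pair (x, xi), hence is a multiple of a power of
  |x|^2 |xi|^2 - (x . xi)^2, the symbol of Omega; induction on the degree shows that A has centre
  generated by Omega and, if w_0 = -1, by w_0.
\<close>

text \<open>The relation to be proved does not visibly single out a value of zeta at z, and
  arbitrary choices need not be multiplicative. This is why the centre has to be known: its elements
  are written uniquely as p(Omega) + w_0 q(Omega), under a normalisation of p and q, and zeta
  substitutes C^2 - 1 for Omega. The operators are those of the left regular representation: the
  Cherednik algebra is written in the order x, w, y, with y renamed xi. The degree in xi is kept as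
  a separate index, so that leading symbols are coefficients at the highest index. Right
  multiplication is computed in the same coordinates, and z M = M z turns into differential
  equations for the leading symbol of z. The angular momentum algebra is given by generators, so
  Omega has to be shown to lie in it; this is read off the square of the Dirac element. The tensor
  product is an abstract quotient, so equality in it is tested on operators. Rotations are used from
  dimension three on; in dimension one there are no M_ij, and in dimension two the description of
  the centre is assumed.\<close>

abbreviation (input) "orth == orthogonal_transformation"

section \<open>Algebras over a field carried by records: subalgebras, homomorphisms, monoid
  algebras, quotients, tensor products\<close>

locale kalg = ring A for A :: "('k::field, 'a) module" (structure) +
 assumes smult_closed [simp, intro]: "a : carrier A ==> k \<odot> a : carrier A"
  and smult_l_distr: "a : carrier A ==> (k + l) \<odot> a = k \<odot> a \<oplus> l \<odot> a"
  and smult_r_distr: "a : carrier A ==> b : carrier A ==> k \<odot> (a \<oplus> b) = k \<odot> a \<oplus> k \<odot> b"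
  and smult_assoc1: "a : carrier A ==> (k * l) \<odot> a = k \<odot> (l \<odot> a)"
  and smult_one [simp]: "a : carrier A ==> 1 \<odot> a = a"
  and smult_mult_l: "a : carrier A ==> b : carrier A ==> (k \<odot> a) \<otimes> b = k \<odot> (a \<otimes> b)"
  and smult_mult_r: "a : carrier A ==> b : carrier A ==> a \<otimes> (k \<odot> b) = k \<odot> (a \<otimes> b)"
begin

lemma smult_zero [simp]: "a : carrier A ==> 0 \<odot> a = \<zero>"
proof -
 assume a: "a : carrier A"
 have "0 \<odot> a \<oplus> 0 \<odot> a = 0 \<odot> a" using smult_l_distr[OF a, of 0 0] a by simp
 thus ?thesis using a by (metis add.l_cancel_one smult_closed)
qed

lemma smult_zero_r [simp]: "k \<odot> \<zero> = \<zero>"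
proof -
 have "k \<odot> \<zero> \<oplus> k \<odot> \<zero> = k \<odot> \<zero>" using smult_r_distr[of \<zero> \<zero> k] by simp
 thus ?thesis by (metis add.l_cancel_one smult_closed zero_closed)
qed

lemma smult_minus1: "a : carrier A ==> (- 1) \<odot> a = \<ominus> a"
proof -
 assume a: "a : carrier A"
 have "(- 1) \<odot> a \<oplus> 1 \<odot> a = \<zero>" using smult_l_distr[OF a, of "-1" 1] a by simp
 thus ?thesis using a by (metis minus_equality smult_closed smult_one)
qed

lemma smult_minus: "a : carrier A ==> (- k) \<odot> a = \<ominus> (k \<odot> a)"
 using smult_minus1[of "k \<odot> a"] smult_assoc1[of a "-1" k] by simp

lemma smult_minus_r: "a : carrier A ==> k \<odot> (\<ominus> a) = \<ominus> (k \<odot> a)"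
 using smult_minus1[of a] smult_minus1[of "k \<odot> a"] smult_assoc1[of a "-1" k] smult_assoc1[of a k "-1"] by simp

lemma smult_diff: "a : carrier A ==> b : carrier A ==> k \<odot> (a \<ominus> b) = k \<odot> a \<ominus> k \<odot> b"
 by (simp add: a_minus_def smult_r_distr smult_minus_r)

lemma smult_finsum:
 "f : I \<rightarrow> carrier A ==> k \<odot> finsum A f I = finsum A (%i. k \<odot> f i) I"
proof (induction I rule: infinite_finite_induct)
 case (insert i I)
 thus ?case by (simp add: smult_r_distr Pi_def)
qed simp_all

end


subsection \<open>Subalgebras\<close>

lemma (in kalg) kalg_subalg:
 assumes T: "is_subalg A T"
 shows "kalg (A\<lparr>carrier := T\<rparr>)"
proof -
 have sub: "\<And>a. a : T ==> a : carrier A" and one: "\<one> : T"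
  and add: "\<And>a b. a : T ==> b : T ==> a \<oplus> b : T"
  and mul: "\<And>a b. a : T ==> b : T ==> a \<otimes> b : T"
  and sm: "\<And>k a. a : T ==> k \<odot> a : T" using T by (auto simp: is_subalg_def)
 have zero: "\<zero> : T" using sm[OF one, of 0] by simp
 have inv: "\<ominus> a : T" if "a : T" for a using sm[OF that, of "-1"] sub[OF that] by (simp add: smult_minus1)
 have "ring (A\<lparr>carrier := T\<rparr>)"
 proof (intro ringI abelian_groupI monoidI)
  fix x assume "x : carrier (A\<lparr>carrier := T\<rparr>)"
  thus "\<exists>y\<in>carrier (A\<lparr>carrier := T\<rparr>). y \<oplus>\<^bsub>A\<lparr>carrier := T\<rparr>\<^esub> x = \<zero>\<^bsub>A\<lparr>carrier := T\<rparr>\<^esub>"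
   using inv[of x] sub[of x] by (intro bexI[of _ "\<ominus> x"]) (simp_all add: l_neg)
 qed (simp_all add: sub one add mul zero a_ac m_assoc l_distr r_distr)
 moreover have "kalg_axioms (A\<lparr>carrier := T\<rparr>)" by (intro kalg_axioms.intro)
   (simp_all add: sub sm smult_l_distr smult_r_distr smult_assoc1 smult_mult_l smult_mult_r)
 ultimately show ?thesis by (rule kalg.intro)
qed

lemma (in kalg) is_subalg_gen:
 assumes "S \<subseteq> carrier A"
 shows "is_subalg A (subalg_gen A S)" "S \<subseteq> subalg_gen A S"
proof -
 have c: "is_subalg A (carrier A)" by (simp add: is_subalg_def)
 have "a \<oplus> b : T & a \<otimes> b : T & k \<odot> a : T" if "a : subalg_gen A S" "b : subalg_gen A S" "is_subalg A T" "S \<subseteq> T" for a b k T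
 proof -
  have "a : T" "b : T" using that by (auto simp: subalg_gen_def)
  with that(3) show ?thesis by (simp add: is_subalg_def)
 qed
 hence "a \<oplus> b : subalg_gen A S & a \<otimes> b : subalg_gen A S & k \<odot> a : subalg_gen A S"
  if "a : subalg_gen A S" "b : subalg_gen A S" for a b k
  unfolding subalg_gen_def[of A S] using that by (intro conjI InterI) (auto simp: subalg_gen_def)
 moreover have "subalg_gen A S \<subseteq> carrier A" using c assms by (auto simp: subalg_gen_def)
 moreover have "\<one> : subalg_gen A S" by (auto simp: subalg_gen_def is_subalg_def)
 ultimately show "is_subalg A (subalg_gen A S)" unfolding is_subalg_def by blast
 show "S \<subseteq> subalg_gen A S" by (auto simp: subalg_gen_def)
qed

lemma subalg_gen_least: "is_subalg A T ==> S \<subseteq> T ==> subalg_gen A S \<subseteq> T" by (auto simp: subalg_gen_def)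

lemma (in kalg) minus_subalg:
 assumes "is_subalg A T" "a : T" "b : T"
 shows "a \<ominus> b : T"
proof -
 have "a : carrier A" "b : carrier A" using assms by (auto simp: is_subalg_def)
 hence "a \<ominus> b = a \<oplus> (-1) \<odot> b" by (simp add: a_minus_def smult_minus1)
 thus ?thesis using assms by (simp add: is_subalg_def)
qed

lemma (in kalg) zero_subalg: "is_subalg A T ==> \<zero> : T" by (metis is_subalg_def one_closed smult_zero)

lemma (in kalg) finsum_subalg:
 assumes "is_subalg A T" "f : I \<rightarrow> T"
 shows "finsum A f I : T" using assms(2)
proof (induction I rule: infinite_finite_induct)
 case (insert i I)
 have "f : I \<rightarrow> carrier A" "f i : carrier A" using insert.prems assms(1) by (auto simp: is_subalg_def)
 thus ?case using insert assms(1) by (auto simp: is_subalg_def)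
qed (use assms(1) zero_subalg in auto)

subsection \<open>Homomorphisms\<close>

locale kalg_hom = A: kalg A + B: kalg B for A :: "('k::field, 'a) module" and B :: "('k, 'b) module" +
 fixes h
 assumes hom: "h : alg_hom A B"
begin

lemma closed [simp, intro]: "a : carrier A ==> h a : carrier B"
 and add [simp]: "a : carrier A ==> b : carrier A ==> h (a \<oplus>\<^bsub>A\<^esub> b) = h a \<oplus>\<^bsub>B\<^esub> h b"
 and mult [simp]: "a : carrier A ==> b : carrier A ==> h (a \<otimes>\<^bsub>A\<^esub> b) = h a \<otimes>\<^bsub>B\<^esub> h b"
 and one [simp]: "h \<one>\<^bsub>A\<^esub> = \<one>\<^bsub>B\<^esub>"
 and smult [simp]: "a : carrier A ==> h (k \<odot>\<^bsub>A\<^esub> a) = k \<odot>\<^bsub>B\<^esub> h a"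
 using hom by (auto simp: alg_hom_def ring_hom_def)

lemma zero [simp]: "h \<zero>\<^bsub>A\<^esub> = \<zero>\<^bsub>B\<^esub>" using smult[of "\<one>\<^bsub>A\<^esub>" 0] by simp

lemma a_inv [simp]: "a : carrier A ==> h (\<ominus>\<^bsub>A\<^esub> a) = \<ominus>\<^bsub>B\<^esub> h a"
 using smult[of a "-1"] by (simp add: A.smult_minus1 B.smult_minus1)

lemma minus [simp]: "a : carrier A ==> b : carrier A ==> h (a \<ominus>\<^bsub>A\<^esub> b) = h a \<ominus>\<^bsub>B\<^esub> h b"
 by (simp add: a_minus_def)

lemma finsum: "f : I \<rightarrow> carrier A ==> h (finsum A f I) = finsum B (%i. h (f i)) I"
proof (induction I rule: infinite_finite_induct)
 case (insert i I)
 thus ?case by (simp add: Pi_def)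
qed simp_all

end

lemma kalg_homI:
 assumes "kalg A" "kalg B" "\<And>a. a : carrier A ==> h a : carrier B"
  "\<And>a b. a : carrier A ==> b : carrier A ==> h (a \<oplus>\<^bsub>A\<^esub> b) = h a \<oplus>\<^bsub>B\<^esub> h b"
  "\<And>a b. a : carrier A ==> b : carrier A ==> h (a \<otimes>\<^bsub>A\<^esub> b) = h a \<otimes>\<^bsub>B\<^esub> h b"
  "h \<one>\<^bsub>A\<^esub> = \<one>\<^bsub>B\<^esub>"
  "\<And>k a. a : carrier A ==> h (k \<odot>\<^bsub>A\<^esub> a) = k \<odot>\<^bsub>B\<^esub> h a"
 shows "kalg_hom A B h" using assms by (auto simp: kalg_hom_def kalg_hom_axioms_def alg_hom_def ring_hom_def)

subsection \<open>Monoid algebras\<close>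

lemma monoid_alg_simps:
 "carrier (monoid_alg M) = {f. finite {x. f x ~= 0} & {x. f x ~= 0} \<subseteq> carrier M}"
 "\<one>\<^bsub>monoid_alg M\<^esub> = single \<one>\<^bsub>M\<^esub>"
 "\<zero>\<^bsub>monoid_alg M\<^esub> = (%x. 0)"
 "f \<oplus>\<^bsub>monoid_alg M\<^esub> g = (%x. f x + g x)"
 "k \<odot>\<^bsub>monoid_alg M\<^esub> f = (%x. k * f x)" by (auto simp: monoid_alg_def single_def)

text \<open>The convolution is defined over the exact supports. Allowing arbitrary finite supersets
  \<open>U\<close> and \<open>V\<close> lets different products be compared over one index
  set.\<close>

lemma monoid_alg_mult:
 assumes "finite U" "finite V" "{u. f u ~= 0} \<subseteq> U" "{v. g v ~= 0} \<subseteq> V"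
 shows "(f \<otimes>\<^bsub>monoid_alg M\<^esub> g) x = (\<Sum>u\<in>U. \<Sum>v\<in>V. if u \<otimes>\<^bsub>M\<^esub> v = x then f u * g v else 0)"
proof -
 have "(f \<otimes>\<^bsub>monoid_alg M\<^esub> g) x
  = (\<Sum>(u, v)\<in>{(u, v). f u ~= 0 & g v ~= 0 & u \<otimes>\<^bsub>M\<^esub> v = x}. f u * g v)" by (simp add: monoid_alg_def)
 also have "... = (\<Sum>(u, v)\<in>U \<times> V. if u \<otimes>\<^bsub>M\<^esub> v = x then f u * g v else 0)"
  by (rule sum.mono_neutral_cong_left) (use assms in \<open>auto split: if_splits\<close>)
 finally show ?thesis by (simp add: sum.cartesian_product)
qed

context monoid
begin

lemma monoid_alg_mult_supp:
 "{x. (f \<otimes>\<^bsub>monoid_alg G\<^esub> g) x ~= 0} \<subseteq> (%(u, v). u \<otimes> v) ` ({u. f u ~= 0} \<times> {v. g v ~= 0})"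
proof
 fix x assume "x : {x. (f \<otimes>\<^bsub>monoid_alg G\<^esub> g) x ~= 0}"
 hence "(\<Sum>(u, v)\<in>{(u, v). f u ~= 0 & g v ~= 0 & u \<otimes> v = x}. f u * g v) ~= 0" by (simp add: monoid_alg_def)
 hence "{(u, v). f u ~= 0 & g v ~= 0 & u \<otimes> v = x} ~= {}" by (metis (no_types, lifting) sum.empty)
 then obtain u v where "f u ~= 0 & g v ~= 0 & u \<otimes> v = x" by auto
 thus "x : (%(u, v). u \<otimes> v) ` ({u. f u ~= 0} \<times> {v. g v ~= 0})" by force
qed

text \<open>Both sides reduce to one sum over triples from the three supports. The sum over the
  support of an intermediate product is opened with a Kronecker delta on the value of that product
  and collapsed again after the sums are exchanged.\<close>

lemma monoid_alg_assoc:
 assumes f: "f : carrier (monoid_alg G)" and g: "g : carrier (monoid_alg G)"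
  and h: "h : carrier (monoid_alg G :: ('k::field, _) module)"
 shows "f \<otimes>\<^bsub>monoid_alg G\<^esub> g \<otimes>\<^bsub>monoid_alg G\<^esub> h = f \<otimes>\<^bsub>monoid_alg G\<^esub> (g \<otimes>\<^bsub>monoid_alg G\<^esub> h)"
proof
 note [simp] = monoid_alg_simps
 fix x
 let ?F = "monoid_alg G"
 let ?U = "{u. f u ~= 0}" and ?V = "{u. g u ~= 0}" and ?W = "{u. h u ~= 0}"
 let ?P = "(%(u, v). u \<otimes> v) ` (?U \<times> ?V)" and ?Q = "(%(u, v). u \<otimes> v) ` (?V \<times> ?W)"
 have fin: "finite ?U" "finite ?V" "finite ?W" "finite ?P" "finite ?Q" using f g h by auto
 have "(f \<otimes>\<^bsub>?F\<^esub> g \<otimes>\<^bsub>?F\<^esub> h) x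
   = (\<Sum>p\<in>?P. \<Sum>w\<in>?W. if p \<otimes> w = x then (f \<otimes>\<^bsub>?F\<^esub> g) p * h w else 0)"
  by (rule monoid_alg_mult) (use fin monoid_alg_mult_supp in auto)
 also have "... = (\<Sum>p\<in>?P. \<Sum>w\<in>?W. \<Sum>u\<in>?U. \<Sum>v\<in>?V. if u \<otimes> v = p then (if p \<otimes> w = x then f u * g v * h w else 0) else 0)"
  by (rule sum.cong[OF HOL.refl], rule sum.cong[OF HOL.refl], subst monoid_alg_mult[OF fin(1,2) order_refl order_refl])
   (auto simp: sum_distrib_right intro!: sum.cong sum.neutral)
 also have "... = (\<Sum>w\<in>?W. \<Sum>u\<in>?U. \<Sum>v\<in>?V. \<Sum>p\<in>?P. if u \<otimes> v = p then (if p \<otimes> w = x then f u * g v * h w else 0) else 0)"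
  by (rule trans[OF sum.swap], rule sum.cong[OF HOL.refl], rule trans[OF sum.swap],
    rule sum.cong[OF HOL.refl], rule sum.swap)
 also have "... = (\<Sum>w\<in>?W. \<Sum>u\<in>?U. \<Sum>v\<in>?V. (if (u \<otimes> v) \<otimes> w = x then f u * g v * h w else 0))"
  by (rule sum.cong[OF HOL.refl], rule sum.cong[OF HOL.refl], rule sum.cong[OF HOL.refl], subst sum.delta'[OF fin(4)]) auto
 also have "... = (\<Sum>u\<in>?U. \<Sum>v\<in>?V. \<Sum>w\<in>?W. (if u \<otimes> (v \<otimes> w) = x then f u * (g v * h w) else 0))"
  apply (rule trans[OF sum.swap], rule sum.cong[OF HOL.refl], rule trans[OF sum.swap],
    rule sum.cong[OF HOL.refl], rule sum.cong[OF HOL.refl]) using f g h by (auto simp: m_assoc subset_iff mult.assoc)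
 also have "... = (\<Sum>u\<in>?U. \<Sum>v\<in>?V. \<Sum>w\<in>?W. \<Sum>q\<in>?Q. if v \<otimes> w = q then (if u \<otimes> q = x then f u * (g v * h w) else 0) else 0)"
  by (rule sum.cong[OF HOL.refl], rule sum.cong[OF HOL.refl], rule sum.cong[OF HOL.refl], subst sum.delta'[OF fin(5)]) auto
 also have "... = (\<Sum>u\<in>?U. \<Sum>q\<in>?Q. \<Sum>v\<in>?V. \<Sum>w\<in>?W. if v \<otimes> w = q then (if u \<otimes> q = x then f u * (g v * h w) else 0) else 0)"
  by (rule sum.cong[OF HOL.refl], rule trans[OF _ sum.swap], rule sum.cong[OF HOL.refl], rule sum.swap)
 also have "... = (\<Sum>u\<in>?U. \<Sum>q\<in>?Q. if u \<otimes> q = x then f u * (g \<otimes>\<^bsub>?F\<^esub> h) q else 0)"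
  by (rule sum.cong[OF HOL.refl], rule sum.cong[OF HOL.refl], subst monoid_alg_mult[OF fin(2,3) order_refl order_refl])
   (auto simp: sum_distrib_left intro!: sum.cong sum.neutral)
 also have "... = (f \<otimes>\<^bsub>?F\<^esub> (g \<otimes>\<^bsub>?F\<^esub> h)) x"
  by (rule monoid_alg_mult[symmetric]) (use fin monoid_alg_mult_supp in auto)
 finally show "(f \<otimes>\<^bsub>?F\<^esub> g \<otimes>\<^bsub>?F\<^esub> h) x = (f \<otimes>\<^bsub>?F\<^esub> (g \<otimes>\<^bsub>?F\<^esub> h)) x" .
qed

lemma single_mult: "single u \<otimes>\<^bsub>monoid_alg G\<^esub> single v = single (u \<otimes> v)"
 by (rule ext) (subst monoid_alg_mult[of "{u}" "{v}"], auto simp: single_def)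

lemma kalg_monoid_alg: "kalg (monoid_alg G :: ('k::field, _) module)"
proof -
 let ?F = "monoid_alg G :: ('k, 'a => 'k) module"
 note [simp] = monoid_alg_simps
 have mc: "f \<otimes>\<^bsub>?F\<^esub> g : carrier ?F" if "f : carrier ?F" "g : carrier ?F" for f g
 proof -
  have i: "finite ((%(u, v). u \<otimes> v) ` ({u. f u ~= 0} \<times> {v. g v ~= 0}))"
   "(%(u, v). u \<otimes> v) ` ({u. f u ~= 0} \<times> {v. g v ~= 0}) \<subseteq> carrier G" using that by auto
  have "finite {x. (f \<otimes>\<^bsub>?F\<^esub> g) x ~= 0}" by (rule finite_subset[OF monoid_alg_mult_supp i(1)])
  moreover have "{x. (f \<otimes>\<^bsub>?F\<^esub> g) x ~= 0} \<subseteq> carrier G" by (rule order.trans[OF monoid_alg_mult_supp i(2)])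
  ultimately show ?thesis by simp
 qed
 have ac: "(%x. f x + g x) : carrier ?F" if "f : carrier ?F" "g : carrier ?F" for f g
 proof -
  have "{x. f x + g x ~= 0} \<subseteq> {x. f x ~= 0} \<union> {x. g x ~= 0}" by auto
  with that show ?thesis by (simp, meson finite_UnI finite_subset le_sup_iff order.trans)
 qed
 have sc: "(%x. k * f x) : carrier ?F" if "f : carrier ?F" for f k
 proof -
  have "{x. k * f x ~= 0} \<subseteq> {x. f x ~= 0}" by auto
  with that show ?thesis by (simp, meson finite_subset order.trans)
 qed
 have ld: "(f \<oplus>\<^bsub>?F\<^esub> g) \<otimes>\<^bsub>?F\<^esub> h = f \<otimes>\<^bsub>?F\<^esub> h \<oplus>\<^bsub>?F\<^esub> g \<otimes>\<^bsub>?F\<^esub> h"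
  if "f : carrier ?F" "g : carrier ?F" "h : carrier ?F" for f g h
 proof
  fix x
  let ?U = "{x. f x ~= 0} \<union> {x. g x ~= 0}" and ?V = "{x. h x ~= 0}"
  have fin: "finite ?U" "finite ?V" using that by auto
  show "((f \<oplus>\<^bsub>?F\<^esub> g) \<otimes>\<^bsub>?F\<^esub> h) x = (f \<otimes>\<^bsub>?F\<^esub> h \<oplus>\<^bsub>?F\<^esub> g \<otimes>\<^bsub>?F\<^esub> h) x"
   by (simp, subst (1 2 3) monoid_alg_mult[OF fin])
     (auto simp: sum.distrib[symmetric] algebra_simps intro!: sum.cong)
 qed
 have rd: "h \<otimes>\<^bsub>?F\<^esub> (f \<oplus>\<^bsub>?F\<^esub> g) = h \<otimes>\<^bsub>?F\<^esub> f \<oplus>\<^bsub>?F\<^esub> h \<otimes>\<^bsub>?F\<^esub> g"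
  if "f : carrier ?F" "g : carrier ?F" "h : carrier ?F" for f g h
 proof
  fix x
  let ?U = "{x. f x ~= 0} \<union> {x. g x ~= 0}" and ?V = "{x. h x ~= 0}"
  have fin: "finite ?V" "finite ?U" using that by auto
  show "(h \<otimes>\<^bsub>?F\<^esub> (f \<oplus>\<^bsub>?F\<^esub> g)) x = (h \<otimes>\<^bsub>?F\<^esub> f \<oplus>\<^bsub>?F\<^esub> h \<otimes>\<^bsub>?F\<^esub> g) x"
   by (simp, subst (1 2 3) monoid_alg_mult[OF fin])
     (auto simp: sum.distrib[symmetric] algebra_simps intro!: sum.cong)
 qed
 have sl: "(k \<odot>\<^bsub>?F\<^esub> f) \<otimes>\<^bsub>?F\<^esub> g = k \<odot>\<^bsub>?F\<^esub> (f \<otimes>\<^bsub>?F\<^esub> g)"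
  and sr: "f \<otimes>\<^bsub>?F\<^esub> (k \<odot>\<^bsub>?F\<^esub> g) = k \<odot>\<^bsub>?F\<^esub> (f \<otimes>\<^bsub>?F\<^esub> g)"
  if "f : carrier ?F" "g : carrier ?F" for f g k
 proof -
  let ?U = "{x. f x ~= 0}" and ?V = "{x. g x ~= 0}"
  have fin: "finite ?U" "finite ?V" using that by auto
  show "(k \<odot>\<^bsub>?F\<^esub> f) \<otimes>\<^bsub>?F\<^esub> g = k \<odot>\<^bsub>?F\<^esub> (f \<otimes>\<^bsub>?F\<^esub> g)"
   by (rule ext, simp, subst (1 2) monoid_alg_mult[OF fin])
     (auto simp: sum_distrib_left mult.assoc intro!: sum.cong)
  show "f \<otimes>\<^bsub>?F\<^esub> (k \<odot>\<^bsub>?F\<^esub> g) = k \<odot>\<^bsub>?F\<^esub> (f \<otimes>\<^bsub>?F\<^esub> g)"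
   by (rule ext, simp, subst (1 2) monoid_alg_mult[OF fin])
     (auto simp: sum_distrib_left mult_ac intro!: sum.cong)
 qed
 have one: "\<one>\<^bsub>?F\<^esub> : carrier ?F" by (auto simp: single_def)
 have l1: "\<one>\<^bsub>?F\<^esub> \<otimes>\<^bsub>?F\<^esub> f = f" and r1: "f \<otimes>\<^bsub>?F\<^esub> \<one>\<^bsub>?F\<^esub> = f" if f: "f : carrier ?F" for f
 proof -
  have fin: "finite {x. f x ~= 0}" using f by auto
  have "(\<Sum>v | f v ~= 0. if \<one> \<otimes> v = x then f v else 0) = f x" for x
  proof -
   have "(\<Sum>v | f v ~= 0. if \<one> \<otimes> v = x then f v else 0) = (\<Sum>v | f v ~= 0. if v = x then f v else 0)"
    using f by (intro sum.cong HOL.refl) auto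
   thus ?thesis using fin by simp
  qed
  thus "\<one>\<^bsub>?F\<^esub> \<otimes>\<^bsub>?F\<^esub> f = f" unfolding monoid_alg_simps(2)
   by (intro ext, subst monoid_alg_mult[of "{\<one>}" "{x. f x ~= 0}"])
    (use fin in \<open>auto simp: single_def cong: if_cong\<close>)
  have "(\<Sum>v | f v ~= 0. if v \<otimes> \<one> = x then f v else 0) = f x" for x
  proof -
   have "(\<Sum>v | f v ~= 0. if v \<otimes> \<one> = x then f v else 0) = (\<Sum>v | f v ~= 0. if v = x then f v else 0)"
    using f by (intro sum.cong HOL.refl) auto
   thus ?thesis using fin by simp
  qed
  thus "f \<otimes>\<^bsub>?F\<^esub> \<one>\<^bsub>?F\<^esub> = f" unfolding monoid_alg_simps(2)
   by (intro ext, subst monoid_alg_mult[of "{x. f x ~= 0}" "{\<one>}"])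
    (use fin in \<open>auto simp: single_def cong: if_cong\<close>)
 qed
 have "ring ?F"
 proof (intro ringI abelian_groupI monoidI)
  show "\<And>x y z. x : carrier ?F ==> y : carrier ?F ==> z : carrier ?F ==>
   x \<otimes>\<^bsub>?F\<^esub> y \<otimes>\<^bsub>?F\<^esub> z = x \<otimes>\<^bsub>?F\<^esub> (y \<otimes>\<^bsub>?F\<^esub> z)" by (rule monoid_alg_assoc)
  show "\<exists>y\<in>carrier ?F. y \<oplus>\<^bsub>?F\<^esub> x = \<zero>\<^bsub>?F\<^esub>" if "x : carrier ?F" for x
   using sc[OF that, of "-1"] by (intro bexI[of _ "%u. - 1 * x u"]) auto
  show "x \<oplus>\<^bsub>?F\<^esub> y : carrier ?F" if "x : carrier ?F" "y : carrier ?F" for x y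
   unfolding monoid_alg_simps(4) by (rule ac[OF that])
  show "\<And>x. x : carrier ?F ==> \<one>\<^bsub>?F\<^esub> \<otimes>\<^bsub>?F\<^esub> x = x" by (rule l1)
  show "\<And>x. x : carrier ?F ==> x \<otimes>\<^bsub>?F\<^esub> \<one>\<^bsub>?F\<^esub> = x" by (rule r1)
  show "\<And>x y. x : carrier ?F ==> y : carrier ?F ==> x \<otimes>\<^bsub>?F\<^esub> y : carrier ?F" by (rule mc)
  show "\<one>\<^bsub>?F\<^esub> : carrier ?F" by (rule one)
 qed ((erule (2) ld | erule (2) rd | simp add: add_ac)+)
 moreover have "kalg_axioms ?F"
 proof
  show "k \<odot>\<^bsub>?F\<^esub> f : carrier ?F" if "f : carrier ?F" for k f unfolding monoid_alg_simps(5) by (rule sc[OF that])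
 qed (erule (1) sl | erule (1) sr | simp add: distrib_left distrib_right mult.assoc)+
 ultimately show ?thesis by (rule kalg.intro)
qed

lemma single_closed: "u : carrier G ==> single u : carrier (monoid_alg G :: ('k::field, _) module)"
 by (auto simp: single_def monoid_alg_simps)

lemma monoid_alg_induct [consumes 1, case_names zero add]:
 assumes "f : carrier (monoid_alg G :: ('k::field, _) module)"
  and z: "P \<zero>\<^bsub>monoid_alg G\<^esub>"
  and a: "\<And>k u f. u : carrier G ==> f : carrier (monoid_alg G) ==> P f ==>
   P (k \<odot>\<^bsub>monoid_alg G\<^esub> single u \<oplus>\<^bsub>monoid_alg G\<^esub> f)"
 shows "P f"
proof -
 note [simp] = monoid_alg_simps
 have "finite S ==> f : carrier (monoid_alg G) ==> {x. f x ~= 0} = S ==> P f" for S f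
 proof (induction S arbitrary: f rule: finite_induct)
  case empty
  hence "f = (%x. 0)" by auto
  thus ?case using z by simp
 next
  case (insert u S)
  let ?g = "f(u := 0)"
  have supp: "{x. ?g x ~= 0} = S" using insert by auto
  hence g: "?g : carrier (monoid_alg G)" using insert by auto
  have u: "u : carrier G" using insert by auto
  have "f = f u \<odot>\<^bsub>monoid_alg G\<^esub> single u \<oplus>\<^bsub>monoid_alg G\<^esub> ?g" by (auto simp: single_def)
  thus ?case using a[OF u g insert.IH[OF g supp], of "f u"] by metis
 qed
 thus ?thesis using assms(1) by auto
qed

end

text \<open>Linear extension of a map given on the monoid. The sum runs over the support, which is
  literally the form in which \<open>rho\<close> is defined.\<close>

definition mext :: "('k::field, 'b) module => ('m => 'b) => ('m => 'k) => 'b" where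
 "mext B \<phi> f = (\<Oplus>\<^bsub>B\<^esub>u\<in>{u. f u ~= 0}. f u \<odot>\<^bsub>B\<^esub> \<phi> u)"

lemma (in kalg) mext_eq:
 assumes "finite U" "{u. f u ~= 0} \<subseteq> U" "\<phi> : U \<rightarrow> carrier A"
 shows "mext A \<phi> f = (\<Oplus>u\<in>U. f u \<odot> \<phi> u)" unfolding mext_def
 by (rule add.finprod_mono_neutral_cong_left) (use assms in \<open>auto simp: Pi_iff\<close>)

lemma (in kalg) mext_single: "\<phi> u : carrier A ==> mext A \<phi> (single u) = \<phi> u"
 by (subst mext_eq[of "{u}"]) (auto simp: single_def finsum_insert)

lemma (in kalg) mext_smult:
 assumes f: "finite {u. f u ~= 0}" "\<phi> : {u. f u ~= 0} \<rightarrow> carrier A"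
 shows "mext A \<phi> (%u. k * f u) = k \<odot> mext A \<phi> f"
proof -
 have "mext A \<phi> (%u. k * f u) = (\<Oplus>u\<in>{u. f u ~= 0}. (k * f u) \<odot> \<phi> u)" using f by (intro mext_eq) auto
 also have "... = (\<Oplus>u\<in>{u. f u ~= 0}. k \<odot> (f u \<odot> \<phi> u))"
  using f by (intro finsum_cong) (auto simp: Pi_iff smult_assoc1 simp_implies_def)
 also have "... = k \<odot> mext A \<phi> f" unfolding mext_def using f by (intro smult_finsum[symmetric]) (auto simp: Pi_iff)
 finally show ?thesis .
qed

lemma (in kalg) mext_add:
 assumes f: "finite {u. f u ~= 0}" "\<phi> : {u. f u ~= 0} \<rightarrow> carrier A"
  and g: "finite {u. g u ~= 0}" "\<phi> : {u. g u ~= 0} \<rightarrow> carrier A"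
 shows "mext A \<phi> (%u. f u + g u) = mext A \<phi> f \<oplus> mext A \<phi> g"
proof -
 let ?U = "{u. f u ~= 0} \<union> {u. g u ~= 0}"
 have U: "finite ?U" "\<phi> : ?U \<rightarrow> carrier A" using assms by auto
 have "mext A \<phi> (%u. f u + g u) = (\<Oplus>u\<in>?U. (f u + g u) \<odot> \<phi> u)" using U by (intro mext_eq) auto
 also have "... = (\<Oplus>u\<in>?U. f u \<odot> \<phi> u \<oplus> g u \<odot> \<phi> u)"
  using U by (intro finsum_cong) (auto simp: Pi_iff smult_l_distr simp_implies_def)
 also have "... = (\<Oplus>u\<in>?U. f u \<odot> \<phi> u) \<oplus> (\<Oplus>u\<in>?U. g u \<odot> \<phi> u)"
  using U by (intro finsum_addf) (auto simp: Pi_iff)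
 also have "... = mext A \<phi> f \<oplus> mext A \<phi> g" using U by (simp add: mext_eq[of ?U])
 finally show ?thesis .
qed

text \<open>The source of all homomorphisms out of free algebras, group algebras and the free model
  of the tensor product. Multiplicativity is checked on basis elements and extended linearly, one
  factor at a time.\<close>

lemma kalg_hom_mext:
 fixes B :: "('k::field, 'b) module"
 assumes M: "monoid M" and B: "kalg B"
  and cl: "\<And>u. u : carrier M ==> \<phi> u : carrier B"
  and mu: "\<And>u v. u : carrier M ==> v : carrier M ==> \<phi> (u \<otimes>\<^bsub>M\<^esub> v) = \<phi> u \<otimes>\<^bsub>B\<^esub> \<phi> v"
  and on: "\<phi> \<one>\<^bsub>M\<^esub> = \<one>\<^bsub>B\<^esub>"
 shows "kalg_hom (monoid_alg M) B (mext B \<phi>)"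
proof -
 interpret M: monoid M by fact
 interpret B: kalg B by fact
 let ?F = "monoid_alg M :: ('k, _) module"
 interpret F: kalg ?F by (rule M.kalg_monoid_alg)
 have c: "mext B \<phi> f : carrier B" if "f : carrier ?F" for f unfolding mext_def using that cl
  by (intro B.finsum_closed) (auto simp: Pi_iff subset_iff monoid_alg_simps)
 have a: "mext B \<phi> (f \<oplus>\<^bsub>?F\<^esub> g) = mext B \<phi> f \<oplus>\<^bsub>B\<^esub> mext B \<phi> g"
  if "f : carrier ?F" "g : carrier ?F" for f g using that cl by (simp add: B.mext_add Pi_iff subset_iff monoid_alg_simps)
 have s: "mext B \<phi> (k \<odot>\<^bsub>?F\<^esub> f) = k \<odot>\<^bsub>B\<^esub> mext B \<phi> f" if "f : carrier ?F" for f k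
  using that cl by (simp add: B.mext_smult Pi_iff subset_iff monoid_alg_simps)
 have z: "mext B \<phi> \<zero>\<^bsub>?F\<^esub> = \<zero>\<^bsub>B\<^esub>" by (simp add: mext_def monoid_alg_simps)
 have sc: "single u : carrier ?F" if "u : carrier M" for u using M.single_closed[OF that] .
 have o: "mext B \<phi> (single u) = \<phi> u" if "u : carrier M" for u by (rule B.mext_single[of \<phi> u, OF cl[OF that]])
 have sm: "mext B \<phi> (single u \<otimes>\<^bsub>?F\<^esub> g) = \<phi> u \<otimes>\<^bsub>B\<^esub> mext B \<phi> g"
  if u: "u : carrier M" and g: "g : carrier ?F" for u g using g
 proof (induction rule: M.monoid_alg_induct)
  case zero
  show ?case by (simp add: z cl u sc)
 next
  case (add k v g)
  have uv: "u \<otimes>\<^bsub>M\<^esub> v : carrier M" using u add by simp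
  show ?case by (simp add: F.r_distr F.smult_mult_r B.r_distr B.smult_mult_r a s o sc cl c u uv add M.single_mult mu)
 qed
 have m: "mext B \<phi> (f \<otimes>\<^bsub>?F\<^esub> g) = mext B \<phi> f \<otimes>\<^bsub>B\<^esub> mext B \<phi> g"
  if f: "f : carrier ?F" and g: "g : carrier ?F" for f g using f
 proof (induction rule: M.monoid_alg_induct)
  case zero
  show ?case by (simp add: z g c)
 next
  case (add k u f)
  show ?case by (simp add: F.l_distr F.smult_mult_l B.l_distr B.smult_mult_l a s o sc cl c g add sm)
 qed
 have "mext B \<phi> \<one>\<^bsub>?F\<^esub> = \<one>\<^bsub>B\<^esub>" by (simp add: monoid_alg_simps o on)
 with c a m s show ?thesis by (intro kalg_homI) (auto simp: F.kalg_axioms B.kalg_axioms)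
qed

subsection \<open>Quotients\<close>

lemma (in ring) minus_eq_zero: "a : carrier R ==> b : carrier R ==> a \<ominus> b = \<zero> \<longleftrightarrow> a = b"
 by (metis a_minus_def add.inv_closed add.inv_inv local.minus_equality r_neg)

locale kalg_quot = F: kalg F for F :: "('k::field, 'a) module" +
 fixes S
 assumes rels: "S \<subseteq> carrier F"
begin

abbreviation "J \<equiv> Idl\<^bsub>F\<^esub> S"
abbreviation "Q \<equiv> alg_quot F S"
abbreviation "cls \<equiv> alg_cls F S"

lemma idealJ: "ideal J F" by (rule F.genideal_ideal[OF rels])

text \<open>A ring ideal of a unital algebra absorbs scalars because k j = (k 1) j, so the ring
  quotient is automatically an algebra.\<close>

lemma J_smult: "j : J ==> k \<odot>\<^bsub>F\<^esub> j : J"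
proof -
 assume j: "j : J"
 hence c: "j : carrier F" using idealJ ideal.Icarr by metis
 have "k \<odot>\<^bsub>F\<^esub> j = (k \<odot>\<^bsub>F\<^esub> \<one>\<^bsub>F\<^esub>) \<otimes>\<^bsub>F\<^esub> j" using c by (simp add: F.smult_mult_l)
 thus ?thesis using ideal.I_l_closed[OF idealJ j, of "k \<odot>\<^bsub>F\<^esub> \<one>\<^bsub>F\<^esub>"] by simp
qed

lemma cls_eq_iff: "a : carrier F ==> b : carrier F ==> cls a = cls b \<longleftrightarrow> a \<ominus>\<^bsub>F\<^esub> b : J"
 using F.quotient_eq_iff_same_a_r_cos[OF idealJ, of a b] by (simp add: alg_cls_def)

lemma cls_self: "a : carrier F ==> a : cls a"
 unfolding alg_cls_def a_r_coset_def' using idealJ additive_subgroup.zero_closed[OF ideal.axioms(1)[OF idealJ]] by (force simp: )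

lemma mem_cls: "a : carrier F ==> b : cls a ==> b : carrier F & b \<ominus>\<^bsub>F\<^esub> a : J"
proof -
 assume a: "a : carrier F" and "b : cls a"
 then obtain j where j: "j : J" "b = j \<oplus>\<^bsub>F\<^esub> a" by (auto simp: alg_cls_def a_r_coset_def')
 have jc: "j : carrier F" using j idealJ ideal.Icarr by metis
 have "b \<ominus>\<^bsub>F\<^esub> a = j" using j jc a by (simp add: a_minus_def F.a_assoc F.r_neg)
 thus ?thesis using j jc a by simp
qed

lemma Q_fields:
 "carrier Q = carrier (F Quot J)" "mult Q = mult (F Quot J)" "one Q = one (F Quot J)"
 "zero Q = zero (F Quot J)" "add Q = add (F Quot J)" by (simp_all add: alg_quot_def Let_def)

lemma carrier_Q: "carrier Q = cls ` carrier F" by (auto simp: Q_fields FactRing_def A_RCOSETS_def' alg_cls_def a_r_coset_def')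

lemma cls_closed [simp, intro]: "a : carrier F ==> cls a : carrier Q" by (auto simp: carrier_Q)

lemma cls_add: "a : carrier F ==> b : carrier F ==> cls (a \<oplus>\<^bsub>F\<^esub> b) = cls a \<oplus>\<^bsub>Q\<^esub> cls b"
 and cls_mult: "a : carrier F ==> b : carrier F ==> cls (a \<otimes>\<^bsub>F\<^esub> b) = cls a \<otimes>\<^bsub>Q\<^esub> cls b"
 and cls_one: "cls \<one>\<^bsub>F\<^esub> = \<one>\<^bsub>Q\<^esub>"
 using ideal.rcos_ring_hom[OF idealJ] by (auto simp: ring_hom_def Q_fields alg_cls_def)

lemma cls_zero: "cls \<zero>\<^bsub>F\<^esub> = \<zero>\<^bsub>Q\<^esub>"
 using F.a_rcos_zero[OF idealJ] additive_subgroup.zero_closed[OF ideal.axioms(1)[OF idealJ]]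
 by (simp add: alg_cls_def Q_fields FactRing_def)

text \<open>The scalar multiple of a coset is defined as a union over its representatives. The union
  is a single coset, since differences of representatives stay in the ideal after scaling.\<close>

lemma cls_smult: "a : carrier F ==> cls (k \<odot>\<^bsub>F\<^esub> a) = k \<odot>\<^bsub>Q\<^esub> cls a"
proof -
 assume a: "a : carrier F"
 have "cls (k \<odot>\<^bsub>F\<^esub> b) = cls (k \<odot>\<^bsub>F\<^esub> a)" if "b : cls a" for b
 proof -
  have b: "b : carrier F" "b \<ominus>\<^bsub>F\<^esub> a : J" using mem_cls[OF a that] by auto
  have "k \<odot>\<^bsub>F\<^esub> b \<ominus>\<^bsub>F\<^esub> k \<odot>\<^bsub>F\<^esub> a : J" using J_smult[OF b(2), of k] a b by (simp add: F.smult_diff)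
  thus ?thesis using a b by (simp add: cls_eq_iff)
 qed
 moreover have "k \<odot>\<^bsub>Q\<^esub> cls a = (\<Union>f\<in>cls a. cls (k \<odot>\<^bsub>F\<^esub> f))"
  by (simp add: alg_quot_def alg_cls_def Let_def)
 moreover have "(\<Union>f\<in>cls a. cls (k \<odot>\<^bsub>F\<^esub> a)) = cls (k \<odot>\<^bsub>F\<^esub> a)"
  using cls_self[OF a] by blast
 ultimately show ?thesis by (metis (no_types, lifting) SUP_cong)
qed

lemma kalg_Q: "kalg Q"
proof -
 interpret Q': ring "F Quot J" by (rule ideal.quotient_is_ring[OF idealJ])
 have "ring Q"
 proof (intro ringI abelian_groupI monoidI; unfold Q_fields)
  fix x assume "x : carrier (F Quot J)"
  thus "\<exists>y\<in>carrier (F Quot J). y \<oplus>\<^bsub>F Quot J\<^esub> x = \<zero>\<^bsub>F Quot J\<^esub>"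
   using Q'.l_neg Q'.a_inv_closed by blast
 qed (simp_all add: Q'.a_ac Q'.m_assoc Q'.l_distr Q'.r_distr)
 moreover have "kalg_axioms Q" by (intro kalg_axioms.intro; unfold carrier_Q; clarify)
   (simp_all add: cls_smult[symmetric] cls_add[symmetric] cls_mult[symmetric] F.smult_l_distr
    F.smult_r_distr F.smult_assoc1 F.smult_mult_l F.smult_mult_r)
 ultimately show ?thesis by (rule kalg.intro)
qed

lemma cls_hom: "kalg_hom F Q cls" by (rule kalg_homI)
  (simp_all add: F.kalg_axioms kalg_Q cls_add cls_mult cls_one cls_smult)

lemma cls_rel_eq: "a \<ominus>\<^bsub>F\<^esub> b : S ==> a : carrier F ==> b : carrier F ==> cls a = cls b"
 using F.genideal_self[OF rels] cls_eq_iff by auto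

lemma ker_ideal:
 assumes "kalg_hom F B h"
 shows "ideal {x : carrier F. h x = \<zero>\<^bsub>B\<^esub>} F"
proof -
 interpret h: kalg_hom F B h by fact
 show ?thesis by (rule idealI[OF F.ring_axioms])
   (auto intro!: subgroup.intro simp: a_inv_def[symmetric])
qed

lemma lift:
 assumes h: "kalg_hom F B h" and S0: "\<And>s. s : S ==> h s = \<zero>\<^bsub>B\<^esub>"
 shows "\<exists>g. kalg_hom Q B g & (\<forall>a\<in>carrier F. g (cls a) = h a)"
proof -
 interpret h: kalg_hom F B h by fact
 have "J \<subseteq> {x : carrier F. h x = \<zero>\<^bsub>B\<^esub>}"
  by (rule F.genideal_minimal[OF ker_ideal[OF h]]) (use S0 rels in auto)
 hence ker: "\<And>x. x : J ==> h x = \<zero>\<^bsub>B\<^esub>" by auto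
 have wd: "h b = h a" if "a : carrier F" "b : cls a" for a b
 proof -
  have "b : carrier F" "h (b \<ominus>\<^bsub>F\<^esub> a) = \<zero>\<^bsub>B\<^esub>" using mem_cls[OF that] ker by auto
  thus ?thesis using that(1) by (simp add: h.B.minus_eq_zero)
 qed
 define g where "g X = h (SOME b. b : X)" for X
 have g: "g (cls a) = h a" if "a : carrier F" for a unfolding g_def using wd[OF that someI[of "%b. b : cls a", OF cls_self[OF that]]] .
 have "kalg_hom Q B g" by (rule kalg_homI; (unfold carrier_Q)?; (clarify)?)
   (simp_all add: kalg_Q h.B.kalg_axioms g cls_smult[symmetric] cls_add[symmetric] cls_mult[symmetric] cls_one[symmetric])
 thus ?thesis using g by blast
qed

end

subsection \<open>Linear spans\<close>

text \<open>Built one scaled generator at a time, so that statements about spans are proved by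
  induction without finite families of coefficients.\<close>

inductive_set lspan :: "('k, 'a) module => 'a set => 'a set" for A S where
 zero: "\<zero>\<^bsub>A\<^esub> : lspan A S"
| step: "s : S ==> t : lspan A S ==> k \<odot>\<^bsub>A\<^esub> s \<oplus>\<^bsub>A\<^esub> t : lspan A S"

context kalg
begin

lemma lspan_closed: "S \<subseteq> carrier A ==> t : lspan A S ==> t : carrier A" by (rotate_tac, induction rule: lspan.induct) auto

lemma lspan_incl: "S \<subseteq> carrier A ==> s : S ==> s : lspan A S" using lspan.step[OF _ lspan.zero, of s S A 1] by auto

lemma lspan_add:
 assumes S: "S \<subseteq> carrier A" and "a : lspan A S" "b : lspan A S"
 shows "a \<oplus> b : lspan A S" using assms(2)
proof (induction rule: lspan.induct)
 case zero
 thus ?case using assms lspan_closed by simp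
next
 case (step s t k)
 hence "s : carrier A" "t : carrier A" "b : carrier A" using S assms lspan_closed by auto
 hence "k \<odot> s \<oplus> t \<oplus> b = k \<odot> s \<oplus> (t \<oplus> b)" by (simp add: a_assoc)
 thus ?case using step lspan.step by metis
qed

lemma lspan_smult:
 assumes S: "S \<subseteq> carrier A" and "a : lspan A S"
 shows "k \<odot> a : lspan A S" using assms(2)
proof (induction rule: lspan.induct)
 case zero
 thus ?case by (simp add: lspan.zero)
next
 case (step s t l)
 hence "s : carrier A" "t : carrier A" using S lspan_closed by auto
 hence "k \<odot> (l \<odot> s \<oplus> t) = (k * l) \<odot> s \<oplus> k \<odot> t" by (simp add: smult_r_distr smult_assoc1)
 thus ?case using step lspan.step by metis
qed

lemma lspan_induct_closed:
 assumes S: "S \<subseteq> carrier A" and "a : lspan A S" and "P \<zero>"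
  and "\<And>a b. a : carrier A ==> b : carrier A ==> P a ==> P b ==> P (a \<oplus> b)"
  and "\<And>k s. s : S ==> P (k \<odot> s)"
 shows "P a" using assms(2)
proof (induction rule: lspan.induct)
 case (step s t l)
 thus ?case using S lspan_closed by (intro assms(4,5)) auto
qed (rule assms(3))

lemma lspan_least:
 assumes S: "S \<subseteq> lspan A S'" "S' \<subseteq> carrier A" and "a : lspan A S"
 shows "a : lspan A S'" using assms(3)
proof (induction rule: lspan.induct)
 case (step s t k)
 thus ?case using S by (intro lspan_add lspan_smult) auto
qed (rule lspan.zero)

lemma lspan_mult_left:
 assumes S: "S \<subseteq> carrier A" "S' \<subseteq> carrier A" and x: "x : carrier A"
  and m: "\<And>s. s : S ==> x \<otimes> s : lspan A S'" and "a : lspan A S"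
 shows "x \<otimes> a : lspan A S'" using assms(5)
proof (induction rule: lspan.induct)
 case zero
 thus ?case using x by (simp add: lspan.zero)
next
 case (step s t k)
 hence c: "s : carrier A" "t : carrier A" using S lspan_closed by auto
 hence "x \<otimes> (k \<odot> s \<oplus> t) = k \<odot> (x \<otimes> s) \<oplus> x \<otimes> t" using x by (simp add: r_distr smult_mult_r)
 thus ?case using step m S by (auto intro!: lspan_add lspan_smult)
qed

lemma lspan_finsum:
 assumes S: "S \<subseteq> carrier A" and "f : I \<rightarrow> lspan A S"
 shows "finsum A f I : lspan A S" using assms(2)
proof (induction I rule: infinite_finite_induct)
 case (insert i I)
 have "f : I \<rightarrow> carrier A" "f i : carrier A" using insert.prems lspan_closed[OF S] by auto
 thus ?case using insert lspan_add[OF S] by (auto simp: finsum_insert)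
qed (simp_all add: lspan.zero)

end

subsection \<open>Evaluation of polynomials\<close>

definition peval :: "('k::field, 'a) module => 'a => 'k poly => 'a" where
 "peval A K p = fold_coeffs (%a v. a \<odot>\<^bsub>A\<^esub> \<one>\<^bsub>A\<^esub> \<oplus>\<^bsub>A\<^esub> K \<otimes>\<^bsub>A\<^esub> v) p \<zero>\<^bsub>A\<^esub>"

context kalg
begin

lemma peval_0 [simp]: "peval A K 0 = \<zero>" by (simp add: peval_def)

lemma peval_pCons: "K : carrier A ==> peval A K (pCons a p) = a \<odot> \<one> \<oplus> K \<otimes> peval A K p"
 by (cases "a = 0 & p = 0") (auto simp: peval_def)

lemma peval_closed [simp]: "K : carrier A ==> peval A K p : carrier A" by (induction p) (auto simp: peval_pCons)

lemma peval_add: "K : carrier A ==> peval A K (p + q) = peval A K p \<oplus> peval A K q"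
proof (induction p q rule: poly_induct2)
 case (pCons a p b q)
 have "peval A K (pCons a p + pCons b q) = (a + b) \<odot> \<one> \<oplus> K \<otimes> (peval A K p \<oplus> peval A K q)"
  using pCons by (simp add: peval_pCons)
 also have "... = peval A K (pCons a p) \<oplus> peval A K (pCons b q)" using pCons by (simp add: peval_pCons smult_l_distr r_distr a_ac)
 finally show ?case .
qed simp

lemma peval_smult: "K : carrier A ==> peval A K (Polynomial.smult k p) = k \<odot> peval A K p"
 by (induction p) (auto simp: peval_pCons smult_r_distr smult_assoc1 smult_mult_r)

lemma peval_mult: "K : carrier A ==> peval A K (p * q) = peval A K p \<otimes> peval A K q"
proof (induction p)
 case (pCons a p)
 have "peval A K (pCons a p * q) = a \<odot> peval A K q \<oplus> K \<otimes> (peval A K p \<otimes> peval A K q)"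
  using pCons by (simp add: peval_add peval_smult peval_pCons)
 also have "... = peval A K (pCons a p) \<otimes> peval A K q" using pCons by (simp add: peval_pCons l_distr smult_mult_l m_assoc)
 finally show ?case .
qed simp

lemma peval_1: "K : carrier A ==> peval A K 1 = \<one>" using peval_pCons[of K 1 0] by (simp add: one_pCons)

end

lemma (in kalg_hom) peval: "K : carrier A ==> h (peval A K p) = peval B (h K) p" by (induction p) (auto simp: A.peval_pCons B.peval_pCons)

subsection \<open>Complexification\<close>

lemma complexify_simps:
 "carrier (complexify A) = carrier A \<times> carrier A"
 "(a, b) \<otimes>\<^bsub>complexify A\<^esub> (a', b') = ((a \<otimes>\<^bsub>A\<^esub> a') \<ominus>\<^bsub>A\<^esub> (b \<otimes>\<^bsub>A\<^esub> b'), (a \<otimes>\<^bsub>A\<^esub> b') \<oplus>\<^bsub>A\<^esub> (b \<otimes>\<^bsub>A\<^esub> a'))"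
 "\<one>\<^bsub>complexify A\<^esub> = (\<one>\<^bsub>A\<^esub>, \<zero>\<^bsub>A\<^esub>)"
 "\<zero>\<^bsub>complexify A\<^esub> = (\<zero>\<^bsub>A\<^esub>, \<zero>\<^bsub>A\<^esub>)"
 "(a, b) \<oplus>\<^bsub>complexify A\<^esub> (a', b') = (a \<oplus>\<^bsub>A\<^esub> a', b \<oplus>\<^bsub>A\<^esub> b')"
 "k \<odot>\<^bsub>complexify A\<^esub> (a, b) = ((Re k \<odot>\<^bsub>A\<^esub> a) \<ominus>\<^bsub>A\<^esub> (Im k \<odot>\<^bsub>A\<^esub> b), (Re k \<odot>\<^bsub>A\<^esub> b) \<oplus>\<^bsub>A\<^esub> (Im k \<odot>\<^bsub>A\<^esub> a))"
 by (simp_all add: complexify_def)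

lemma kalg_complexify:
 fixes A :: "(real, 'a) module"
 assumes "kalg A"
 shows "kalg (complexify A)"
proof -
 interpret kalg A by fact
 note s = a_minus_def a_ac m_assoc l_distr r_distr smult_l_distr smult_r_distr smult_mult_l smult_mult_r
  minus_add l_minus r_minus smult_minus smult_minus_r
 have assoc1: "Re k \<odot>\<^bsub>A\<^esub> (l \<odot>\<^bsub>A\<^esub> a) = (Re k * l) \<odot>\<^bsub>A\<^esub> a" if "a : carrier A" for k l a
  using smult_assoc1[OF that] by simp
 have assoc2: "Im k \<odot>\<^bsub>A\<^esub> (l \<odot>\<^bsub>A\<^esub> a) = (Im k * l) \<odot>\<^bsub>A\<^esub> a" if "a : carrier A" for k l a
  using smult_assoc1[OF that] by simp
 have d: "(r - t) \<odot>\<^bsub>A\<^esub> a = r \<odot>\<^bsub>A\<^esub> a \<oplus>\<^bsub>A\<^esub> \<ominus>\<^bsub>A\<^esub> (t \<odot>\<^bsub>A\<^esub> a)" if "a : carrier A" for r t a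
  using smult_l_distr[OF that, of r "-t"] smult_minus[OF that] by simp
 have "ring (complexify A)"
 proof (intro ringI abelian_groupI monoidI; (unfold complexify_simps(1))?)
  fix x assume "x : carrier A \<times> carrier A"
  thus "\<exists>y\<in>carrier A \<times> carrier A. y \<oplus>\<^bsub>complexify A\<^esub> x = \<zero>\<^bsub>complexify A\<^esub>"
   by (intro bexI[of _ "(\<ominus>\<^bsub>A\<^esub> fst x, \<ominus>\<^bsub>A\<^esub> snd x)"]) (auto simp: complexify_simps l_neg)
 qed (auto simp: complexify_simps s)
 moreover have "kalg_axioms (complexify A)" by (intro kalg_axioms.intro; (unfold complexify_simps(1))?)
   (auto simp: complexify_simps s assoc1 assoc2 d mult.commute)
 ultimately show ?thesis by (rule kalg.intro)
qed

subsection \<open>Tensor products\<close>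

locale tensor = A: kalg A + B: kalg B
 for A :: "('k::field, 'a) module" and B :: "('k, 'b) module"
begin

abbreviation "TF \<equiv> tensor_free A B"
abbreviation "T \<equiv> tensor_alg A B"
abbreviation "tn \<equiv> tens A B"

lemma monoid_AB: "monoid (A \<times>\<times> B)" by (intro DirProd_monoid A.monoid_axioms B.monoid_axioms)

lemma kalg_TF: "kalg TF" unfolding tensor_free_def by (rule monoid.kalg_monoid_alg[OF monoid_AB])

sublocale TF: kalg TF by (rule kalg_TF)

lemma single_TF: "a : carrier A ==> b : carrier B ==> single (a, b) : carrier TF"
 unfolding tensor_free_def by (rule monoid.single_closed[OF monoid_AB]) simp

lemma rels_TF: "bilinear_rels A B \<subseteq> carrier TF" by (auto simp: bilinear_rels_def Let_def single_TF)

sublocale q: kalg_quot TF "bilinear_rels A B" by unfold_locales (rule rels_TF)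

lemma T_eq: "T = q.Q" and tn_eq: "tn a b = q.cls (single (a, b))" by (simp_all add: tensor_alg_def tens_def)

lemma kalg_T: "kalg T" unfolding T_eq by (rule q.kalg_Q)

sublocale T: kalg T by (rule kalg_T)

lemma tn_closed [simp, intro]: "a : carrier A ==> b : carrier B ==> tn a b : carrier T" by (simp add: T_eq tn_eq single_TF)

lemma tn_add_l: "a : carrier A ==> a' : carrier A ==> b : carrier B ==>
  tn (a \<oplus>\<^bsub>A\<^esub> a') b = tn a b \<oplus>\<^bsub>T\<^esub> tn a' b" unfolding T_eq tn_eq
 by (subst q.cls_add[symmetric], simp_all only: single_TF A.a_closed B.a_closed, rule q.cls_rel_eq,
   simp_all only: single_TF A.a_closed B.a_closed TF.a_closed)
  (unfold bilinear_rels_def Let_def, blast)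

lemma tn_add_r: "a : carrier A ==> b : carrier B ==> b' : carrier B ==>
  tn a (b \<oplus>\<^bsub>B\<^esub> b') = tn a b \<oplus>\<^bsub>T\<^esub> tn a b'" unfolding T_eq tn_eq
 by (subst q.cls_add[symmetric], simp_all only: single_TF A.a_closed B.a_closed, rule q.cls_rel_eq,
   simp_all only: single_TF A.a_closed B.a_closed TF.a_closed)
  (unfold bilinear_rels_def Let_def, blast)

lemma tn_smult_l: "a : carrier A ==> b : carrier B ==> tn (k \<odot>\<^bsub>A\<^esub> a) b = k \<odot>\<^bsub>T\<^esub> tn a b"
 unfolding T_eq tn_eq by (subst q.cls_smult[symmetric], simp_all only: single_TF, rule q.cls_rel_eq,
   simp_all only: single_TF A.smult_closed B.smult_closed TF.smult_closed)
  (unfold bilinear_rels_def Let_def, blast)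

lemma tn_smult_r: "a : carrier A ==> b : carrier B ==> tn a (k \<odot>\<^bsub>B\<^esub> b) = k \<odot>\<^bsub>T\<^esub> tn a b"
 unfolding T_eq tn_eq by (subst q.cls_smult[symmetric], simp_all only: single_TF, rule q.cls_rel_eq,
   simp_all only: single_TF A.smult_closed B.smult_closed TF.smult_closed)
  (unfold bilinear_rels_def Let_def, blast)

lemma tn_mult: "a : carrier A ==> a' : carrier A ==> b : carrier B ==> b' : carrier B ==>
  tn a b \<otimes>\<^bsub>T\<^esub> tn a' b' = tn (a \<otimes>\<^bsub>A\<^esub> a') (b \<otimes>\<^bsub>B\<^esub> b')"
proof -
 assume c: "a : carrier A" "a' : carrier A" "b : carrier B" "b' : carrier B"
 have "single (a, b) \<otimes>\<^bsub>TF\<^esub> single (a', b') = single (a \<otimes>\<^bsub>A\<^esub> a', b \<otimes>\<^bsub>B\<^esub> b')"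
  unfolding tensor_free_def by (subst monoid.single_mult[OF monoid_AB]) simp
 thus ?thesis unfolding T_eq tn_eq using q.cls_mult[OF single_TF single_TF, of a b a' b'] c by simp
qed

lemma tn_one: "tn \<one>\<^bsub>A\<^esub> \<one>\<^bsub>B\<^esub> = \<one>\<^bsub>T\<^esub>"
 unfolding T_eq tn_eq q.cls_one[symmetric] by (simp add: tensor_free_def monoid_alg_simps)

lemma tn_zero_l [simp]: "b : carrier B ==> tn \<zero>\<^bsub>A\<^esub> b = \<zero>\<^bsub>T\<^esub>"
 using tn_smult_l[of "\<zero>\<^bsub>A\<^esub>" b 0] by simp

lemma tensor_span: "carrier T = lspan T {tn a b | a b. a : carrier A & b : carrier B}" (is "_ = lspan T ?S")
proof
 have S: "?S \<subseteq> carrier T" by auto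
 thus "lspan T ?S \<subseteq> carrier T" using T.lspan_closed by auto
 have "q.cls f : lspan T ?S" if "f : carrier TF" for f using that unfolding tensor_free_def
 proof (induction rule: monoid.monoid_alg_induct[OF monoid_AB])
  case 1
  show ?case using that unfolding tensor_free_def .
 next
  case 2
  show ?case using q.cls_zero lspan.zero[of T] by (simp add: T_eq tensor_free_def)
 next
  case (3 k u f)
  obtain a b where u: "u = (a, b)" "a : carrier A" "b : carrier B" using 3(1) by auto
  have f: "f : carrier TF" using 3 by (simp add: tensor_free_def)
  have "q.cls (k \<odot>\<^bsub>TF\<^esub> single (a, b) \<oplus>\<^bsub>TF\<^esub> f) = k \<odot>\<^bsub>T\<^esub> tn a b \<oplus>\<^bsub>T\<^esub> q.cls f"
   unfolding T_eq tn_eq using u f single_TF[OF u(2,3)] by (simp only: q.cls_add q.cls_smult TF.smult_closed)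
  moreover have "... : lspan T ?S" using u 3(3) f by (intro lspan.step) (auto simp: tensor_free_def)
  ultimately show ?case by (simp add: u tensor_free_def)
 qed
 thus "carrier T \<subseteq> lspan T ?S" by (auto simp: T_eq q.carrier_Q)
qed

text \<open>That the two images commute is what makes (a, b) |-> p a q b multiplicative on the
  product monoid; its bilinearity then kills the relations of the tensor product.\<close>

lemma tensor_lift:
 assumes p: "kalg_hom A D p" and q: "kalg_hom B D q"
  and c: "\<And>a b. a : carrier A ==> b : carrier B ==> p a \<otimes>\<^bsub>D\<^esub> q b = q b \<otimes>\<^bsub>D\<^esub> p a"
 shows "\<exists>g. kalg_hom T D g & (\<forall>a\<in>carrier A. \<forall>b\<in>carrier B. g (tn a b) = p a \<otimes>\<^bsub>D\<^esub> q b)"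
proof -
 interpret p: kalg_hom A D p by fact
 interpret q: kalg_hom B D q by fact
 let ?\<phi> = "%(a, b). p a \<otimes>\<^bsub>D\<^esub> q b"
 let ?h = "mext D ?\<phi>"
 have h: "kalg_hom TF D ?h" unfolding tensor_free_def
 proof (rule kalg_hom_mext[OF monoid_AB p.B.kalg_axioms])
  fix u v assume u: "u : carrier (A \<times>\<times> B)" and v: "v : carrier (A \<times>\<times> B)"
  obtain a b a' b' where uv: "u = (a, b)" "v = (a', b')" by (cases u, cases v)
  have ab: "a : carrier A" "b : carrier B" "a' : carrier A" "b' : carrier B" using u v uv by auto
  have "p a \<otimes>\<^bsub>D\<^esub> p a' \<otimes>\<^bsub>D\<^esub> (q b \<otimes>\<^bsub>D\<^esub> q b') = p a \<otimes>\<^bsub>D\<^esub> (p a' \<otimes>\<^bsub>D\<^esub> q b) \<otimes>\<^bsub>D\<^esub> q b'"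
   using ab by (simp add: p.B.m_assoc)
  also have "... = p a \<otimes>\<^bsub>D\<^esub> (q b \<otimes>\<^bsub>D\<^esub> p a') \<otimes>\<^bsub>D\<^esub> q b'"
   using c[OF ab(3,2)] by simp
  also have "... = p a \<otimes>\<^bsub>D\<^esub> q b \<otimes>\<^bsub>D\<^esub> (p a' \<otimes>\<^bsub>D\<^esub> q b')"
   using ab by (simp add: p.B.m_assoc)
  finally show "?\<phi> (u \<otimes>\<^bsub>A \<times>\<times> B\<^esub> v) = ?\<phi> u \<otimes>\<^bsub>D\<^esub> ?\<phi> v"
   using ab by (simp add: uv)
 qed auto
 interpret h: kalg_hom TF D ?h by (rule h)
 have hs: "?h (single (a, b)) = p a \<otimes>\<^bsub>D\<^esub> q b" if "a : carrier A" "b : carrier B" for a b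
  using that p.B.mext_single[of ?\<phi> "(a, b)"] by simp
 have s0: "?h s = \<zero>\<^bsub>D\<^esub>" if "s : bilinear_rels A B" for s using that unfolding bilinear_rels_def Let_def
  by (auto simp: hs single_TF p.B.l_distr p.B.r_distr p.B.smult_mult_l p.B.smult_mult_r p.B.minus_eq_zero)
 obtain g where "kalg_hom q.Q D g" "\<forall>a\<in>carrier TF. g (q.cls a) = ?h a" using q.lift[OF h s0] by blast
 thus ?thesis using hs by (intro exI[of _ g]) (auto simp: T_eq tn_eq single_TF)
qed

end

section \<open>Polynomial functions on a Euclidean space and their calculus\<close>

section \<open>Polynomial functions\<close>

text \<open>Polynomials are taken as functions on a real space, so that identities can be checked
  pointwise and substitutions are compositions. The price is that the independence of monomials has
  to be proved.\<close>

inductive cpoly :: "('a::euclidean_space => complex) => bool" where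
 const: "cpoly (%v. k)"
| lin: "cpoly (%v. of_real (v \<bullet> u))"
| add: "cpoly f ==> cpoly g ==> cpoly (%v. f v + g v)"
| mult: "cpoly f ==> cpoly g ==> cpoly (%v. f v * g v)"

typedef (overloaded) 'a pf = "{f :: 'a::euclidean_space => complex. cpoly f}" morphisms ev Abs_pf by (auto intro: cpoly.const)

setup_lifting type_definition_pf

instantiation pf :: (euclidean_space) comm_ring_1
begin

lift_definition zero_pf :: "'a pf" is "%v. 0" by (rule cpoly.const)
lift_definition one_pf :: "'a pf" is "%v. 1" by (rule cpoly.const)
lift_definition plus_pf :: "'a pf => 'a pf => 'a pf" is "%f g v. f v + g v" by (rule cpoly.add)
lift_definition times_pf :: "'a pf => 'a pf => 'a pf" is "%f g v. f v * g v" by (rule cpoly.mult)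
lift_definition uminus_pf :: "'a pf => 'a pf" is "%f v. - f v" using cpoly.mult[OF cpoly.const[of "-1"]] by simp
lift_definition minus_pf :: "'a pf => 'a pf => 'a pf" is "%f g v. f v - g v"
 using cpoly.add[OF _ cpoly.mult[OF cpoly.const[of "-1"]]] by simp

instance by standard (transfer; simp add: algebra_simps fun_eq_iff)+

end

lift_definition const :: "complex => 'a::euclidean_space pf" is "%k v. k" by (rule cpoly.const)
lift_definition lin :: "'a => 'a::euclidean_space pf" is "%u v. of_real (v \<bullet> u)" by (rule cpoly.lin)

lemma pf_eqI: "(\<And>v. ev f v = ev g v) ==> f = g" by (metis ev_inject ext)

lemma ev_simps [simp]:
 "ev 0 v = 0" "ev 1 v = 1" "ev (f + g) v = ev f v + ev g v" "ev (f * g) v = ev f v * ev g v"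
 "ev (- f) v = - ev f v" "ev (f - g) v = ev f v - ev g v" "ev (const k) v = k"
 "ev (lin u) v = of_real (v \<bullet> u)" by (transfer; simp)+

lemma ev_sum: "ev (sum f I) v = (\<Sum>i\<in>I. ev (f i) v)" by (induction I rule: infinite_finite_induct) auto

lemma ev_prod_mset: "ev (\<Prod>i\<in>#m. f i) v = (\<Prod>i\<in>#m. ev (f i) v)" by (induction m) auto

lemma ev_power: "ev (f ^ n) v = ev f v ^ n" by (induction n) auto

lemma pf_induct [case_names const lin add mult]:
 assumes "\<And>k. P (const k)" "\<And>u. P (lin u)" "\<And>f g. P f ==> P g ==> P (f + g)" "\<And>f g. P f ==> P g ==> P (f * g)"
 shows "P f"
proof -
 have "cpoly g ==> P (Abs_pf g)" for g
 proof (induction rule: cpoly.induct)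
  case (const k)
  thus ?case using assms(1)[of k] by (simp add: const_def)
 next
  case (lin u)
  thus ?case using assms(2)[of u] by (simp add: lin_def)
 next
  case (add f g)
  have "Abs_pf f + Abs_pf g = Abs_pf (%v. f v + g v)" using add by (intro pf_eqI) (simp add: Abs_pf_inverse cpoly.add)
  thus ?case using assms(3) add by metis
 next
  case (mult f g)
  have "Abs_pf f * Abs_pf g = Abs_pf (%v. f v * g v)" using mult by (intro pf_eqI) (simp add: Abs_pf_inverse cpoly.mult)
  thus ?case using assms(4) mult by metis
 qed
 from this[of "ev f"] show ?thesis using ev[of f] by (simp add: ev_inverse)
qed

lemma const_simps:
 "const 0 = 0" "const 1 = 1" "const (a + b) = const a + const b" "const (a * b) = const a * const b"
 "const (- a) = - const a" "const (a - b) = const a - const b" by (auto intro!: pf_eqI)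

lemma lin_simps:
 "lin 0 = 0" "lin (u + v) = lin u + lin v" "lin (r *\<^sub>R u) = const (of_real r) * lin u" "lin (- u) = - lin u"
 "lin (u - v) = lin u - lin v" by (auto intro!: pf_eqI simp: inner_simps)

text \<open>Restriction to a line reduces questions to one variable; it yields the absence of zero
  divisors, on which all later cancellations rest.\<close>

lemma pf_line: "\<exists>p. \<forall>t. ev f (v + t *\<^sub>R u) = poly p (of_real t)"
proof (induction f rule: pf_induct)
 case (const k)
 thus ?case by (intro exI[of _ "[:k:]"]) simp
next
 case (lin w)
 thus ?case by (intro exI[of _ "[:of_real (v \<bullet> w), of_real (u \<bullet> w):]"]) (simp add: inner_simps)
next
 case (add f g)
 then obtain p q where "\<forall>t. ev f (v + t *\<^sub>R u) = poly p (of_real t)" "\<forall>t. ev g (v + t *\<^sub>R u) = poly q (of_real t)"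
  by blast
 thus ?case by (intro exI[of _ "p + q"]) simp
next
 case (mult f g)
 then obtain p q where "\<forall>t. ev f (v + t *\<^sub>R u) = poly p (of_real t)" "\<forall>t. ev g (v + t *\<^sub>R u) = poly q (of_real t)"
  by blast
 thus ?case by (intro exI[of _ "p * q"]) simp
qed

lemma poly_real_zero:
 fixes p :: "complex poly"
 assumes "\<And>t::real. poly p (of_real t) = 0"
 shows "p = 0"
proof (rule ccontr)
 assume "p ~= 0"
 hence "finite {x. poly p x = 0}" by (rule poly_roots_finite)
 moreover have "range complex_of_real \<subseteq> {x. poly p x = 0}" using assms by auto
 moreover have "infinite (range complex_of_real)"
  using finite_imageD[of complex_of_real UNIV] by (auto simp: inj_on_def infinite_UNIV_char_0)
 ultimately show False by (meson finite_subset)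
qed

instance pf :: (euclidean_space) idom
proof
 fix f g :: "'a pf"
 assume "f ~= 0" "g ~= 0"
 then obtain a b where ab: "ev f a ~= 0" "ev g b ~= 0" by (metis ev_simps(1) pf_eqI)
 \<comment> \<open>On the line from a to b both restrictions are nonzero: that of f at t = 0, that
   of g at t = 1.\<close>
 obtain p q where pq: "\<forall>t. ev f (a + t *\<^sub>R (b - a)) = poly p (of_real t)"
  "\<forall>t. ev g (a + t *\<^sub>R (b - a)) = poly q (of_real t)" using pf_line by metis
 have "p ~= 0" using pq(1)[rule_format, of 0] ab by auto
 moreover have "q ~= 0" using pq(2)[rule_format, of 1] ab by auto
 ultimately have "p * q ~= 0" by simp
 then obtain t :: real where "poly (p * q) (of_real t) ~= 0" using poly_real_zero by blast
 hence "ev (f * g) (a + t *\<^sub>R (b - a)) ~= 0" using pq by simp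
 thus "f * g ~= 0" by (metis ev_simps(1))
qed

lemma lin_eq_0_iff: "lin u = 0 \<longleftrightarrow> u = 0"
proof
 assume "lin u = 0"
 hence "ev (lin u) u = 0" by simp
 thus "u = 0" by simp
qed (simp add: lin_simps)

subsection \<open>Directional derivatives\<close>

lemma pd_exists:
 "\<exists>g. \<forall>\<gamma> t. (\<gamma> has_vector_derivative u) (at t) -->
   ((%s::real. ev f (\<gamma> s)) has_vector_derivative ev g (\<gamma> t)) (at t)"
proof (induction f rule: pf_induct)
 case (const k)
 thus ?case by (intro exI[of _ 0]) simp
next
 case (lin w)
 show ?case
 proof (intro exI[of _ "const (of_real (u \<bullet> w))"] allI impI)
  fix \<gamma> :: "real => 'a" and t assume "(\<gamma> has_vector_derivative u) (at t)"
  hence "((%s. \<gamma> s \<bullet> w) has_vector_derivative u \<bullet> w) (at t)"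
   by (rule bounded_linear.has_vector_derivative[OF bounded_linear_inner_left])
  hence "((%s. complex_of_real (\<gamma> s \<bullet> w)) has_vector_derivative of_real (u \<bullet> w)) (at t)"
   by (rule bounded_linear.has_vector_derivative[OF bounded_linear_of_real])
  thus "((%s. ev (lin w) (\<gamma> s)) has_vector_derivative ev (const (of_real (u \<bullet> w))) (\<gamma> t)) (at t)" by simp
 qed
next
 case (add f g)
 then obtain f' g' where
  "\<forall>\<gamma> t. (\<gamma> has_vector_derivative u) (at t) --> ((%s::real. ev f (\<gamma> s)) has_vector_derivative ev f' (\<gamma> t)) (at t)"
  "\<forall>\<gamma> t. (\<gamma> has_vector_derivative u) (at t) --> ((%s::real. ev g (\<gamma> s)) has_vector_derivative ev g' (\<gamma> t)) (at t)"
  by blast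
 thus ?case by (intro exI[of _ "f' + g'"]) (auto intro!: has_vector_derivative_add)
next
 case (mult f g)
 then obtain f' g' where
  "\<forall>\<gamma> t. (\<gamma> has_vector_derivative u) (at t) --> ((%s::real. ev f (\<gamma> s)) has_vector_derivative ev f' (\<gamma> t)) (at t)"
  "\<forall>\<gamma> t. (\<gamma> has_vector_derivative u) (at t) --> ((%s::real. ev g (\<gamma> s)) has_vector_derivative ev g' (\<gamma> t)) (at t)"
  by blast
 thus ?case by (intro exI[of _ "f * g' + f' * g"]) (auto intro!: has_vector_derivative_mult)
qed

text \<open>The derivative is demanded along every curve with velocity u at the given time, not only
  along lines. The chain rule then holds by definition; it is needed along rotations.\<close>

definition pd :: "'a::euclidean_space => 'a pf => 'a pf" where
 "pd u f = (SOME g. \<forall>\<gamma> t. (\<gamma> has_vector_derivative u) (at t) -->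
   ((%s::real. ev f (\<gamma> s)) has_vector_derivative ev g (\<gamma> t)) (at t))"

lemma pd_chain:
 "(\<gamma> has_vector_derivative u) (at t) ==> ((%s::real. ev f (\<gamma> s)) has_vector_derivative ev (pd u f) (\<gamma> t)) (at t)"
 using someI_ex[OF pd_exists[of u f]] unfolding pd_def by blast

lemma line_deriv: "((%t::real. v + t *\<^sub>R u) has_vector_derivative u) (at t)"
 by (auto intro!: derivative_eq_intros simp: has_vector_derivative_def)

lemma pdI:
 assumes "\<And>v. ((%t::real. ev f (v + t *\<^sub>R u)) has_vector_derivative ev g v) (at 0)"
 shows "pd u f = g"
proof (rule pf_eqI)
 fix v
 have "((%t::real. ev f (v + t *\<^sub>R u)) has_vector_derivative ev (pd u f) v) (at 0)"
  using pd_chain[OF line_deriv[of v u 0], of f] by simp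
 thus "ev (pd u f) v = ev g v" using assms vector_derivative_unique_at by blast
qed

lemma pd_line: "((%t::real. ev f (v + t *\<^sub>R u)) has_vector_derivative ev (pd u f) v) (at 0)"
 using pd_chain[OF line_deriv[of v u 0], of f] by simp

lemma pd_const [simp]: "pd u (const k) = 0" by (rule pdI) simp

lemma pd_0 [simp]: "pd u 0 = 0" and pd_1 [simp]: "pd u 1 = 0" using pd_const[of u 0] pd_const[of u 1] by (simp_all add: const_simps)

lemma pd_lin [simp]: "pd u (lin w) = const (of_real (u \<bullet> w))"
proof (rule pdI)
 fix v
 have "((%t. (v + t *\<^sub>R u) \<bullet> w) has_vector_derivative u \<bullet> w) (at 0)"
  by (rule bounded_linear.has_vector_derivative[OF bounded_linear_inner_left line_deriv])
 hence "((%t. complex_of_real ((v + t *\<^sub>R u) \<bullet> w)) has_vector_derivative of_real (u \<bullet> w)) (at 0)"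
  by (rule bounded_linear.has_vector_derivative[OF bounded_linear_of_real])
 thus "((%t. ev (lin w) (v + t *\<^sub>R u)) has_vector_derivative ev (const (of_real (u \<bullet> w))) v) (at 0)" by simp
qed

lemma pd_add [simp]: "pd u (f + g) = pd u f + pd u g" by (rule pdI) (auto intro!: has_vector_derivative_add pd_line)

lemma pd_mult: "pd u (f * g) = f * pd u g + pd u f * g"
proof (rule pdI)
 fix v
 show "((%t. ev (f * g) (v + t *\<^sub>R u)) has_vector_derivative ev (f * pd u g + pd u f * g) v) (at 0)"
  using has_vector_derivative_mult[OF pd_line[of f v u] pd_line[of g v u]] by simp
qed

lemma pd_cmult [simp]: "pd u (const k * f) = const k * pd u f" by (simp add: pd_mult)

lemma pd_minus [simp]: "pd u (- f) = - pd u f" using pd_cmult[of u "-1" f] by (simp add: const_simps)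

lemma pd_diff [simp]: "pd u (f - g) = pd u f - pd u g" using pd_add[of u f "- g"] by simp

lemma pd_sum: "pd u (sum f I) = (\<Sum>i\<in>I. pd u (f i))" by (induction I rule: infinite_finite_induct) auto

lemma pd_vec_add: "pd (u + v) f = pd u f + pd v f"
 by (induction f rule: pf_induct) (simp_all add: inner_simps const_simps pd_mult algebra_simps)

lemma pd_vec_scale: "pd (r *\<^sub>R u) f = const (of_real r) * pd u f"
 by (induction f rule: pf_induct) (simp_all add: inner_simps const_simps pd_mult algebra_simps)

lemma pd_vec_0 [simp]: "pd 0 f = 0" using pd_vec_scale[of 0 0 f] by (simp add: const_simps)

lemma pd_vec_sum: "pd (sum u I) f = (\<Sum>i\<in>I. pd (u i) f)" by (induction I rule: infinite_finite_induct) (simp_all add: pd_vec_add)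

lemma pd_commute: "pd u (pd v f) = pd v (pd u f)" by (induction f rule: pf_induct) (simp_all add: pd_mult algebra_simps)


text \<open>Integrates infinitesimal invariance: a function whose derivative along the velocity of a
  curve vanishes is constant on that curve.\<close>

lemma ev_const_curve:
 assumes "\<And>t::real. (\<gamma> has_vector_derivative \<gamma>' t) (at t)" "\<And>t. ev (pd (\<gamma>' t) f) (\<gamma> t) = 0"
 shows "ev f (\<gamma> s) = ev f (\<gamma> t)"
proof -
 have d: "((%t. ev f (\<gamma> t)) has_vector_derivative 0) (at t)" for t using pd_chain[OF assms(1), of f t] assms(2) by simp
 show ?thesis using has_vector_derivative_zero_constant[of UNIV "%t. ev f (\<gamma> t)"] d by (metis UNIV_I convex_UNIV)
qed

subsection \<open>Linear substitutions\<close>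

definition sub :: "('a::euclidean_space => 'a) => 'a pf => 'a pf" where
 "sub L f = Abs_pf (%v. ev f (L v))"

lemma ev_sub: "linear L ==> ev (sub L f) v = ev f (L v)"
proof -
 assume L: "linear L"
 have "cpoly g ==> cpoly (%v. g (L v))" for g
 proof (induction rule: cpoly.induct)
  case (lin u)
  have "(%v. complex_of_real (L v \<bullet> u)) = (%v. complex_of_real (v \<bullet> adjoint L u))" using adjoint_works[OF L] by metis
  thus ?case by (simp add: cpoly.lin)
 qed (auto intro: cpoly.intros)
 hence "cpoly (%v. ev f (L v))" using ev[of f] by simp
 thus ?thesis by (simp add: sub_def Abs_pf_inverse)
qed

context
 fixes L :: "'a::euclidean_space => 'a"
 assumes L: "linear L"
begin

lemma sub_simps:
 "sub L (f + g) = sub L f + sub L g" "sub L (f * g) = sub L f * sub L g" "sub L (const k) = const k"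
 "sub L (- f) = - sub L f" "sub L (f - g) = sub L f - sub L g" "sub L 0 = 0" "sub L 1 = 1" by (auto intro!: pf_eqI simp: ev_sub[OF L])

lemma sub_lin: "sub L (lin u) = lin (adjoint L u)" by (auto intro!: pf_eqI simp: ev_sub[OF L] adjoint_works[OF L])

lemma sub_sum: "sub L (sum f I) = (\<Sum>i\<in>I. sub L (f i))" by (induction I rule: infinite_finite_induct) (simp_all add: sub_simps)

lemma pd_sub: "pd u (sub L f) = sub L (pd (L u) f)" by (induction f rule: pf_induct)
  (simp_all add: sub_simps sub_lin pd_mult adjoint_works[OF L])

end

lemma sub_sub: "linear L ==> linear M ==> sub L (sub M f) = sub (M o L) f" by (rule pf_eqI) (simp add: ev_sub linear_compose)

lemma sub_id: "sub id f = f" by (rule pf_eqI) (simp add: ev_sub linear_id)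

subsection \<open>Reflections and divided differences\<close>

text \<open>At a = 0 the formula gives the identity, so linearity and orthogonality hold for every
  a.\<close>

definition rf :: "'a::euclidean_space => 'a => 'a" where
 "rf a v = v - (2 * (v \<bullet> a) / (a \<bullet> a)) *\<^sub>R a"

lemma linear_rf: "linear (rf a)"
proof (rule linearI)
 show "rf a (u + v) = rf a u + rf a v" for u v by (simp add: rf_def inner_add_left distrib_left add_divide_distrib scaleR_add_left)
 show "rf a (r *\<^sub>R v) = r *\<^sub>R rf a v" for r v by (simp add: rf_def scaleR_diff_right mult.left_commute)
qed

lemma rf_inner: "rf a u \<bullet> v = u \<bullet> rf a v" by (simp add: rf_def inner_simps inner_commute)

lemma rf_rf [simp]: "rf a (rf a v) = v" by (cases "a = 0") (simp_all add: rf_def inner_simps)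

lemma rf_self: "a ~= 0 ==> rf a a = - a" by (simp add: rf_def scaleR_2)

lemma rf_uminus [simp]: "rf (- a) = rf a" by (simp add: rf_def fun_eq_iff)

lemma rf_orth: "orth (rf a)" unfolding orthogonal_transformation_def using linear_rf by (simp add: rf_inner)

lemma rf_conj: "orth g ==> rf (g a) (g v) = g (rf a v)" by (simp add: rf_def orthogonal_transformation_def linear_diff linear_scale)

lemma sub_rf_lin: "sub (rf a) (lin u) = lin (rf a u)" by (auto intro!: pf_eqI simp: ev_sub[OF linear_rf] rf_inner)

text \<open>Divisibility by the linear form passes to products through f g - s(f g) = f (g - s g) +
  (f - s f) s g, so induction over the construction of f replaces a division algorithm.\<close>

lemma dd_exists: "\<exists>g. a = 0 \<or> lin a * g = f - sub (rf a) f"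
proof (cases "a = 0")
 case False
 have "\<exists>g. lin a * g = f - sub (rf a) f"
 proof (induction f rule: pf_induct)
  case (const k)
  thus ?case by (intro exI[of _ 0]) (simp add: sub_simps linear_rf)
 next
  case (lin u)
  have "lin u - lin (rf a u) = lin ((2 * (u \<bullet> a) / (a \<bullet> a)) *\<^sub>R a)" by (simp add: lin_simps[symmetric] rf_def)
  thus ?case by (intro exI[of _ "const (of_real (2 * (u \<bullet> a) / (a \<bullet> a)))"])
    (simp add: sub_rf_lin lin_simps mult.commute)
 next
  case (add f g)
  then obtain f' g' where "lin a * f' = f - sub (rf a) f" "lin a * g' = g - sub (rf a) g" by blast
  thus ?case by (intro exI[of _ "f' + g'"]) (simp add: sub_simps linear_rf algebra_simps)
 next
  case (mult f g)
  then obtain f' g' where *: "lin a * f' = f - sub (rf a) f" "lin a * g' = g - sub (rf a) g" by blast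
  have "lin a * (f * g' + f' * sub (rf a) g) = f * (lin a * g') + (lin a * f') * sub (rf a) g" by (simp add: algebra_simps)
  also have "... = f * g - sub (rf a) (f * g)" unfolding * by (simp add: sub_simps linear_rf algebra_simps)
  finally show ?case by blast
 qed
 thus ?thesis by blast
qed simp

definition dd :: "'a::euclidean_space => 'a pf => 'a pf" where
 "dd a f = (SOME g. a = 0 \<or> lin a * g = f - sub (rf a) f)"

lemma lin_dd: "a ~= 0 ==> lin a * dd a f = f - sub (rf a) f" using someI_ex[OF dd_exists[of a f]] unfolding dd_def by blast

text \<open>The quotient is unique because there are no zero divisors. Rules for \<open>dd\<close>
  are therefore proved by verifying its defining equation.\<close>

lemma ddI: "a ~= 0 ==> lin a * g = f - sub (rf a) f ==> dd a f = g" using lin_dd[of a f] by (metis lin_eq_0_iff mult_cancel_left)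

context
 fixes a :: "'a::euclidean_space"
 assumes a: "a ~= 0"
begin

lemma dd_add: "dd a (f + g) = dd a f + dd a g" by (rule ddI[OF a]) (simp add: lin_dd[OF a] distrib_left sub_simps linear_rf)

lemma dd_mult: "dd a (f * g) = f * dd a g + dd a f * sub (rf a) g"
proof (rule ddI[OF a])
 have "lin a * (f * dd a g + dd a f * sub (rf a) g)
   = f * (lin a * dd a g) + (lin a * dd a f) * sub (rf a) g" by (simp add: algebra_simps)
 thus "lin a * (f * dd a g + dd a f * sub (rf a) g) = f * g - sub (rf a) (f * g)"
  unfolding lin_dd[OF a] by (simp add: sub_simps linear_rf algebra_simps)
qed

lemma dd_const [simp]: "dd a (const k) = 0" by (rule ddI[OF a]) (simp add: sub_simps linear_rf)

lemma dd_0 [simp]: "dd a 0 = 0" and dd_1 [simp]: "dd a 1 = 0" using dd_const[of 0] dd_const[of 1] by (simp_all add: const_simps)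

lemma dd_cmult: "dd a (const k * f) = const k * dd a f" by (simp add: dd_mult)

lemma dd_lin: "dd a (lin u) = const (of_real (2 * (u \<bullet> a) / (a \<bullet> a)))"
proof (rule ddI[OF a])
 have "lin u - lin (rf a u) = lin ((2 * (u \<bullet> a) / (a \<bullet> a)) *\<^sub>R a)" by (simp add: lin_simps[symmetric] rf_def)
 thus "lin a * const (of_real (2 * (u \<bullet> a) / (a \<bullet> a))) = lin u - sub (rf a) (lin u)"
  by (simp add: sub_rf_lin lin_simps mult.commute)
qed

lemma dd_sum: "dd a (sum f I) = (\<Sum>i\<in>I. dd a (f i))" by (induction I rule: infinite_finite_induct) (simp_all add: dd_add)

lemma dd_sub_conj:
 assumes M: "linear M" and Mr: "\<And>v. rf a (M v) = M (rf b v)" and lM: "sub M (lin a) = lin b"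
  and b: "b ~= 0"
 shows "dd b (sub M f) = sub M (dd a f)"
proof (rule ddI[OF b])
 have "sub M (sub (rf a) f) = sub (rf b) (sub M f)" by (rule pf_eqI) (simp add: ev_sub M linear_rf Mr)
 thus "lin b * sub M (dd a f) = sub M f - sub (rf b) (sub M f)" unfolding lM[symmetric] sub_simps(2)[OF M, symmetric] lin_dd[OF a]
  by (simp add: sub_simps(5)[OF M])
qed

end

subsection \<open>Linear independence of monomials\<close>

text \<open>Induction on the set of variables. With the values of the others fixed, the relation is
  a polynomial identity in the value of one variable i, and a single coefficient of it is a relation
  among monomials in the remaining variables.\<close>

lemma monomials_independent:
 fixes c :: "'i multiset => complex"
 assumes "finite I" "finite F" "\<And>m. m : F ==> set_mset m \<subseteq> I"
  and "\<And>r. (\<Sum>m\<in>F. c m * (\<Prod>i\<in>#m. of_real (r i))) = 0" and "m : F"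
 shows "c m = 0" using assms
proof (induction I arbitrary: F c m rule: finite_induct)
 case empty
 hence "F = {{#}}" by auto
 thus ?case using empty.prems by simp
next
 case (insert i I)
 let ?k = "count m i"
 let ?f = "filter_mset (%j. j ~= i)"
 let ?F = "{m' : F. count m' i = ?k}"
 let ?g = "%m'. m' + replicate_mset ?k i"
 have split: "x = ?f x + replicate_mset (count x i) i" for x by (rule multiset_eqI) auto
 have gf: "x : ?F ==> ?g (?f x) = x" for x using split[of x] by auto
 hence inj: "inj_on ?f ?F" by (metis (no_types, lifting) inj_onI)
 have zero: "(\<Sum>m'\<in>?F. c m' * (\<Prod>j\<in>#?f m'. of_real (r j))) = 0" for r :: "'i => real"
 proof -
  \<comment> \<open>The sum as a polynomial in the value t of the variable i. Its coefficient at the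
    power \<open>?k\<close> selects exactly the monomials that contain i as often as m does.\<close>
  define P where "P = (\<Sum>m'\<in>F. monom (c m' * (\<Prod>j\<in>#?f m'. of_real (r j))) (count m' i))"
  have "poly P (of_real t) = 0" for t :: real
  proof -
   have "(\<Prod>j\<in>#x. of_real ((r(i := t)) j)) = (\<Prod>j\<in>#?f x. of_real (r j)) * complex_of_real t ^ count x i" for x
   proof -
    have "(\<Prod>j\<in>#x. complex_of_real ((r(i := t)) j))
     = (\<Prod>j\<in>#?f x. complex_of_real ((r(i := t)) j)) * (\<Prod>j\<in>#replicate_mset (count x i) i. of_real ((r(i := t)) j))"
     by (subst split[of x]) (simp only: image_mset_union prod_mset.union)
    also have "(\<Prod>j\<in>#?f x. complex_of_real ((r(i := t)) j)) = (\<Prod>j\<in>#?f x. of_real (r j))"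
     by (intro arg_cong[of _ _ prod_mset] image_mset_cong) auto
    finally show ?thesis by simp
   qed
   hence "poly P (of_real t) = (\<Sum>m'\<in>F. c m' * (\<Prod>j\<in>#m'. of_real ((r(i := t)) j)))"
    by (simp add: P_def poly_sum poly_monom mult.assoc)
   thus ?thesis using insert.prems(3) by simp
  qed
  hence "P = 0" by (rule poly_real_zero)
  hence "coeff P ?k = 0" by simp
  hence "(\<Sum>m'\<in>F. if count m' i = ?k then c m' * (\<Prod>j\<in>#?f m'. of_real (r j)) else 0) = 0" by (simp add: P_def coeff_sum)
  thus ?thesis using insert.prems(1) by (simp add: sum.inter_filter)
 qed
 have "(c o ?g) (?f m) = 0"
 proof (rule insert.IH[of "?f ` ?F" "c o ?g"])
  show "finite (?f ` ?F)" using insert.prems by simp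
  show "set_mset x \<subseteq> I" if "x : ?f ` ?F" for x using that insert.prems(2) by force
  show "(\<Sum>x\<in>?f ` ?F. (c o ?g) x * (\<Prod>j\<in>#x. of_real (r j))) = 0" for r
   using zero[of r] by (subst sum.reindex[OF inj]) (simp add: gf cong: sum.cong_simp)
  show "?f m : ?f ` ?F" using insert.prems by auto
 qed
 thus ?case using gf[of m] insert.prems by simp
qed

section \<open>The module: left regular representation in normally ordered coordinates, with a
  Clifford factor\<close>

section \<open>A module for the Dunkl operators and the Clifford algebra\<close>

abbreviation ivf :: "('a => 'b) => 'b => 'a" where "ivf \<equiv> inv_into UNIV"

text \<open>The component at (n, S, w) is the coefficient of the group element w and of the Clifford
  word with letter set S; as a polynomial in (x, xi) it stands for terms p(x) w q(y) with y written
  as xi, and n counts the degree in y. The index w ranges over all maps, so that the type does not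
  depend on the group, and no finiteness is imposed.\<close>

type_synonym 'e vv = "nat => nat set => ('e => 'e) => ('e \<times> 'e) pf"

definition smv :: "complex => 'e::euclidean_space vv => 'e vv" where
 "smv k f = (%n S w. const k * f n S w)"

definition linop :: "('e::euclidean_space vv => 'e vv) => bool" where
 "linop F \<longleftrightarrow> (\<forall>f g. F (f + g) = F f + F g) & (\<forall>k f. F (smv k f) = smv k (F f))"

lemma smv_add: "smv k (f + g) = smv k f + smv k g" by (simp add: smv_def fun_eq_iff distrib_left)

lemma smv_simps: "smv (k + l) f = smv k f + smv l f" "smv (k * l) f = smv k (smv l f)" "smv 1 f = f"
 "smv (- 1) f = - f" "smv 0 f = 0" by (simp_all add: smv_def fun_eq_iff const_simps distrib_right mult.assoc)

text \<open>Linear operators become a type of class \<open>ring_1\<close>, so that operator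
  identities are accessible to the ring rewriting rules.\<close>

typedef (overloaded) 'e op = "{F :: 'e::euclidean_space vv => 'e vv. linop F}" morphisms app Abs_op
 by (rule exI[of _ id]) (simp add: linop_def)

setup_lifting type_definition_op

lemma linop_app: "linop (app F)" using app[of F] by simp

lemma app_add [simp]: "app F (f + g) = app F f + app F g"
 and app_smv [simp]: "app F (smv k f) = smv k (app F f)" using linop_app[of F] by (simp_all add: linop_def)

lemma app_uminus [simp]: "app F (- f) = - app F f" using app_smv[of F "-1" f] by (simp add: smv_simps)

lemma app_diff [simp]: "app F (f - g) = app F f - app F g" using app_add[of F f "- g"] by simp

lemma app_zero [simp]: "app F 0 = 0" using app_diff[of F 0 0] by simp

lemma app_sum: "app F (sum f I) = (\<Sum>i\<in>I. app F (f i))"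
 by (induction I rule: infinite_finite_induct) (simp_all only: sum.infinite sum.empty sum.insert app_zero app_add not_False_eq_True)

lemma sum_vv: "(sum f I) n S w = (\<Sum>i\<in>I. f i n S w)" for f :: "_ => 'e::euclidean_space vv"
 by (induction I rule: infinite_finite_induct) auto

lemma op_eqI: "(\<And>f. app F f = app G f) ==> F = G" by (metis app_inject ext)

instantiation op :: (euclidean_space) ring_1
begin

lift_definition zero_op :: "'a op" is "%f. 0" by (simp add: linop_def smv_def fun_eq_iff)
lift_definition one_op :: "'a op" is "%f. f" by (simp add: linop_def)
lift_definition plus_op :: "'a op => 'a op => 'a op" is "%F G f. F f + G f" by (simp add: linop_def smv_add)
lift_definition times_op :: "'a op => 'a op => 'a op" is "%F G f. F (G f)" by (simp add: linop_def)
lift_definition uminus_op :: "'a op => 'a op" is "%F f. - F f" by (simp add: linop_def smv_def fun_eq_iff)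
lift_definition minus_op :: "'a op => 'a op => 'a op" is "%F G f. F f - G f" by (simp add: linop_def smv_def fun_eq_iff right_diff_distrib)

instance
proof
 have "app 0 (%n S w. 1) ~= app (1 :: 'a op) (%n S w. 1)" by transfer (simp add: fun_eq_iff)
 thus "(0 :: 'a op) ~= 1" by metis
qed (transfer; simp add: linop_def fun_eq_iff algebra_simps)+

end

lemma app_simps [simp]: "app 0 f = 0" "app 1 f = f" "app (F + G) f = app F f + app G f"
 "app (F * G) f = app F (app G f)" "app (- F) f = - app F f" "app (F - G) f = app F f - app G f" by (transfer; simp)+

lemma app_op_sum: "app (sum F I) f = (\<Sum>i\<in>I. app (F i) f)" by (induction I rule: infinite_finite_induct) auto

lift_definition sc :: "complex => 'e::euclidean_space op" is smv by (simp add: linop_def smv_add smv_simps(2)[symmetric] mult.commute)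

lemma app_sc [simp]: "app (sc k) f = smv k f" by transfer simp

lemma sc_simps: "sc 0 = 0" "sc 1 = 1" "sc (a + b) = sc a + sc b" "sc (a * b) = sc a * sc b"
 "sc (- a) = - sc a" "sc (a - b) = sc a - sc b" by (auto intro!: op_eqI simp: smv_simps smv_def fun_eq_iff const_simps algebra_simps)

lemma sc_commute: "F * sc k = sc k * F" by (rule op_eqI) simp

lemma sc_left: "F * (sc k * G) = sc k * (F * G)" by (metis mult.assoc sc_commute)

lemma sc_sum: "sc (sum f I) = (\<Sum>i\<in>I. sc (f i))" by (induction I rule: infinite_finite_induct) (auto simp: sc_simps)

lemma sc_numeral: "sc (numeral k) = numeral k"
proof -
 have "sc (of_nat n) = of_nat n" for n by (induction n) (simp_all add: sc_simps)
 from this[of "numeral k"] show ?thesis by simp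
qed

lemma app_Abs_op: "linop F ==> app (Abs_op F) = F" by (simp add: Abs_op_inverse)

subsection \<open>Multiplication, group and Clifford operators\<close>

definition Mo :: "('e \<times> 'e) pf => 'e::euclidean_space op" where
 "Mo p = Abs_op (%f n S w. p * f n S w)"

lemma app_Mo [simp]: "app (Mo p) f = (%n S w. p * f n S w)"
 unfolding Mo_def by (subst app_Abs_op) (auto simp: linop_def smv_def fun_eq_iff algebra_simps)

lemma Mo_simps: "Mo (p + q) = Mo p + Mo q" "Mo (p * q) = Mo p * Mo q" "Mo (const k) = sc k"
 by (auto intro!: op_eqI simp: fun_eq_iff smv_def algebra_simps)

abbreviation Xo :: "'e::euclidean_space => 'e op" where "Xo u \<equiv> Mo (lin (u, 0))"

lemma Xo_add: "Xo (u + v) = Xo u + Xo v" for u :: "'e::euclidean_space"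
 using lin_simps(2)[of "(u, 0 :: 'e)" "(v, 0)"] by (simp add: Mo_simps[symmetric])

lemma Xo_scale: "Xo (r *\<^sub>R u) = sc (of_real r) * Xo u" for u :: "'e::euclidean_space"
 using lin_simps(3)[of r "(u, 0 :: 'e)"] by (simp add: Mo_simps[symmetric])

lemma Xo_commute: "Mo p * Mo q = Mo q * Mo p" by (simp add: Mo_simps(2)[symmetric] mult.commute)

lemma Xo_minus: "Xo (- u) = - Xo u" using Xo_scale[of "-1" u] by (simp add: sc_simps)

lemma orth_linear: "orth g ==> linear g" by (simp add: orthogonal_transformation_def)

lemma orth_inv: "orth g ==> orth (ivf g)" for g :: "'e::euclidean_space => 'e" by (rule orthogonal_transformation_inv)

lemma orth_inv_app [simp]: "orth g ==> ivf g (g v) = v" "orth g ==> g (ivf g v) = v"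
 for g :: "'e::euclidean_space => 'e" by (simp_all add: orthogonal_transformation_inj orthogonal_transformation_surj surj_f_inv_f)

lemma orth_inv_comp: "orth g ==> orth g' ==> ivf (g o g') = ivf g' o ivf g"
 for g g' :: "'e::euclidean_space => 'e" by (rule o_inv_distrib) (rule orthogonal_transformation_bij, assumption)+

lemma orth_inv_inner: "orth g ==> ivf g u \<bullet> v = u \<bullet> g v" for g :: "'e::euclidean_space => 'e"
 by (metis orth_inv_app(2) orthogonal_transformation_def)

lemma orth_comp_iff: "orth g ==> orth (g o w) \<longleftrightarrow> orth w"
 for g w :: "'e::euclidean_space => 'e"
proof
 assume g: "orth g" and gw: "orth (g o w)"
 have "w = ivf g o (g o w)" using g by (simp add: fun_eq_iff)
 thus "orth w" using orth_inv[OF g] gw orthogonal_transformation_compose by metis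
qed (rule orthogonal_transformation_compose)

definition fs :: "('e => 'e) => 'e \<times> 'e => 'e \<times> 'e" where
 "fs g = (%(x, \<xi>). (g x, \<xi>))"

lemma linear_fs: "linear g ==> linear (fs g)" for g :: "'e::euclidean_space => 'e"
 by (auto intro!: linearI simp: fs_def linear_add linear_scale)

lemma fs_comp: "fs g o fs g' = fs (g o g')" by (auto simp: fs_def)

lemma rf_fst: "rf (a, 0) = fs (rf a)" by (auto simp: rf_def fs_def fun_eq_iff)

lemma rf_snd: "rf (0, a) (x, \<xi>) = (x, rf a \<xi>)" by (simp add: rf_def)

text \<open>Left multiplication of p(x) w' q(y) by g transforms p, replaces w' by g w' and leaves q
  alone. Hence only the first variable is substituted, and the coefficient at w comes from g^-1
  w.\<close>

definition Wo :: "('e::euclidean_space => 'e) => 'e op" where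
 "Wo g = Abs_op (%f n S w. sub (fs (ivf g)) (f n S (ivf g o w)))"

lemma app_Wo:
 assumes g: "orth g"
 shows "app (Wo g) f = (%n S w. sub (fs (ivf g)) (f n S (ivf g o w)))"
proof -
 have l: "linear (fs (ivf g))" by (intro linear_fs orth_linear orth_inv g)
 show ?thesis unfolding Wo_def by (subst app_Abs_op) (auto simp: linop_def smv_def fun_eq_iff sub_simps[OF l])
qed

lemma Wo_Wo:
 assumes g: "orth g" and g': "orth g'"
 shows "Wo g * Wo g' = Wo (g o g')"
proof (rule op_eqI)
 fix f
 have l: "linear (fs (ivf g))" "linear (fs (ivf g'))" by (intro linear_fs orth_linear orth_inv g g')+
 show "app (Wo g * Wo g') f = app (Wo (g o g')) f"
  using g g' by (simp add: app_Wo orthogonal_transformation_compose sub_sub[OF l] fs_comp orth_inv_comp o_assoc)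
qed

lemma Wo_id: "Wo (id :: 'e::euclidean_space => 'e) = 1"
proof -
 have "fs id = (id :: 'e \<times> 'e => _)" by (auto simp: fs_def)
 thus ?thesis using app_Wo[of "id :: 'e => 'e"] by (intro op_eqI) (simp add: sub_id inv_id orthogonal_transformation_def linear_id)
qed

lemma sub_fs_lin1:
 assumes g: "orth g"
 shows "sub (fs (ivf g)) (lin (u, v)) = lin (g u, v)"
proof (rule pf_eqI)
 fix p
 have "ev (sub (fs (ivf g)) (lin (u, v))) p = ev (lin (u, v)) (fs (ivf g) p)" by (rule ev_sub) (intro linear_fs orth_linear orth_inv g)
 thus "ev (sub (fs (ivf g)) (lin (u, v))) p = ev (lin (g u, v)) p" by (cases p) (simp add: fs_def orth_inv_inner g)
qed

lemma Wo_Xo: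
 assumes g: "orth g"
 shows "Wo g * Xo u = Xo (g u) * Wo g" by (rule op_eqI)
  (simp add: app_Wo g sub_simps linear_fs orth_linear orth_inv sub_fs_lin1 fun_eq_iff)

definition tog :: "nat => nat set => nat set" where
 "tog i S = (if i : S then S - {i} else insert i S)"

text \<open>The sign of left multiplication by c_i on increasing Clifford words: c_i passes all
  smaller letters and is then inserted or cancelled, which is \<open>tog\<close>.\<close>

definition sg :: "nat => nat set => complex" where
 "sg i S = (if even (card {j : S. j < i}) then 1 else - 1)"

lemma tog_tog [simp]: "tog i (tog i S) = S" by (auto simp: tog_def)

lemma tog_commute: "tog i (tog j S) = tog j (tog i S)" by (auto simp: tog_def)

lemma sg_sq [simp]: "sg i S * sg i S = 1" by (simp add: sg_def)

lemma sg_tog_le: "i \<le> j ==> sg i (tog j S) = sg i S"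
proof -
 assume "i \<le> j"
 hence "{k : tog j S. k < i} = {k : S. k < i}" by (auto simp: tog_def split: if_splits)
 thus ?thesis by (simp add: sg_def)
qed

lemma sg_tog_less: "i < j ==> sg j (tog i S) = - sg j S"
proof -
 assume ij: "i < j"
 show ?thesis
 proof (cases "i : S")
  case True
  hence "{k : S. k < j} = insert i {k : tog i S. k < j}" "i \<notin> {k : tog i S. k < j}" using ij by (auto simp: tog_def)
  hence "card {k : S. k < j} = Suc (card {k : tog i S. k < j})" by simp
  thus ?thesis by (simp add: sg_def)
 next
  case False
  hence "{k : tog i S. k < j} = insert i {k : S. k < j}" "i \<notin> {k : S. k < j}" using ij by (auto simp: tog_def)
  hence "card {k : tog i S. k < j} = Suc (card {k : S. k < j})" by simp
  thus ?thesis by (simp add: sg_def)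
 qed
qed

definition co :: "nat => 'e::euclidean_space op" where
 "co i = Abs_op (%f n S w. const (sg i S) * f n (tog i S) w)"

lemma app_co [simp]: "app (co i) f = (%n S w. const (sg i S) * f n (tog i S) w)"
 unfolding co_def by (subst app_Abs_op) (auto simp: linop_def smv_def fun_eq_iff algebra_simps)

lemma co_sq: "co i * co i = 1" by (rule op_eqI) (simp add: fun_eq_iff mult.assoc[symmetric] const_simps(4)[symmetric] const_simps sg_tog_le)

lemma co_anti: "i < j ==> co i * co j = - (co j * co i)"
proof (rule op_eqI, intro ext)
 fix f :: "'a vv" and n S w
 assume ij: "i < j"
 have "const a * (const (- b) * X) = - (const b * (const a * X))" for a b and X :: "('a \<times> 'a) pf"
  by (simp add: const_simps mult.left_commute)
 thus "app (co i * co j) f n S w = app (- (co j * co i)) f n S w"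
  using sg_tog_less[OF ij, of S] sg_tog_le[of i j S] ij by (simp add: tog_commute[of j i])
qed

lemma co_co: "co i * co j + co j * co i = (if i = j then 2 else 0)"
proof (cases i j rule: linorder_cases)
 case less
 show ?thesis unfolding co_anti[OF less] using less by simp
next
 case equal
 thus ?thesis by (simp add: co_sq)
next
 case greater
 show ?thesis unfolding co_anti[OF greater] using greater by simp
qed

lemma Mo_co: "Mo p * co i = co i * Mo p" by (rule op_eqI) (simp add: fun_eq_iff algebra_simps)

lemma Wo_co: "orth g ==> Wo g * co i = co i * Wo g" by (rule op_eqI) (simp add: fun_eq_iff app_Wo sub_simps linear_fs orth_linear orth_inv)

subsection \<open>Dunkl operators\<close>

text \<open>Roots are vectors here, and \<open>rf_root\<close> with a = b puts both signs of every
  root into \<open>Ph\<close>. Each reflection thus occurs twice in sums over \<open>Ph\<close>, so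
  \<open>h\<close> corresponds to half of the usual parameter.\<close>

locale dunkl =
 fixes Ph :: "'e::euclidean_space set" and h :: "'e => complex"
 assumes fin: "finite Ph" and nz: "0 \<notin> Ph"
  and rf_root: "a : Ph ==> b : Ph ==> rf a b : Ph"
  and h_rf: "a : Ph ==> b : Ph ==> h (rf a b) = h b"
begin

definition symm :: "('e => 'e) => bool" where
 "symm g \<longleftrightarrow> orth g & g ` Ph = Ph & (\<forall>a\<in>Ph. h (g a) = h a)"

lemma symm_orth: "symm g ==> orth g" by (simp add: symm_def)

lemma symm_rf: "a : Ph ==> symm (rf a)" unfolding symm_def using rf_orth[of a] rf_root h_rf by (auto simp: image_iff) (metis rf_rf)

lemma nzE: "a : Ph ==> (a, 0::'e) ~= 0" "a : Ph ==> (0::'e, a) ~= 0" "a : Ph ==> a ~= 0" using nz by (auto simp: zero_prod_def)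

text \<open>Left multiplication of p(x) w q(y) by y. Passing p yields the derivative and the Dunkl
  term, whose reflection multiplies w from the left; therefore the coefficient at w uses the
  component at \<open>rf a o w\<close>. Passing w turns y into w^-1 y, which multiplies q and raises
  the level. Level 0 has no predecessor, and for maps w that are not orthogonal the inverse need not
  be linear, so there the shift is set to 0.\<close>

definition To :: "'e => 'e op" where
 "To y = Abs_op (%f n S w. pd (y, 0) (f n S w)
   + (if n = 0 \<or> \<not> orth w then 0 else lin (0, ivf w y) * f (n - 1) S w)
   + (\<Sum>a\<in>Ph. const (h a * of_real (a \<bullet> y)) * dd (a, 0) (f n S (rf a o w))))"

lemma app_To: "app (To y) f = (%n S w. pd (y, 0) (f n S w)
   + (if n = 0 \<or> \<not> orth w then 0 else lin (0, ivf w y) * f (n - 1) S w)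
   + (\<Sum>a\<in>Ph. const (h a * of_real (a \<bullet> y)) * dd (a, 0) (f n S (rf a o w))))"
proof -
 have "linop (%f n S w. pd (y, 0) (f n S w)
   + (if n = 0 \<or> \<not> orth w then 0 else lin (0, ivf w y) * f (n - 1) S w)
   + (\<Sum>a\<in>Ph. const (h a * of_real (a \<bullet> y)) * dd (a, 0) (f n S (rf a o w))))" (is "linop ?F") unfolding linop_def
 proof (intro conjI allI ext)
  fix f g :: "'e vv" and n S w
  have "(\<Sum>a\<in>Ph. const (h a * of_real (a \<bullet> y)) * dd (a, 0) ((f + g) n S (rf a o w)))
    = (\<Sum>a\<in>Ph. const (h a * of_real (a \<bullet> y)) * dd (a, 0) (f n S (rf a o w)))
    + (\<Sum>a\<in>Ph. const (h a * of_real (a \<bullet> y)) * dd (a, 0) (g n S (rf a o w)))"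
   by (subst sum.distrib[symmetric], rule sum.cong) (simp_all add: dd_add nzE distrib_left)
  thus "?F (f + g) n S w = (?F f + ?F g) n S w" by (simp add: distrib_left)
 next
  fix f :: "'e vv" and n S w k
  have "(\<Sum>a\<in>Ph. const (h a * of_real (a \<bullet> y)) * dd (a, 0) (smv k f n S (rf a o w)))
    = const k * (\<Sum>a\<in>Ph. const (h a * of_real (a \<bullet> y)) * dd (a, 0) (f n S (rf a o w)))"
   unfolding sum_distrib_left by (rule sum.cong) (simp_all add: dd_cmult nzE smv_def mult.left_commute)
  thus "?F (smv k f) n S w = smv k (?F f) n S w" by (simp add: smv_def distrib_left mult.left_commute)
 qed
 thus ?thesis unfolding To_def by (subst app_Abs_op) simp_all
qed

lemma To_add: "To (u + v) = To u + To v"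
proof (rule op_eqI)
 fix f :: "'e vv"
 have *: "lin (0, ivf w (u + v)) = lin (0, ivf w u) + lin (0, ivf w v)" if "orth w" for w :: "'e => 'e"
  using lin_simps(2)[of "(0, ivf w u)" "(0, ivf w v)"] linear_add[OF orth_linear[OF orth_inv[OF that]], of u v] by simp
 show "app (To (u + v)) f = app (To u + To v) f" using pd_vec_add[of "(u, 0)" "(v, 0)"]
  by (auto simp: app_To fun_eq_iff * inner_add_right const_simps distrib_left distrib_right sum.distrib)
qed

lemma To_scale: "To (r *\<^sub>R u) = sc (of_real r) * To u"
proof (rule op_eqI)
 fix f :: "'e vv"
 have *: "lin (0, ivf w (r *\<^sub>R u)) = const (of_real r) * lin (0, ivf w u)" if "orth w" for w :: "'e => 'e"
  using lin_simps(3)[of r "(0, ivf w u)"] linear_scale[OF orth_linear[OF orth_inv[OF that]], of r u] by simp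
 show "app (To (r *\<^sub>R u)) f = app (sc (of_real r) * To u) f" using pd_vec_scale[of r "(u, 0)"]
  by (auto simp: app_To fun_eq_iff * smv_def const_simps distrib_left sum_distrib_left algebra_simps intro!: sum.cong)
qed

lemma To_minus: "To (- u) = - To u" using To_scale[of "-1" u] by (simp add: sc_simps)

lemma To_co: "To y * co i = co i * To y"
proof (rule op_eqI)
 fix f :: "'e vv"
 have "(\<Sum>a\<in>Ph. const (h a * of_real (a \<bullet> y)) * dd (a, 0) (const (sg i S) * f n (tog i S) (rf a o w)))
   = const (sg i S) * (\<Sum>a\<in>Ph. const (h a * of_real (a \<bullet> y)) * dd (a, 0) (f n (tog i S) (rf a o w)))" for n S and w :: "'e => 'e"
  unfolding sum_distrib_left by (rule sum.cong) (simp_all add: dd_cmult nzE mult.left_commute)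
 thus "app (To y * co i) f = app (co i * To y) f" by (auto simp: app_To fun_eq_iff algebra_simps)
qed

lemma To_Mo2: "To y * Mo (lin (0, v)) = Mo (lin (0, v)) * To y"
proof (rule op_eqI)
 fix f :: "'e vv"
 have "(\<Sum>a\<in>Ph. const (h a * of_real (a \<bullet> y)) * dd (a, 0) (lin (0, v) * f n S (rf a o w)))
   = lin (0, v) * (\<Sum>a\<in>Ph. const (h a * of_real (a \<bullet> y)) * dd (a, 0) (f n S (rf a o w)))" for n S and w :: "'e => 'e"
  unfolding sum_distrib_left by (rule sum.cong) (simp_all add: dd_mult dd_lin nzE mult.left_commute const_simps)
 thus "app (To y * Mo (lin (0, v))) f = app (Mo (lin (0, v)) * To y) f" by (auto simp: app_To fun_eq_iff pd_mult const_simps algebra_simps)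
qed

text \<open>The twisted product rule for \<open>dd\<close> turns the Dunkl term into reflections; 2
  (u.a)/(a.a) is the pairing of u with the coroot of a.\<close>

lemma To_Xo:
 "To y * Xo u = Xo u * To y + sc (of_real (u \<bullet> y))
   + (\<Sum>a\<in>Ph. sc (h a * of_real ((a \<bullet> y) * (2 * (u \<bullet> a) / (a \<bullet> a)))) * Wo (rf a))"
proof (rule op_eqI, intro ext)
 fix f :: "'e vv" and n S w
 have "const (h a * of_real (a \<bullet> y)) * dd (a, 0) (lin (u, 0) * f n S (rf a o w))
   = lin (u, 0) * (const (h a * of_real (a \<bullet> y)) * dd (a, 0) (f n S (rf a o w)))
   + app (sc (h a * of_real ((a \<bullet> y) * (2 * (u \<bullet> a) / (a \<bullet> a)))) * Wo (rf a)) f n S w" if "a : Ph" for a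
 proof -
  have "ivf (rf a) = rf a" by (rule Hilbert_Choice.inv_equality) simp_all
  hence "app (Wo (rf a)) f n S w = sub (rf (a, 0)) (f n S (rf a o w))" by (simp add: app_Wo rf_orth rf_fst)
  moreover have "const (h a * of_real (a \<bullet> y)) * const (of_real (2 * (u \<bullet> a) / (a \<bullet> a)))
    = (const (h a * of_real ((a \<bullet> y) * (2 * (u \<bullet> a) / (a \<bullet> a)))) :: ('e \<times> 'e) pf)"
   by (simp add: const_simps(4)[symmetric] mult.assoc)
  moreover have "K * (L * D + R * s) = L * (K * D) + (K * R) * s" for K L D R s :: "('e \<times> 'e) pf" by (simp add: algebra_simps)
  moreover have "dd (a, 0) (lin (u, 0) * f n S (rf a o w)) = lin (u, 0) * dd (a, 0) (f n S (rf a o w))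
    + const (of_real (2 * (u \<bullet> a) / (a \<bullet> a))) * sub (rf (a, 0)) (f n S (rf a o w))"
   using that dd_lin[of "(a, 0 :: 'e)" "(u, 0)"] by (simp add: dd_mult nzE)
  ultimately show ?thesis by (simp only: app_simps app_sc smv_def)
 qed
 hence "(\<Sum>a\<in>Ph. const (h a * of_real (a \<bullet> y)) * dd (a, 0) (lin (u, 0) * f n S (rf a o w)))
   = lin (u, 0) * (\<Sum>a\<in>Ph. const (h a * of_real (a \<bullet> y)) * dd (a, 0) (f n S (rf a o w)))
   + (\<Sum>a\<in>Ph. app (sc (h a * of_real ((a \<bullet> y) * (2 * (u \<bullet> a) / (a \<bullet> a)))) * Wo (rf a)) f n S w)"
  by (simp add: sum_distrib_left sum.distrib)
 thus "app (To y * Xo u) f n S w = app (Xo u * To y + sc (of_real (u \<bullet> y))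
   + (\<Sum>a\<in>Ph. sc (h a * of_real ((a \<bullet> y) * (2 * (u \<bullet> a) / (a \<bullet> a)))) * Wo (rf a))) f n S w"
  by (simp add: app_To app_op_sum sum_vv pd_mult smv_def inner_commute algebra_simps)
qed

lemma Wo_To:
 assumes g: "symm g"
 shows "Wo g * To y = To (g y) * Wo g"
proof (rule op_eqI, intro ext)
 fix f :: "'e vv" and n S and w :: "'e => 'e"
 have go: "orth g" using g by (rule symm_orth)
 let ?s = "sub (fs (ivf g))"
 have l: "linear (fs (ivf g))" by (intro linear_fs orth_linear orth_inv go)
 have 1: "pd (g y, 0) (?s p) = ?s (pd (y, 0) p)" for p using pd_sub[OF l, of "(g y, 0)" p] go by (simp add: fs_def)
 have 2: "ivf (ivf g o w) y = ivf w (g y)" if "orth w"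
  using orth_inv_comp[OF orth_inv[OF go] that] go by (simp add: inv_inv_eq[OF orthogonal_transformation_bij])
 have 3: "orth (ivf g o w) \<longleftrightarrow> orth w" by (rule orth_comp_iff[OF orth_inv[OF go]])
 have inj: "inj_on g Ph" using orthogonal_transformation_inj[OF go] by (rule inj_on_subset) simp
 have 4: "dd (g a, 0) (?s p) = ?s (dd (a, 0) p)" if "a : Ph" for a p
 proof (rule dd_sub_conj)
  show "(a, 0) ~= (0 :: 'e \<times> 'e)" using that nzE by blast
  have "g a : Ph" using g that by (auto simp: symm_def)
  thus "(g a, 0) ~= (0 :: 'e \<times> 'e)" using nzE by blast
  show "?s (lin (a, 0)) = lin (g a, 0)" by (simp add: sub_fs_lin1 go)
  show "rf (a, 0) (fs (ivf g) v) = fs (ivf g) (rf (g a, 0) v)" for v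
   using rf_conj[OF orth_inv[OF go], of "g a"] go by (cases v) (simp add: rf_fst fs_def)
 qed (rule l)
 have 5: "ivf g o (rf (g a) o w) = rf a o (ivf g o w)" for a using rf_conj[OF orth_inv[OF go], of "g a"] go by (simp add: fun_eq_iff)
 have "(\<Sum>a\<in>Ph. const (h a * of_real (a \<bullet> g y)) * dd (a, 0) (?s (f n S (ivf g o (rf a o w)))))
  = (\<Sum>a\<in>g ` Ph. const (h a * of_real (a \<bullet> g y)) * dd (a, 0) (?s (f n S (ivf g o (rf a o w)))))"
  using g by (simp add: symm_def)
 also have "... = (\<Sum>a\<in>Ph. const (h (g a) * of_real (g a \<bullet> g y)) * dd (g a, 0) (?s (f n S (ivf g o (rf (g a) o w)))))"
  by (simp add: sum.reindex[OF inj])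
 also have "... = (\<Sum>a\<in>Ph. const (h a * of_real (a \<bullet> y)) * ?s (dd (a, 0) (f n S (rf a o (ivf g o w)))))"
  using g go by (intro sum.cong) (simp_all add: symm_def 4 5 orthogonal_transformation_def)
 also have "... = ?s (\<Sum>a\<in>Ph. const (h a * of_real (a \<bullet> y)) * dd (a, 0) (f n S (rf a o (ivf g o w))))"
  by (simp add: sub_sum[OF l] sub_simps[OF l])
 finally have 6: "(\<Sum>a\<in>Ph. const (h a * of_real (a \<bullet> g y)) * dd (a, 0) (?s (f n S (ivf g o (rf a o w))))) = ..." .
 show "app (Wo g * To y) f n S w = app (To (g y) * Wo g) f n S w" using sub_fs_lin1[OF go]
  linear_0[OF orth_linear[OF go]] by (simp add: app_Wo go app_To 1 2 3 6 sub_simps[OF l])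
qed

text \<open>Vectors concentrated at one index with constant polynomial 1. Multiplication operators
  applied to them produce every vector of finite support.\<close>

definition dl :: "nat => nat set => ('e => 'e) => 'e vv" where
 "dl n S w = (%n' S' w'. if n' = n & S' = S & w' = w then 1 else 0)"

lemma To_dl:
 "app (To y) (dl n S w) = (if orth w then app (Mo (lin (0, ivf w y))) (dl (Suc n) S w) else 0)"
proof (intro ext)
 fix n' S' w'
 have "(\<Sum>a\<in>Ph. const (h a * of_real (a \<bullet> y)) * dd (a, 0) (dl n S w n' S' (rf a o w'))) = 0"
  by (rule sum.neutral) (simp add: dl_def nzE)
 moreover have "pd (y, 0) (dl n S w n' S' w') = 0" by (simp add: dl_def)
 moreover have "(if n' = 0 \<or> \<not> orth w' then 0 else lin (0, ivf w' y) * dl n S w (n' - 1) S' w')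
  = (if orth w then lin (0, ivf w y) * dl (Suc n) S w n' S' w' else 0)" by (cases n') (simp_all add: dl_def)
 ultimately show "app (To y) (dl n S w) n' S' w'
  = (if orth w then app (Mo (lin (0, ivf w y))) (dl (Suc n) S w) else 0) n' S' w'" by (simp add: app_To)
qed


text \<open>Moving T_a past a reflection s_c leaves a multiple of T_c s_c, so the double commutator
  has coefficients proportional to (a.c)(b.c)(u.c). The symmetry of these in a and b is the reason
  why Dunkl operators commute.\<close>

lemma To_commutator_Xo:
 "To a * (To b * Xo u - Xo u * To b) - (To b * Xo u - Xo u * To b) * To a
  = (\<Sum>c\<in>Ph. sc (h c * of_real ((c \<bullet> b) * (2 * (u \<bullet> c) / (c \<bullet> c)) * (2 * (a \<bullet> c) / (c \<bullet> c)))) * (To c * Wo (rf c)))"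
proof -
 let ?k = "%c. sc (h c * of_real ((c \<bullet> b) * (2 * (u \<bullet> c) / (c \<bullet> c)))) :: 'e op"
 have 1: "To b * Xo u - Xo u * To b = sc (of_real (u \<bullet> b)) + (\<Sum>c\<in>Ph. ?k c * Wo (rf c))" by (simp add: To_Xo)
 have 2: "To a * Wo (rf c) - Wo (rf c) * To a = sc (of_real (2 * (a \<bullet> c) / (c \<bullet> c))) * (To c * Wo (rf c))"
  if "c : Ph" for c
 proof -
  have "To (rf c a) = To a - sc (of_real (2 * (a \<bullet> c) / (c \<bullet> c))) * To c"
   using To_add[of a "- ((2 * (a \<bullet> c) / (c \<bullet> c)) *\<^sub>R c)"] by (simp only: rf_def To_minus To_scale diff_conv_add_uminus)
  hence "(To a - To (rf c a)) * Wo (rf c) = sc (of_real (2 * (a \<bullet> c) / (c \<bullet> c))) * (To c * Wo (rf c))"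
   by (simp add: mult.assoc)
  thus ?thesis using Wo_To[OF symm_rf[OF that], of a] by (simp add: left_diff_distrib)
 qed
 have "To a * (To b * Xo u - Xo u * To b) - (To b * Xo u - Xo u * To b) * To a
  = (\<Sum>c\<in>Ph. To a * (?k c * Wo (rf c)) - (?k c * Wo (rf c)) * To a)"
  unfolding 1 by (simp add: distrib_left distrib_right sum_distrib_left sum_distrib_right sc_commute sum_subtractf)
 also have "... = (\<Sum>c\<in>Ph. ?k c * (To a * Wo (rf c) - Wo (rf c) * To a))"
  by (rule sum.cong) (simp_all add: sc_left right_diff_distrib mult.assoc)
 also have "... = (\<Sum>c\<in>Ph. sc (h c * of_real ((c \<bullet> b) * (2 * (u \<bullet> c) / (c \<bullet> c)) * (2 * (a \<bullet> c) / (c \<bullet> c)))) * (To c * Wo (rf c)))"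
 proof (rule sum.cong[OF HOL.refl])
  fix c assume c: "c : Ph"
  have "?k c * sc (of_real (2 * (a \<bullet> c) / (c \<bullet> c)))
    = sc (h c * of_real ((c \<bullet> b) * (2 * (u \<bullet> c) / (c \<bullet> c)) * (2 * (a \<bullet> c) / (c \<bullet> c))))"
   by (simp only: sc_simps(4)[symmetric] of_real_mult mult.assoc)
  thus "?k c * (To a * Wo (rf c) - Wo (rf c) * To a)
    = sc (h c * of_real ((c \<bullet> b) * (2 * (u \<bullet> c) / (c \<bullet> c)) * (2 * (a \<bullet> c) / (c \<bullet> c)))) * (To c * Wo (rf c))"
   using 2[OF c] by (simp only: mult.assoc[symmetric])
 qed
 finally show ?thesis .
qed

text \<open>By the Jacobi identity, the commutator of Q = [T_a, T_b] with X_u is a difference of two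
  equal double commutators. So Q commutes with all multiplication operators; it also kills the delta
  vectors, and each value of Q f depends on only finitely many components of f.\<close>

lemma To_commute: "To a * To b = To b * To a"
proof -
 define Q where "Q = To a * To b - To b * To a"
 have QX: "Q * Xo u = Xo u * Q" for u
 proof -
  have "Q * Xo u - Xo u * Q = (To a * (To b * Xo u - Xo u * To b) - (To b * Xo u - Xo u * To b) * To a)
   - (To b * (To a * Xo u - Xo u * To a) - (To a * Xo u - Xo u * To a) * To b)"
   unfolding Q_def by (simp only: left_diff_distrib right_diff_distrib mult.assoc) simp
  also have "... = 0" unfolding To_commutator_Xo by (simp add: inner_commute mult_ac)
  finally show ?thesis by simp
 qed
 have Q2: "Q * Mo (lin (0, v)) = Mo (lin (0, v)) * Q" for v
 proof -
  have "To x * (To y * Mo (lin (0, v))) = Mo (lin (0, v)) * (To x * To y)" for x y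
   unfolding To_Mo2[of y] mult.assoc[symmetric] To_Mo2[of x] ..
  thus ?thesis by (simp only: Q_def left_diff_distrib right_diff_distrib mult.assoc)
 qed
 have QM: "Q * Mo p = Mo p * Q" for p
 proof (induction p rule: pf_induct)
  case (const k)
  thus ?case by (simp add: Mo_simps sc_commute)
 next
  case (lin u)
  have "lin u = lin (fst u, 0) + lin (0, snd u)" using lin_simps(2)[of "(fst u, 0)" "(0, snd u)"] by simp
  thus ?case using QX[of "fst u"] Q2[of "snd u"] by (simp only: Mo_simps distrib_left distrib_right)
 next
  case (add f g)
  thus ?case by (simp only: Mo_simps distrib_left distrib_right)
 next
  case (mult f g)
  thus ?case by (metis Mo_simps(2) mult.assoc)
 qed
 \<comment> \<open>On a delta vector a Dunkl operator is multiplication by a linear form in xi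
   together with a shift of the level, and such forms commute.\<close>
 have Qd: "app Q (dl n S w) = 0" for n S and w :: "'e => 'e"
 proof -
  have "app (To x) (app (Mo (lin (0, v))) f) = app (Mo (lin (0, v))) (app (To x) f)" for x v f
   using To_Mo2[of x v] by (metis app_simps(4))
  thus ?thesis by (simp add: Q_def To_dl del: app_Mo) (simp add: fun_eq_iff mult.left_commute)
 qed
 have "app Q f n S w = 0" for f n S w
 proof -
  \<comment> \<open>Two Dunkl operators reach at most two reflections away from w, and they never
    use a level above n. So f may be replaced by the finite combination \<open>f'\<close> that
    agrees with it on these indices.\<close>
  define W2 where "W2 = {w} \<union> (%c. rf c o w) ` Ph \<union> (%(c, d). rf c o (rf d o w)) ` (Ph \<times> Ph)"
  have finW: "finite W2" using fin by (simp add: W2_def)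
  define f' where "f' = (\<Sum>(m, v)\<in>{..n} \<times> W2. app (Mo (f m S v)) (dl m S v))"
  have ff': "f' m S v = f m S v" if "m \<le> n" "v : W2" for m v
  proof -
   have "f' m S v = (\<Sum>z\<in>{..n} \<times> W2. if z = (m, v) then f m S v else 0)"
    unfolding f'_def sum_vv by (rule sum.cong) (auto simp: dl_def split: if_splits)
   also have "... = f m S v" using that finW by (subst sum.delta) auto
   finally show ?thesis .
  qed
  have Qf': "app Q f' = 0"
  proof -
   have "app Q (app (Mo p) v) = app (Mo p) (app Q v)" for p v using QM[of p] by (metis app_simps(4))
   thus ?thesis unfolding f'_def by (simp add: app_sum split_def Qd del: app_Mo)
  qed
  have loc: "app (To x) (app (To z) g) n S w = 0" if g: "\<And>m v. m \<le> n ==> v : W2 ==> g m S v = 0" for g x z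
  proof -
   have w2: "w : W2" "\<And>c. c : Ph ==> rf c o w : W2" "\<And>c d. c : Ph ==> d : Ph ==> rf c o (rf d o w) : W2" by (auto simp: W2_def)
   have z1: "app (To z) g m S w = 0" if "m \<le> n" for m using that by (simp add: app_To g w2 nzE)
   have z2: "app (To z) g n S (rf c o w) = 0" if "c : Ph" for c using that by (simp add: app_To g w2 nzE)
   show ?thesis by (subst app_To) (simp add: z1 z2 nzE)
  qed
  have "app Q (f - f') n S w = 0" using loc[of "f - f'"] ff' by (simp add: Q_def del: app_diff)
  thus ?thesis using Qf' by simp
 qed
 hence "Q = 0" by (intro op_eqI) (simp add: fun_eq_iff)
 thus ?thesis by (simp add: Q_def)
qed

end

section \<open>Algebras presented by generators and relations\<close>

lemma monoid_free_monoid: "monoid (free_monoid S)" by (unfold_locales) (auto simp: free_monoid_def)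

lemma kalg_free_alg: "kalg (free_alg S :: ('k::field, _) module)"
 unfolding free_alg_def by (rule monoid.kalg_monoid_alg[OF monoid_free_monoid])

lemma gen_closed [simp, intro]: "s : S ==> gen s : carrier (free_alg S)" unfolding free_alg_def gen_def
 by (rule monoid.single_closed[OF monoid_free_monoid]) (simp add: free_monoid_def)

lemma free_alg_lift:
 assumes B: "kalg B" and g: "\<And>s. s : S ==> g s : carrier B"
 shows "\<exists>h. kalg_hom (free_alg S) B h & (\<forall>s\<in>S. h (gen s) = g s)"
proof -
 interpret B: kalg B by fact
 define \<phi> where "\<phi> = (%u. foldr (%s v. g s \<otimes>\<^bsub>B\<^esub> v) u \<one>\<^bsub>B\<^esub>)"
 have cl: "\<phi> u : carrier B" if "set u \<subseteq> S" for u using that by (induction u) (auto simp: \<phi>_def g)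
 have mu: "\<phi> (u @ v) = \<phi> u \<otimes>\<^bsub>B\<^esub> \<phi> v" if "set u \<subseteq> S" "set v \<subseteq> S" for u v
  using that(1)
 proof (induction u)
  case Nil
  thus ?case using cl[OF that(2)] by (simp add: \<phi>_def)
 next
  case (Cons s u)
  thus ?case using cl[OF that(2)] cl[of u] g[of s] by (simp add: \<phi>_def B.m_assoc)
 qed
 have "kalg_hom (monoid_alg (free_monoid S)) B (mext B \<phi>)"
 proof (rule kalg_hom_mext[OF monoid_free_monoid B])
  show "\<phi> \<one>\<^bsub>free_monoid S\<^esub> = \<one>\<^bsub>B\<^esub>" by (simp add: \<phi>_def free_monoid_def)
 qed (auto simp: free_monoid_def in_lists_conv_set subset_iff intro!: cl mu)
 moreover have "mext B \<phi> (gen s) = g s" if "s : S" for s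
  unfolding gen_def using g[OF that] cl[of "[s]"] that B.mext_single[of \<phi> "[s]"] by (simp add: \<phi>_def)
 ultimately show ?thesis unfolding free_alg_def by blast
qed

locale presented = kalg_quot "free_alg G" S for G :: "'g set" and S :: "('g list => 'k::field) set"
begin

abbreviation "gn g \<equiv> cls (gen g)"

lemma gn_closed [simp, intro]: "g : G ==> gn g : carrier Q" by (simp add: cls_closed)

text \<open>Every word is reached from 1 by multiplying with generators from the left, so stability
  under the generators is enough. This gives the spanning sets of both the Clifford and the
  Cherednik algebra.\<close>

lemma span_generators:
 assumes S': "S' \<subseteq> carrier Q" and one: "\<one>\<^bsub>Q\<^esub> : lspan Q S'"
  and m: "\<And>g s. g : G ==> s : S' ==> gn g \<otimes>\<^bsub>Q\<^esub> s : lspan Q S'"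
 shows "carrier Q = lspan Q S'"
proof
 interpret Q: kalg Q by (rule kalg_Q)
 have M: "monoid (free_monoid G)" by (rule monoid_free_monoid)
 show "lspan Q S' \<subseteq> carrier Q" using Q.lspan_closed[OF S'] by blast
 have w: "cls (single u) : lspan Q S'" if "set u \<subseteq> G" for u using that
 proof (induction u)
  case Nil
  have "cls (single []) = \<one>\<^bsub>Q\<^esub>" using cls_one by (simp add: free_alg_def monoid_alg_simps free_monoid_def)
  thus ?case using one by simp
 next
  case (Cons g u)
  have c: "(single u :: 'g list => 'k) : carrier (free_alg G)" unfolding free_alg_def
   by (rule monoid.single_closed[OF M]) (use Cons in \<open>auto simp: free_monoid_def\<close>)
  have "(single (g # u) :: 'g list => 'k) = gen g \<otimes>\<^bsub>free_alg G\<^esub> single u"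
   unfolding free_alg_def gen_def by (subst monoid.single_mult[OF M]) (simp add: free_monoid_def)
  hence "cls (single (g # u)) = gn g \<otimes>\<^bsub>Q\<^esub> cls (single u)" using cls_mult[OF gen_closed c, of g] Cons by simp
  thus ?case using Q.lspan_mult_left[OF S' S' _ m] Cons by simp
 qed
 have "cls f : lspan Q S'" if "f : carrier (free_alg G)" for f using that[unfolded free_alg_def]
 proof (induction rule: monoid.monoid_alg_induct[OF M, consumes 1])
  case 1
  thus ?case using cls_zero lspan.zero[of Q S'] by (simp add: free_alg_def)
 next
  case (2 k u f)
  have u: "set u \<subseteq> G" using 2(1) by (auto simp: free_monoid_def)
  have c: "(single u :: 'g list => 'k) : carrier (free_alg G)" "f : carrier (free_alg G)"
   using monoid.single_closed[OF M 2(1)] 2(2) by (simp_all add: free_alg_def)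
  have "cls (k \<odot>\<^bsub>free_alg G\<^esub> single u \<oplus>\<^bsub>free_alg G\<^esub> f) = k \<odot>\<^bsub>Q\<^esub> cls (single u) \<oplus>\<^bsub>Q\<^esub> cls f"
   using c by (simp add: cls_add cls_smult)
  also have "... : lspan Q S'" by (intro Q.lspan_add Q.lspan_smult S' w u 2(3))
  finally show ?case by (simp add: free_alg_def)
 qed
 thus "carrier Q \<subseteq> lspan Q S'" by (auto simp: carrier_Q)
qed

text \<open>The relations are verified for an arbitrary extension h of the values on generators,
  since only these values enter the verification.\<close>

lemma lift_gen:
 assumes B: "kalg B" and g: "\<And>s. s : G ==> g s : carrier B"
  and r: "\<And>h s. kalg_hom (free_alg G) B h ==> (\<forall>s\<in>G. h (gen s) = g s) ==> s : S ==> h s = \<zero>\<^bsub>B\<^esub>"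
 shows "\<exists>h. kalg_hom Q B h & (\<forall>s\<in>G. h (gn s) = g s)"
proof -
 have "\<exists>h. kalg_hom (free_alg G) B h & (\<forall>s\<in>G. h (gen s) = g s)" by (rule free_alg_lift[OF B]) (rule g)
 then obtain h where h: "kalg_hom (free_alg G) B h" "\<forall>s\<in>G. h (gen s) = g s" by (elim exE conjE)
 have s0: "h s = \<zero>\<^bsub>B\<^esub>" if "s : S" for s by (rule r[OF h that])
 have "\<exists>k. kalg_hom Q B k & (\<forall>a\<in>carrier (free_alg G). k (cls a) = h a)" by (rule lift[OF h(1)]) (rule s0)
 then obtain k where "kalg_hom Q B k" "\<forall>a\<in>carrier (free_alg G). k (cls a) = h a" by (elim exE conjE)
 thus ?thesis using h by (intro exI[of _ k]) auto
qed

end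

subsection \<open>Operators as an algebra\<close>

text \<open>The operators as a record, which lets presented algebras map into them.
  \<open>ralg\<close> is the same ring with real scalars, the target of the real Clifford
  algebra.\<close>

definition talg :: "(complex, 'e::euclidean_space op) module" where
 "talg = \<lparr>carrier = UNIV, mult = (*), one = 1, zero = 0, add = (+), smult = (%k F. sc k * F)\<rparr>"

definition ralg :: "(real, 'e::euclidean_space op) module" where
 "ralg = \<lparr>carrier = UNIV, mult = (*), one = 1, zero = 0, add = (+), smult = (%k F. sc (of_real k) * F)\<rparr>"

lemma talg_simps [simp]: "carrier talg = UNIV" "a \<otimes>\<^bsub>talg\<^esub> b = a * b" "\<one>\<^bsub>talg\<^esub> = 1" "\<zero>\<^bsub>talg\<^esub> = 0"
 "a \<oplus>\<^bsub>talg\<^esub> b = a + b" "k \<odot>\<^bsub>talg\<^esub> a = sc k * a" by (simp_all add: talg_def)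

lemma ralg_simps [simp]: "carrier ralg = UNIV" "a \<otimes>\<^bsub>ralg\<^esub> b = a * b" "\<one>\<^bsub>ralg\<^esub> = 1" "\<zero>\<^bsub>ralg\<^esub> = 0"
 "a \<oplus>\<^bsub>ralg\<^esub> b = a + b" "r \<odot>\<^bsub>ralg\<^esub> a = sc (of_real r) * a" by (simp_all add: ralg_def)

lemma kalg_talg: "kalg (talg :: (complex, 'e::euclidean_space op) module)"
proof -
 have "ring (talg :: (complex, 'e op) module)"
 proof (intro ringI abelian_groupI monoidI)
  show "\<exists>y\<in>carrier talg. y \<oplus>\<^bsub>talg\<^esub> x = \<zero>\<^bsub>talg\<^esub>" for x :: "'e op"
   by (rule bexI[of _ "- x"]) simp_all
 qed (simp_all add: add_ac mult.assoc distrib_left distrib_right)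
 moreover have "kalg_axioms (talg :: (complex, 'e op) module)"
  by (intro kalg_axioms.intro) (simp_all add: sc_simps distrib_left distrib_right mult.assoc, simp only: sc_left)
 ultimately show ?thesis by (rule kalg.intro)
qed

lemma kalg_ralg: "kalg (ralg :: (real, 'e::euclidean_space op) module)"
proof -
 have "ring (ralg :: (real, 'e op) module)"
 proof (intro ringI abelian_groupI monoidI)
  show "\<exists>y\<in>carrier ralg. y \<oplus>\<^bsub>ralg\<^esub> x = \<zero>\<^bsub>ralg\<^esub>" for x :: "'e op"
   by (rule bexI[of _ "- x"]) simp_all
 qed (simp_all add: add_ac mult.assoc distrib_left distrib_right)
 moreover have "kalg_axioms (ralg :: (real, 'e op) module)"
  by (intro kalg_axioms.intro) (simp_all add: sc_simps distrib_left distrib_right mult.assoc, simp only: sc_left)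
 ultimately show ?thesis by (rule kalg.intro)
qed

interpretation talg: kalg "talg :: (complex, 'e::euclidean_space op) module" by (rule kalg_talg)
interpretation ralg: kalg "ralg :: (real, 'e::euclidean_space op) module" by (rule kalg_ralg)

lemma talg_minus [simp]: "a \<ominus>\<^bsub>talg\<^esub> b = a - b" "\<ominus>\<^bsub>talg\<^esub> b = - b"
 using talg.smult_minus1[of b] by (simp_all add: a_minus_def sc_simps)

lemma ralg_minus [simp]: "a \<ominus>\<^bsub>ralg\<^esub> b = a - b" "\<ominus>\<^bsub>ralg\<^esub> b = - b"
 using ralg.smult_minus1[of b] by (simp_all add: a_minus_def sc_simps)

lemma talg_finsum [simp]: "finsum talg f I = sum f I" by (induction I rule: infinite_finite_induct) (simp_all add: talg.finsum_insert)

text \<open>Turns anti-homomorphisms such as transposition and star into homomorphisms, to which the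
  universal properties apply.\<close>

definition opp :: "('k, 'a) module => ('k, 'a) module" where
 "opp A = A\<lparr>mult := (%a b. b \<otimes>\<^bsub>A\<^esub> a)\<rparr>"

lemma opp_simps [simp]: "carrier (opp A) = carrier A" "a \<otimes>\<^bsub>opp A\<^esub> b = b \<otimes>\<^bsub>A\<^esub> a" "\<one>\<^bsub>opp A\<^esub> = \<one>\<^bsub>A\<^esub>"
 "\<zero>\<^bsub>opp A\<^esub> = \<zero>\<^bsub>A\<^esub>" "a \<oplus>\<^bsub>opp A\<^esub> b = a \<oplus>\<^bsub>A\<^esub> b" "k \<odot>\<^bsub>opp A\<^esub> a = k \<odot>\<^bsub>A\<^esub> a"
 by (simp_all add: opp_def)

lemma (in kalg) kalg_opp: "kalg (opp A)"
proof -
 have "ring (opp A)"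
 proof (intro ringI abelian_groupI monoidI)
  fix x assume "x : carrier (opp A)"
  thus "\<exists>y\<in>carrier (opp A). y \<oplus>\<^bsub>opp A\<^esub> x = \<zero>\<^bsub>opp A\<^esub>"
   by (intro bexI[of _ "\<ominus> x"]) (simp_all add: l_neg)
 qed (simp_all add: a_ac m_assoc l_distr r_distr)
 moreover have "kalg_axioms (opp A)"
  by (intro kalg_axioms.intro) (simp_all add: smult_l_distr smult_r_distr smult_assoc1 smult_mult_l smult_mult_r)
 ultimately show ?thesis by (rule kalg.intro)
qed

section \<open>The Clifford algebra\<close>

lemma cliff_rels_closed: "cliff_rels \<subseteq> carrier (free_alg UNIV)"
proof -
 interpret F: kalg "free_alg UNIV :: (real, 'e list => real) module" by (rule kalg_free_alg)
 show ?thesis by (auto simp: cliff_rels_def cliff_free_def Let_def)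
qed

interpretation cl: presented "UNIV :: 'e::euclidean_space set" "cliff_rels :: ('e list => real) set"
 by (intro presented.intro kalg_quot.intro kalg_quot_axioms.intro kalg_free_alg cliff_rels_closed)

lemma cliff_rels_cases:
 assumes "s : cliff_rels"
 obtains (add) u v where "s = gen (u + v) \<ominus>\<^bsub>free_alg UNIV\<^esub> (gen u \<oplus>\<^bsub>free_alg UNIV\<^esub> gen v)"
 | (scale) r v where "s = gen (r *\<^sub>R v) \<ominus>\<^bsub>free_alg UNIV\<^esub> (r \<odot>\<^bsub>free_alg UNIV\<^esub> gen v)"
 | (anti) u v where "s = (gen u \<otimes>\<^bsub>free_alg UNIV\<^esub> gen v \<oplus>\<^bsub>free_alg UNIV\<^esub> gen v \<otimes>\<^bsub>free_alg UNIV\<^esub> gen u)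
   \<ominus>\<^bsub>free_alg UNIV\<^esub> (2 * (u \<bullet> v)) \<odot>\<^bsub>free_alg UNIV\<^esub> \<one>\<^bsub>free_alg UNIV\<^esub>"
 using assms unfolding cliff_rels_def Let_def cliff_free_def by blast

abbreviation (input) "CR == Cliff_real"

abbreviation (input) cl_mult (infixl "\<ast>" 70) where "a \<ast> b == a \<otimes>\<^bsub>CR\<^esub> b"

lemma Cliff_real_eq: "CR = cl.Q" and cliff_vec_eq: "cliff_vec y = cl.gn y" by (simp_all add: Cliff_real_def cliff_free_def cliff_vec_def)

interpretation C: kalg "CR :: (real, 'e::euclidean_space cliff) module" unfolding Cliff_real_eq by (rule cl.kalg_Q)

lemma cv_closed [simp, intro]: "cliff_vec y : carrier CR" by (simp add: Cliff_real_eq cliff_vec_eq)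

lemma cliff_vec_add: "cliff_vec (u + v) = cliff_vec u \<oplus>\<^bsub>CR\<^esub> cliff_vec v"
proof -
 have "cl.cls (gen (u + v)) = cl.cls (gen u \<oplus>\<^bsub>free_alg UNIV\<^esub> gen v)"
  by (rule cl.cls_rel_eq) (auto simp: cliff_rels_def Let_def cliff_free_def)
 thus ?thesis by (simp add: cliff_vec_eq Cliff_real_eq cl.cls_add)
qed

lemma cliff_vec_scale: "cliff_vec (r *\<^sub>R v) = r \<odot>\<^bsub>CR\<^esub> cliff_vec v"
proof -
 have "cl.cls (gen (r *\<^sub>R v)) = cl.cls (r \<odot>\<^bsub>free_alg UNIV\<^esub> gen v)"
  by (rule cl.cls_rel_eq) (auto simp: cliff_rels_def Let_def cliff_free_def)
 thus ?thesis by (simp add: cliff_vec_eq Cliff_real_eq cl.cls_smult)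
qed

lemma cliff_vec_anticomm:
 "cliff_vec u \<ast> cliff_vec v \<oplus>\<^bsub>CR\<^esub> cliff_vec v \<ast> cliff_vec u
  = (2 * (u \<bullet> v)) \<odot>\<^bsub>CR\<^esub> \<one>\<^bsub>CR\<^esub>"
proof -
 have "cl.cls (gen u \<otimes>\<^bsub>free_alg UNIV\<^esub> gen v \<oplus>\<^bsub>free_alg UNIV\<^esub> gen v \<otimes>\<^bsub>free_alg UNIV\<^esub> gen u)
  = cl.cls ((2 * (u \<bullet> v)) \<odot>\<^bsub>free_alg UNIV\<^esub> \<one>\<^bsub>free_alg UNIV\<^esub>)"
  by (rule cl.cls_rel_eq) (auto simp: cliff_rels_def Let_def cliff_free_def)
 thus ?thesis by (simp add: cliff_vec_eq Cliff_real_eq cl.cls_add cl.cls_mult cl.cls_smult cl.cls_one)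
qed

lemma cliff_vec_sum: "finite I ==> cliff_vec (\<Sum>i\<in>I. f i *\<^sub>R v i) = (\<Oplus>\<^bsub>CR\<^esub>i\<in>I. f i \<odot>\<^bsub>CR\<^esub> cliff_vec (v i))"
proof (induction I rule: finite_induct)
 case empty
 show ?case using cliff_vec_scale[of 0 0] by simp
next
 case (insert i I)
 thus ?case by (simp add: C.finsum_insert cliff_vec_add cliff_vec_scale)
qed

subsection \<open>The parity automorphism and the transposition\<close>

definition wsgn :: "('e list => real) => 'e list => real" where
 "wsgn f = (%u. (-1) ^ length u * f u)"

definition wrev :: "('e list => real) => 'e list => real" where
 "wrev f = (%u. f (rev u))"

lemma free_mult: "f \<otimes>\<^bsub>free_alg S\<^esub> g = (%x. \<Sum>(u, v)\<in>{(u, v). f u ~= 0 & g v ~= 0 & u @ v = x}. f u * g v)"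
 by (simp add: free_alg_def monoid_alg_def free_monoid_def)

lemma wsgn_hom: "kalg_hom (free_alg UNIV) (free_alg UNIV) wsgn"
proof (rule kalg_homI[OF kalg_free_alg kalg_free_alg])
 fix f g :: "'a list => real"
 show "wsgn (f \<otimes>\<^bsub>free_alg UNIV\<^esub> g) = wsgn f \<otimes>\<^bsub>free_alg UNIV\<^esub> wsgn g"
 proof
  fix x
  have "wsgn (f \<otimes>\<^bsub>free_alg UNIV\<^esub> g) x
   = (\<Sum>(u, v)\<in>{(u, v). f u ~= 0 & g v ~= 0 & u @ v = x}. wsgn f u * wsgn g v)"
   unfolding free_mult wsgn_def sum_distrib_left by (rule sum.cong) (auto simp: power_add)
  thus "wsgn (f \<otimes>\<^bsub>free_alg UNIV\<^esub> g) x = (wsgn f \<otimes>\<^bsub>free_alg UNIV\<^esub> wsgn g) x"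
   by (simp add: free_mult wsgn_def)
 qed
qed (auto simp: free_alg_def monoid_alg_simps free_monoid_def wsgn_def single_def algebra_simps)

lemma wrev_hom: "kalg_hom (free_alg UNIV) (opp (free_alg UNIV)) wrev"
proof (rule kalg_homI[OF kalg_free_alg kalg.kalg_opp[OF kalg_free_alg]])
 fix f g :: "'a list => real"
 show "wrev (f \<otimes>\<^bsub>free_alg UNIV\<^esub> g) = wrev f \<otimes>\<^bsub>opp (free_alg UNIV)\<^esub> wrev g"
 proof
  fix x
  have "wrev (f \<otimes>\<^bsub>free_alg UNIV\<^esub> g) x
   = (\<Sum>(u, v)\<in>{(u, v). f u ~= 0 & g v ~= 0 & u @ v = rev x}. f u * g v)" by (simp add: free_mult wrev_def)
  also have "... = (\<Sum>(v, u)\<in>{(v, u). g (rev v) ~= 0 & f (rev u) ~= 0 & v @ u = x}. g (rev v) * f (rev u))"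
   by (rule sum.reindex_bij_witness[of _ "%(v, u). (rev u, rev v)" "%(u, v). (rev v, rev u)"])
    (auto simp: rev_swap[symmetric] simp flip: rev_append)
  finally show "wrev (f \<otimes>\<^bsub>free_alg UNIV\<^esub> g) x = (wrev f \<otimes>\<^bsub>opp (free_alg UNIV)\<^esub> wrev g) x"
   by (simp add: free_mult wrev_def)
 qed
next
 fix f :: "'a list => real" assume "f : carrier (free_alg UNIV)"
 hence f: "finite {u. f u ~= 0}" by (simp add: free_alg_def monoid_alg_simps)
 have "{u. f (rev u) ~= 0} = rev ` {u. f u ~= 0}" by (force simp: image_iff)
 thus "wrev f : carrier (opp (free_alg UNIV))" using f by (simp add: free_alg_def monoid_alg_simps wrev_def free_monoid_def)
qed (auto simp: free_alg_def monoid_alg_simps free_monoid_def wrev_def single_def)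

lemma wsgn_gen: "wsgn (gen y) = (- 1) \<odot>\<^bsub>free_alg UNIV\<^esub> gen y"
 by (auto simp: wsgn_def gen_def single_def free_alg_def monoid_alg_simps)

lemma wrev_gen: "wrev (gen y) = gen y" by (auto simp: wrev_def gen_def single_def)

lemma wsgn_wsgn: "wsgn (wsgn f) = f" by (auto simp: wsgn_def fun_eq_iff power_mult_distrib[symmetric] simp flip: mult.assoc)

lemma wrev_wrev: "wrev (wrev f) = f" by (auto simp: wrev_def)

lemma wsgn_wrev: "wsgn (wrev f) = wrev (wsgn f)" by (auto simp: wrev_def wsgn_def)

lemma kalg_hom_comp: "kalg_hom A B f ==> kalg_hom B D g ==> kalg_hom A D (%x. g (f x))"
proof -
 assume "kalg_hom A B f" and "kalg_hom B D g"
 interpret f: kalg_hom A B f by fact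
 interpret g: kalg_hom B D g by fact
 show ?thesis by (rule kalg_homI) (auto simp: f.A.kalg_axioms g.B.kalg_axioms)
qed

lemma kalg_hom_opp: "kalg_hom A B f ==> kalg_hom (opp A) (opp B) f"
proof -
 assume "kalg_hom A B f"
 interpret f: kalg_hom A B f by fact
 show ?thesis by (rule kalg_homI) (auto simp: f.A.kalg_opp f.B.kalg_opp)
qed

text \<open>An involution of the free algebra that maps the relations to zero induces, by taking
 images of cosets, a map of the Clifford algebra.\<close>

lemma coset_image:
 fixes m :: "('e::euclidean_space list => real) => _"
 assumes e: "\<And>f g. f : carrier (free_alg UNIV) ==> g : carrier (free_alg UNIV) ==> cl.cls f = cl.cls g ==> cl.cls (m f) = cl.cls (m g)"
  and c: "\<And>f. f : carrier (free_alg UNIV) ==> m f : carrier (free_alg UNIV)"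
  and inv: "\<And>f. m (m f) = f" and f: "f : carrier (free_alg UNIV)"
 shows "m ` cl.cls f = cl.cls (m f)"
proof -
 have *: "m b : cl.cls (m f)" if "b : cl.cls f" and f: "f : carrier (free_alg UNIV)" for b f
 proof -
  have b: "b : carrier (free_alg UNIV)" "cl.cls b = cl.cls f" using cl.mem_cls[OF f that(1)] f by (auto simp: cl.cls_eq_iff)
  hence "cl.cls (m b) = cl.cls (m f)" using e f by blast
  thus ?thesis using cl.cls_self[OF c[OF b(1)]] by simp
 qed
 show ?thesis
 proof
  show "m ` cl.cls f \<subseteq> cl.cls (m f)" using *[OF _ f] by auto
  show "cl.cls (m f) \<subseteq> m ` cl.cls f"
  proof
   fix b assume "b : cl.cls (m f)"
   hence "m b : cl.cls f" using *[OF _ c[OF f]] inv by metis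
   thus "b : m ` cl.cls f" by (metis imageI inv)
  qed
 qed
qed

lemma cliff_eps_hom: "kalg_hom CR CR (cliff_eps :: 'e::euclidean_space cliff => _)"
 and cliff_eps_cls: "f : carrier (free_alg UNIV) ==> cliff_eps (cl.cls (f :: 'e list => real)) = cl.cls (wsgn f)"
proof -
 interpret s: kalg_hom "free_alg UNIV" "free_alg UNIV" "wsgn :: ('e list => real) => _" by (rule wsgn_hom)
 have h: "kalg_hom (free_alg UNIV) cl.Q (%f. cl.cls (wsgn (f :: 'e list => real)))" by (rule kalg_hom_comp[OF wsgn_hom cl.cls_hom])
 interpret h: kalg_hom "free_alg UNIV" cl.Q "%f. cl.cls (wsgn (f :: 'e list => real))" by (rule h)
 have g: "cl.cls (wsgn (gen y)) = \<ominus>\<^bsub>CR\<^esub> cliff_vec y" for y :: 'e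
  by (simp add: wsgn_gen cl.cls_smult cliff_vec_eq[symmetric] Cliff_real_eq[symmetric] C.smult_minus1)
 have "cl.cls (wsgn s) = \<zero>\<^bsub>cl.Q\<^esub>" if "s : cliff_rels" for s :: "'e list => real" using that
  by (cases rule: cliff_rels_cases)
   (simp_all del: s.add s.mult s.minus s.smult s.one add: g Cliff_real_eq[symmetric] cliff_vec_add cliff_vec_scale
    C.minus_add C.smult_minus_r C.minus_eq_zero C.l_minus C.r_minus cliff_vec_anticomm)
 then obtain e where e: "kalg_hom cl.Q cl.Q e" "\<forall>a\<in>carrier (free_alg UNIV). e (cl.cls a) = cl.cls (wsgn (a :: 'e list => real))"
  using cl.lift[OF h] by blast
 have eps: "cliff_eps (cl.cls f) = cl.cls (wsgn f)" if "f : carrier (free_alg UNIV)" for f :: "'e list => real"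
  unfolding cliff_eps_def wsgn_def[symmetric] by (rule coset_image) (use e that wsgn_wsgn s.closed in \<open>metis+\<close>)
 thus "f : carrier (free_alg UNIV) ==> cliff_eps (cl.cls (f :: 'e list => real)) = cl.cls (wsgn f)" .
 have "cliff_eps X = e X" if "X : carrier CR" for X using that eps e(2) by (auto simp: Cliff_real_eq cl.carrier_Q)
 thus "kalg_hom CR CR (cliff_eps :: 'e cliff => _)"
  using e(1) unfolding Cliff_real_eq[symmetric] kalg_hom_def kalg_hom_axioms_def alg_hom_def ring_hom_def by (auto simp: C.m_closed)
qed

lemma cliff_transp_hom: "kalg_hom CR (opp CR) (cliff_transp :: 'e::euclidean_space cliff => _)"
 and cliff_transp_cls: "f : carrier (free_alg UNIV) ==> cliff_transp (cl.cls (f :: 'e list => real)) = cl.cls (wrev f)"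
proof -
 interpret s: kalg_hom "free_alg UNIV" "opp (free_alg UNIV)" "wrev :: ('e list => real) => _" by (rule wrev_hom)
 have h: "kalg_hom (free_alg UNIV) (opp cl.Q) (%f. cl.cls (wrev (f :: 'e list => real)))"
  by (rule kalg_hom_comp[OF wrev_hom kalg_hom_opp[OF cl.cls_hom]])
 interpret h: kalg_hom "free_alg UNIV" "opp cl.Q" "%f. cl.cls (wrev (f :: 'e list => real))" by (rule h)
 interpret o: kalg "opp (CR :: (real, 'e cliff) module)" by (rule C.kalg_opp)
 have g: "cl.cls (wrev (gen y)) = cliff_vec y" for y :: 'e by (simp add: wrev_gen cliff_vec_eq)
 have "cl.cls (wrev s) = \<zero>\<^bsub>opp cl.Q\<^esub>" if "s : cliff_rels" for s :: "'e list => real" using that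
  by (cases rule: cliff_rels_cases)
   (simp_all del: s.add s.mult s.minus s.smult s.one opp_simps(4) add: g Cliff_real_eq[symmetric] cliff_vec_add
    cliff_vec_scale o.minus_eq_zero cliff_vec_anticomm inner_commute)
 then obtain e where e: "kalg_hom cl.Q (opp cl.Q) e" "\<forall>a\<in>carrier (free_alg UNIV). e (cl.cls a) = cl.cls (wrev (a :: 'e list => real))"
  using cl.lift[OF h] by blast
 have tr: "cliff_transp (cl.cls f) = cl.cls (wrev f)" if "f : carrier (free_alg UNIV)" for f :: "'e list => real"
  unfolding cliff_transp_def wrev_def[symmetric]
  by (rule coset_image) (use e that wrev_wrev s.closed opp_simps(1) in \<open>metis+\<close>)
 thus "f : carrier (free_alg UNIV) ==> cliff_transp (cl.cls (f :: 'e list => real)) = cl.cls (wrev f)" .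
 have "cliff_transp X = e X" if "X : carrier CR" for X using that tr e(2) by (auto simp: Cliff_real_eq cl.carrier_Q)
 thus "kalg_hom CR (opp CR) (cliff_transp :: 'e cliff => _)"
  using e(1) unfolding Cliff_real_eq[symmetric] kalg_hom_def kalg_hom_axioms_def alg_hom_def ring_hom_def by (auto simp: C.m_closed)
qed

interpretation eps: kalg_hom CR CR "cliff_eps :: 'e::euclidean_space cliff => _" by (rule cliff_eps_hom)

lemma cliff_star_hom: "kalg_hom CR (opp CR) (cliff_star :: 'e::euclidean_space cliff => _)"
 unfolding cliff_star_def by (rule kalg_hom_comp[OF cliff_transp_hom kalg_hom_opp[OF cliff_eps_hom]])

interpretation star: kalg_hom CR "opp CR" "cliff_star :: 'e::euclidean_space cliff => _" by (rule cliff_star_hom)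

lemma eps_vec: "cliff_eps (cliff_vec y) = \<ominus>\<^bsub>CR\<^esub> cliff_vec y"
 by (simp add: cliff_vec_eq cliff_eps_cls wsgn_gen cl.cls_smult)
  (simp add: cliff_vec_eq[symmetric] Cliff_real_eq[symmetric] C.smult_minus1)

lemma star_vec: "cliff_star (cliff_vec y) = \<ominus>\<^bsub>CR\<^esub> cliff_vec y"
 using eps_vec[of y] by (simp add: cliff_star_def cliff_vec_eq cliff_transp_cls wrev_gen)

lemma eps_eps: "\<eta> : carrier CR ==> cliff_eps (cliff_eps \<eta>) = \<eta>"
proof -
 assume "\<eta> : carrier CR"
 then obtain f where f: "f : carrier (free_alg UNIV)" "\<eta> = cl.cls f" by (auto simp: Cliff_real_eq cl.carrier_Q)
 thus ?thesis using kalg_hom.closed[OF wsgn_hom f(1)] by (simp add: cliff_eps_cls wsgn_wsgn)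
qed

lemma eps_star: "\<eta> : carrier CR ==> cliff_eps (cliff_star \<eta>) = cliff_star (cliff_eps \<eta>)"
proof -
 assume "\<eta> : carrier CR"
 then obtain f where f: "f : carrier (free_alg UNIV)" "\<eta> = cl.cls f" by (auto simp: Cliff_real_eq cl.carrier_Q)
 thus ?thesis using kalg_hom.closed[OF wsgn_hom f(1)] kalg_hom.closed[OF wrev_hom f(1)]
  by (simp add: cliff_star_def cliff_eps_cls cliff_transp_cls wsgn_wrev)
qed

section \<open>The Clifford algebra in an orthonormal frame: operators, basis words and the Pin
  group\<close>

locale onb =
 fixes y :: "nat => 'e::euclidean_space"
 assumes ob: "orthonormal_basis y"
begin

lemma y_inner: "i : {1..DIM('e)} ==> j : {1..DIM('e)} ==> y i \<bullet> y j = (if i = j then 1 else 0)"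
 using ob unfolding orthonormal_basis_def by blast

text \<open>As many orthonormal vectors as the dimension span the space; the remainder w is
  orthogonal to all of them and hence to itself.\<close>

lemma y_expand: "(\<Sum>i\<in>{1..DIM('e)}. (v \<bullet> y i) *\<^sub>R y i) = v"
proof -
 have inj: "inj_on y {1..DIM('e)}"
 proof (rule inj_onI)
  fix i j assume "i : {1..DIM('e)}" "j : {1..DIM('e)}" "y i = y j"
  thus "i = j" using y_inner[of i j] y_inner[of i i] by (auto split: if_splits)
 qed
 have "pairwise orthogonal (y ` {1..DIM('e)})" unfolding pairwise_def orthogonal_def using y_inner by auto
 moreover have "0 \<notin> y ` {1..DIM('e)}" using y_inner by force
 ultimately have ind: "independent (y ` {1..DIM('e)})" by (rule pairwise_orthogonal_independent)
 have "card (y ` {1..DIM('e)}) = DIM('e)" using card_image[OF inj] by simp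
 hence span: "UNIV \<subseteq> span (y ` {1..DIM('e)})" by (intro card_ge_dim_independent) (use ind in \<open>auto simp: dim_UNIV\<close>)
 define w where "w = v - (\<Sum>i\<in>{1..DIM('e)}. (v \<bullet> y i) *\<^sub>R y i)"
 have "orthogonal w b" if "b : y ` {1..DIM('e)}" for b
 proof -
  obtain j where j: "j : {1..DIM('e)}" "b = y j" using \<open>b : y ` {1..DIM('e)}\<close> by auto
  have "(\<Sum>i\<in>{1..DIM('e)}. (v \<bullet> y i) * (y i \<bullet> y j)) = (\<Sum>i\<in>{1..DIM('e)}. if i = j then v \<bullet> y i else 0)"
   using j y_inner by (intro sum.cong) auto
  thus ?thesis using j by (simp add: orthogonal_def w_def inner_diff_left inner_sum_left)
 qed
 hence "orthogonal w w" using orthogonal_to_span[of w "y ` {1..DIM('e)}" w] span by auto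
 thus ?thesis by (simp add: w_def orthogonal_def)
qed

lemma y_parseval: "u \<bullet> v = (\<Sum>i\<in>{1..DIM('e)}. (u \<bullet> y i) * (v \<bullet> y i))"
 by (subst y_expand[of v, symmetric]) (simp add: inner_sum_right mult.commute)

definition cv :: "'e => 'e op" where
 "cv v = (\<Sum>i\<in>{1..DIM('e)}. sc (of_real (v \<bullet> y i)) * co i)"

lemma cv_y: "i : {1..DIM('e)} ==> cv (y i) = co i"
proof -
 assume i: "i : {1..DIM('e)}"
 have "cv (y i) = (\<Sum>j\<in>{1..DIM('e)}. if j = i then co j else 0)"
  unfolding cv_def by (rule sum.cong) (use i y_inner in \<open>auto simp: sc_simps\<close>)
 thus ?thesis using i by simp
qed

lemma cv_add: "cv (u + v) = cv u + cv v" by (simp add: cv_def inner_add_left sc_simps distrib_right sum.distrib)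

lemma cv_scale: "cv (r *\<^sub>R v) = sc (of_real r) * cv v" by (simp add: cv_def sc_simps mult.assoc sum_distrib_left)

lemma cv_cv: "cv u * cv v + cv v * cv u = sc (of_real (2 * (u \<bullet> v)))"
proof -
 have m: "cv u * cv v = (\<Sum>i\<in>{1..DIM('e)}. \<Sum>j\<in>{1..DIM('e)}. sc (of_real ((u \<bullet> y i) * (v \<bullet> y j))) * (co i * co j))" for u v
  unfolding cv_def sum_distrib_left sum_distrib_right by (subst sum.swap, rule sum.cong[OF HOL.refl], rule sum.cong[OF HOL.refl])
   (simp add: sc_simps mult.assoc sc_left[of "co _"])
 have "cv v * cv u = (\<Sum>i\<in>{1..DIM('e)}. \<Sum>j\<in>{1..DIM('e)}. sc (of_real ((u \<bullet> y i) * (v \<bullet> y j))) * (co j * co i))"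
  unfolding m by (subst sum.swap) (simp add: mult.commute)
 hence "cv u * cv v + cv v * cv u
   = (\<Sum>i\<in>{1..DIM('e)}. \<Sum>j\<in>{1..DIM('e)}. sc (of_real ((u \<bullet> y i) * (v \<bullet> y j))) * (co i * co j + co j * co i))"
  unfolding m by (simp add: sum.distrib distrib_left)
 also have "... = (\<Sum>i\<in>{1..DIM('e)}. \<Sum>j\<in>{1..DIM('e)}. if i = j then sc (of_real ((u \<bullet> y i) * (v \<bullet> y j))) * 2 else 0)"
  by (intro sum.cong HOL.refl) (simp add: co_co)
 also have "... = (\<Sum>i\<in>{1..DIM('e)}. sc (of_real ((u \<bullet> y i) * (v \<bullet> y i))) * 2)" by (rule sum.cong) auto
 also have "... = (\<Sum>i\<in>{1..DIM('e)}. sc (of_real (2 * ((u \<bullet> y i) * (v \<bullet> y i)))))"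
  by (rule sum.cong[OF HOL.refl]) (simp only: mult_2 mult_2_right of_real_add sc_simps)
 also have "... = sc (of_real (2 * (u \<bullet> v)))" by (simp only: y_parseval[of u v] sum_distrib_left of_real_sum sc_sum)
 finally show ?thesis .
qed

lemma cv_commute:
 assumes "\<And>i. F * co i = co i * F"
 shows "F * cv v = cv v * F" by (simp add: cv_def sum_distrib_left sum_distrib_right sc_left assms mult.assoc)

lemma kr_ex: "\<exists>h. kalg_hom CR ralg h & (\<forall>v. h (cliff_vec v) = cv v)"
proof -
 have "\<exists>h. kalg_hom cl.Q ralg h & (\<forall>v\<in>UNIV. h (cl.gn v) = cv v)"
 proof (rule cl.lift_gen[OF kalg_ralg])
  fix h and s :: "'e list => real"
  assume h: "kalg_hom (free_alg UNIV) ralg h" and g: "\<forall>v\<in>UNIV. h (gen v) = cv v" and s: "s : cliff_rels"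
  interpret h: kalg_hom "free_alg UNIV" ralg h by fact
  show "h s = \<zero>\<^bsub>ralg\<^esub>" using s by (cases rule: cliff_rels_cases) (simp_all add: g cv_add cv_scale cv_cv)
 qed simp
 thus ?thesis by (simp add: Cliff_real_eq cliff_vec_eq)
qed

definition kr :: "'e cliff => 'e op" where
 "kr = (SOME h. kalg_hom CR ralg h & (\<forall>v. h (cliff_vec v) = cv v))"

lemma kr_hom: "kalg_hom CR ralg kr" and kr_vec: "kr (cliff_vec v) = cv v" using someI_ex[OF kr_ex] unfolding kr_def by blast+

sublocale kr: kalg_hom CR ralg kr by (rule kr_hom)

lemma sg_single: "sg i {i} = 1"
proof -
 have "{j : {i}. j < i} = {}" by auto
 thus ?thesis unfolding sg_def by (simp only: card.empty even_zero if_True)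
qed

text \<open>Acting on the vector supported at S = {}, \<open>cv u\<close> shows the coordinate u.y_i
  at S = {i}. Injectivity is what makes the description in \<open>pin_proj\<close> unique.\<close>

lemma cliff_vec_inj: "cliff_vec u = cliff_vec v ==> u = v" for u v :: 'e
proof -
 assume "cliff_vec u = cliff_vec v"
 hence eq: "cv u = cv v" using kr_vec by metis
 define f :: "'e vv" where "f = (%n S w. if S = {} then 1 else 0)"
 have c: "ev (app (cv w) f 0 {i} id) 0 = of_real (w \<bullet> y i)" if "i : {1..DIM('e)}" for w i
 proof -
  have "app (cv w) f 0 {i} id = (\<Sum>j\<in>{1..DIM('e)}. if j = i then const (of_real (w \<bullet> y i)) else 0)"
   unfolding cv_def app_op_sum sum_vv by (rule sum.cong) (auto simp: smv_def f_def tog_def sg_single const_simps)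
  thus ?thesis using that by simp
 qed
 have "u \<bullet> y i = v \<bullet> y i" if "i : {1..DIM('e)}" for i using c[OF that, of u] c[OF that, of v] eq by simp
 hence "(\<Sum>i\<in>{1..DIM('e)}. (u \<bullet> y i) *\<^sub>R y i) = (\<Sum>i\<in>{1..DIM('e)}. (v \<bullet> y i) *\<^sub>R y i)" by simp
 thus "u = v" unfolding y_expand .
qed

definition kc :: "'e cliff \<times> 'e cliff => 'e op" where
 "kc = (%(a, b). kr a + sc \<i> * kr b)"

lemma kalg_Cliff: "kalg (Cliff :: (complex, 'e cliff \<times> 'e cliff) module)"
 unfolding Cliff_def by (rule kalg_complexify) (rule C.kalg_axioms)

lemma kc_hom: "kalg_hom Cliff talg kc"
proof (rule kalg_homI[OF kalg_Cliff kalg_talg])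
 have ii: "sc \<i> * (sc \<i> * F) = - F" for F :: "'e op" by (simp add: mult.assoc[symmetric] sc_simps(4)[symmetric] sc_simps)
 fix p q :: "'e cliff \<times> 'e cliff" and k
 assume p: "p : carrier Cliff"
 obtain a b where ab: "p = (a, b)" "a : carrier CR" "b : carrier CR" using p by (auto simp: Cliff_def complexify_simps)
 have k: "k = of_real (Re k) + \<i> * of_real (Im k)" by (rule complex_eq)
 have "(sc k :: 'e op) = sc (of_real (Re k)) + sc \<i> * sc (of_real (Im k))" by (subst k) (simp only: sc_simps)
 hence skF: "sc k * F = sc (of_real (Re k)) * F + sc \<i> * (sc (of_real (Im k)) * F)" for F :: "'e op"
  by (simp only: distrib_right mult.assoc)
 have c1: "sc (of_real r) * (sc \<i> * F) = sc \<i> * (sc (of_real r) * F)" for r and F :: "'e op"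
  by (simp only: mult.assoc[symmetric] sc_commute[of "sc \<i>"])
 show "kc (k \<odot>\<^bsub>Cliff\<^esub> p) = k \<odot>\<^bsub>talg\<^esub> kc p"
  using ab by (simp add: kc_def Cliff_def complexify_simps distrib_left skF c1 ii)
 assume q: "q : carrier Cliff"
 obtain c d where cd: "q = (c, d)" "c : carrier CR" "d : carrier CR" using q by (auto simp: Cliff_def complexify_simps)
 show "kc (p \<oplus>\<^bsub>Cliff\<^esub> q) = kc p \<oplus>\<^bsub>talg\<^esub> kc q"
  using ab cd by (simp add: kc_def Cliff_def complexify_simps distrib_left)
 show "kc (p \<otimes>\<^bsub>Cliff\<^esub> q) = kc p \<otimes>\<^bsub>talg\<^esub> kc q"
  using ab cd by (simp add: kc_def Cliff_def complexify_simps distrib_left distrib_right mult.assoc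
    sc_left[of "kr _"] ii)
qed (simp_all add: kc_def Cliff_def complexify_simps)

lemma kc_cx: "kc (cx_incl CR a) = kr a" by (simp add: kc_def cx_incl_def)

subsection \<open>A spanning set of the Clifford algebra\<close>

abbreviation ci :: "nat => 'e cliff" where "ci i \<equiv> cliff_vec (y i)"

definition cw :: "nat list => 'e cliff" where
 "cw l = foldr (%i z. ci i \<ast> z) l \<one>\<^bsub>CR\<^esub>"

lemma cw_simps [simp]: "cw [] = \<one>\<^bsub>CR\<^esub>" "cw (i # l) = ci i \<ast> cw l" by (simp_all add: cw_def)

lemma cw_closed [simp, intro]: "cw l : carrier CR" by (induction l) auto

lemma ci_sq: "i : {1..DIM('e)} ==> ci i \<ast> ci i = \<one>\<^bsub>CR\<^esub>"
proof -
 assume i: "i : {1..DIM('e)}"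
 let ?z = "ci i \<ast> ci i"
 have "2 \<odot>\<^bsub>CR\<^esub> ?z = 2 \<odot>\<^bsub>CR\<^esub> \<one>\<^bsub>CR\<^esub>"
  using cliff_vec_anticomm[of "y i" "y i"] C.smult_l_distr[of ?z 1 1] y_inner[OF i i] by simp
 hence "(1/2 * 2) \<odot>\<^bsub>CR\<^esub> ?z = (1/2 * 2) \<odot>\<^bsub>CR\<^esub> \<one>\<^bsub>CR\<^esub>"
  by (simp only: C.smult_assoc1 C.m_closed C.one_closed cv_closed)
 thus ?thesis by simp
qed

lemma ci_anti: "i : {1..DIM('e)} ==> j : {1..DIM('e)} ==> i ~= j ==>
 ci i \<ast> ci j = \<ominus>\<^bsub>CR\<^esub> (ci j \<ast> ci i)" using cliff_vec_anticomm[of "y i" "y j"] y_inner[of i j]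
 by (simp add: C.minus_equality[symmetric])

definition srt :: "nat list set" where
 "srt = {l. sorted_wrt (<) l & set l \<subseteq> {1..DIM('e)}}"

lemma finite_srt: "finite srt"
proof (rule finite_subset)
 show "srt \<subseteq> {l. set l \<subseteq> {1..DIM('e)} & distinct l}" by (auto simp: srt_def strict_sorted_iff)
 show "finite {l. set l \<subseteq> {1..DIM('e)} & distinct l}" by (rule finite_subset_distinct) simp
qed

text \<open>The bound on the letters is part of the induction: when c_i is exchanged with a smaller
  first letter j, the rewritten tail still has only letters above j, so that j may be put in front
  again.\<close>

lemma ci_cw:
 "i : {1..DIM('e)} ==> l : srt ==>
  ci i \<ast> cw l : lspan CR (cw ` {l' : srt. set l' \<subseteq> insert i (set l)})"
proof (induction l)
 case Nil
 have "cw [i] : lspan CR (cw ` {l' : srt. set l' \<subseteq> insert i (set [])})"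
  by (rule C.lspan_incl, blast, rule imageI) (use Nil in \<open>simp add: srt_def\<close>)
 thus ?case by simp
next
 case (Cons j l)
 have j: "j : {1..DIM('e)}" "l : srt" using Cons.prems by (auto simp: srt_def)
 let ?T = "cw ` {l' : srt. set l' \<subseteq> insert i (set (j # l))}"
 have T: "?T \<subseteq> carrier CR" by auto
 consider "i < j" | "i = j" | "j < i" by linarith
 thus ?case
 proof cases
  case 1
  have "ci i \<ast> cw (j # l) = cw (i # j # l)" by simp
  moreover have "i # j # l : srt" using Cons.prems 1 by (auto simp: srt_def)
  ultimately show ?thesis by (intro C.lspan_incl[OF T]) force
 next
  case 2
  have "ci i \<ast> cw (j # l) = cw l" using 2 j by (simp add: C.m_assoc[symmetric] ci_sq)
  thus ?thesis using j by (intro C.lspan_incl[OF T]) force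
 next
  case 3
  have "ci j \<ast> (ci i \<ast> cw l) : lspan CR ?T"
  proof (rule C.lspan_mult_left[OF _ T _ _ Cons.IH[OF Cons.prems(1) j(2)]])
   fix s assume "s : cw ` {l' : srt. set l' \<subseteq> insert i (set l)}"
   then obtain l' where l': "l' : srt" "set l' \<subseteq> insert i (set l)" "s = cw l'" by auto
   have "j # l' : srt" using l' Cons.prems 3 by (auto simp: srt_def)
   moreover have "ci j \<ast> s = cw (j # l')" using l' by simp
   ultimately show "ci j \<ast> s : lspan CR ?T" using l' by (intro C.lspan_incl[OF T]) force
  qed auto
  moreover have "ci i \<ast> cw (j # l)
    = (- 1) \<odot>\<^bsub>CR\<^esub> (ci j \<ast> (ci i \<ast> cw l))" using ci_anti[OF Cons.prems(1) j(1)] 3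
   by (simp add: C.m_assoc[symmetric] C.smult_minus1 C.l_minus)
  ultimately show ?thesis using C.lspan_smult[OF T] by simp
 qed
qed

lemma cliff_vec_expand: "cliff_vec v = (\<Oplus>\<^bsub>CR\<^esub>i\<in>{1..DIM('e)}. (v \<bullet> y i) \<odot>\<^bsub>CR\<^esub> ci i)"
 using cliff_vec_sum[of "{1..DIM('e)}" "%i. v \<bullet> y i" y] by (simp only: y_expand finite_atLeastAtMost)

lemma cliff_span: "carrier CR = lspan CR (cw ` srt)" unfolding Cliff_real_eq
proof (rule cl.span_generators; unfold Cliff_real_eq[symmetric] cliff_vec_eq[symmetric])
 show c: "cw ` srt \<subseteq> carrier CR" by auto
 have "cw [] : lspan CR (cw ` srt)" by (rule C.lspan_incl[OF c], rule imageI) (simp add: srt_def)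
 thus "\<one>\<^bsub>CR\<^esub> : lspan CR (cw ` srt)" by simp
 fix g s assume "s : cw ` srt"
 then obtain l where l: "l : srt" "s = cw l" by auto
 have "cliff_vec g \<ast> cw l = (\<Oplus>\<^bsub>CR\<^esub>i\<in>{1..DIM('e)}. (g \<bullet> y i) \<odot>\<^bsub>CR\<^esub> (ci i \<ast> cw l))"
  by (subst cliff_vec_expand[of g], subst C.finsum_ldistr) (simp_all add: C.smult_mult_l)
 also have "... : lspan CR (cw ` srt)"
 proof (rule C.lspan_finsum[OF c], rule Pi_I)
  fix i assume i: "i : {1..DIM('e)}"
  have "ci i \<ast> cw l : lspan CR (cw ` srt)" by (rule C.lspan_least[OF _ c ci_cw[OF i l(1)]]) (auto intro!: C.lspan_incl)
  thus "(g \<bullet> y i) \<odot>\<^bsub>CR\<^esub> (ci i \<ast> cw l) : lspan CR (cw ` srt)" by (rule C.lspan_smult[OF c])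
 qed
 finally show "cliff_vec g \<ast> s : lspan CR (cw ` srt)" using l by simp
qed

subsection \<open>The kernel of the twisted adjoint action\<close>

text \<open>This map is diagonal on increasing words: the eigenvalue is -1 if the letter i occurs
  and 1 otherwise, see \<open>qi_cw\<close>.\<close>

definition qi :: "nat => 'e cliff => 'e cliff" where
 "qi i X = ci i \<ast> cliff_eps X \<ast> ci i"

lemma qi_closed [simp]: "X : carrier CR ==> qi i X : carrier CR" by (simp add: qi_def eps.closed)

lemma qi_lin: "X : carrier CR ==> Y : carrier CR ==>
  qi i (k \<odot>\<^bsub>CR\<^esub> X \<oplus>\<^bsub>CR\<^esub> Y) = k \<odot>\<^bsub>CR\<^esub> qi i X \<oplus>\<^bsub>CR\<^esub> qi i Y"
 by (simp add: qi_def C.r_distr C.l_distr C.smult_mult_l C.smult_mult_r)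

lemma qi_cons: "i : {1..DIM('e)} ==> j : {1..DIM('e)} ==> i ~= j ==> X : carrier CR ==>
  qi i (ci j \<ast> X) = ci j \<ast> qi i X" using ci_anti[of i j] by (simp add: qi_def eps_vec C.m_assoc[symmetric] C.l_minus C.r_minus)

lemma qi_self: "i : {1..DIM('e)} ==> X : carrier CR ==> qi i X = X ==>
  qi i (ci i \<ast> X) = \<ominus>\<^bsub>CR\<^esub> (ci i \<ast> X)"
proof -
 assume i: "i : {1..DIM('e)}" and X: "X : carrier CR" and q: "qi i X = X"
 have "ci i \<ast> X = ci i \<ast> qi i X" by (simp only: q)
 also have "... = ci i \<ast> ci i \<ast> (cliff_eps X \<ast> ci i)" using X by (simp add: qi_def C.m_assoc eps.closed)
 finally have "ci i \<ast> X = cliff_eps X \<ast> ci i" using X i by (simp add: ci_sq eps.closed)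
 moreover have "qi i (ci i \<ast> X) = \<ominus>\<^bsub>CR\<^esub> (cliff_eps X \<ast> ci i)"
  using X i by (simp add: qi_def eps_vec C.m_assoc[symmetric] C.l_minus C.r_minus ci_sq eps.closed)
 ultimately show ?thesis by simp
qed

lemma qi_cw: "i : {1..DIM('e)} ==> l : srt ==> qi i (cw l) = (if i : set l then - 1 else 1) \<odot>\<^bsub>CR\<^esub> cw l"
proof (induction l)
 case Nil
 thus ?case by (simp add: qi_def ci_sq)
next
 case (Cons j l)
 have j: "j : {1..DIM('e)}" "l : srt" "j \<notin> set l" using Cons.prems by (auto simp: srt_def)
 show ?case
 proof (cases "i = j")
  case True
  hence "qi i (cw l) = cw l" using Cons.IH[OF Cons.prems(1) j(2)] j by simp
  thus ?thesis using True qi_self[OF Cons.prems(1)] by (simp add: C.smult_minus1)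
 next
  case False
  thus ?thesis using qi_cons[OF Cons.prems(1) j(1) False] Cons.IH[OF Cons.prems(1) j(2)] by (simp add: C.smult_mult_r)
 qed
qed

text \<open>The hypothesis makes N a fixed point of every \<open>qi i\<close>. Removing the words
  that contain 1, 2, and so on, one letter at a time, leaves only the empty word.\<close>

lemma twisted_kernel:
 fixes N :: "'e cliff"
 assumes N: "N : carrier CR"
  and c: "\<And>v. cliff_eps N \<ast> cliff_vec v = cliff_vec v \<ast> N"
 shows "\<exists>r. N = r \<odot>\<^bsub>CR\<^esub> \<one>\<^bsub>CR\<^esub>"
proof -
 have qN: "qi i N = N" if "i : {1..DIM('e)}" for i
 proof -
  have "qi i N = ci i \<ast> (ci i \<ast> N)" using N by (simp add: qi_def C.m_assoc c eps.closed)
  thus ?thesis using N ci_sq[OF that] by (simp add: C.m_assoc[symmetric])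
 qed
 let ?S = "%k. cw ` {l : srt. set l \<inter> {1..k} = {}}"
 have S: "?S k \<subseteq> carrier CR" for k by auto
 have "k \<le> DIM('e) ==> N : lspan CR (?S k)" for k
 proof (induction k)
  case 0
  thus ?case using N cliff_span by simp
 next
  case (Suc k)
  \<comment> \<open>The projection onto the span of the words that do not contain the letter k + 1;
    N is fixed by it.\<close>
  let ?P = "%X. (1/2) \<odot>\<^bsub>CR\<^esub> (X \<oplus>\<^bsub>CR\<^esub> qi (Suc k) X)"
  have i: "Suc k : {1..DIM('e)}" using Suc.prems by simp
  have "?P X : lspan CR (?S (Suc k))" if "X : lspan CR (?S k)" for X using that
  proof (induction rule: lspan.induct)
   case zero
   have "qi (Suc k) \<zero>\<^bsub>CR\<^esub> = \<zero>\<^bsub>CR\<^esub>" by (simp add: qi_def)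
   thus ?case by (simp add: lspan.zero)
  next
   case (step s t r)
   obtain l where l: "s = cw l" "l : srt" "set l \<inter> {1..k} = {}" using step(1) by auto
   have t: "t : carrier CR" using step(2) C.lspan_closed[OF S] by blast
   have P: "?P (r \<odot>\<^bsub>CR\<^esub> s \<oplus>\<^bsub>CR\<^esub> t) = r \<odot>\<^bsub>CR\<^esub> ?P s \<oplus>\<^bsub>CR\<^esub> ?P t"
   proof -
    have s: "s : carrier CR" using l by simp
    have ac: "(a \<oplus>\<^bsub>CR\<^esub> b) \<oplus>\<^bsub>CR\<^esub> (c \<oplus>\<^bsub>CR\<^esub> d) = (a \<oplus>\<^bsub>CR\<^esub> c) \<oplus>\<^bsub>CR\<^esub> (b \<oplus>\<^bsub>CR\<^esub> d)"
     if "a : carrier CR" "b : carrier CR" "c : carrier CR" "d : carrier CR"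
     for a b c d :: "'e cliff" using that by (simp add: C.a_ac)
    show ?thesis using s t by (simp add: qi_lin ac C.smult_r_distr C.smult_assoc1[symmetric] mult.commute)
   qed
   have "?P s : lspan CR (?S (Suc k))"
   proof (cases "Suc k : set l")
    case True
    hence "?P s = \<zero>\<^bsub>CR\<^esub>" using l qi_cw[OF i l(2)] by (simp add: C.smult_minus1 C.r_neg)
    thus ?thesis by (simp add: lspan.zero)
   next
    case False
    hence "?P s = (1/2) \<odot>\<^bsub>CR\<^esub> ((1 + 1) \<odot>\<^bsub>CR\<^esub> s)"
     using l qi_cw[OF i l(2)] C.smult_l_distr[of s 1 1] by simp
    also have "... = s" using l by (subst C.smult_assoc1[symmetric]) simp_all
    finally have "?P s = s" .
    moreover have "set l \<inter> {1..Suc k} = {}" using l False by (auto simp: atLeastAtMostSuc_conv)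
    ultimately show ?thesis using l by (simp only: l(1)) (rule C.lspan_incl[OF S], blast)
   qed
   thus ?case unfolding P by (rule C.lspan_add[OF S C.lspan_smult[OF S] step(3)])
  qed
  hence "?P N : lspan CR (?S (Suc k))" using Suc by simp
  moreover have "?P N = N"
  proof -
   have "?P N = (1/2) \<odot>\<^bsub>CR\<^esub> ((1 + 1) \<odot>\<^bsub>CR\<^esub> N)" using N qN[OF i] C.smult_l_distr[of N 1 1] by simp
   thus ?thesis using N by (simp add: C.smult_assoc1[symmetric])
  qed
  ultimately show ?case by (simp only:)
 qed
 from this[of "DIM('e)"] have "N : lspan CR (?S (DIM('e)))" by simp
 moreover have "?S (DIM('e)) \<subseteq> {\<one>\<^bsub>CR\<^esub>}"
 proof
  fix s assume "s : ?S (DIM('e))"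
  then obtain l where "s = cw l" "l : srt" "set l \<inter> {1..DIM('e)} = {}" by auto
  hence "l = []" by (cases l) (auto simp: srt_def)
  thus "s : {\<one>\<^bsub>CR\<^esub>}" using \<open>s = cw l\<close> by simp
 qed
 moreover have "\<exists>r. X = r \<odot>\<^bsub>CR\<^esub> \<one>\<^bsub>CR\<^esub>" if X: "X : lspan CR S" and S1: "S \<subseteq> {\<one>\<^bsub>CR\<^esub>}" for X :: "'e cliff" and S
  using X
 proof (induction rule: lspan.induct)
  case zero
  thus ?case by (intro exI[of _ 0]) simp
 next
  case (step s t k)
  then obtain r where "t = r \<odot>\<^bsub>CR\<^esub> \<one>\<^bsub>CR\<^esub>" "s = \<one>\<^bsub>CR\<^esub>" using S1 by auto
  thus ?case by (intro exI[of _ "k + r"]) (simp add: C.smult_l_distr)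
 qed
 ultimately show ?thesis by blast
qed

subsection \<open>The Pin group\<close>

lemma Pin_carrier: "\<eta> : Pin ==> \<eta> : carrier CR" for \<eta> :: "'e cliff" by (auto simp: Pin_def)

lemma pin_proj_eq: "\<eta> : Pin ==> cliff_vec (pin_proj \<eta> v) = twisted_conj \<eta> v" for v :: 'e
proof -
 assume "\<eta> : Pin"
 hence "twisted_conj \<eta> v : range cliff_vec" by (simp add: Pin_def)
 then obtain u where "cliff_vec u = twisted_conj \<eta> v" by auto
 thus ?thesis unfolding pin_proj_def by (rule theI) (metis \<open>cliff_vec u = _\<close> cliff_vec_inj)
qed

lemma pin_projI: "cliff_vec u = twisted_conj \<eta> v ==> pin_proj \<eta> v = u" for u v :: 'e
 unfolding pin_proj_def by (rule the_equality) (auto intro: cliff_vec_inj)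

lemma pin_commute1: "\<eta> : Pin ==> cliff_eps \<eta> \<ast> cliff_vec v = cliff_vec (pin_proj \<eta> v) \<ast> \<eta>" for v :: 'e
proof -
 assume e: "\<eta> : Pin"
 hence u: "\<eta> : Units CR" by (simp add: Pin_def)
 show ?thesis using u by (simp add: pin_proj_eq[OF e] twisted_conj_def C.m_assoc C.Units_l_inv eps.closed C.Units_closed)
qed

text \<open>The parity automorphism applied to \<open>pin_commute1\<close>. The two forms alternate
  when a product of two vectors is moved past a Pin element.\<close>

lemma pin_commute2: "\<eta> : Pin ==> \<eta> \<ast> cliff_vec v = cliff_vec (pin_proj \<eta> v) \<ast> cliff_eps \<eta>" for v :: 'e
proof -
 assume e: "\<eta> : Pin"
 have "cliff_eps (cliff_eps \<eta> \<ast> cliff_vec v) = cliff_eps (cliff_vec (pin_proj \<eta> v) \<ast> \<eta>)"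
  by (simp only: pin_commute1[OF e])
 hence "\<ominus>\<^bsub>CR\<^esub> (\<eta> \<ast> cliff_vec v) = \<ominus>\<^bsub>CR\<^esub> (cliff_vec (pin_proj \<eta> v) \<ast> cliff_eps \<eta>)"
  using Pin_carrier[OF e] by (simp add: eps_vec eps_eps C.l_minus C.r_minus)
 thus ?thesis using Pin_carrier[OF e] C.minus_minus by (metis C.m_closed cv_closed eps.closed)
qed

text \<open>Twisted commutation of an element and of its star cancel, so the norm lies in the kernel
  of the twisted action and is a scalar. Scalar norms multiply, which closes Pin under
  products.\<close>

lemma pin_norm: "\<eta> : Pin ==> \<exists>r. cliff_star \<eta> \<ast> \<eta> = r \<odot>\<^bsub>CR\<^esub> \<one>\<^bsub>CR\<^esub>" for \<eta> :: "'e cliff"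
proof (rule twisted_kernel)
 assume e: "\<eta> : Pin"
 have c: "\<eta> : carrier CR" "cliff_star \<eta> : carrier CR" "cliff_eps \<eta> : carrier CR"
  "cliff_eps (cliff_star \<eta>) : carrier CR" using Pin_carrier[OF e] star.closed[of \<eta>] eps.closed by auto
 show "cliff_star \<eta> \<ast> \<eta> : carrier CR" using c by simp
 fix v
 let ?u = "pin_proj \<eta> v"
 \<comment> \<open>The star of the commutation relation reverses the factors and yields the relation
   for \<open>cliff_star\<close>, from right to left.\<close>
 have "cliff_star (\<eta> \<ast> cliff_vec v) = cliff_star (cliff_vec ?u \<ast> cliff_eps \<eta>)" by (simp only: pin_commute2[OF e])
 hence "\<ominus>\<^bsub>CR\<^esub> (cliff_vec v \<ast> cliff_star \<eta>) = \<ominus>\<^bsub>CR\<^esub> (cliff_eps (cliff_star \<eta>) \<ast> cliff_vec ?u)"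
  using c by (simp add: star_vec eps_star C.l_minus C.r_minus)
 hence s: "cliff_vec v \<ast> cliff_star \<eta> = cliff_eps (cliff_star \<eta>) \<ast> cliff_vec ?u"
  using c C.minus_minus by (metis C.m_closed cv_closed)
 have "cliff_eps (cliff_star \<eta> \<ast> \<eta>) \<ast> cliff_vec v
   = cliff_eps (cliff_star \<eta>) \<ast> (cliff_vec ?u \<ast> \<eta>)" using c by (simp add: C.m_assoc pin_commute1[OF e])
 also have "... = cliff_vec v \<ast> cliff_star \<eta> \<ast> \<eta>" using c s by (simp add: C.m_assoc[symmetric])
 finally show "cliff_eps (cliff_star \<eta> \<ast> \<eta>) \<ast> cliff_vec v
   = cliff_vec v \<ast> (cliff_star \<eta> \<ast> \<eta>)" using c by (simp add: C.m_assoc)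
qed

lemma twisted_conj_mult:
 fixes \<eta> \<eta>' :: "'e cliff"
 assumes "\<eta> : Pin" "\<eta>' : Pin"
 shows "twisted_conj (\<eta> \<ast> \<eta>') v = cliff_vec (pin_proj \<eta> (pin_proj \<eta>' v))"
proof -
 have u: "\<eta> : Units CR" "\<eta>' : Units CR" using assms by (auto simp: Pin_def)
 have inv: "inv\<^bsub>CR\<^esub> (\<eta> \<ast> \<eta>') = inv\<^bsub>CR\<^esub> \<eta>' \<ast> inv\<^bsub>CR\<^esub> \<eta>"
 proof (rule C.inv_char)
  have c: "\<eta> : carrier CR" "\<eta>' : carrier CR" using u by auto
  have "\<eta> \<ast> \<eta>' \<ast> (inv\<^bsub>CR\<^esub> \<eta>' \<ast> inv\<^bsub>CR\<^esub> \<eta>)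
   = \<eta> \<ast> (\<eta>' \<ast> inv\<^bsub>CR\<^esub> \<eta>') \<ast> inv\<^bsub>CR\<^esub> \<eta>"
   using u c by (simp only: C.m_assoc C.Units_inv_closed C.m_closed)
  thus "\<eta> \<ast> \<eta>' \<ast> (inv\<^bsub>CR\<^esub> \<eta>' \<ast> inv\<^bsub>CR\<^esub> \<eta>) = \<one>\<^bsub>CR\<^esub>"
   using u c by (simp add: C.Units_r_inv)
  have "inv\<^bsub>CR\<^esub> \<eta>' \<ast> inv\<^bsub>CR\<^esub> \<eta> \<ast> (\<eta> \<ast> \<eta>')
   = inv\<^bsub>CR\<^esub> \<eta>' \<ast> (inv\<^bsub>CR\<^esub> \<eta> \<ast> \<eta>) \<ast> \<eta>'"
   using u c by (simp only: C.m_assoc C.Units_inv_closed C.m_closed)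
  thus "inv\<^bsub>CR\<^esub> \<eta>' \<ast> inv\<^bsub>CR\<^esub> \<eta> \<ast> (\<eta> \<ast> \<eta>') = \<one>\<^bsub>CR\<^esub>"
   using u c by (simp add: C.Units_l_inv)
 qed (use u in auto)
 have "twisted_conj (\<eta> \<ast> \<eta>') v
   = cliff_eps \<eta> \<ast> twisted_conj \<eta>' v \<ast> inv\<^bsub>CR\<^esub> \<eta>"
  using u by (simp add: twisted_conj_def inv C.m_assoc C.Units_closed eps.closed)
 also have "... = twisted_conj \<eta> (pin_proj \<eta>' v)" unfolding pin_proj_eq[OF assms(2), symmetric] by (simp add: twisted_conj_def)
 also have "... = cliff_vec (pin_proj \<eta> (pin_proj \<eta>' v))" by (rule pin_proj_eq[OF assms(1), symmetric])
 finally show ?thesis .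
qed

lemma pin_proj_mult: "\<eta> : Pin ==> \<eta>' : Pin ==> pin_proj (\<eta> \<ast> \<eta>') = pin_proj \<eta> o pin_proj \<eta>'" for \<eta> \<eta>' :: "'e cliff"
 by (rule ext, unfold o_apply, rule pin_projI) (simp only: twisted_conj_mult)

lemma pin_norm_sq: "\<eta> : Pin ==> cliff_star \<eta> \<ast> \<eta> = r \<odot>\<^bsub>CR\<^esub> \<one>\<^bsub>CR\<^esub> ==>
  (r * r) \<odot>\<^bsub>CR\<^esub> (\<one>\<^bsub>CR\<^esub> :: 'e cliff) = \<one>\<^bsub>CR\<^esub>" for \<eta> :: "'e cliff"
 unfolding Pin_def by (simp add: numeral_2_eq_2 C.smult_mult_l C.smult_mult_r C.smult_assoc1)

lemma Pin_mult: "\<eta> : Pin ==> \<eta>' : Pin ==> \<eta> \<ast> \<eta>' : Pin" for \<eta> \<eta>' :: "'e cliff"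
proof -
 assume e: "\<eta> : Pin" "\<eta>' : Pin"
 have c: "\<eta> : carrier CR" "\<eta>' : carrier CR"
  "cliff_star \<eta> : carrier CR" "cliff_star \<eta>' : carrier CR" using Pin_carrier e star.closed by auto
 have u: "\<eta> \<ast> \<eta>' : Units CR" using e by (intro C.Units_m_closed) (auto simp: Pin_def)
 obtain r r' where r: "cliff_star \<eta> \<ast> \<eta> = r \<odot>\<^bsub>CR\<^esub> \<one>\<^bsub>CR\<^esub>"
  "cliff_star \<eta>' \<ast> \<eta>' = r' \<odot>\<^bsub>CR\<^esub> \<one>\<^bsub>CR\<^esub>" using pin_norm e by metis
 have "cliff_star (\<eta> \<ast> \<eta>') \<ast> (\<eta> \<ast> \<eta>')
   = cliff_star \<eta>' \<ast> (cliff_star \<eta> \<ast> \<eta>) \<ast> \<eta>'" using c by (simp add: C.m_assoc)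
 also have "... = (r * r') \<odot>\<^bsub>CR\<^esub> \<one>\<^bsub>CR\<^esub>"
  using c r by (simp add: C.smult_mult_l C.smult_mult_r C.smult_assoc1)
 finally have n: "cliff_star (\<eta> \<ast> \<eta>') \<ast> (\<eta> \<ast> \<eta>') = ..." .
 have "(cliff_star (\<eta> \<ast> \<eta>') \<ast> (\<eta> \<ast> \<eta>')) [^]\<^bsub>CR\<^esub> (2::nat)
   = ((r * r) * (r' * r')) \<odot>\<^bsub>CR\<^esub> \<one>\<^bsub>CR\<^esub>"
  unfolding n by (simp add: numeral_2_eq_2 C.smult_mult_l C.smult_mult_r C.smult_assoc1[symmetric] mult_ac)
 also have "... = \<one>\<^bsub>CR\<^esub>" unfolding C.smult_assoc1[of "\<one>\<^bsub>CR\<^esub>" "r * r" "r' * r'", OF C.one_closed]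
   pin_norm_sq[OF e(2) r(2)] by (rule pin_norm_sq[OF e(1) r(1)])
 finally show ?thesis using u twisted_conj_mult[OF e] by (auto simp: Pin_def)
qed

lemma Pin_one: "\<one>\<^bsub>CR\<^esub> : (Pin :: 'e cliff set)" "pin_proj \<one>\<^bsub>CR\<^esub> = (id :: 'e => 'e)"
proof -
 have t: "twisted_conj \<one>\<^bsub>CR\<^esub> v = cliff_vec v" for v :: 'e by (simp add: twisted_conj_def)
 show "pin_proj \<one>\<^bsub>CR\<^esub> = (id :: 'e => 'e)"
 proof (rule ext)
  show "pin_proj \<one>\<^bsub>CR\<^esub> v = id v" for v :: 'e by (rule pin_projI) (simp add: t)
 qed
 have "cliff_star \<one>\<^bsub>CR\<^esub> = (\<one>\<^bsub>CR\<^esub> :: 'e cliff)" using star.one by simp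
 thus "\<one>\<^bsub>CR\<^esub> : (Pin :: 'e cliff set)" by (simp add: Pin_def t)
qed

end

section \<open>Reflection groups: inversions, words and the longest element\<close>

section \<open>Reflection groups\<close>

inductive_set WG :: "'e::euclidean_space set => ('e => 'e) set" for Ph where
 WG_id: "id : WG Ph"
| WG_rf: "a : Ph ==> w : WG Ph ==> rf a o w : WG Ph"

lemma WG_comp: "w : WG Ph ==> v : WG Ph ==> w o v : WG Ph" by (induction rule: WG.induct) (auto simp: comp_assoc intro: WG.intros)

lemma WG_single: "a : Ph ==> rf a : WG Ph" using WG_rf[OF _ WG_id] by simp

lemma WG_orth: "w : WG Ph ==> orth w"
proof (induction rule: WG.induct)
 case WG_id
 thus ?case by (simp add: orthogonal_transformation_def linear_id)
next
 case (WG_rf a w)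
 thus ?case by (intro orthogonal_transformation_compose rf_orth)
qed

text \<open>The aim is \<open>longest_uminus_iff\<close>: the definitions speak of the longest
  element, whereas the arguments about the centre need to know whether -id belongs to the
  group.\<close>

locale coxeter =
 fixes Ph Php \<Delta> :: "'e::euclidean_space set"
 assumes finR: "finite Ph" and nzR: "0 \<notin> Ph"
  and rfR: "a : Ph ==> b : Ph ==> rf a b : Ph"
  and red: "a : Ph ==> t *\<^sub>R a : Ph ==> t = 1 \<or> t = - 1"
  and \<Delta>_sub: "\<Delta> \<subseteq> Ph" and ind: "independent \<Delta>"
  and pos_def: "Php = {b : Ph. \<exists>t. (\<forall>d\<in>\<Delta>. 0 \<le> t d) & b = (\<Sum>d\<in>\<Delta>. t d *\<^sub>R d)}"
  and pos_or_neg: "b : Ph ==> b : Php \<or> - b : Php"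
begin

abbreviation "rp \<equiv> representation \<Delta>"

lemma fin\<Delta>: "finite \<Delta>" using finR \<Delta>_sub finite_subset by blast

lemma pos_root: "b : Php ==> b : Ph" by (simp add: pos_def)

lemma uminus_root: "b : Ph ==> - b : Ph" using rfR[of b b] rf_self[of b] nzR by force

lemma rp_sum: "(\<Sum>d\<in>\<Delta>. t d *\<^sub>R d) : span \<Delta>" "e : \<Delta> ==> rp (\<Sum>d\<in>\<Delta>. t d *\<^sub>R d) e = t e"
proof -
 show s: "(\<Sum>d\<in>\<Delta>. t d *\<^sub>R d) : span \<Delta>" by (intro span_sum span_scale span_base)
 assume e: "e : \<Delta>"
 have "rp (\<Sum>d\<in>\<Delta>. t d *\<^sub>R d) e = (\<Sum>d\<in>\<Delta>. t d * rp d e)"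
  by (subst representation_sum[OF ind]) (auto simp: span_base span_scale representation_scale[OF ind])
 also have "... = (\<Sum>d\<in>\<Delta>. if d = e then t d else 0)" by (rule sum.cong) (auto simp: representation_basis[OF ind])
 finally show "rp (\<Sum>d\<in>\<Delta>. t d *\<^sub>R d) e = t e" using e fin\<Delta> by simp
qed

lemma pos_iff: "b : Php \<longleftrightarrow> b : Ph & b : span \<Delta> & (\<forall>d\<in>\<Delta>. 0 \<le> rp b d)"
proof
 assume "b : Php"
 thus "b : Ph & b : span \<Delta> & (\<forall>d\<in>\<Delta>. 0 \<le> rp b d)" using rp_sum by (auto simp: pos_def)
next
 assume b: "b : Ph & b : span \<Delta> & (\<forall>d\<in>\<Delta>. 0 \<le> rp b d)"
 hence "(\<Sum>d\<in>\<Delta>. rp b d *\<^sub>R d) = b" by (intro sum_representation_eq[OF ind _ fin\<Delta>]) auto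
 thus "b : Php" using b by (auto simp: pos_def intro!: exI[of _ "rp b"])
qed

lemma \<Delta>_nz: "d : \<Delta> ==> d ~= 0" using \<Delta>_sub nzR by blast

lemma root_span: "b : Ph ==> b : span \<Delta>" using pos_or_neg[of b] by (auto simp: pos_iff) (metis add.inverse_inverse span_neg)

lemma root_expand: "b : span \<Delta> ==> (\<Sum>d\<in>\<Delta>. rp b d *\<^sub>R d) = b"
 by (intro sum_representation_eq[OF ind _ fin\<Delta>]) auto

lemma not_both: "b : Php ==> - b \<notin> Php"
proof
 assume b: "b : Php" "- b : Php"
 hence "rp b d = 0" if "d : \<Delta>" for d using that representation_neg[OF ind, of b] by (force simp: pos_iff)
 hence "b = 0" using root_expand[of b] b by (simp add: pos_iff)
 thus False using b nzR pos_root by auto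
qed

lemma \<Delta>_pos: "d : \<Delta> ==> d : Php" using \<Delta>_sub by (auto simp: pos_iff span_base representation_basis[OF ind])

text \<open>By reducedness a positive root b other than d has a positive coefficient at a second
  simple root e. The reflection s_d changes only the coefficient at d, so the image is still
  positive at e.\<close>

lemma simple_perm: "d : \<Delta> ==> b : Php ==> b ~= d ==> rf d b : Php"
proof -
 assume d: "d : \<Delta>" and b: "b : Php" and ne: "b ~= d"
 have r: "rf d b : Ph" using rfR d b \<Delta>_sub pos_root by auto
 have "\<exists>e\<in>\<Delta>. e ~= d & 0 < rp b e"
 proof (rule ccontr)
  assume "\<not> ?thesis"
  hence z: "rp b e = 0" if "e : \<Delta>" "e ~= d" for e using that b by (force simp: pos_iff)
  have "(\<Sum>e\<in>\<Delta>. rp b e *\<^sub>R e) = (\<Sum>e\<in>\<Delta>. if e = d then rp b d *\<^sub>R d else 0)"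
   by (rule sum.cong) (auto simp: z)
  hence bd: "b = rp b d *\<^sub>R d" using root_expand[of b] b d fin\<Delta> by (simp add: pos_iff)
  hence "rp b d = 1 \<or> rp b d = - 1" using red[of d "rp b d"] b d \<Delta>_sub pos_root by auto
  thus False using bd ne b d by (auto simp: pos_iff)
 qed
 then obtain e where e: "e : \<Delta>" "e ~= d" "0 < rp b e" by auto
 have "rp (rf d b) e = rp b e" unfolding rf_def using e d b by (subst representation_diff[OF ind])
   (auto simp: pos_iff span_base span_scale representation_scale[OF ind] representation_basis[OF ind])
 hence "\<not> - rf d b : Php" using e representation_neg[OF ind root_span[OF r]] by (auto simp: pos_iff intro!: bexI[of _ e])
 thus ?thesis using pos_or_neg[OF r] by auto
qed

lemma WG_root: "w : WG Ph ==> b : Ph ==> w b : Ph" by (induction arbitrary: b rule: WG.induct) (auto simp: rfR)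

lemma WG_linear: "w : WG Ph ==> linear w" using WG_orth by (rule orth_linear)

text \<open>The inversions of w; their number will turn out to be the length.\<close>

definition Nw :: "('e => 'e) => 'e set" where
 "Nw w = {b : Php. - w b : Php}"

lemma finp: "finite Php" using finR by (simp add: pos_def)

lemma finN: "finite (Nw w)" using finp by (simp add: Nw_def)

text \<open>The simple reflection permutes the positive roots other than d, so it matches the
  inversions of w and of w s_d away from d; d itself is settled separately.\<close>

lemma Nw_rf:
 assumes w: "w : WG Ph" and d: "d : \<Delta>"
 shows "Nw (w o rf d) - {d} = rf d ` (Nw w - {d})" and "d : Nw (w o rf d) \<longleftrightarrow> w d : Php"
proof -
 have dd: "rf d d = - d" "d : Php" using \<Delta>_nz[OF d] \<Delta>_pos[OF d] by (simp_all add: rf_self)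
 have *: "rf d b : Php - {d} & rf d (rf d b) = b" if "b : Php - {d}" for b
 proof -
  have "rf d b ~= d"
  proof
   assume "rf d b = d"
   hence "b = rf d d" by (metis rf_rf)
   thus False using dd that not_both by auto
  qed
  thus ?thesis using simple_perm[OF d] that by auto
 qed
 show "Nw (w o rf d) - {d} = rf d ` (Nw w - {d})"
 proof
  show "Nw (w o rf d) - {d} \<subseteq> rf d ` (Nw w - {d})"
  proof
   fix b assume "b : Nw (w o rf d) - {d}"
   hence "b : Php - {d}" "- w (rf d b) : Php" by (auto simp: Nw_def)
   thus "b : rf d ` (Nw w - {d})" using *[of b] by (intro image_eqI[of _ _ "rf d b"]) (auto simp: Nw_def)
  qed
  show "rf d ` (Nw w - {d}) \<subseteq> Nw (w o rf d) - {d}"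
  proof
   fix c assume "c : rf d ` (Nw w - {d})"
   then obtain b where b: "c = rf d b" "b : Php - {d}" "- w b : Php" by (auto simp: Nw_def)
   thus "c : Nw (w o rf d) - {d}" using *[OF b(2)] by (simp add: Nw_def)
  qed
 qed
 show "d : Nw (w o rf d) \<longleftrightarrow> w d : Php" using dd linear_neg[OF WG_linear[OF w], of d] by (simp add: Nw_def)
qed

lemma card_Nw:
 assumes w: "w : WG Ph" and d: "d : \<Delta>"
 shows "w d : Php ==> card (Nw (w o rf d)) = Suc (card (Nw w))"
  and "- w d : Php ==> card (Nw w) = Suc (card (Nw (w o rf d)))"
proof -
 have inj: "inj_on (rf d) A" for A by (rule inj_onI) (metis rf_rf)
 have c: "card (Nw (w o rf d) - {d}) = card (Nw w - {d})" unfolding Nw_rf(1)[OF w d] using card_image[OF inj] .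
 have dN: "d : Nw w \<longleftrightarrow> - w d : Php" using \<Delta>_pos[OF d] by (simp add: Nw_def)
 show "card (Nw (w o rf d)) = Suc (card (Nw w))" if wd: "w d : Php"
 proof -
  have "d \<notin> Nw w" "d : Nw (w o rf d)" using dN not_both[OF wd] Nw_rf(2)[OF w d] wd by auto
  thus ?thesis using c card_Suc_Diff1[OF finN, of d "w o rf d"] by simp
 qed
 show "card (Nw w) = Suc (card (Nw (w o rf d)))" if wd: "- w d : Php"
 proof -
  have "d : Nw w" "d \<notin> Nw (w o rf d)" using dN not_both[of "w d"] Nw_rf(2)[OF w d] wd by auto
  thus ?thesis using c card_Suc_Diff1[OF finN, of d "w"] by simp
 qed
qed

definition wrd :: "'e list => 'e => 'e" where
 "wrd ds = foldr (o) (map rf ds) id"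

lemma wrd_simps [simp]: "wrd [] = id" "wrd (d # ds) = rf d o wrd ds" by (simp_all add: wrd_def)

lemma wrd_append: "wrd (ds @ es) = wrd ds o wrd es" by (induction ds) (auto simp: comp_assoc)

lemma wrd_rev: "wrd (rev ds) o wrd ds = id"
proof (induction ds)
 case (Cons d ds)
 have "wrd (rev (d # ds)) o wrd (d # ds) = wrd (rev ds) o (rf d o rf d) o wrd ds" by (simp add: wrd_append comp_assoc)
 also have "rf d o rf d = id" by (simp add: fun_eq_iff)
 finally show ?case using Cons by simp
qed simp

lemma wrd_WG: "set ds \<subseteq> \<Delta> ==> wrd ds : WG Ph" using \<Delta>_sub by (induction ds) (auto intro: WG.intros)

text \<open>Among the positive roots reached from b by words in simple reflections, one of least
  height is simple: otherwise g.g > 0 provides a simple root d with g.d > 0, and s_d g is again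
  positive and lower. The reflection in b is then conjugate to a simple one by such a word.\<close>

lemma rf_word: "b : Php ==> \<exists>ds. set ds \<subseteq> \<Delta> & rf b = wrd ds"
proof -
 assume b: "b : Php"
 define Ob where "Ob = {g : Php. \<exists>ds. set ds \<subseteq> \<Delta> & wrd ds b = g}"
 define ht where "ht g = (\<Sum>d\<in>\<Delta>. rp g d)" for g
 have "b : Ob" using b unfolding Ob_def by (auto intro!: exI[of _ "[]"])
 moreover have "finite Ob" using finp by (simp add: Ob_def)
 ultimately obtain g where g: "g : Ob" "\<And>g'. g' : Ob ==> ht g \<le> ht g'" by (metis arg_min_if_finite(1) arg_min_least empty_iff)
 obtain ds where ds: "set ds \<subseteq> \<Delta>" "wrd ds b = g" and gp: "g : Php" using g by (auto simp: Ob_def)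
 have "g : \<Delta>"
 proof (rule ccontr)
  assume gD: "g \<notin> \<Delta>"
  have gs: "g : span \<Delta>" using gp by (simp add: pos_iff)
  have "g ~= 0" using gp pos_root nzR by auto
  hence "0 < g \<bullet> g" by simp
  also have "g \<bullet> g = (\<Sum>d\<in>\<Delta>. rp g d * (g \<bullet> d))"
   using root_expand[OF gs] by (metis (no_types, lifting) inner_scaleR_right inner_sum_right sum.cong)
  finally obtain d where d: "d : \<Delta>" "0 < rp g d * (g \<bullet> d)" by (metis (no_types, lifting) not_less sum_nonpos)
  have "0 \<le> rp g d" using gp d by (simp add: pos_iff)
  hence gd: "0 < g \<bullet> d" using d(2) by (metis mult_nonneg_nonpos not_less)
  have "d ~= 0" using d \<Delta>_sub nzR by auto
  hence k: "0 < 2 * (g \<bullet> d) / (d \<bullet> d)" using gd by simp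
  have "rf d g : Php" using simple_perm[OF d(1) gp] gD d by auto
  moreover have "wrd (d # ds) b = rf d g" using ds by simp
  ultimately have "rf d g : Ob" using ds d unfolding Ob_def by (auto intro!: exI[of _ "d # ds"])
  hence "ht g \<le> ht (rf d g)" using g by blast
  also have "rp (rf d g) e = rp g e - (if e = d then 2 * (g \<bullet> d) / (d \<bullet> d) else 0)" for e unfolding rf_def using d gs
   by (subst representation_diff[OF ind])
    (auto simp: span_base span_scale representation_scale[OF ind] representation_basis[OF ind])
  hence "ht (rf d g) = ht g - 2 * (g \<bullet> d) / (d \<bullet> d)" using d fin\<Delta> by (simp add: ht_def sum_subtractf)
  finally show False using k by simp
 qed
 have "rf (wrd ds b) (wrd ds v) = wrd ds (rf b v)" for v by (rule rf_conj) (rule WG_orth[OF wrd_WG[OF ds(1)]])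
 hence "rf b = wrd (rev ds) o (rf g o wrd ds)" using wrd_rev[of ds] ds(2) by (simp add: fun_eq_iff)
 hence "rf b = wrd (rev ds @ g # ds)" by (simp add: wrd_append)
 thus ?thesis using ds \<open>g : \<Delta>\<close> by (intro exI[of _ "rev ds @ g # ds"]) auto
qed

lemma WG_word: "w : WG Ph ==> \<exists>ds. set ds \<subseteq> \<Delta> & w = wrd ds"
proof (induction rule: WG.induct)
 case WG_id
 show ?case by (intro exI[of _ "[]"]) simp
next
 case (WG_rf a w)
 have "\<exists>es. set es \<subseteq> \<Delta> & rf a = wrd es" using rf_word[of a] rf_word[of "- a"] pos_or_neg[OF WG_rf(1)] by auto
 then obtain es ds where "set es \<subseteq> \<Delta>" "rf a = wrd es" "set ds \<subseteq> \<Delta>" "w = wrd ds" using WG_rf by blast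
 thus ?case by (intro exI[of _ "es @ ds"]) (auto simp: wrd_append)
qed

lemma WG_inv: "w : WG Ph ==> \<exists>v\<in>WG Ph. v o w = id & w o v = id"
proof -
 assume "w : WG Ph"
 then obtain ds where "set ds \<subseteq> \<Delta>" "w = wrd ds" using WG_word by blast
 thus ?thesis using wrd_rev[of ds] wrd_rev[of "rev ds"] by (intro bexI[of _ "wrd (rev ds)"] wrd_WG) auto
qed

section \<open>Exchange of letters, minimal words and existence of a longest element\<close>

lemma card_Nw_word: "set ds \<subseteq> \<Delta> ==> card (Nw (wrd ds)) \<le> length ds"
proof (induction ds rule: rev_induct)
 case Nil
 have "Nw id = {}" using not_both by (auto simp: Nw_def)
 thus ?case by (simp only: wrd_simps card.empty list.size)
next
 case (snoc d ds)
 have w: "wrd ds : WG Ph" "d : \<Delta>" using snoc wrd_WG by auto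
 have "wrd ds d : Ph" using WG_root[OF w(1)] w \<Delta>_sub by auto
 hence "card (Nw (wrd ds o rf d)) \<le> Suc (card (Nw (wrd ds)))" using pos_or_neg card_Nw[OF w] by fastforce
 thus ?case using snoc by (simp add: wrd_append o_def)
qed

text \<open>Reading the word from the right, the image of d becomes negative at some letter f. A
  simple reflection makes only its own root negative, so the image just before that letter equals
  f.\<close>

lemma exchange:
 "set es \<subseteq> \<Delta> ==> d : \<Delta> ==> - wrd es d : Php ==>
  \<exists>e1 f e2. es = e1 @ f # e2 & wrd e2 d = f"
proof (induction es)
 case Nil
 thus ?case using not_both[OF \<Delta>_pos] by auto
next
 case (Cons f es)
 show ?case
 proof (cases "- wrd es d : Php")
  case True
  then obtain e1 g e2 where "es = e1 @ g # e2" "wrd e2 d = g" using Cons by auto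
  thus ?thesis by (intro exI[of _ "f # e1"] exI[of _ g] exI[of _ e2]) simp
 next
  case False
  have "wrd es d : Ph" using WG_root[OF wrd_WG, of es d] Cons \<Delta>_sub by auto
  hence p: "wrd es d : Php" using pos_or_neg False by blast
  have "wrd es d = f" using simple_perm[of f "wrd es d"] p Cons not_both by auto
  thus ?thesis by (intro exI[of _ "[]"] exI[of _ f] exI[of _ es]) simp
 qed
qed

text \<open>Take a shortest word for w. If it had a last letter d, the positivity of w d would make
  d negative under the remaining word, and exchange would delete two letters.\<close>

lemma Nw_empty: "w : WG Ph ==> Nw w = {} ==> w = id"
proof -
 assume w: "w : WG Ph" and N: "Nw w = {}"
 define L where "L = (LEAST k. \<exists>ds. set ds \<subseteq> \<Delta> & w = wrd ds & length ds = k)"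
 have "\<exists>ds. set ds \<subseteq> \<Delta> & w = wrd ds & length ds = L"
  unfolding L_def by (rule LeastI_ex) (use WG_word[OF w] in blast)
 then obtain ds where ds: "set ds \<subseteq> \<Delta>" "w = wrd ds" "length ds = L" by blast
 show ?thesis
 proof (cases ds rule: rev_cases)
  case Nil
  thus ?thesis using ds by simp
 next
  case (snoc es d)
  have d: "d : \<Delta>" "set es \<subseteq> \<Delta>" using ds snoc by auto
  have wd: "w d = - wrd es d" using ds snoc \<Delta>_nz[OF d(1)] linear_neg[OF WG_linear[OF wrd_WG[OF d(2)]], of d]
   by (simp add: wrd_append rf_self)
  have "w d : Php" using pos_or_neg[OF WG_root[OF w, of d]] N \<Delta>_pos[OF d(1)] d \<Delta>_sub by (auto simp: Nw_def)
  then obtain e1 f e2 where e: "es = e1 @ f # e2" "wrd e2 d = f" using exchange[OF d(2,1)] wd by auto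
  have e2: "set e2 \<subseteq> \<Delta>" using d e by auto
  have "rf f (wrd e2 v) = wrd e2 (rf d v)" for v using rf_conj[OF WG_orth[OF wrd_WG[OF e2]], of d v] e by simp
  hence "w = wrd (e1 @ e2)" using ds snoc e by (simp add: wrd_append fun_eq_iff)
  hence "L \<le> length (e1 @ e2)" unfolding L_def using d e by (intro Least_le exI[of _ "e1 @ e2"]) auto
  thus ?thesis using ds snoc e by simp
 qed
qed

text \<open>If every simple root stays positive, so does every nonnegative combination, and there
  are no inversions. Otherwise the reflection in an inverted simple root removes exactly one
  inversion.\<close>

lemma short_word: "w : WG Ph ==> \<exists>ds. set ds \<subseteq> \<Delta> & w = wrd ds & length ds = card (Nw w)"
proof (induction "card (Nw w)" arbitrary: w)
 case 0
 hence "w = id" using Nw_empty finN by simp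
 thus ?case using 0 by (intro exI[of _ "[]"]) simp
next
 case (Suc k)
 have "\<exists>d\<in>\<Delta>. - w d : Php"
 proof (rule ccontr)
  assume "\<not> ?thesis"
  hence p: "w d : Php" if "d : \<Delta>" for d using that pos_or_neg[OF WG_root[OF Suc(3), of d]] \<Delta>_sub by auto
  have "w b : Php" if b: "b : Php" for b
  proof -
   have bs: "b : span \<Delta>" using b by (simp add: pos_iff)
   have "w b = (\<Sum>d\<in>\<Delta>. rp b d *\<^sub>R w d)"
    using linear_sum[OF WG_linear[OF Suc(3)], of "%d. rp b d *\<^sub>R d" \<Delta>] root_expand[OF bs]
    by (simp add: linear_scale[OF WG_linear[OF Suc(3)]])
   moreover have "0 \<le> rp (\<Sum>d\<in>\<Delta>. rp b d *\<^sub>R w d) e" if "e : \<Delta>" for e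
    using p b that by (subst representation_sum[OF ind])
     (auto simp: pos_iff span_scale representation_scale[OF ind] intro!: sum_nonneg mult_nonneg_nonneg)
   ultimately show ?thesis using WG_root[OF Suc(3) pos_root[OF b]] root_span by (simp add: pos_iff)
  qed
  hence "Nw w = {}" using not_both by (auto simp: Nw_def)
  thus False using Suc(2) by simp
 qed
 then obtain d where d: "d : \<Delta>" "- w d : Php" by blast
 have wd: "w o rf d : WG Ph" using Suc(3) d \<Delta>_sub WG_comp WG_single by blast
 have "k = card (Nw (w o rf d))" using card_Nw(2)[OF Suc(3) d] Suc(2) by simp
 from Suc(1)[OF this wd] obtain ds where ds: "set ds \<subseteq> \<Delta>" "w o rf d = wrd ds" "length ds = card (Nw (w o rf d))" by blast
 have "w = w o rf d o rf d" by (simp add: fun_eq_iff)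
 hence "w = wrd (ds @ [d])" using ds by (simp add: wrd_append)
 thus ?case using ds d card_Nw(2)[OF Suc(3) d] by (intro exI[of _ "ds @ [d]"]) simp
qed

definition len :: "('e => 'e) => nat" where
 "len w = (LEAST k. \<exists>ds. length ds = k & set ds \<subseteq> \<Delta> & wrd ds = w)"

lemma len_eq: "w : WG Ph ==> len w = card (Nw w)" unfolding len_def
proof (rule Least_equality)
 assume "w : WG Ph"
 thus "\<exists>ds. length ds = card (Nw w) & set ds \<subseteq> \<Delta> & wrd ds = w" using short_word by blast
qed (use card_Nw_word in blast)

text \<open>If v and w both invert all positive roots, then v^-1 w inverts none and is the
  identity.\<close>

lemma full_unique: "v : WG Ph ==> w : WG Ph ==> Nw v = Php ==> Nw w = Php ==> v = w"
proof -
 assume v: "v : WG Ph" and w: "w : WG Ph" and N: "Nw v = Php" "Nw w = Php"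
 obtain u where u: "u : WG Ph" "u o v = id" "v o u = id" using WG_inv[OF v] by blast
 have "u (w b) : Php" if b: "b : Php" for b
 proof -
  let ?c = "- u (w b)"
  have "?c : Ph" using WG_root u w pos_root[OF b] uminus_root by blast
  moreover have "?c \<notin> Php"
  proof
   assume "?c : Php"
   hence "- v ?c : Php" using N by (auto simp: Nw_def)
   moreover have "v ?c = - w b" using u(3) linear_neg[OF WG_linear[OF v]] by (simp add: fun_eq_iff)
   moreover have "- w b : Php" using b N by (auto simp: Nw_def)
   ultimately show False using not_both by auto
  qed
  ultimately show ?thesis using pos_or_neg[of ?c] by simp
 qed
 hence "Nw (u o w) = {}" using not_both by (auto simp: Nw_def)
 hence "u o w = id" using Nw_empty[OF WG_comp[OF u(1) w]] by simp
 hence "v o (u o w) = v" by simp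
 thus "v = w" using u(3) by (simp add: comp_assoc[symmetric])
qed

text \<open>For an element with the largest number of inversions every simple root is inverted,
  since a further simple reflection would add an inversion; hence every positive root is.\<close>

lemma full_exists: "\<exists>w\<in>WG Ph. Nw w = Php"
proof -
 have bd: "card (Nw w) \<le> card Php" for w using card_mono[OF finp, of "Nw w"] by (auto simp: Nw_def)
 define m where "m = Max ((%w. card (Nw w)) ` WG Ph)"
 have fin: "finite ((%w. card (Nw w)) ` WG Ph)" by (rule finite_subset[of _ "{..card Php}"]) (use bd in auto)
 have "m : (%w. card (Nw w)) ` WG Ph" unfolding m_def by (rule Max_in[OF fin]) (use WG_id in auto)
 then obtain w where w: "w : WG Ph" "card (Nw w) = m" by auto
 have neg: "- w d : Php" if d: "d : \<Delta>" for d
 proof (rule ccontr)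
  assume "- w d \<notin> Php"
  hence "w d : Php" using pos_or_neg[OF WG_root[OF w(1), of d]] d \<Delta>_sub by auto
  hence "card (Nw (w o rf d)) = Suc m" using card_Nw(1)[OF w(1) d] w by simp
  moreover have "w o rf d : WG Ph" using w d \<Delta>_sub WG_comp WG_single by blast
  ultimately have "Suc m \<le> m" unfolding m_def by (metis Max_ge fin imageI)
  thus False by simp
 qed
 have "- w b : Php" if b: "b : Php" for b
 proof -
  have bs: "b : span \<Delta>" using b by (simp add: pos_iff)
  have "- w b = (\<Sum>d\<in>\<Delta>. rp b d *\<^sub>R (- w d))"
   using linear_sum[OF WG_linear[OF w(1)], of "%d. rp b d *\<^sub>R d" \<Delta>] root_expand[OF bs]
   by (simp add: linear_scale[OF WG_linear[OF w(1)]] sum_negf)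
  moreover have "0 \<le> rp (\<Sum>d\<in>\<Delta>. rp b d *\<^sub>R (- w d)) e" if "e : \<Delta>" for e
  proof (subst representation_sum[OF ind])
   show "rp b d *\<^sub>R - w d : span \<Delta>" if "d : \<Delta>" for d using neg[OF that] by (intro span_scale) (simp add: pos_iff)
   show "0 \<le> (\<Sum>d\<in>\<Delta>. rp (rp b d *\<^sub>R - w d) e)"
   proof (rule sum_nonneg)
    fix d assume d: "d : \<Delta>"
    have "rp (rp b d *\<^sub>R - w d) e = rp b d * rp (- w d) e"
     using neg[OF d] by (subst representation_scale[OF ind]) (simp_all add: pos_iff)
    thus "0 \<le> rp (rp b d *\<^sub>R - w d) e" using neg[OF d] b d that by (simp add: pos_iff)
   qed
  qed
  moreover have "- w b : Ph" using WG_root[OF w(1) pos_root[OF b]] uminus_root by blast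
  ultimately show ?thesis using root_span[of "- w b"] by (simp add: pos_iff)
 qed
 hence "Nw w = Php" by (auto simp: Nw_def)
 thus ?thesis using w by blast
qed

lemma longest:
 assumes w: "w : WG Ph" "Nw w = Php"
 shows "(THE w. w : WG Ph & (\<forall>v\<in>WG Ph. len v \<le> len w)) = w"
proof (rule the_equality)
 have bd: "card (Nw w) \<le> card Php" for w using card_mono[OF finp, of "Nw w"] by (auto simp: Nw_def)
 thus "w : WG Ph & (\<forall>v\<in>WG Ph. len v \<le> len w)" using w by (simp add: len_eq)
 fix v assume v: "v : WG Ph & (\<forall>u\<in>WG Ph. len u \<le> len v)"
 hence "card Php \<le> card (Nw v)" using w by (metis len_eq)
 hence "Nw v = Php" using finp by (intro card_seteq) (auto simp: Nw_def)
 thus "v = w" using full_unique v w by blast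
qed

text \<open>-id inverts every positive root, so it is the longest element as soon as it lies in the
  group.\<close>

lemma longest_uminus_iff:
 "(THE w. w : WG Ph & (\<forall>v\<in>WG Ph. len v \<le> len w)) = uminus \<longleftrightarrow> uminus : WG Ph"
proof
 assume "(THE w. w : WG Ph & (\<forall>v\<in>WG Ph. len v \<le> len w)) = uminus"
 thus "uminus : WG Ph" using full_exists longest by metis
next
 assume "uminus : WG Ph"
 moreover have "Nw uminus = Php" by (auto simp: Nw_def)
 ultimately show "(THE w. w : WG Ph & (\<forall>v\<in>WG Ph. len v \<le> len w)) = uminus" by (rule longest)
qed

end

section \<open>The rational Cherednik algebra\<close>

subsection \<open>Covectors as vectors\<close>

definition blin :: "'e::euclidean_space => 'e \<Rightarrow>\<^sub>L real" where
 "blin a = Blinfun (%v. a \<bullet> v)"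

lemma blin_apply [simp]: "blinfun_apply (blin a) v = a \<bullet> v"
 unfolding blin_def by (subst bounded_linear_Blinfun_apply) (auto intro: bounded_linear_inner_right)

lemma riesz_inner: "blinfun_apply \<alpha> v = riesz \<alpha> \<bullet> v"
proof -
 have "blinfun_apply \<alpha> v = blinfun_apply \<alpha> (\<Sum>b\<in>Basis. (v \<bullet> b) *\<^sub>R b)" by (simp add: euclidean_representation)
 also have "... = (\<Sum>b\<in>Basis. (v \<bullet> b) * blinfun_apply \<alpha> b)" by (simp add: blinfun.sum_right blinfun.scaleR_right)
 also have "... = riesz \<alpha> \<bullet> v" unfolding riesz_def inner_sum_left inner_scaleR_left
  by (rule sum.cong[OF HOL.refl]) (simp add: inner_commute mult.commute)
 finally show ?thesis .
qed

lemma riesz_eqI: "(\<And>v. blinfun_apply \<alpha> v = a \<bullet> v) ==> riesz \<alpha> = a"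
 unfolding riesz_inner by (metis inner_diff_left inner_eq_zero_iff right_minus_eq)

lemma riesz_blin [simp]: "riesz (blin a) = a" by (rule riesz_eqI) simp

lemma blin_riesz [simp]: "blin (riesz \<alpha>) = \<alpha>" by (rule blinfun_eqI) (simp add: riesz_inner)

lemma riesz_inj: "inj_on riesz A" by (rule inj_onI) (metis blin_riesz)

lemma riesz_simps: "riesz (\<alpha> + \<beta>) = riesz \<alpha> + riesz \<beta>" "riesz (r *\<^sub>R \<alpha>) = r *\<^sub>R riesz \<alpha>" "riesz (- \<alpha>) = - riesz \<alpha>"
 "riesz 0 = 0" by (rule riesz_eqI, simp only: blinfun.add_left blinfun.scaleR_left blinfun.minus_left blinfun.zero_left
   inner_add_left inner_scaleR_left inner_minus_left inner_zero_left riesz_inner[symmetric] real_scaleR_def)+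

lemma riesz_eq_0: "riesz \<alpha> = 0 \<longleftrightarrow> \<alpha> = 0" by (metis riesz_simps(4) blin_riesz)

lemma linear_riesz: "linear riesz" by (rule linearI) (simp_all add: riesz_simps)

lemma refl_eq: "Defs.refl \<alpha> = rf (riesz \<alpha>)"
 by (auto simp: refl_def rf_def coroot_def riesz_inner inner_commute fun_eq_iff mult.commute)

lemma riesz_dual_act:
 assumes w: "orth w"
 shows "riesz (dual_act w \<alpha>) = w (riesz \<alpha>)"
proof (rule riesz_eqI)
 fix v
 have "bounded_linear (%v. blinfun_apply \<alpha> (ivf w v))" by (rule bounded_linear_compose[OF blinfun.bounded_linear_right])
   (use orth_inv[OF w] in \<open>simp add: orthogonal_transformation_def linear_conv_bounded_linear\<close>)
 hence "blinfun_apply (dual_act w \<alpha>) v = riesz \<alpha> \<bullet> ivf w v"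
  by (simp add: dual_act_def bounded_linear_Blinfun_apply riesz_inner)
 thus "blinfun_apply (dual_act w \<alpha>) v = w (riesz \<alpha>) \<bullet> v"
  using orth_inv_inner[OF w, of v "riesz \<alpha>"] by (simp add: inner_commute)
qed

lemma reflection_group_eq: "reflection_group R = WG (riesz ` R)"
proof
 show "reflection_group R \<subseteq> WG (riesz ` R)"
 proof
  fix w assume "w : reflection_group R"
  thus "w : WG (riesz ` R)"
  proof (induction rule: reflection_group.induct)
   case id
   show ?case by (rule WG_id)
  next
   case (refl \<alpha> w)
   show ?case unfolding refl_eq by (rule WG_rf) (use refl in auto)
  qed
 qed
 show "WG (riesz ` R) \<subseteq> reflection_group R"
 proof
  fix w assume "w : WG (riesz ` R)"
  thus "w : reflection_group R"
  proof (induction rule: WG.induct)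
   case WG_id
   show ?case by (rule reflection_group.id)
  next
   case (WG_rf a w)
   then obtain \<alpha> where "\<alpha> : R" "a = riesz \<alpha>" by auto
   thus ?case using reflection_group.refl[OF _ WG_rf(3), of \<alpha>] by (simp only: refl_eq)
  qed
 qed
qed

locale cherednik = onb y for y :: "nat => 'e::euclidean_space" +
 fixes R Rp D :: "('e \<Rightarrow>\<^sub>L real) set" and c :: "('e \<Rightarrow>\<^sub>L real) => complex"
  and x :: "nat => 'e \<Rightarrow>\<^sub>L real"
 assumes rs: "root_system R" and ps: "positive_system R Rp D" and wi: "W_invariant R Rp c"
  and db: "dual_basis y x"
begin

definition "Ph = riesz ` R"

text \<open>Half of the parameter, extended to negative roots by c(-a) = c(a); the half compensates
  for summing over both signs.\<close>

definition h :: "'e => complex" where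
 "h a = (if blin a : Rp then c (blin a) else c (blin (- a))) / 2"

abbreviation "W \<equiv> reflection_group R"

lemma W_eq: "W = WG Ph" by (simp add: reflection_group_eq Ph_def)

lemma W_orth: "w : W ==> orth w" by (simp add: W_eq WG_orth)

lemma riesz_x: "i : {1..DIM('e)} ==> riesz (x i) = y i"
proof (rule riesz_eqI)
 fix v assume i: "i : {1..DIM('e)}"
 have "blinfun_apply (x i) v = blinfun_apply (x i) (\<Sum>j\<in>{1..DIM('e)}. (v \<bullet> y j) *\<^sub>R y j)" by (simp only: y_expand)
 also have "... = (\<Sum>j\<in>{1..DIM('e)}. (v \<bullet> y j) * blinfun_apply (x i) (y j))"
  by (simp add: blinfun.sum_right blinfun.scaleR_right)
 also have "... = (\<Sum>j\<in>{1..DIM('e)}. if j = i then v \<bullet> y j else 0)"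
  using db i by (intro sum.cong HOL.refl) (auto simp: dual_basis_def)
 also have "... = y i \<bullet> v" using i by (simp add: inner_commute)
 finally show "blinfun_apply (x i) v = y i \<bullet> v" .
qed

lemma finR': "finite R" and zR: "0 \<notin> R"
 and reflR: "\<alpha> : R ==> \<beta> : R ==> dual_act (Defs.refl \<alpha>) \<beta> : R"
 and redR: "\<alpha> : R ==> t *\<^sub>R \<alpha> : R ==> t = 1 \<or> t = -1" using rs by (auto simp: root_system_def)

lemma Rp_sub: "Rp \<subseteq> R" and pmR: "\<beta> : R ==> \<beta> : Rp \<or> - \<beta> : Rp" and D_sub: "D \<subseteq> R" and D_ind: "independent D"
 and Rp_eq: "Rp = {\<beta> : R. nonneg_comb D \<beta>}" using ps by (auto simp: positive_system_def)

lemma rf_Ph: "a : Ph ==> b : Ph ==> rf a b : Ph"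
proof -
 assume "a : Ph" "b : Ph"
 then obtain \<alpha> \<beta> where "\<alpha> : R" "a = riesz \<alpha>" "\<beta> : R" "b = riesz \<beta>" by (auto simp: Ph_def)
 hence "rf a b = riesz (dual_act (Defs.refl \<alpha>) \<beta>)" "dual_act (Defs.refl \<alpha>) \<beta> : R"
  using reflR[of \<alpha> \<beta>] riesz_dual_act[OF rf_orth, of "riesz \<alpha>" \<beta>] by (simp_all add: refl_eq)
 thus ?thesis unfolding Ph_def by blast
qed

sublocale cx: coxeter Ph "riesz ` Rp" "riesz ` D"
proof
 show "finite Ph" using finR' by (simp add: Ph_def)
 show "0 \<notin> Ph" using zR by (auto simp: Ph_def riesz_eq_0)
 show "\<And>a b. a : Ph ==> b : Ph ==> rf a b : Ph" by (rule rf_Ph)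
 show "t = 1 \<or> t = - 1" if "a : Ph" "t *\<^sub>R a : Ph" for a t
 proof -
  from that(1) obtain \<alpha> where ab1: "\<alpha> : R" "a = riesz \<alpha>" by (auto simp: Ph_def)
  from that(2) obtain \<beta> where ab2: "\<beta> : R" "t *\<^sub>R a = riesz \<beta>" unfolding Ph_def by blast
  note ab = ab1 ab2
  hence "\<beta> = t *\<^sub>R \<alpha>" by (metis blin_riesz riesz_simps(2))
  thus ?thesis using redR ab by blast
 qed
 show "riesz ` D \<subseteq> Ph" using D_sub by (auto simp: Ph_def)
 show "independent (riesz ` D)" by (rule linear_independent_injective_image[OF linear_riesz D_ind]) (rule riesz_inj)
 have sum: "(\<Sum>d\<in>riesz ` D. t d *\<^sub>R d) = riesz (\<Sum>\<delta>\<in>D. t (riesz \<delta>) *\<^sub>R \<delta>)" for t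
  by (subst sum.reindex[OF riesz_inj]) (simp add: linear_sum[OF linear_riesz] riesz_simps)
 show "riesz ` Rp = {b : Ph. \<exists>t. (\<forall>d\<in>riesz ` D. 0 \<le> t d) & b = (\<Sum>d\<in>riesz ` D. t d *\<^sub>R d)}"
 proof (rule Set.set_eqI)
  fix b
  have "b : riesz ` Rp \<longleftrightarrow> (\<exists>\<beta>\<in>R. b = riesz \<beta> & nonneg_comb D \<beta>)" by (auto simp: Rp_eq)
  also have "... \<longleftrightarrow> (\<exists>\<beta>\<in>R. b = riesz \<beta> & (\<exists>t. (\<forall>d\<in>riesz ` D. 0 \<le> t d) & b = (\<Sum>d\<in>riesz ` D. t d *\<^sub>R d)))"
  proof (intro bex_cong HOL.refl conj_cong)
   fix \<beta> assume b: "b = riesz \<beta>"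
   show "nonneg_comb D \<beta> \<longleftrightarrow> (\<exists>t. (\<forall>d\<in>riesz ` D. 0 \<le> t d) & b = (\<Sum>d\<in>riesz ` D. t d *\<^sub>R d))"
   proof
    assume "nonneg_comb D \<beta>"
    then obtain t where "\<forall>\<delta>\<in>D. 0 \<le> t \<delta>" "\<beta> = (\<Sum>\<delta>\<in>D. t \<delta> *\<^sub>R \<delta>)" by (auto simp: nonneg_comb_def)
    thus "\<exists>t. (\<forall>d\<in>riesz ` D. 0 \<le> t d) & b = (\<Sum>d\<in>riesz ` D. t d *\<^sub>R d)"
     using b by (intro exI[of _ "%a. t (blin a)"]) (simp add: sum)
   next
    assume "\<exists>t. (\<forall>d\<in>riesz ` D. 0 \<le> t d) & b = (\<Sum>d\<in>riesz ` D. t d *\<^sub>R d)"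
    then obtain t where t: "\<forall>d\<in>riesz ` D. 0 \<le> t d" "riesz \<beta> = riesz (\<Sum>\<delta>\<in>D. t (riesz \<delta>) *\<^sub>R \<delta>)"
     using b by (auto simp: sum)
    hence "\<beta> = (\<Sum>\<delta>\<in>D. t (riesz \<delta>) *\<^sub>R \<delta>)" by (metis blin_riesz)
    thus "nonneg_comb D \<beta>" using t by (auto simp: nonneg_comb_def intro!: exI[of _ "%\<delta>. t (riesz \<delta>)"])
   qed
  qed
  finally show "b : riesz ` Rp \<longleftrightarrow> b : {b : Ph. \<exists>t. (\<forall>d\<in>riesz ` D. 0 \<le> t d) & b = (\<Sum>d\<in>riesz ` D. t d *\<^sub>R d)}"
   by (auto simp: Ph_def)
 qed
 show "b : riesz ` Rp \<or> - b : riesz ` Rp" if b: "b : Ph" for b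
 proof -
  from b obtain \<beta> where "\<beta> : R" "b = riesz \<beta>" by (auto simp: Ph_def)
  thus ?thesis using pmR[of \<beta>] by (metis imageI riesz_simps(3))
 qed
qed

text \<open>\<open>W_invariant\<close> compares positive roots only. If s_a preserves the sign of b
  it applies to s_a; if not, it applies to s_g s_a with g = s_a b, which sends b to -g.\<close>

lemma h_rfPh: "a : Ph ==> b : Ph ==> h (rf a b) = h b"
proof -
 assume a: "a : Ph" and b: "b : Ph"
 let ?g = "rf a b"
 have g: "?g : Ph" by (rule rf_Ph[OF a b])
 have inv: "c (blin (w v)) = c (blin v)" if "w : W" "blin v : Rp" "blin (w v) : Rp" for w v
 proof -
  have "dual_act w (blin v) = blin (w v)" using riesz_dual_act[OF W_orth[OF that(1)], of "blin v"] by (metis blin_riesz riesz_blin)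
  thus ?thesis using wi[unfolded W_invariant_def, rule_format, OF that(1,2)] that(3) by simp
 qed
 have mem: "blin v : Rp \<longleftrightarrow> v : riesz ` Rp" for v by (metis blin_riesz image_iff riesz_blin)
 have w1: "rf a : W" using WG_single[OF a] by (simp add: W_eq)
 have w2: "rf ?g o rf a : W" using WG_comp[OF WG_single[OF g] WG_single[OF a]] by (simp add: W_eq)
 have gg: "rf ?g ?g = - ?g" using g cx.nzR by (intro rf_self) auto
 have neg: "rf k (- v) = - rf k v" for k v :: 'e by (rule linear_neg[OF linear_rf])
 have "(if ?g : riesz ` Rp then c (blin ?g) else c (blin (- ?g))) = (if b : riesz ` Rp then c (blin b) else c (blin (- b)))"
  using inv[OF w1, of b] inv[OF w1, of "- b"] inv[OF w2, of b] inv[OF w2, of "- b"]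
   cx.pos_or_neg[OF g] cx.pos_or_neg[OF b] by (auto simp: mem neg gg)
 thus ?thesis by (simp add: h_def mem)
qed

sublocale dunkl Ph h by unfold_locales (use cx.finR cx.nzR rf_Ph h_rfPh in auto)

lemma h_uminus: "a : Ph ==> h (- a) = h a" using h_rfPh[of a a] rf_self[of a] nzE by force

lemma W_symm: "w : W ==> symm w" unfolding W_eq
proof (induction rule: WG.induct)
 case WG_id
 thus ?case by (simp add: symm_def orthogonal_transformation_def linear_id)
next
 case (WG_rf a w)
 have a: "symm (rf a)" by (rule symm_rf[OF WG_rf(1)])
 have "(rf a o w) ` Ph = Ph" using a WG_rf(3) by (simp only: symm_def image_comp[symmetric])
 moreover have "h ((rf a o w) b) = h b" if "b : Ph" for b
 proof -
  have "w b : Ph" using WG_rf(3) that by (auto simp: symm_def)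
  thus ?thesis using a WG_rf(3) that by (simp add: symm_def)
 qed
 ultimately show ?case using a WG_rf(3) orthogonal_transformation_compose[of "rf a" w] unfolding symm_def by blast
qed

text \<open>Replaces a sum over positive roots by one over all roots, so that the operator
  computations need no positive system and may be reindexed by group elements.\<close>

lemma sum_Rp:
 assumes F: "\<And>a. F (- a) = F a"
 shows "(\<Sum>\<alpha>\<in>Rp. sc (c \<alpha>) * F (riesz \<alpha>)) = (\<Sum>a\<in>Ph. sc (h a) * (F a :: 'e op))"
proof -
 let ?P = "riesz ` Rp"
 have P: "finite ?P" "?P \<subseteq> Ph" using finR' Rp_sub finite_subset by (auto simp: Ph_def)
 have Ph: "Ph = ?P \<union> uminus ` ?P"
 proof
  show "Ph \<subseteq> ?P \<union> uminus ` ?P"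
  proof
   fix a assume "a : Ph"
   then consider "a : ?P" | "- a : ?P" using cx.pos_or_neg by blast
   thus "a : ?P \<union> uminus ` ?P"
   proof cases
    case 2
    hence "- (- a) : uminus ` ?P" by (rule imageI)
    thus ?thesis by simp
   qed simp
  qed
  show "?P \<union> uminus ` ?P \<subseteq> Ph" using P(2) cx.uminus_root by blast
 qed
 have dis: "?P \<inter> uminus ` ?P = {}"
 proof (rule equals0I)
  fix a assume "a : ?P \<inter> uminus ` ?P"
  then obtain b where "b : ?P" "a = - b" "a : ?P" by blast
  thus False using cx.not_both[of b] by simp
 qed
 have "(\<Sum>a\<in>Ph. sc (h a) * F a) = (\<Sum>a\<in>?P. sc (h a) * F a) + (\<Sum>a\<in>uminus ` ?P. sc (h a) * F a)"
  by (subst Ph, rule sum.union_disjoint) (use P dis in auto)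
 also have "(\<Sum>a\<in>uminus ` ?P. sc (h a) * F a) = (\<Sum>a\<in>?P. sc (h (- a)) * F (- a))"
  by (subst sum.reindex) (auto simp: inj_on_def)
 also have "... = (\<Sum>a\<in>?P. sc (h a) * F a)" by (rule sum.cong[OF HOL.refl]) (use P h_uminus F in auto)
 also have "(\<Sum>a\<in>?P. sc (h a) * F a) + (\<Sum>a\<in>?P. sc (h a) * F a) = (\<Sum>a\<in>?P. sc (2 * h a) * F a)"
  by (simp only: sum.distrib[symmetric] mult_2 sc_simps(3) distrib_right)
 also have "... = (\<Sum>\<alpha>\<in>Rp. sc (c \<alpha>) * F (riesz \<alpha>))" by (subst sum.reindex[OF riesz_inj]) (simp add: h_def)
 finally show ?thesis by simp
qed

lemma longest_iff: "longest_element R D = uminus \<longleftrightarrow> uminus : W"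
proof -
 have wl: "word_length D w = cx.len w" for w
 proof -
  have "(\<exists>\<alpha>s. length \<alpha>s = k & set \<alpha>s \<subseteq> D & foldr (o) (map Defs.refl \<alpha>s) id = w)
   \<longleftrightarrow> (\<exists>ds. length ds = k & set ds \<subseteq> riesz ` D & cx.wrd ds = w)" for k
  proof
   assume "\<exists>\<alpha>s. length \<alpha>s = k & set \<alpha>s \<subseteq> D & foldr (o) (map Defs.refl \<alpha>s) id = w"
   then obtain \<alpha>s where "length \<alpha>s = k" "set \<alpha>s \<subseteq> D" "foldr (o) (map Defs.refl \<alpha>s) id = w" by blast
   thus "\<exists>ds. length ds = k & set ds \<subseteq> riesz ` D & cx.wrd ds = w"
    by (intro exI[of _ "map riesz \<alpha>s"]) (auto simp: cx.wrd_def refl_eq[abs_def] comp_def)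
  next
   assume "\<exists>ds. length ds = k & set ds \<subseteq> riesz ` D & cx.wrd ds = w"
   then obtain ds where "length ds = k" "set ds \<subseteq> riesz ` D" "cx.wrd ds = w" by blast
   thus "\<exists>\<alpha>s. length \<alpha>s = k & set \<alpha>s \<subseteq> D & foldr (o) (map Defs.refl \<alpha>s) id = w"
    by (intro exI[of _ "map blin ds"]) (auto simp: cx.wrd_def refl_eq[abs_def] comp_def)
  qed
  thus ?thesis by (simp add: word_length_def cx.len_def)
 qed
 show ?thesis using cx.longest_uminus_iff unfolding longest_element_def W_eq wl .
qed

subsection \<open>The Dunkl representation\<close>

abbreviation "G \<equiv> (range GX \<union> range GY \<union> GW ` W :: 'e cher_gen set)"

sublocale HF: kalg "free_alg G :: (complex, _) module" by (rule kalg_free_alg)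

lemma gen_in [simp]: "GX \<xi> : G" "GY v : G" "w : W ==> GW w : G" by auto

lemma refl_W [simp]: "\<alpha> : Rp ==> Defs.refl \<alpha> : W"
 using Rp_sub reflection_group.refl[OF _ reflection_group.id, of \<alpha> R] by auto

lemma id_W [simp]: "id : W" by (rule reflection_group.id)

lemma comp_W [simp]: "w : W ==> v : W ==> w o v : W" by (simp add: W_eq WG_comp)

abbreviation "cm \<equiv> %\<xi> v. (complex_of_real (blinfun_apply \<xi> v) \<odot>\<^bsub>free_alg G\<^esub> \<one>\<^bsub>free_alg G\<^esub>) \<oplus>\<^bsub>free_alg G\<^esub>
     (\<Oplus>\<^bsub>free_alg G\<^esub>\<alpha>\<in>Rp. (c \<alpha> * complex_of_real (blinfun_apply \<alpha> v * blinfun_apply \<xi> (coroot \<alpha>)))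
       \<odot>\<^bsub>free_alg G\<^esub> gen (GW (Defs.refl \<alpha>)))"

lemma cher_rels_cases:
 assumes "s : cher_rels R Rp c"
 obtains (xadd) \<xi> \<xi>' where "s = gen (GX (\<xi> + \<xi>')) \<ominus>\<^bsub>free_alg G\<^esub> (gen (GX \<xi>) \<oplus>\<^bsub>free_alg G\<^esub> gen (GX \<xi>'))"
 | (xsc) r \<xi> where "s = gen (GX (r *\<^sub>R \<xi>)) \<ominus>\<^bsub>free_alg G\<^esub> (complex_of_real r \<odot>\<^bsub>free_alg G\<^esub> gen (GX \<xi>))"
 | (yadd) v v' where "s = gen (GY (v + v')) \<ominus>\<^bsub>free_alg G\<^esub> (gen (GY v) \<oplus>\<^bsub>free_alg G\<^esub> gen (GY v'))"
 | (ysc) r v where "s = gen (GY (r *\<^sub>R v)) \<ominus>\<^bsub>free_alg G\<^esub> (complex_of_real r \<odot>\<^bsub>free_alg G\<^esub> gen (GY v))"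
 | (wid) "s = gen (GW id) \<ominus>\<^bsub>free_alg G\<^esub> \<one>\<^bsub>free_alg G\<^esub>"
 | (ww) w w' where "w : W" "w' : W" "s = (gen (GW w) \<otimes>\<^bsub>free_alg G\<^esub> gen (GW w')) \<ominus>\<^bsub>free_alg G\<^esub> gen (GW (w o w'))"
 | (wx) w \<xi> where "w : W" "s = (gen (GW w) \<otimes>\<^bsub>free_alg G\<^esub> gen (GX \<xi>)) \<ominus>\<^bsub>free_alg G\<^esub> (gen (GX (dual_act w \<xi>)) \<otimes>\<^bsub>free_alg G\<^esub> gen (GW w))"
 | (wy) w v where "w : W" "s = (gen (GW w) \<otimes>\<^bsub>free_alg G\<^esub> gen (GY v)) \<ominus>\<^bsub>free_alg G\<^esub> (gen (GY (w v)) \<otimes>\<^bsub>free_alg G\<^esub> gen (GW w))"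
 | (xx) \<xi> \<xi>' where "s = (gen (GX \<xi>) \<otimes>\<^bsub>free_alg G\<^esub> gen (GX \<xi>')) \<ominus>\<^bsub>free_alg G\<^esub> (gen (GX \<xi>') \<otimes>\<^bsub>free_alg G\<^esub> gen (GX \<xi>))"
 | (yy) v v' where "s = (gen (GY v) \<otimes>\<^bsub>free_alg G\<^esub> gen (GY v')) \<ominus>\<^bsub>free_alg G\<^esub> (gen (GY v') \<otimes>\<^bsub>free_alg G\<^esub> gen (GY v))"
 | (yx) \<xi> v where "s = ((gen (GY v) \<otimes>\<^bsub>free_alg G\<^esub> gen (GX \<xi>)) \<ominus>\<^bsub>free_alg G\<^esub> (gen (GX \<xi>) \<otimes>\<^bsub>free_alg G\<^esub> gen (GY v))) \<ominus>\<^bsub>free_alg G\<^esub> cm \<xi> v"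
proof -
 consider "s : linear_rels R" | "s : smash_rels R" | "s : commutation_rels R Rp c" using assms unfolding cher_rels_def by blast
 thus ?thesis
 proof cases
  case 1
  thus ?thesis unfolding linear_rels_def Let_def cher_free_def using xadd xsc yadd ysc by blast
 next
  case 2
  thus ?thesis unfolding smash_rels_def Let_def cher_free_def using wid ww wx wy by blast
 next
  case 3
  thus ?thesis unfolding commutation_rels_def Let_def cher_free_def commutator_def using xx yy yx by blast
 qed
qed

lemma cm_closed: "cm \<xi> v : carrier (free_alg G)"
 by (intro HF.a_closed HF.smult_closed HF.one_closed HF.finsum_closed Pi_I gen_closed) simp_all

lemma cher_rels_closed: "cher_rels R Rp c \<subseteq> carrier (free_alg G)"
proof
 fix s assume "s : cher_rels R Rp c"
 thus "s : carrier (free_alg G)" by (cases rule: cher_rels_cases)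
   (simp_all only: HF.minus_closed HF.a_closed HF.m_closed HF.smult_closed HF.one_closed gen_closed gen_in id_W comp_W cm_closed)
qed

sublocale H: presented G "cher_rels R Rp c" by (intro presented.intro kalg_quot.intro kalg_quot_axioms.intro kalg_free_alg cher_rels_closed)

abbreviation "HH \<equiv> Cherednik R Rp c"

abbreviation (input) hh_mult (infixl "\<star>" 70) where "a \<star> b == a \<otimes>\<^bsub>HH\<^esub> b"

abbreviation (input) hh_smult (infixl "\<cdot>" 70) where "a \<cdot> b == a \<odot>\<^bsub>HH\<^esub> b"

abbreviation (input) "FG == free_alg G"

lemma HH_eq: "HH = H.Q" by (simp add: Cherednik_def cher_free_def)

sublocale HK: kalg HH unfolding HH_eq by (rule H.kalg_Q)

definition Xe :: "('e \<Rightarrow>\<^sub>L real) => 'e cher" where "Xe \<xi> = cher_elt R Rp c (GX \<xi>)"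
definition Ye :: "'e => 'e cher" where "Ye v = cher_elt R Rp c (GY v)"
definition We :: "('e => 'e) => 'e cher" where "We w = cher_elt R Rp c (GW w)"

lemma elt_eq: "cher_elt R Rp c g = H.gn g" by (simp add: cher_elt_def cher_free_def)

lemma gens_closed [simp, intro]: "Xe \<xi> : carrier HH" "Ye v : carrier HH" "w : W ==> We w : carrier HH"
 unfolding Xe_def Ye_def We_def elt_eq HH_eq by (intro H.gn_closed; simp)+

definition pgen :: "'e cher_gen => 'e op" where
 "pgen g = (case g of GX \<xi> => Xo (riesz \<xi>) | GY v => To v | GW w => Wo w)"

text \<open>Each defining relation is an operator identity already known. Only the one between y and
  x needs preparation: its sum over positive roots has to be rewritten over all roots.\<close>

lemma pi_ex: "\<exists>p. kalg_hom HH talg p & (\<forall>g\<in>G. p (H.gn g) = pgen g)" unfolding HH_eq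
proof (rule H.lift_gen[OF kalg_talg])
 fix p and s :: "'e cher_gen list => complex"
 assume p: "kalg_hom FG talg p" and g: "\<forall>g\<in>G. p (gen g) = pgen g" and s: "s : cher_rels R Rp c"
 interpret p: kalg_hom "FG" talg p by fact
 have gX: "p (gen (GX \<xi>)) = Xo (riesz \<xi>)" and gY: "p (gen (GY v)) = To v" for \<xi> v using g by (auto simp: pgen_def)
 have gW: "p (gen (GW w)) = Wo w" if "w : W" for w using g that by (auto simp: pgen_def)
 have cl: "gen (GX \<xi>) : carrier FG" "gen (GY v) : carrier FG" for \<xi> v by auto
 have clW: "gen (GW w) : carrier FG" if "w : W" for w using that by auto
 show "p s = \<zero>\<^bsub>talg\<^esub>" using s
 proof (cases rule: cher_rels_cases)
  case (yx \<xi> v)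
  have f: "(%\<alpha>. (c \<alpha> * complex_of_real (blinfun_apply \<alpha> v * blinfun_apply \<xi> (coroot \<alpha>)))
       \<odot>\<^bsub>FG\<^esub> gen (GW (Defs.refl \<alpha>))) : Rp \<rightarrow> carrier FG"
   by (intro Pi_I HF.smult_closed clW refl_W)
  have "p (finsum FG (%\<alpha>. (c \<alpha> * complex_of_real (blinfun_apply \<alpha> v * blinfun_apply \<xi> (coroot \<alpha>)))
       \<odot>\<^bsub>FG\<^esub> gen (GW (Defs.refl \<alpha>))) Rp)
   = (\<Sum>\<alpha>\<in>Rp. sc (c \<alpha>) * (sc (of_real ((riesz \<alpha> \<bullet> v) * (2 * (riesz \<xi> \<bullet> riesz \<alpha>) / (riesz \<alpha> \<bullet> riesz \<alpha>)))) * Wo (rf (riesz \<alpha>))))"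
   unfolding p.finsum[OF f] talg_finsum by (rule sum.cong[OF HOL.refl])
    (simp add: clW gW refl_W refl_eq[symmetric] riesz_inner coroot_def sc_simps mult.assoc[symmetric] del: refl_eq; simp add: refl_eq mult.assoc sc_simps(4)[symmetric] mult_ac)
  also have "... = (\<Sum>a\<in>Ph. sc (h a) * (sc (of_real ((a \<bullet> v) * (2 * (riesz \<xi> \<bullet> a) / (a \<bullet> a)))) * Wo (rf a)))"
   by (rule sum_Rp) simp
  also have "... = (\<Sum>a\<in>Ph. sc (h a * of_real ((a \<bullet> v) * (2 * (riesz \<xi> \<bullet> a) / (a \<bullet> a)))) * Wo (rf a))"
   by (rule sum.cong[OF HOL.refl]) (simp only: sc_simps(4) mult.assoc)
  finally have fs: "p (finsum FG (%\<alpha>. (c \<alpha> * complex_of_real (blinfun_apply \<alpha> v * blinfun_apply \<xi> (coroot \<alpha>)))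
       \<odot>\<^bsub>FG\<^esub> gen (GW (Defs.refl \<alpha>))) Rp) = ..." .
  have k1: "p (complex_of_real (blinfun_apply \<xi> v) \<odot>\<^bsub>FG\<^esub> \<one>\<^bsub>FG\<^esub>) = sc (of_real (riesz \<xi> \<bullet> v))"
   by (simp add: riesz_inner)
  have pc: "p (cm \<xi> v) = sc (of_real (riesz \<xi> \<bullet> v))
    + (\<Sum>a\<in>Ph. sc (h a * of_real ((a \<bullet> v) * (2 * (riesz \<xi> \<bullet> a) / (a \<bullet> a)))) * Wo (rf a))"
   by (simp only: p.add HF.smult_closed HF.one_closed HF.finsum_closed[OF f] fs k1 talg_simps)
  have "p s = (To v * Xo (riesz \<xi>) - Xo (riesz \<xi>) * To v) - p (cm \<xi> v)"
   unfolding yx p.minus[OF HF.minus_closed[OF HF.m_closed[OF cl(2) cl(1)] HF.m_closed[OF cl(1) cl(2)]] cm_closed]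
    p.minus[OF HF.m_closed[OF cl(2) cl(1)] HF.m_closed[OF cl(1) cl(2)]] p.mult[OF cl(1) cl(2)] p.mult[OF cl(2) cl(1)] gX gY
   by (simp only: talg_minus talg_simps)
  thus ?thesis unfolding pc To_Xo by (simp only: talg_simps) simp
 qed (simp_all add: cl clW gX gY gW riesz_simps Xo_add Xo_scale To_add To_scale Wo_id[unfolded id_def] Wo_id Wo_Wo W_orth
   Wo_Xo riesz_dual_act Wo_To W_symm Xo_commute To_commute)
qed (simp add: talg_def)

definition pr :: "'e cher => 'e op" where
 "pr = (SOME p. kalg_hom HH talg p & (\<forall>g\<in>G. p (H.gn g) = pgen g))"

lemma pr_hom: "kalg_hom HH talg pr" and pr_gn: "g : G ==> pr (H.gn g) = pgen g" using someI_ex[OF pi_ex] unfolding pr_def by blast+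

sublocale pr: kalg_hom HH talg pr by (rule pr_hom)

lemma pr_gens: "pr (Xe \<xi>) = Xo (riesz \<xi>)" "pr (Ye v) = To v" "w : W ==> pr (We w) = Wo w"
 unfolding Xe_def Ye_def We_def elt_eq by (subst pr_gn; simp add: pgen_def)+

end

subsection \<open>The Dunkl representation is faithful\<close>

context cherednik
begin

lemma rel_mem:
 "gen (GX (\<xi> + \<xi>')) \<ominus>\<^bsub>FG\<^esub> (gen (GX \<xi>) \<oplus>\<^bsub>FG\<^esub> gen (GX \<xi>')) : cher_rels R Rp c"
 "gen (GX (r *\<^sub>R \<xi>)) \<ominus>\<^bsub>FG\<^esub> (complex_of_real r \<odot>\<^bsub>FG\<^esub> gen (GX \<xi>)) : cher_rels R Rp c"
 "gen (GY (v + v')) \<ominus>\<^bsub>FG\<^esub> (gen (GY v) \<oplus>\<^bsub>FG\<^esub> gen (GY v')) : cher_rels R Rp c"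
 "gen (GY (r *\<^sub>R v)) \<ominus>\<^bsub>FG\<^esub> (complex_of_real r \<odot>\<^bsub>FG\<^esub> gen (GY v)) : cher_rels R Rp c"
 "gen (GW id) \<ominus>\<^bsub>FG\<^esub> \<one>\<^bsub>FG\<^esub> : cher_rels R Rp c"
 "w : W ==> w' : W ==> (gen (GW w) \<otimes>\<^bsub>FG\<^esub> gen (GW w')) \<ominus>\<^bsub>FG\<^esub> gen (GW (w o w')) : cher_rels R Rp c"
 "w : W ==> (gen (GW w) \<otimes>\<^bsub>FG\<^esub> gen (GX \<xi>)) \<ominus>\<^bsub>FG\<^esub> (gen (GX (dual_act w \<xi>)) \<otimes>\<^bsub>FG\<^esub> gen (GW w)) : cher_rels R Rp c"
 "w : W ==> (gen (GW w) \<otimes>\<^bsub>FG\<^esub> gen (GY v)) \<ominus>\<^bsub>FG\<^esub> (gen (GY (w v)) \<otimes>\<^bsub>FG\<^esub> gen (GW w)) : cher_rels R Rp c"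
 by (unfold cher_rels_def linear_rels_def smash_rels_def Let_def cher_free_def, blast+)

lemma rel_mem2:
 "(gen (GX \<xi>) \<otimes>\<^bsub>FG\<^esub> gen (GX \<xi>')) \<ominus>\<^bsub>FG\<^esub> (gen (GX \<xi>') \<otimes>\<^bsub>FG\<^esub> gen (GX \<xi>)) : cher_rels R Rp c"
 "(gen (GY v) \<otimes>\<^bsub>FG\<^esub> gen (GY v')) \<ominus>\<^bsub>FG\<^esub> (gen (GY v') \<otimes>\<^bsub>FG\<^esub> gen (GY v)) : cher_rels R Rp c"
 "((gen (GY v) \<otimes>\<^bsub>FG\<^esub> gen (GX \<xi>)) \<ominus>\<^bsub>FG\<^esub> (gen (GX \<xi>) \<otimes>\<^bsub>FG\<^esub> gen (GY v))) \<ominus>\<^bsub>FG\<^esub> cm \<xi> v : cher_rels R Rp c"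
 by (unfold cher_rels_def commutation_rels_def commutator_def Let_def cher_free_def, blast+)

lemmas eltU = Xe_def Ye_def We_def elt_eq HH_eq

lemma gcl: "gen (GX \<xi>) : carrier FG" "gen (GY v) : carrier FG"
 "w : W ==> gen (GW w) : carrier FG" by auto

lemma Xe_add: "Xe (\<xi> + \<xi>') = Xe \<xi> \<oplus>\<^bsub>HH\<^esub> Xe \<xi>'"
 unfolding eltU by (subst H.cls_add[symmetric]; (rule gcl)?) (rule H.cls_rel_eq[OF rel_mem(1)]; intro HF.a_closed gcl)

lemma Xe_scale: "Xe (r *\<^sub>R \<xi>) = complex_of_real r \<cdot> Xe \<xi>"
 unfolding eltU by (subst H.cls_smult[symmetric]; (rule gcl)?) (rule H.cls_rel_eq[OF rel_mem(2)]; intro HF.smult_closed gcl)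

lemma Ye_add: "Ye (v + v') = Ye v \<oplus>\<^bsub>HH\<^esub> Ye v'"
 unfolding eltU by (subst H.cls_add[symmetric]; (rule gcl)?) (rule H.cls_rel_eq[OF rel_mem(3)]; intro HF.a_closed gcl)

lemma Ye_scale: "Ye (r *\<^sub>R v) = complex_of_real r \<cdot> Ye v"
 unfolding eltU by (subst H.cls_smult[symmetric]; (rule gcl)?) (rule H.cls_rel_eq[OF rel_mem(4)]; intro HF.smult_closed gcl)

lemma We_id: "We id = \<one>\<^bsub>HH\<^esub>"
 unfolding eltU H.cls_one[symmetric] by (rule H.cls_rel_eq[OF rel_mem(5)]; intro HF.one_closed gcl id_W)

lemma We_We: "w : W ==> w' : W ==> We w \<star> We w' = We (w o w')"
 unfolding eltU by (subst H.cls_mult[symmetric]; (rule gcl; assumption)?) (rule H.cls_rel_eq[OF rel_mem(6)]; (intro HF.m_closed gcl comp_W)?; assumption)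

lemma We_Xe: "w : W ==> We w \<star> Xe \<xi> = Xe (dual_act w \<xi>) \<star> We w"
 unfolding eltU by (subst H.cls_mult[symmetric]; (intro gcl; assumption)?)+ (rule H.cls_rel_eq[OF rel_mem(7)]; (intro HF.m_closed gcl)?; assumption)

lemma We_Ye: "w : W ==> We w \<star> Ye v = Ye (w v) \<star> We w"
 unfolding eltU by (subst H.cls_mult[symmetric]; (intro gcl; assumption)?)+ (rule H.cls_rel_eq[OF rel_mem(8)]; (intro HF.m_closed gcl)?; assumption)

lemma Xe_Xe: "Xe \<xi> \<star> Xe \<xi>' = Xe \<xi>' \<star> Xe \<xi>"
 unfolding eltU by (subst H.cls_mult[symmetric]; (rule gcl)?)+ (rule H.cls_rel_eq[OF rel_mem2(1)]; intro HF.m_closed gcl)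

lemma Ye_Ye: "Ye v \<star> Ye v' = Ye v' \<star> Ye v"
 unfolding eltU by (subst H.cls_mult[symmetric]; (rule gcl)?)+ (rule H.cls_rel_eq[OF rel_mem2(2)]; intro HF.m_closed gcl)

lemma Ye_Xe: "Ye v \<star> Xe \<xi> = Xe \<xi> \<star> Ye v \<oplus>\<^bsub>HH\<^esub>
  (complex_of_real (blinfun_apply \<xi> v) \<cdot> \<one>\<^bsub>HH\<^esub> \<oplus>\<^bsub>HH\<^esub>
  (\<Oplus>\<^bsub>HH\<^esub>\<alpha>\<in>Rp. (c \<alpha> * complex_of_real (blinfun_apply \<alpha> v * blinfun_apply \<xi> (coroot \<alpha>))) \<cdot> We (Defs.refl \<alpha>)))"
proof -
 interpret cl: kalg_hom "FG" HH H.cls unfolding HH_eq by (rule H.cls_hom)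
 have f: "(%\<alpha>. (c \<alpha> * complex_of_real (blinfun_apply \<alpha> v * blinfun_apply \<xi> (coroot \<alpha>)))
       \<odot>\<^bsub>FG\<^esub> gen (GW (Defs.refl \<alpha>))) : Rp \<rightarrow> carrier FG"
  by (intro Pi_I HF.smult_closed gcl refl_W)
 have fH: "(\<Oplus>\<^bsub>HH\<^esub>\<alpha>\<in>Rp. (c \<alpha> * complex_of_real (blinfun_apply \<alpha> v * blinfun_apply \<xi> (coroot \<alpha>))) \<cdot> We (Defs.refl \<alpha>)) : carrier HH"
  by (intro HK.finsum_closed Pi_I HK.smult_closed gens_closed refl_W)
 have s: "H.cls (\<Oplus>\<^bsub>FG\<^esub>\<alpha>\<in>Rp. (c \<alpha> * complex_of_real (blinfun_apply \<alpha> v * blinfun_apply \<xi> (coroot \<alpha>))) \<odot>\<^bsub>FG\<^esub> gen (GW (Defs.refl \<alpha>)))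
  = (\<Oplus>\<^bsub>HH\<^esub>\<alpha>\<in>Rp. (c \<alpha> * complex_of_real (blinfun_apply \<alpha> v * blinfun_apply \<xi> (coroot \<alpha>))) \<cdot> We (Defs.refl \<alpha>))"
  unfolding cl.finsum[OF f] by (rule HK.finsum_cong') (simp_all add: Pi_I We_def elt_eq gcl)
 have cm: "H.cls (cm \<xi> v) = complex_of_real (blinfun_apply \<xi> v) \<cdot> \<one>\<^bsub>HH\<^esub> \<oplus>\<^bsub>HH\<^esub>
  (\<Oplus>\<^bsub>HH\<^esub>\<alpha>\<in>Rp. (c \<alpha> * complex_of_real (blinfun_apply \<alpha> v * blinfun_apply \<xi> (coroot \<alpha>))) \<cdot> We (Defs.refl \<alpha>))"
  unfolding s[symmetric] by (subst cl.add[OF HF.smult_closed[OF HF.one_closed] HF.finsum_closed[OF f]]) simp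
 have "H.cls (gen (GY v) \<otimes>\<^bsub>FG\<^esub> gen (GX \<xi>) \<ominus>\<^bsub>FG\<^esub> gen (GX \<xi>) \<otimes>\<^bsub>FG\<^esub> gen (GY v)) = H.cls (cm \<xi> v)"
  by (rule H.cls_rel_eq[OF rel_mem2(3)]) (intro HF.minus_closed HF.m_closed gcl cm_closed)+
 hence "Ye v \<star> Xe \<xi> \<ominus>\<^bsub>HH\<^esub> Xe \<xi> \<star> Ye v = H.cls (cm \<xi> v)"
  by (simp add: gcl Xe_def Ye_def elt_eq)
 moreover have "a = b \<oplus>\<^bsub>HH\<^esub> d" if "a \<ominus>\<^bsub>HH\<^esub> b = d" "a : carrier HH" "b : carrier HH" for a b d
  using that by (metis a_minus_def HK.add.inv_closed HK.add.m_comm HK.add.m_assoc HK.r_neg HK.r_zero)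
 ultimately show ?thesis unfolding cm by (simp only: HK.m_closed gens_closed)
qed

lemma Xe_sum: "finite I ==> Xe (\<Sum>i\<in>I. f i *\<^sub>R v i) = (\<Oplus>\<^bsub>HH\<^esub>i\<in>I. complex_of_real (f i) \<cdot> Xe (v i))"
proof (induction I rule: finite_induct)
 case empty
 show ?case using Xe_scale[of 0 0] by simp
next
 case (insert i I)
 thus ?case by (simp add: HK.finsum_insert Xe_add Xe_scale)
qed

lemma Ye_sum: "finite I ==> Ye (\<Sum>i\<in>I. f i *\<^sub>R v i) = (\<Oplus>\<^bsub>HH\<^esub>i\<in>I. complex_of_real (f i) \<cdot> Ye (v i))"
proof (induction I rule: finite_induct)
 case empty
 show ?case using Ye_scale[of 0 0] by simp
next
 case (insert i I)
 thus ?case by (simp add: HK.finsum_insert Ye_add Ye_scale)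
qed

lemma Xe_expand: "Xe \<xi> = (\<Oplus>\<^bsub>HH\<^esub>i\<in>{1..DIM('e)}. complex_of_real (riesz \<xi> \<bullet> y i) \<cdot> Xe (x i))"
proof -
 have "riesz (\<Sum>i\<in>{1..DIM('e)}. (riesz \<xi> \<bullet> y i) *\<^sub>R x i) = riesz \<xi>"
  using y_expand[of "riesz \<xi>"] by (simp only: linear_sum[OF linear_riesz] riesz_simps) (simp add: riesz_x)
 hence "(\<Sum>i\<in>{1..DIM('e)}. (riesz \<xi> \<bullet> y i) *\<^sub>R x i) = \<xi>" by (metis blin_riesz)
 thus ?thesis using Xe_sum[of "{1..DIM('e)}" "%i. riesz \<xi> \<bullet> y i" x] by simp
qed

lemma Ye_expand: "Ye v = (\<Oplus>\<^bsub>HH\<^esub>i\<in>{1..DIM('e)}. complex_of_real (v \<bullet> y i) \<cdot> Ye (y i))"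
 using Ye_sum[of "{1..DIM('e)}" "%i. v \<bullet> y i" y] by (simp only: y_expand finite_atLeastAtMost)

definition Xw :: "nat list => 'e cher" where "Xw l = foldr (%i z. Xe (x i) \<star> z) l \<one>\<^bsub>HH\<^esub>"
definition Yw :: "nat list => 'e cher" where "Yw l = foldr (%i z. Ye (y i) \<star> z) l \<one>\<^bsub>HH\<^esub>"

lemma Xw_simps [simp]: "Xw [] = \<one>\<^bsub>HH\<^esub>" "Xw (i # l) = Xe (x i) \<star> Xw l"
 and Yw_simps [simp]: "Yw [] = \<one>\<^bsub>HH\<^esub>" "Yw (i # l) = Ye (y i) \<star> Yw l" by (simp_all add: Xw_def Yw_def)

lemma XYw_closed [simp, intro]: "Xw l : carrier HH" "Yw l : carrier HH" by (induction l) auto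

lemma Xw_insort: "Xw (insort i l) = Xe (x i) \<star> Xw l"
proof (induction l)
 case (Cons j l)
 thus ?case using Xe_Xe[of "x i" "x j"] by (simp add: HK.m_assoc[symmetric])
qed simp

lemma Yw_insort: "Yw (insort i l) = Ye (y i) \<star> Yw l"
proof (induction l)
 case (Cons j l)
 thus ?case using Ye_Ye[of "y i" "y j"] by (simp add: HK.m_assoc[symmetric])
qed simp

definition BT :: "(nat list \<times> ('e => 'e) \<times> nat list) set" where
 "BT = {(l, w, j). sorted l & set l \<subseteq> {1..DIM('e)} & w : W & sorted j & set j \<subseteq> {1..DIM('e)}}"

definition bm :: "nat list \<times> ('e => 'e) \<times> nat list => 'e cher" where
 "bm = (%(l, w, j). Xw l \<star> (We w \<star> Yw j))"

lemma bm_closed: "bm ` BT \<subseteq> carrier HH" by (auto simp: BT_def bm_def)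

text \<open>Normal ordering x, w, y. Stability under x and under the group is direct; for y one
  moves through the word in x letter by letter, and the commutators produce reflections, for which
  stability is already known.\<close>

lemma cher_basis_span: "carrier HH = lspan HH (bm ` BT)" unfolding HH_eq
proof (rule H.span_generators; unfold HH_eq[symmetric])
 let ?L = "lspan HH (bm ` BT)"
 show bc: "bm ` BT \<subseteq> carrier HH" by (rule bm_closed)
 have b_in: "Xw l \<star> (We w \<star> Yw j) : ?L" if "sorted l" "set l \<subseteq> {1..DIM('e)}" "w : W" "sorted j" "set j \<subseteq> {1..DIM('e)}" for l w j
  using HK.lspan_incl[OF bc, of "bm (l, w, j)"] that by (auto simp: BT_def bm_def)
 show "\<one>\<^bsub>HH\<^esub> : ?L" using b_in[of "[]" id "[]"] by (simp add: We_id)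
 have Lc: "z : carrier HH" if "z : ?L" for z using HK.lspan_closed[OF bc that] .
 have X1: "Xe \<xi> \<star> bm t : ?L" if "t : BT" for \<xi> t
 proof -
  obtain l w j where t: "t = (l, w, j)" by (cases t)
  have tt: "sorted l" "set l \<subseteq> {1..DIM('e)}" "w : W" "sorted j" "set j \<subseteq> {1..DIM('e)}" using that by (auto simp: BT_def t)
  have "Xe (x i) \<star> bm t : ?L" if "i : {1..DIM('e)}" for i
  proof -
   have "Xe (x i) \<star> bm t = Xw (insort i l) \<star> (We w \<star> Yw j)" using tt by (simp add: bm_def t Xw_insort HK.m_assoc)
   thus ?thesis using b_in[of "insort i l" w j] tt that by (simp add: sorted_insort set_insort_key)
  qed
  hence "(\<Oplus>\<^bsub>HH\<^esub>i\<in>{1..DIM('e)}. complex_of_real (riesz \<xi> \<bullet> y i) \<cdot> (Xe (x i) \<star> bm t)) : ?L"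
   by (intro HK.lspan_finsum[OF bc] Pi_I HK.lspan_smult[OF bc])
  moreover have btc: "bm t : carrier HH" using bc \<open>t : BT\<close> by auto
  have "Xe \<xi> \<star> bm t = (\<Oplus>\<^bsub>HH\<^esub>i\<in>{1..DIM('e)}. complex_of_real (riesz \<xi> \<bullet> y i) \<cdot> (Xe (x i) \<star> bm t))"
   using btc by (subst Xe_expand, subst HK.finsum_ldistr) (auto simp: HK.smult_mult_l)
  ultimately show ?thesis by simp
 qed
 have XL: "Xe \<xi> \<star> z : ?L" if "z : ?L" for \<xi> z by (rule HK.lspan_mult_left[OF bc bc gens_closed(1) _ that]) (use X1 in auto)
 have W1: "We g \<star> (Xw l \<star> (We w \<star> Yw j)) : ?L"
  if "g : W" "set l \<subseteq> {1..DIM('e)}" "w : W" "sorted j" "set j \<subseteq> {1..DIM('e)}" for g l w j using that(2)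
 proof (induction l)
  case Nil
  have "We g \<star> (We w \<star> Yw j) = We (g o w) \<star> Yw j" using that by (simp add: We_We HK.m_assoc[symmetric])
  thus ?case using b_in[of "[]" "g o w" j] that by simp
 next
  case (Cons i l)
  let ?r = "Xw l \<star> (We w \<star> Yw j)"
  have "We g \<star> (Xw (i # l) \<star> (We w \<star> Yw j)) = (We g \<star> Xe (x i)) \<star> ?r" using that by (simp add: HK.m_assoc)
  also have "... = Xe (dual_act g (x i)) \<star> (We g \<star> ?r)" using that by (simp add: We_Xe HK.m_assoc)
  finally show ?case using XL Cons by simp
 qed
 have WL: "We g \<star> z : ?L" if "z : ?L" "g : W" for g z
  by (rule HK.lspan_mult_left[OF bc bc gens_closed(3)[OF that(2)] _ that(1)]) (use W1 that(2) in \<open>auto simp: BT_def bm_def\<close>)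
 have Y1: "Ye v \<star> (Xw l \<star> (We w \<star> Yw j)) : ?L"
  if "sorted l" "set l \<subseteq> {1..DIM('e)}" "w : W" "sorted j" "set j \<subseteq> {1..DIM('e)}" for v l w j using that(1,2)
 proof (induction l arbitrary: v)
  case Nil
  \<comment> \<open>The relation y w = w (w^-1 y) lets y pass the group element and join the word in
    y.\<close>
  let ?v = "ivf w v"
  have "Ye v \<star> (We w \<star> Yw j) = We w \<star> (Ye ?v \<star> Yw j)"
   using that We_Ye[of w ?v] W_orth[OF that(3)] by (simp add: HK.m_assoc[symmetric])
  moreover have "Ye ?v \<star> Yw j : ?L"
  proof -
   have "Ye (y i) \<star> Yw j : ?L" if "i : {1..DIM('e)}" for i
    using b_in[of "[]" id "insort i j"] that \<open>sorted j\<close> \<open>set j \<subseteq> {1..DIM('e)}\<close> by (simp add: sorted_insort set_insort_key We_id Yw_insort)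
   hence "(\<Oplus>\<^bsub>HH\<^esub>i\<in>{1..DIM('e)}. complex_of_real (?v \<bullet> y i) \<cdot> (Ye (y i) \<star> Yw j)) : ?L"
    by (intro HK.lspan_finsum[OF bc] Pi_I HK.lspan_smult[OF bc])
   moreover have "Ye ?v \<star> Yw j = (\<Oplus>\<^bsub>HH\<^esub>i\<in>{1..DIM('e)}. complex_of_real (?v \<bullet> y i) \<cdot> (Ye (y i) \<star> Yw j))"
    by (subst Ye_expand, subst HK.finsum_ldistr) (auto simp: HK.smult_mult_l)
   ultimately show ?thesis by simp
  qed
  ultimately show ?case using WL that by simp
 next
  case (Cons i l)
  let ?r = "Xw l \<star> (We w \<star> Yw j)"
  have r: "?r : ?L" using Cons that b_in by simp
  have rc: "?r : carrier HH" using that by simp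
  let ?S = "\<Oplus>\<^bsub>HH\<^esub>\<alpha>\<in>Rp. (c \<alpha> * complex_of_real (blinfun_apply \<alpha> v * blinfun_apply (x i) (coroot \<alpha>))) \<cdot> We (Defs.refl \<alpha>)"
  let ?k = "complex_of_real (blinfun_apply (x i) v)"
  have Sc: "?S : carrier HH" by (intro HK.finsum_closed Pi_I HK.smult_closed gens_closed refl_W)
  have "Ye v \<star> (Xw (i # l) \<star> (We w \<star> Yw j)) = (Ye v \<star> Xe (x i)) \<star> ?r" using that by (simp add: HK.m_assoc)
  also have "... = Xe (x i) \<star> (Ye v \<star> ?r) \<oplus>\<^bsub>HH\<^esub> (?k \<cdot> ?r \<oplus>\<^bsub>HH\<^esub> ?S \<star> ?r)"
   using rc Sc by (simp only: Ye_Xe HK.l_distr HK.m_assoc HK.smult_mult_l HK.l_one gens_closed HK.m_closed HK.a_closed HK.smult_closed HK.one_closed)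
  also have "?S \<star> ?r = (\<Oplus>\<^bsub>HH\<^esub>\<alpha>\<in>Rp. (c \<alpha> * complex_of_real (blinfun_apply \<alpha> v * blinfun_apply (x i) (coroot \<alpha>))) \<cdot> (We (Defs.refl \<alpha>) \<star> ?r))"
  proof (subst HK.finsum_ldistr)
   show "finite Rp" using finR' Rp_sub finite_subset by blast
   show "(\<Oplus>\<^bsub>HH\<^esub>\<alpha>\<in>Rp. (c \<alpha> * complex_of_real (blinfun_apply \<alpha> v * blinfun_apply (x i) (coroot \<alpha>))) \<cdot> We (Defs.refl \<alpha>) \<star> ?r)
    = (\<Oplus>\<^bsub>HH\<^esub>\<alpha>\<in>Rp. (c \<alpha> * complex_of_real (blinfun_apply \<alpha> v * blinfun_apply (x i) (coroot \<alpha>))) \<cdot> (We (Defs.refl \<alpha>) \<star> ?r))"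
    using rc by (intro HK.finsum_cong') (auto simp: HK.smult_mult_l)
  qed (use rc in auto)
  finally have e: "Ye v \<star> (Xw (i # l) \<star> (We w \<star> Yw j)) = Xe (x i) \<star> (Ye v \<star> ?r) \<oplus>\<^bsub>HH\<^esub>
    (?k \<cdot> ?r \<oplus>\<^bsub>HH\<^esub> (\<Oplus>\<^bsub>HH\<^esub>\<alpha>\<in>Rp. (c \<alpha> * complex_of_real (blinfun_apply \<alpha> v * blinfun_apply (x i) (coroot \<alpha>))) \<cdot> (We (Defs.refl \<alpha>) \<star> ?r)))" .
  have IH: "Ye v \<star> ?r : ?L" using Cons by simp
  show ?case unfolding e by (intro HK.lspan_add[OF bc] HK.lspan_smult[OF bc] XL IH r HK.lspan_finsum[OF bc] Pi_I WL refl_W)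
 qed
 fix g s assume g: "g : G" and "s : bm ` BT"
 then obtain l w j where s: "s = Xw l \<star> (We w \<star> Yw j)" "(l, w, j) : BT" by (auto simp: bm_def)
 hence sL: "s : ?L" using \<open>s : bm ` BT\<close> HK.lspan_incl[OF bc] by blast
 show "H.gn g \<star> s : ?L"
 proof (cases g)
  case (GX \<xi>)
  thus ?thesis using XL[OF sL, of \<xi>] by (simp add: Xe_def elt_eq)
 next
  case (GY v)
  thus ?thesis using Y1[of l w j v] s by (simp add: Ye_def elt_eq BT_def)
 next
  case (GW w)
  hence "w : W" using g by auto
  thus ?thesis using WL[OF sL, of w] GW by (simp add: We_def elt_eq)
 qed
qed

lemma lspan_finite_sum:
 assumes "z : lspan HH (bm ` BT)"
 shows "\<exists>F k. finite F & F \<subseteq> BT & z = (\<Oplus>\<^bsub>HH\<^esub>t\<in>F. k t \<cdot> bm t)" using assms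
proof (induction rule: lspan.induct)
 case zero
 show ?case by (intro exI[of _ "{}"]) simp
next
 case (step s z l)
 then obtain F k t where F: "finite F" "F \<subseteq> BT" "z = (\<Oplus>\<^bsub>HH\<^esub>t\<in>F. k t \<cdot> bm t)" and t: "t : BT" "s = bm t" by blast
 have c: "u : BT ==> bm u : carrier HH" for u using bm_closed by auto
 define m where "m u = (if u = t then l + (if t : F then k t else 0) else k u)" for u
 have m': "(\<Oplus>\<^bsub>HH\<^esub>u\<in>F - {t}. m u \<cdot> bm u) = (\<Oplus>\<^bsub>HH\<^esub>u\<in>F - {t}. k u \<cdot> bm u)"
  by (rule HK.finsum_cong') (use F c in \<open>auto simp: m_def\<close>)
 have cl: "(\<Oplus>\<^bsub>HH\<^esub>u\<in>F - {t}. k u \<cdot> bm u) : carrier HH"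
  using F(2) c by (intro HK.finsum_closed Pi_I HK.smult_closed) auto
 have "(\<Oplus>\<^bsub>HH\<^esub>u\<in>insert t (F - {t}). m u \<cdot> bm u) = m t \<cdot> bm t \<oplus>\<^bsub>HH\<^esub> (\<Oplus>\<^bsub>HH\<^esub>u\<in>F - {t}. m u \<cdot> bm u)"
  by (rule HK.finsum_insert) (use F c t in auto)
 also have "... = l \<cdot> bm t \<oplus>\<^bsub>HH\<^esub> z"
 proof (cases "t : F")
  case True
  have "z = (\<Oplus>\<^bsub>HH\<^esub>u\<in>insert t (F - {t}). k u \<cdot> bm u)" using F(3) True by (simp add: insert_absorb)
  also have "... = k t \<cdot> bm t \<oplus>\<^bsub>HH\<^esub> (\<Oplus>\<^bsub>HH\<^esub>u\<in>F - {t}. k u \<cdot> bm u)"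
   by (rule HK.finsum_insert) (use F c t in auto)
  finally show ?thesis unfolding m' using True cl c[OF t(1)] by (simp add: m_def HK.smult_l_distr HK.a_assoc)
 next
  case False
  thus ?thesis unfolding m' using F(3) c[OF t(1)] by (simp add: m_def)
 qed
 finally show ?case using F t by (intro exI[of _ "insert t (F - {t})"] exI[of _ m]) auto
qed

section \<open>Coordinates of an element with respect to the normally ordered basis, and
  faithfulness\<close>

definition vac :: "'e vv" where "vac = dl 0 {} id"

text \<open>Acting on the vector of 1 returns the element itself in coordinates: the part of degree
  k in y that goes with the group element w. The Clifford index stays empty.\<close>

definition sy :: "'e cher => nat => ('e => 'e) => ('e \<times> 'e) pf" where
 "sy z k w = app (pr z) vac k {} w"

definition mon1 :: "nat list => ('e \<times> 'e) pf" where "mon1 l = (\<Prod>i\<in>#mset l. lin (y i, 0))"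
definition mon2 :: "nat list => ('e \<times> 'e) pf" where "mon2 l = (\<Prod>i\<in>#mset l. lin (0, y i))"

lemma app_Yw: "app (pr (Yw j)) vac = app (Mo (mon2 j)) (dl (length j) {} id)"
proof (induction j)
 case Nil
 thus ?case by (simp add: vac_def mon2_def id_def)
next
 case (Cons i j)
 have o: "orth (id :: 'e => 'e)" by (rule W_orth) simp
 have To_mon2: "To v * Mo (mon2 j) = Mo (mon2 j) * To v" for v
 proof (induction j)
  case Nil
  have "Mo (mon2 []) = (1 :: 'e op)" by (rule op_eqI) (simp add: mon2_def)
  thus ?case by simp
 next
  case (Cons i j)
  have e: "Mo (mon2 (i # j)) = Mo (lin (0, y i)) * Mo (mon2 j)" by (simp add: mon2_def Mo_simps)
  have "To v * Mo (mon2 (i # j)) = Mo (lin (0, y i)) * (To v * Mo (mon2 j))" unfolding e mult.assoc[symmetric] To_Mo2 ..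
  thus ?case unfolding Cons e mult.assoc .
 qed
 have "app (pr (Yw (i # j))) vac = app (To (y i)) (app (Mo (mon2 j)) (dl (length j) {} id))"
  by (simp only: Yw_simps pr.mult gens_closed XYw_closed talg_simps pr_gens app_simps Cons.IH)
 also have "... = app (Mo (mon2 j)) (app (To (y i)) (dl (length j) {} id))" using To_mon2[of "y i"] by (metis app_simps(4))
 also have "... = app (Mo (mon2 (i # j))) (dl (length (i # j)) {} id)" using o by (simp add: To_dl inv_id mon2_def fun_eq_iff)
 finally show ?case .
qed

lemma app_Wo_Mo2:
 assumes w: "orth w"
 shows "app (Wo w) (app (Mo (mon2 j)) (dl k {} id)) = app (Mo (mon2 j)) (dl k {} w)"
proof -
 have l: "linear (fs (ivf w))" by (intro linear_fs orth_linear orth_inv w)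
 have s: "sub (fs (ivf w)) (mon2 j) = mon2 j"
 proof (induction j)
  case (Cons i j)
  have "sub (fs (ivf w)) (lin (0, y i)) = lin (0, y i)" using linear_0[OF orth_linear[OF w]] by (simp add: sub_fs_lin1 w)
  thus ?case using Cons by (simp add: mon2_def sub_simps[OF l])
 qed (simp add: mon2_def sub_simps[OF l])
 have iw: "ivf w o v = id \<longleftrightarrow> v = w" for v using w by (auto simp: fun_eq_iff) (metis orth_inv_app(2))
 show ?thesis by (intro ext) (auto simp: app_Wo w sub_simps[OF l] s dl_def iw)
qed

lemma app_bm: "t : BT ==> app (pr (bm t)) vac =
  (case t of (l, w, j) => app (Mo (mon1 l * mon2 j)) (dl (length j) {} w))"
proof -
 assume t: "t : BT"
 obtain l w j where t': "t = (l, w, j)" by (cases t)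
 have w: "w : W" and l: "set l \<subseteq> {1..DIM('e)}" using t by (auto simp: BT_def t')
 have X: "pr (Xw l) = Mo (mon1 l)" using l
 proof (induction l)
  case Nil
  show ?case by (rule op_eqI) (simp add: mon1_def)
 next
  case (Cons i l)
  thus ?case by (simp add: pr_gens riesz_x mon1_def Mo_simps)
 qed
 have "app (pr (bm t)) vac = app (Mo (mon1 l)) (app (Wo w) (app (pr (Yw j)) vac))" using w by (simp add: t' bm_def pr_gens X del: app_Mo)
 also have "... = app (Mo (mon1 l * mon2 j)) (dl (length j) {} w)"
  unfolding app_Yw app_Wo_Mo2[OF W_orth[OF w]] Mo_simps by (simp del: app_Mo)
 finally show ?thesis by (simp add: t')
qed

text \<open>The words in x and in y are merged into one monomial over the disjoint union of two
  alphabets, the form required by \<open>monomials_independent\<close>.\<close>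

definition lrm :: "nat list \<times> ('e => 'e) \<times> nat list => (nat + nat) multiset" where
 "lrm = (%(l, w, j). image_mset Inl (mset l) + image_mset Inr (mset j))"

lemma lrm_inj: "sorted l ==> sorted j ==> sorted l' ==> sorted j' ==> lrm (l, w, j) = lrm (l', w', j') ==> l = l' & j = j'"
proof -
 assume s: "sorted l" "sorted j" "sorted l'" "sorted j'" and e: "lrm (l, w, j) = lrm (l', w', j')"
 have c: "sum (count (mset l)) ({i} \<inter> set l) = count (mset l) i" for l and i :: nat
  by (cases "i : set l") (auto simp: count_eq_zero_iff)
 have "count (lrm (l, w, j)) (Inl i) = count (mset l) i" "count (lrm (l, w, j)) (Inr i) = count (mset j) i" for l w j i
  using c by (simp_all add: lrm_def count_image_mset vimage_def)
 hence "mset l = mset l'" "mset j = mset j'" using e by (metis multiset_eqI)+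
 thus ?thesis using s by (metis sorted_list_of_multiset_mset sorted_sort_id)
qed

text \<open>The basis element with words l, j and group element w shows up at level
  \<open>length j\<close> and index w as one monomial. Fixing level and index leaves a relation
  among distinct monomials, so every coefficient vanishes.\<close>

lemma sy_zero:
 assumes z: "z : carrier HH" and 0: "\<And>k w. w : W ==> sy z k w = 0"
 shows "z = \<zero>\<^bsub>HH\<^esub>"
proof -
 obtain F k where F: "finite F" "F \<subseteq> BT" and zF: "z = (\<Oplus>\<^bsub>HH\<^esub>t\<in>F. k t \<cdot> bm t)"
  using lspan_finite_sum z unfolding cher_basis_span by blast
 have c: "u : BT ==> bm u : carrier HH" for u using bm_closed by auto
 have "pr z = (\<Sum>t\<in>F. sc (k t) * pr (bm t))"
  unfolding zF by (subst pr.finsum) (use F c in \<open>auto simp: talg_finsum intro!: sum.cong\<close>)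
 hence az: "app (pr z) vac = (\<Sum>t\<in>F. smv (k t) (app (pr (bm t)) vac))" by (simp add: app_op_sum)
 have "k t = 0" if t: "t : F" for t
 proof -
  obtain l0 w0 j0 where t0: "t = (l0, w0, j0)" by (cases t)
  have w0: "w0 : W" using t F by (auto simp: BT_def t0)
  let ?n = "length j0"
  let ?F = "{(l, w, j). (l, w, j) : F & w = w0 & length j = ?n}"
  have sub: "?F \<subseteq> F" by auto
  have fin: "finite ?F" using F(1) sub by (rule rev_finite_subset)
  have "0 = sy z ?n w0" using 0 w0 by simp
  also have "... = (\<Sum>t\<in>F. smv (k t) (app (pr (bm t)) vac) ?n {} w0)" by (simp add: sy_def az sum_vv)
  also have "... = (\<Sum>t\<in>?F. const (k t) * (mon1 (fst t) * mon2 (snd (snd t))))"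
  proof (rule sum.mono_neutral_cong_right[OF F(1) sub])
   show "\<forall>t\<in>F - ?F. smv (k t) (app (pr (bm t)) vac) ?n {} w0 = 0"
    using F(2) by (auto simp: app_bm subset_iff smv_def dl_def split: if_splits)
   show "smv (k t) (app (pr (bm t)) vac) ?n {} w0 = const (k t) * (mon1 (fst t) * mon2 (snd (snd t)))" if "t : ?F" for t
    using that F(2) by (auto simp: app_bm subset_iff smv_def dl_def)
  qed
  finally have s0: "(\<Sum>t\<in>?F. const (k t) * (mon1 (fst t) * mon2 (snd (snd t)))) = 0" by simp
  have inj: "inj_on lrm ?F"
  proof (rule inj_onI)
   fix a b assume ab: "a : ?F" "b : ?F" "lrm a = lrm b"
   obtain l w j l' w' j' where e: "a = (l, w, j)" "b = (l', w', j')" by (cases a, cases b)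
   have "sorted l" "sorted j" "sorted l'" "sorted j'" using ab F(2) by (auto simp: BT_def e)
   thus "a = b" using lrm_inj[of l j l' j' w w'] ab by (auto simp: e)
  qed
  define kk where "kk m = k (the_inv_into ?F lrm m)" for m
  have kk: "kk (lrm t) = k t" if "t : ?F" for t using the_inv_into_f_f[OF inj that] by (simp add: kk_def)
  let ?I = "Inl ` {1..DIM('e)} \<union> Inr ` {1..DIM('e)}"
  have tF: "t : ?F" using t by (simp add: t0)
  have "kk (lrm t) = 0"
  proof (rule monomials_independent[of ?I "lrm ` ?F"])
   show "finite ?I" by simp
   show "finite (lrm ` ?F)" using fin by simp
   show "set_mset m \<subseteq> ?I" if "m : lrm ` ?F" for m
   proof -
    from that obtain l w j where "(l, w, j) : F" "m = lrm (l, w, j)" by auto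
    moreover from this have "set l \<subseteq> {1..DIM('e)}" "set j \<subseteq> {1..DIM('e)}" using F(2) by (auto simp: BT_def)
    ultimately show ?thesis unfolding lrm_def by (auto simp del: atLeastAtMost_iff)
   qed
   show "lrm t : lrm ` ?F" using tF by simp
   fix r :: "nat + nat => real"
   \<comment> \<open>Points with prescribed coordinates, so that evaluating the monomials in x and
     xi realises arbitrary values r of the variables.\<close>
   define v where "v = (\<Sum>i\<in>{1..DIM('e)}. r (Inl i) *\<^sub>R y i)"
   define \<xi> where "\<xi> = (\<Sum>i\<in>{1..DIM('e)}. r (Inr i) *\<^sub>R y i)"
   have vi: "v \<bullet> y i = r (Inl i)" "\<xi> \<bullet> y i = r (Inr i)" if "i : {1..DIM('e)}" for i
   proof -
    have "(\<Sum>j\<in>{1..DIM('e)}. f j * (y j \<bullet> y i)) = (\<Sum>j\<in>{1..DIM('e)}. if j = i then f j else 0)" for f :: "nat => real"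
     by (rule sum.cong[OF HOL.refl]) (use that y_inner in auto)
    thus "v \<bullet> y i = r (Inl i)" "\<xi> \<bullet> y i = r (Inr i)" using that by (simp_all add: v_def \<xi>_def inner_sum_left)
   qed
   have e: "ev (mon1 (fst t) * mon2 (snd (snd t))) (v, \<xi>) = (\<Prod>i\<in>#lrm t. of_real (r i))" if "t : ?F" for t
   proof -
    obtain l w j where tt: "t = (l, w, j)" by (cases t)
    have s: "set l \<subseteq> {1..DIM('e)}" "set j \<subseteq> {1..DIM('e)}" using that F(2) by (auto simp: BT_def tt)
    have "ev (mon1 l) (v, \<xi>) = (\<Prod>i\<in>#mset l. of_real (r (Inl i)))"
     unfolding mon1_def ev_prod_mset by (rule arg_cong[of _ _ prod_mset], rule image_mset_cong) (use s vi in auto)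
    moreover have "ev (mon2 j) (v, \<xi>) = (\<Prod>i\<in>#mset j. of_real (r (Inr i)))"
     unfolding mon2_def ev_prod_mset by (rule arg_cong[of _ _ prod_mset], rule image_mset_cong) (use s vi in auto)
    ultimately show ?thesis by (simp add: tt lrm_def image_mset.compositionality comp_def)
   qed
   have "(\<Sum>m\<in>lrm ` ?F. kk m * (\<Prod>i\<in>#m. of_real (r i))) = (\<Sum>t\<in>?F. kk (lrm t) * (\<Prod>i\<in>#lrm t. of_real (r i)))"
    by (rule sum.reindex_cong[OF inj]) auto
   also have "... = (\<Sum>t\<in>?F. ev (const (k t) * (mon1 (fst t) * mon2 (snd (snd t)))) (v, \<xi>))"
   proof (rule sum.cong[OF HOL.refl])
    fix t assume t: "t : ?F"
    show "kk (lrm t) * (\<Prod>i\<in>#lrm t. of_real (r i)) = ev (const (k t) * (mon1 (fst t) * mon2 (snd (snd t)))) (v, \<xi>)"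
     unfolding ev_simps(4) e[OF t, symmetric] kk[OF t] by simp
   qed
   also have "... = 0" using s0 unfolding ev_sum[symmetric] by simp
   finally show "(\<Sum>m\<in>lrm ` ?F. kk m * (\<Prod>i\<in>#m. of_real (r i))) = 0" .
  qed
  thus ?thesis using kk[OF tF] by simp
 qed
 hence "z = (\<Oplus>\<^bsub>HH\<^esub>t\<in>F. \<zero>\<^bsub>HH\<^esub>)" unfolding zF by (intro HK.finsum_cong') (use F c in auto)
 thus ?thesis by simp
qed

lemma sy_eqI:
 assumes "z : carrier HH" "z' : carrier HH" "\<And>k w. w : W ==> sy z k w = sy z' k w"
 shows "z = z'"
proof -
 have "z \<ominus>\<^bsub>HH\<^esub> z' = \<zero>\<^bsub>HH\<^esub>" by (rule sy_zero) (use assms in \<open>simp_all add: sy_def\<close>)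
 thus ?thesis using assms by (simp add: HK.minus_eq_zero)
qed

lemma pr_inj: "z : carrier HH ==> z' : carrier HH ==> pr z = pr z' ==> z = z'" by (rule sy_eqI) (simp_all add: sy_def)

lemma sy_simps:
 assumes "z : carrier HH" "z' : carrier HH"
 shows "sy (z \<oplus>\<^bsub>HH\<^esub> z') k w = sy z k w + sy z' k w" "sy (z \<ominus>\<^bsub>HH\<^esub> z') k w = sy z k w - sy z' k w"
  "sy (a \<cdot> z) k w = const a * sy z k w" using assms by (simp_all add: sy_def smv_def)

lemma sy_one: "sy \<one>\<^bsub>HH\<^esub> k w = (if k = 0 & w = id then 1 else 0)" by (simp add: sy_def vac_def dl_def)

lemma sy_Xe: "z : carrier HH ==> sy (Xe \<xi> \<star> z) k w = lin (riesz \<xi>, 0) * sy z k w" by (simp add: sy_def pr_gens)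

lemma sy_We: "z : carrier HH ==> g : W ==> sy (We g \<star> z) k w = sub (fs (ivf g)) (sy z k (ivf g o w))"
 by (simp add: sy_def pr_gens app_Wo W_orth)

lemma sy_Ye: "z : carrier HH ==> w : W ==> sy (Ye v \<star> z) k w = pd (v, 0) (sy z k w)
   + (if k = 0 then 0 else lin (0, ivf w v) * sy z (k - 1) w)
   + (\<Sum>a\<in>Ph. const (h a * of_real (a \<bullet> v)) * dd (a, 0) (sy z k (rf a o w)))" by (simp add: sy_def pr_gens app_To W_orth)

text \<open>Induction along left multiplication by generators. It is the means to prove formulas for
  right multiplication, which commutes with it.\<close>

lemma HH_induct [consumes 1, case_names one add smult X Y W]:
 assumes z: "z : carrier HH" and one: "P \<one>\<^bsub>HH\<^esub>"
  and add: "\<And>z z'. z : carrier HH ==> z' : carrier HH ==> P z ==> P z' ==> P (z \<oplus>\<^bsub>HH\<^esub> z')"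
  and smult: "\<And>a z. z : carrier HH ==> P z ==> P (a \<cdot> z)"
  and X: "\<And>u z. z : carrier HH ==> P z ==> P (Xe u \<star> z)"
  and Y: "\<And>v z. z : carrier HH ==> P z ==> P (Ye v \<star> z)"
  and W: "\<And>g z. z : carrier HH ==> g : W ==> P z ==> P (We g \<star> z)"
 shows "P z"
proof -
 let ?S = "{z : carrier HH. P z}"
 have S: "?S \<subseteq> carrier HH" by auto
 have "carrier HH = lspan HH ?S" unfolding HH_eq
 proof (rule H.span_generators; unfold HH_eq[symmetric])
  show "?S \<subseteq> carrier HH" by (rule S)
  show "\<one>\<^bsub>HH\<^esub> : lspan HH ?S" by (rule HK.lspan_incl[OF S]) (simp add: one)
  fix g s assume g: "g : G" and s: "s : ?S"
  have "H.gn g \<star> s : ?S"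
  proof (cases g)
   case (GX \<xi>)
   thus ?thesis using X[of s \<xi>] s gens_closed(1)[of \<xi>] by (simp add: Xe_def elt_eq)
  next
   case (GY v)
   thus ?thesis using Y[of s v] s gens_closed(2)[of v] by (simp add: Ye_def elt_eq)
  next
   case (GW w)
   hence "w : W" using g by auto
   thus ?thesis using W[of s w] s gens_closed(3)[of w] GW by (simp add: We_def elt_eq)
  qed
  thus "H.gn g \<star> s : lspan HH ?S" by (rule HK.lspan_incl[OF S])
 qed
 hence "z : lspan HH ?S" using z by simp
 hence "z : carrier HH & P z"
 proof (induction rule: lspan.induct)
  case zero
  show ?case using smult[OF HK.one_closed one, of 0] by simp
 next
  case (step s t k)
  thus ?case using add smult by auto
 qed
 thus ?thesis by simp
qed

end

section \<open>The Casimir element and the Dirac operator\<close>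

lemma op_cancel: "k ~= 0 ==> sc k * F = sc k * G ==> F = G"
proof -
 assume k: "k ~= 0" and e: "sc k * F = sc k * G"
 have "sc (inverse k) * (sc k * F) = F" for F :: "'a op" using k by (simp add: mult.assoc[symmetric] sc_simps(4)[symmetric] sc_simps(2))
 thus ?thesis using e by metis
qed

lemma commute_prod:
 fixes F P Q :: "'a::semigroup_mult"
 assumes "F * P = P * F" "F * Q = Q * F"
 shows "F * (P * Q) = (P * Q) * F" unfolding mult.assoc[of P] assms(2)[symmetric] by (simp only: mult.assoc[symmetric] assms(1))

lemma sc_prod: "(sc a * F) * (sc b * G) = sc (a * b) * (F * G)" by (simp only: mult.assoc sc_left[of F] sc_simps(4))

lemma sum_offdiag:
 fixes f :: "nat => nat => 'a::ab_group_add"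
 shows "(\<Sum>i\<in>{1..n}. \<Sum>j\<in>{1..n}. f i j) = (\<Sum>i\<in>{1..n}. f i i) + (\<Sum>(i, j)\<in>{(i, j). 1 \<le> i & i < j & j \<le> n}. f i j + f j i)"
proof -
 let ?L = "{(i, j). 1 \<le> i & i < j & j \<le> n}"
 have finL: "finite ?L" by (rule finite_subset[of _ "{1..n} \<times> {1..n}"]) auto
 have fin2: "finite (prod.swap ` ?L)" using finL by simp
 have d: "{1..n} \<times> {1..n} = (%i. (i, i)) ` {1..n} \<union> (?L \<union> prod.swap ` ?L)" by (auto simp: image_iff)
 have "(\<Sum>i\<in>{1..n}. \<Sum>j\<in>{1..n}. f i j) = (\<Sum>(i, j)\<in>{1..n} \<times> {1..n}. f i j)" by (rule sum.cartesian_product)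
 also have "... = (\<Sum>(i, j)\<in>(%i. (i, i)) ` {1..n}. f i j) + (\<Sum>(i, j)\<in>?L \<union> prod.swap ` ?L. f i j)"
  unfolding d by (rule sum.union_disjoint) (use finL fin2 in auto)
 also have "(\<Sum>(i, j)\<in>?L \<union> prod.swap ` ?L. f i j) = (\<Sum>(i, j)\<in>?L. f i j) + (\<Sum>(i, j)\<in>prod.swap ` ?L. f i j)"
  by (rule sum.union_disjoint) (use finL fin2 in auto)
 also have "(\<Sum>(i, j)\<in>prod.swap ` ?L. f i j) = (\<Sum>(i, j)\<in>?L. f j i)"
  by (subst sum.reindex) (auto simp: split_def intro!: inj_onI)
 also have "(\<Sum>(i, j)\<in>(%i. (i, i)) ` {1..n}. f i j) = (\<Sum>i\<in>{1..n}. f i i)" by (subst sum.reindex) (auto simp: inj_on_def)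
 finally show ?thesis by (simp add: sum.distrib[symmetric] split_def)
qed

context cherednik
begin

section \<open>The sl(2)-triple of Dunkl operators and its commutation relations\<close>

abbreviation "xi i \<equiv> Xo (y i)"
abbreviation "ti i \<equiv> To (y i)"

definition r2 :: "'e op" where "r2 = (\<Sum>i\<in>{1..DIM('e)}. xi i * xi i)"
definition la :: "'e op" where "la = (\<Sum>i\<in>{1..DIM('e)}. ti i * ti i)"
definition eu :: "'e op" where "eu = (\<Sum>i\<in>{1..DIM('e)}. xi i * ti i)"
definition Zo :: "'e op" where "Zo = (\<Sum>a\<in>Ph. sc (h a) * Wo (rf a))"
definition Ho :: "'e op" where "Ho = sc (1/2) * (\<Sum>i\<in>{1..DIM('e)}. xi i * ti i + ti i * xi i)"
definition Om :: "'e op" where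
 "Om = Ho * Ho + sc 2 * ((sc (-1/2) * r2) * (sc (1/2) * la) + (sc (1/2) * la) * (sc (-1/2) * r2))"
definition Ko :: "'e => 'e => 'e op" where "Ko u v = To v * Xo u - Xo u * To v"
definition Mm :: "'e => 'e => 'e op" where "Mm u v = Xo u * To v - Xo v * To u"
definition kap :: "'e => complex" where "kap a = 2 * h a / of_real (a \<bullet> a)"

lemma Ko_eq: "Ko u v = sc (of_real (u \<bullet> v)) + (\<Sum>a\<in>Ph. sc (kap a * of_real ((a \<bullet> u) * (a \<bullet> v))) * Wo (rf a))"
 unfolding Ko_def To_Xo by (simp add: kap_def inner_commute mult_ac)

text \<open>A coroot is a multiple of its root, so the coefficient of a reflection in [T_v, X_u] is
  \<open>kap a\<close> times (a.u)(a.v).\<close>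

lemma Ko_sym: "Ko u v = Ko v u" unfolding Ko_eq by (simp add: inner_commute mult_ac)

lemma To_expand: "To v = (\<Sum>i\<in>{1..DIM('e)}. sc (of_real (v \<bullet> y i)) * ti i)"
proof -
 have "To (\<Sum>i\<in>I. f i *\<^sub>R y i) = (\<Sum>i\<in>I. sc (of_real (f i)) * ti i)" if "finite I" for I f
  using that by (induction I rule: finite_induct) (use To_scale[of 0 0] in \<open>simp_all add: sc_simps To_add To_scale\<close>)
 from this[of "{1..DIM('e)}" "%i. v \<bullet> y i"] show ?thesis by (simp only: y_expand finite_atLeastAtMost)
qed

lemma Xo_expand: "Xo v = (\<Sum>i\<in>{1..DIM('e)}. sc (of_real (v \<bullet> y i)) * xi i)"
proof -
 have "Xo (\<Sum>i\<in>I. f i *\<^sub>R y i) = (\<Sum>i\<in>I. sc (of_real (f i)) * xi i)" if "finite I" for I f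
  using that by (induction I rule: finite_induct) (use Xo_scale[of 0 0] in \<open>simp_all add: sc_simps Xo_add Xo_scale\<close>)
 from this[of "{1..DIM('e)}" "%i. v \<bullet> y i"] show ?thesis by (simp only: y_expand finite_atLeastAtMost)
qed

lemma Wo_rf_To: "a : Ph ==> Wo (rf a) * To a = - (To a * Wo (rf a))"
 using Wo_To[OF symm_rf, of a a] rf_self[OF nzE(3)] by (simp add: To_minus)

lemma Wo_rf_Xo: "a : Ph ==> Wo (rf a) * Xo a = - (Xo a * Wo (rf a))"
 using Wo_Xo[OF rf_orth, of a a] rf_self[OF nzE(3)] by (simp add: Xo_minus)

text \<open>The scalar part of K(u, y_i) contributes F(u) twice. In the reflection part the sum over
  the basis collapses to F(a), which anticommutes with s_a, so the two orders cancel. The cases F =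
  T and F = X give the commutators with \<open>la\<close> and \<open>r2\<close>.\<close>

lemma sum_Ko:
 fixes F :: "'e => 'e op"
 assumes e: "\<And>v. F v = (\<Sum>i\<in>{1..DIM('e)}. sc (of_real (v \<bullet> y i)) * F (y i))"
  and m: "\<And>a. a : Ph ==> Wo (rf a) * F a = - (F a * Wo (rf a))"
 shows "(\<Sum>i\<in>{1..DIM('e)}. F (y i) * Ko u (y i) + Ko u (y i) * F (y i)) = 2 * F u"
proof -
 let ?N = "{1..DIM('e)}"
 have t1: "F (y i) * Ko u (y i) = sc (of_real (u \<bullet> y i)) * F (y i) + (\<Sum>a\<in>Ph. sc (kap a * of_real (a \<bullet> u)) * (sc (of_real (a \<bullet> y i)) * F (y i) * Wo (rf a)))" for i
  unfolding Ko_eq distrib_left sum_distrib_left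
  by (simp only: sc_commute[of "F (y i)"] sc_left[of "F (y i)"] sc_simps(4) of_real_mult mult.assoc)
 have t2: "Ko u (y i) * F (y i) = sc (of_real (u \<bullet> y i)) * F (y i) + (\<Sum>a\<in>Ph. sc (kap a * of_real (a \<bullet> u)) * (Wo (rf a) * (sc (of_real (a \<bullet> y i)) * F (y i))))" for i
  unfolding Ko_eq distrib_right sum_distrib_right by (simp only: sc_left[of "Wo g" for g] sc_simps(4) of_real_mult mult.assoc)
 have "(\<Sum>i\<in>?N. F (y i) * Ko u (y i)) = F u + (\<Sum>a\<in>Ph. sc (kap a * of_real (a \<bullet> u)) * (F a * Wo (rf a)))"
  unfolding t1 sum.distrib e[of u, symmetric]
  by (subst sum.swap) (simp only: sum_distrib_left[symmetric] sum_distrib_right[symmetric] e[symmetric])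
 moreover have "(\<Sum>i\<in>?N. Ko u (y i) * F (y i)) = F u + (\<Sum>a\<in>Ph. sc (kap a * of_real (a \<bullet> u)) * (Wo (rf a) * F a))"
  unfolding t2 sum.distrib e[of u, symmetric] by (subst sum.swap) (simp only: sum_distrib_left[symmetric] e[symmetric])
 moreover have "(\<Sum>a\<in>Ph. sc (kap a * of_real (a \<bullet> u)) * (Wo (rf a) * F a)) = - (\<Sum>a\<in>Ph. sc (kap a * of_real (a \<bullet> u)) * (F a * Wo (rf a)))"
  unfolding sum_negf[symmetric] by (rule sum.cong[OF HOL.refl]) (simp add: m)
 ultimately show ?thesis by (simp add: sum.distrib mult_2)
qed

lemma la_Xo: "la * Xo u = Xo u * la + 2 * To u"
proof -
 have "la * Xo u - Xo u * la = (\<Sum>i\<in>{1..DIM('e)}. ti i * Ko u (y i) + Ko u (y i) * ti i)"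
  unfolding la_def sum_distrib_left sum_distrib_right sum_subtractf[symmetric]
  by (rule sum.cong[OF HOL.refl]) (simp add: Ko_def algebra_simps)
 also have "... = 2 * To u" by (rule sum_Ko[OF To_expand]) (rule Wo_rf_To)
 finally show ?thesis by (simp add: algebra_simps)
qed

lemma To_r2: "To v * r2 = r2 * To v + 2 * Xo v"
proof -
 have "To v * r2 - r2 * To v = (\<Sum>i\<in>{1..DIM('e)}. xi i * Ko v (y i) + Ko v (y i) * xi i)"
  unfolding r2_def sum_distrib_left sum_distrib_right sum_subtractf[symmetric] Ko_sym[of v]
  by (rule sum.cong[OF HOL.refl]) (simp add: Ko_def algebra_simps)
 also have "... = 2 * Xo v" by (rule sum_Ko[OF Xo_expand]) (rule Wo_rf_Xo)
 finally show ?thesis by (simp add: algebra_simps)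
qed

lemma Xo_r2: "Xo u * r2 = r2 * Xo u"
proof -
 have "Xo u * (xi i * xi i) = (xi i * xi i) * Xo u" for i by (simp only: Mo_simps(2)[symmetric] mult_ac)
 thus ?thesis by (simp only: r2_def sum_distrib_left sum_distrib_right)
qed

lemma To_la: "To u * la = la * To u"
proof -
 have "To u * (ti i * ti i) = (ti i * ti i) * To u" for i by (rule commute_prod[OF To_commute To_commute])
 thus ?thesis by (simp only: la_def sum_distrib_left sum_distrib_right)
qed

lemma Ho2: "2 * Ho = (\<Sum>i\<in>{1..DIM('e)}. xi i * ti i + ti i * xi i)"
proof -
 have "(2 :: 'e op) * sc (1/2) = 1" by (simp add: sc_numeral[symmetric] sc_simps(4)[symmetric] sc_simps(2))
 thus ?thesis by (simp add: Ho_def mult.assoc[symmetric])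
qed

lemma la_r2: "la * r2 = r2 * la + 4 * Ho"
proof -
 have "la * r2 - r2 * la = (\<Sum>i\<in>{1..DIM('e)}. 2 * (xi i * ti i + ti i * xi i))"
  unfolding r2_def sum_distrib_left sum_distrib_right sum_subtractf[symmetric]
 proof (rule sum.cong[OF HOL.refl])
  fix i
  have "la * (xi i * xi i) = (xi i * la + 2 * ti i) * xi i" by (simp only: mult.assoc[symmetric] la_Xo)
  also have "... = xi i * (xi i * la + 2 * ti i) + 2 * (ti i * xi i)" by (simp only: distrib_right mult.assoc la_Xo)
  finally show "la * (xi i * xi i) - xi i * xi i * la = 2 * (xi i * ti i + ti i * xi i)" by (simp add: algebra_simps mult_2)
 qed
 also have "... = 2 * (2 * Ho)" by (simp only: Ho2 sum_distrib_left)
 finally show ?thesis by (simp add: algebra_simps mult.assoc[symmetric])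
qed

text \<open>The sum of the (a.y_i)^2 is a.a, which cancels the denominator of \<open>kap a\<close>.
  This trace is the origin of the dimension and of Z in \<open>Pho\<close>.\<close>

lemma sum_Ko_diag: "(\<Sum>i\<in>{1..DIM('e)}. Ko (y i) (y i)) = of_nat DIM('e) + 2 * Zo"
proof -
 have "(\<Sum>i\<in>{1..DIM('e)}. sc (of_real (y i \<bullet> y i))) = (\<Sum>i\<in>{1..DIM('e)}. (1 :: 'e op))"
  by (rule sum.cong[OF HOL.refl]) (use y_inner in \<open>auto simp: sc_simps\<close>)
 moreover have "(\<Sum>i\<in>{1..DIM('e)}. \<Sum>a\<in>Ph. sc (kap a * of_real ((a \<bullet> y i) * (a \<bullet> y i))) * Wo (rf a)) = (\<Sum>a\<in>Ph. sc (2 * h a) * Wo (rf a))"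
 proof (subst sum.swap, rule sum.cong[OF HOL.refl])
  fix a assume a: "a : Ph"
  have "(\<Sum>i\<in>{1..DIM('e)}. kap a * of_real ((a \<bullet> y i) * (a \<bullet> y i))) = kap a * of_real (a \<bullet> a)"
   by (subst y_parseval[of a a]) (simp only: of_real_sum sum_distrib_left)
  also have "... = 2 * h a" using nzE[OF a] by (simp add: kap_def)
  finally show "(\<Sum>i\<in>{1..DIM('e)}. sc (kap a * of_real ((a \<bullet> y i) * (a \<bullet> y i))) * Wo (rf a)) = sc (2 * h a) * Wo (rf a)"
   by (simp only: sum_distrib_right[symmetric] sc_sum[symmetric])
 qed
 moreover have "(\<Sum>a\<in>Ph. sc (2 * h a) * Wo (rf a)) = 2 * Zo" by (simp add: Zo_def sum_distrib_left sc_simps sc_numeral mult.assoc)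
 ultimately show ?thesis unfolding Ko_eq sum.distrib by simp
qed

lemma Ho_eu: "2 * Ho = 2 * eu + of_nat DIM('e) + 2 * Zo"
proof -
 have "ti i * xi i = xi i * ti i + Ko (y i) (y i)" for i by (simp add: Ko_def)
 hence "2 * Ho = eu + (eu + (\<Sum>i\<in>{1..DIM('e)}. Ko (y i) (y i)))" by (simp only: Ho2 sum.distrib eu_def)
 thus ?thesis unfolding sum_Ko_diag by (simp add: mult_2 add.assoc)
qed

lemma Mm_r2: "Mm u v * r2 = r2 * Mm u v"
proof -
 have "Xo u * To v * r2 = r2 * (Xo u * To v) + 2 * (Xo u * Xo v)" for u v
 proof -
  have "Xo u * To v * r2 = Xo u * r2 * To v + Xo u * (2 * Xo v)" by (simp only: mult.assoc To_r2 distrib_left)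
  also have "Xo u * (2 * Xo v) = 2 * (Xo u * Xo v)" by (simp add: mult_2 distrib_left)
  finally show ?thesis by (simp only: Xo_r2 mult.assoc)
 qed
 thus ?thesis by (simp add: Mm_def left_diff_distrib right_diff_distrib Xo_commute)
qed

lemma Mm_la: "Mm u v * la = la * Mm u v"
proof -
 have "la * (Xo u * To v) = Xo u * To v * la + 2 * (To u * To v)" for u v
 proof -
  have "la * (Xo u * To v) = Xo u * (la * To v) + 2 * (To u * To v)" by (simp only: mult.assoc[symmetric] la_Xo distrib_right)
  thus ?thesis by (simp only: To_la[symmetric] mult.assoc)
 qed
 thus ?thesis by (simp add: Mm_def left_diff_distrib right_diff_distrib To_commute)
qed

text \<open>Four times H is the commutator of \<open>la\<close> and \<open>r2\<close>, so commuting
  with these two forces commuting with H and with the whole Casimir.\<close>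

lemma commutes_Om:
 assumes r: "F * r2 = r2 * F" and l: "F * la = la * F"
 shows "F * Om = Om * F"
proof -
 have "F * (la * r2 - r2 * la) = (la * r2 - r2 * la) * F" by (simp only: left_diff_distrib right_diff_distrib mult.assoc[symmetric] r l)
   (simp only: mult.assoc r l)
 hence "F * (4 * Ho) = 4 * Ho * F" by (simp add: la_r2)
 hence "sc 4 * (F * Ho) = sc 4 * (Ho * F)" by (simp only: sc_numeral[symmetric] sc_left mult.assoc)
 hence H: "F * Ho = Ho * F" by (rule op_cancel[rotated]) simp
 note c = commute_prod[OF H H] commute_prod[OF r l] commute_prod[OF l r]
 have Om': "Om = Ho * Ho + sc (-1/2) * (r2 * la) + sc (-1/2) * (la * r2)"
  unfolding Om_def by (simp only: sc_prod distrib_left) (simp add: mult.assoc[symmetric] sc_simps(4)[symmetric] add.assoc)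
 show ?thesis unfolding Om' distrib_left distrib_right sc_left[of F] mult.assoc[of "sc k" for k] c ..
qed

lemma Mm_Om: "Mm u v * Om = Om * Mm u v" by (rule commutes_Om[OF Mm_r2 Mm_la])

text \<open>For linear F and G the sum of F(y_i) G(y_i) does not depend on the orthonormal basis;
  the proof is the Parseval identity for the images of the basis under w.\<close>

lemma orthonormal_sum_inv:
 fixes F G :: "'e => 'e op"
 assumes w: "orth w"
  and e: "\<And>v. F v = (\<Sum>i\<in>{1..DIM('e)}. sc (of_real (v \<bullet> y i)) * F (y i))"
  "\<And>v. G v = (\<Sum>i\<in>{1..DIM('e)}. sc (of_real (v \<bullet> y i)) * G (y i))"
 shows "(\<Sum>i\<in>{1..DIM('e)}. F (w (y i)) * G (w (y i))) = (\<Sum>i\<in>{1..DIM('e)}. F (y i) * G (y i))"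
proof -
 let ?N = "{1..DIM('e)}"
 have FG: "F u * G v = (\<Sum>j\<in>?N. \<Sum>k\<in>?N. sc (of_real ((u \<bullet> y j) * (v \<bullet> y k))) * (F (y j) * G (y k)))" for u v
  unfolding e(1)[of u] e(2)[of v] sum_product sc_prod by simp
 have "(\<Sum>i\<in>?N. F (w (y i)) * G (w (y i))) = (\<Sum>i\<in>?N. \<Sum>j\<in>?N. \<Sum>k\<in>?N. sc (of_real ((w (y i) \<bullet> y j) * (w (y i) \<bullet> y k))) * (F (y j) * G (y k)))"
  by (rule sum.cong[OF HOL.refl], rule FG)
 also have "... = (\<Sum>j\<in>?N. \<Sum>k\<in>?N. \<Sum>i\<in>?N. sc (of_real ((w (y i) \<bullet> y j) * (w (y i) \<bullet> y k))) * (F (y j) * G (y k)))"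
  by (subst sum.swap, rule sum.cong[OF HOL.refl], rule sum.swap)
 also have "... = (\<Sum>j\<in>?N. \<Sum>k\<in>?N. sc (of_real (y j \<bullet> y k)) * (F (y j) * G (y k)))"
 proof (intro sum.cong[OF HOL.refl])
  fix j k
  have k: "w (y i) \<bullet> u = ivf w u \<bullet> y i" for i u by (metis inner_commute orth_inv_inner w)
  have "(\<Sum>i\<in>?N. (w (y i) \<bullet> y j) * (w (y i) \<bullet> y k)) = (\<Sum>i\<in>?N. (ivf w (y j) \<bullet> y i) * (ivf w (y k) \<bullet> y i))"
   by (simp only: k)
  also have "... = ivf w (y j) \<bullet> ivf w (y k)" by (rule y_parseval[symmetric])
  also have "... = y j \<bullet> y k" using orth_inv[OF w] by (simp add: orthogonal_transformation_def)
  finally show "(\<Sum>i\<in>?N. sc (of_real ((w (y i) \<bullet> y j) * (w (y i) \<bullet> y k))) * (F (y j) * G (y k))) = sc (of_real (y j \<bullet> y k)) * (F (y j) * G (y k))"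
   by (simp only: sum_distrib_right[symmetric] sc_sum[symmetric] of_real_sum[symmetric])
 qed
 also have "... = (\<Sum>j\<in>?N. \<Sum>k\<in>?N. if k = j then F (y j) * G (y k) else 0)"
  by (intro sum.cong[OF HOL.refl]) (use y_inner in \<open>auto simp: sc_simps\<close>)
 also have "... = (\<Sum>i\<in>?N. F (y i) * G (y i))" by (rule sum.cong[OF HOL.refl]) simp
 finally show ?thesis .
qed

lemma Wo_r2: "w : W ==> Wo w * r2 = r2 * Wo w"
 and Wo_la: "w : W ==> Wo w * la = la * Wo w"
proof -
 assume w: "w : W"
 hence o: "orth w" and s: "symm w" by (simp_all add: W_orth W_symm)
 have "Wo w * (Xo u * Xo u) = (Xo (w u) * Xo (w u)) * Wo w" for u
  by (simp only: mult.assoc[symmetric] Wo_Xo[OF o]) (simp only: mult.assoc Wo_Xo[OF o])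
 hence "Wo w * r2 = (\<Sum>i\<in>{1..DIM('e)}. Xo (w (y i)) * Xo (w (y i))) * Wo w"
  by (simp only: r2_def sum_distrib_left sum_distrib_right)
 thus "Wo w * r2 = r2 * Wo w" unfolding orthonormal_sum_inv[OF o Xo_expand Xo_expand] r2_def .
 have "Wo w * (To u * To u) = (To (w u) * To (w u)) * Wo w" for u
  by (simp only: mult.assoc[symmetric] Wo_To[OF s]) (simp only: mult.assoc Wo_To[OF s])
 hence "Wo w * la = (\<Sum>i\<in>{1..DIM('e)}. To (w (y i)) * To (w (y i))) * Wo w"
  by (simp only: la_def sum_distrib_left sum_distrib_right)
 thus "Wo w * la = la * Wo w" unfolding orthonormal_sum_inv[OF o To_expand To_expand] la_def .
qed

lemma Wo_Om: "w : W ==> Wo w * Om = Om * Wo w" by (rule commutes_Om[OF Wo_r2 Wo_la])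

subsection \<open>The square of the Dirac operator\<close>

definition Xs :: "'e op" where "Xs = (\<Sum>i\<in>{1..DIM('e)}. xi i * co i)"
definition Ys :: "'e op" where "Ys = (\<Sum>i\<in>{1..DIM('e)}. ti i * co i)"
definition Do :: "'e op" where
 "Do = (\<Sum>(i, j)\<in>{(i, j). 1 \<le> i & i < j & j \<le> DIM('e)}. Mm (y i) (y j) * (co i * co j))"
definition Pho :: "'e op" where "Pho = Zo + sc ((of_nat DIM('e) - 2) / 2)"

lemma slash_mult:
 assumes "\<And>i j. K j * co i = co i * K j"
 shows "(\<Sum>i\<in>{1..n}. F i * co i) * (\<Sum>j\<in>{1..n}. K j * co j) = (\<Sum>i\<in>{1..n}. \<Sum>j\<in>{1..n}. (F i * K j) * (co i * co j :: 'e op))"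
proof -
 have "F i * co i * (K j * co j) = (F i * K j) * (co i * co j)" for i j by (metis assms mult.assoc)
 thus ?thesis by (simp only: sum_product)
qed

lemma slash_diag:
 assumes s: "\<And>i j. F i j = F j i"
 shows "(\<Sum>i\<in>{1..n}. \<Sum>j\<in>{1..n}. F i j * (co i * co j)) = (\<Sum>i\<in>{1..n}. F i i :: 'e op)"
proof -
 have "F i j * (co i * co j) + F j i * (co j * co i) = 0" if "i < j" for i j using co_anti[OF that, where 'a = 'e] s[of i j] by simp
 thus ?thesis unfolding sum_offdiag co_sq by (auto intro!: sum.neutral)
qed

lemma Xs_Xs: "Xs * Xs = r2" unfolding Xs_def by (subst slash_mult[OF Mo_co], subst slash_diag) (simp_all add: Xo_commute r2_def)

lemma Ys_Ys: "Ys * Ys = la" unfolding Ys_def by (subst slash_mult[OF To_co], subst slash_diag) (simp_all add: To_commute la_def)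

text \<open>The diagonal terms form the Euler operator. Off the diagonal c_i c_j is antisymmetric,
  so the terms pair up to the M_ij.\<close>

lemma Xs_Ys: "Xs * Ys = eu + Do"
proof -
 have "Mm (y i) (y j) * (co i * co j) = (xi i * ti j) * (co i * co j) + (xi j * ti i) * (co j * co i)" if "i < j" for i j
  using co_anti[OF that, where 'a = 'e] by (simp add: Mm_def left_diff_distrib)
 hence "Do = (\<Sum>(i, j)\<in>{(i, j). 1 \<le> i & i < j & j \<le> DIM('e)}. (xi i * ti j) * (co i * co j) + (xi j * ti i) * (co j * co i))"
  unfolding Do_def by (intro sum.cong[OF HOL.refl]) auto
 thus ?thesis unfolding Xs_def Ys_def slash_mult[OF To_co] sum_offdiag eu_def by (simp only: co_sq mult_1_right)
qed

text \<open>Reordering T past X costs K(y_j, y_i), which is symmetric, so only its trace survives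
  next to c_i c_j. The reordered terms meet the anticommutator of c_i and c_j and leave twice the
  Euler operator.\<close>

lemma Ys_Xs: "Xs * Ys + Ys * Xs = 2 * Ho"
proof -
 let ?N = "{1..DIM('e)}"
 have "Ys * Xs = (\<Sum>i\<in>?N. \<Sum>j\<in>?N. (ti i * xi j) * (co i * co j))" unfolding Xs_def Ys_def slash_mult[OF Mo_co] ..
 also have "... = (\<Sum>i\<in>?N. \<Sum>j\<in>?N. (xi j * ti i) * (co i * co j)) + (\<Sum>i\<in>?N. \<Sum>j\<in>?N. Ko (y j) (y i) * (co i * co j))"
  by (simp only: sum.distrib[symmetric] distrib_right[symmetric] Ko_def) simp
 also have "(\<Sum>i\<in>?N. \<Sum>j\<in>?N. Ko (y j) (y i) * (co i * co j)) = (\<Sum>i\<in>?N. Ko (y i) (y i))"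
  by (rule slash_diag) (rule Ko_sym)
 also have "(\<Sum>i\<in>?N. \<Sum>j\<in>?N. (xi j * ti i) * (co i * co j)) = (\<Sum>i\<in>?N. \<Sum>j\<in>?N. (xi i * ti j) * (co j * co i))"
  by (rule sum.swap)
 finally have e: "Xs * Ys + Ys * Xs = (\<Sum>i\<in>?N. \<Sum>j\<in>?N. (xi i * ti j) * (co i * co j + co j * co i)) + (\<Sum>i\<in>?N. Ko (y i) (y i))"
  unfolding Xs_def Ys_def slash_mult[OF To_co] by (simp add: sum.distrib distrib_left)
 have "(\<Sum>i\<in>?N. \<Sum>j\<in>?N. (xi i * ti j) * (co i * co j + co j * co i)) = (\<Sum>i\<in>?N. \<Sum>j\<in>?N. if j = i then 2 * (xi i * ti j) else 0)"
  by (intro sum.cong[OF HOL.refl]) (auto simp: co_co mult_2 mult_2_right)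
 also have "... = (\<Sum>i\<in>?N. 2 * (xi i * ti i))" by (rule sum.cong[OF HOL.refl]) simp
 also have "... = 2 * eu" by (simp only: eu_def sum_distrib_left)
 finally show ?thesis unfolding e sum_Ko_diag Ho_eu by (simp add: add.assoc)
qed

text \<open>Eliminating the Euler operator from the product and the anticommutator of
  \<open>Xs\<close> and \<open>Ys\<close> leaves exactly the shift \<open>Pho\<close>; the identity
  is doubled to avoid fractions of operators.\<close>

lemma Dirac_half: "2 * (Do - Pho) = Xs * Ys - Ys * Xs + 2"
proof -
 have "2 * Pho = 2 * Zo + of_nat DIM('e) - 2"
 proof -
  have "2 * sc ((of_nat DIM('e) - 2) / 2) = (of_nat DIM('e) - 2 :: 'e op)"
  proof -
   have "sc (of_nat m) = (of_nat m :: 'e op)" for m by (induction m) (simp_all add: sc_simps)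
   moreover have "2 * sc (k / 2) = (sc k :: 'e op)" for k by (simp add: sc_numeral[symmetric] sc_simps(4)[symmetric])
   ultimately show ?thesis by (simp add: sc_simps(6) sc_numeral)
  qed
  thus ?thesis by (simp add: Pho_def distrib_left)
 qed
 moreover have "Ys * Xs = 2 * eu + of_nat DIM('e) + 2 * Zo - (eu + Do)"
  unfolding Ho_eu[symmetric] Xs_Ys[symmetric] Ys_Xs[symmetric] by simp
 ultimately show ?thesis by (simp only: right_diff_distrib Xs_Ys) (simp add: mult_2)
qed

text \<open>Everything follows from [B, A^2] = 2 A and [B^2, A] = 2 B for A = \<open>Xs\<close> and
  B = \<open>Ys\<close>. After multiplication by 4 both sides are expanded in p = A B and q = B
  A.\<close>

lemma Dirac_square: "(Do - Pho) * (Do - Pho) = Om + 1"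
proof -
 let ?A = Xs and ?B = Ys
 have BA2: "?B * (?A * ?A) = ?A * ?A * ?B + 2 * ?A"
 proof -
  have "?B * r2 - r2 * ?B = (\<Sum>i\<in>{1..DIM('e)}. 2 * (xi i * co i))"
   unfolding Ys_def sum_distrib_left sum_distrib_right sum_subtractf[symmetric]
  proof (rule sum.cong[OF HOL.refl])
   fix i
   have cr: "co i * r2 = r2 * co i"
   proof -
    have "co i * (xi j * xi j) = (xi j * xi j) * co i" for j by (rule commute_prod[OF Mo_co[symmetric] Mo_co[symmetric]])
    thus ?thesis by (simp only: r2_def sum_distrib_left sum_distrib_right)
   qed
   have "ti i * co i * r2 = ti i * r2 * co i" by (simp only: mult.assoc cr)
   thus "ti i * co i * r2 - r2 * (ti i * co i) = 2 * (xi i * co i)" by (simp add: To_r2 distrib_right mult.assoc)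
  qed
  also have "... = 2 * ?A" unfolding Xs_def sum_distrib_left ..
  finally show ?thesis unfolding Xs_Xs by (simp add: algebra_simps)
 qed
 have B2A: "?B * ?B * ?A = ?A * (?B * ?B) + 2 * ?B"
 proof -
  have "la * ?A - ?A * la = (\<Sum>i\<in>{1..DIM('e)}. 2 * (ti i * co i))"
   unfolding Xs_def sum_distrib_left sum_distrib_right sum_subtractf[symmetric]
  proof (rule sum.cong[OF HOL.refl])
   fix i
   have cr: "co i * la = la * co i"
   proof -
    have "co i * (ti j * ti j) = (ti j * ti j) * co i" for j by (rule commute_prod[OF To_co[symmetric] To_co[symmetric]])
    thus ?thesis by (simp only: la_def sum_distrib_left sum_distrib_right)
   qed
   have "xi i * co i * la = xi i * la * co i" by (simp only: mult.assoc cr)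
   thus "la * (xi i * co i) - xi i * co i * la = 2 * (ti i * co i)" by (simp add: la_Xo distrib_right mult.assoc[symmetric])
  qed
  also have "... = 2 * ?B" unfolding Ys_def sum_distrib_left ..
  finally show ?thesis unfolding Ys_Ys by (simp add: algebra_simps)
 qed
 have l4: "?B * ?B * (?A * ?A) = ?A * ?A * (?B * ?B) + 2 * (?A * ?B + ?B * ?A)"
  using la_r2 by (simp add: Xs_Xs Ys_Ys Ys_Xs mult.assoc[symmetric])
 have 4: "sc 4 * ((Do - Pho) * (Do - Pho)) = (2 * (Do - Pho)) * (2 * (Do - Pho))"
  using sc_prod[of 2 "Do - Pho" 2 "Do - Pho"] by (simp add: sc_numeral)
 have Om4: "sc 4 * Om = (2 * Ho) * (2 * Ho) - 2 * (r2 * la + la * r2)"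
 proof -
  have "sc 4 * Om = sc 4 * (Ho * Ho) + sc (- 2) * (r2 * la) + sc (- 2) * (la * r2)"
   unfolding Om_def by (simp only: sc_prod distrib_left) (simp add: mult.assoc[symmetric] sc_simps(4)[symmetric] add.assoc)
  moreover have "(2 * Ho) * (2 * Ho) = sc 4 * (Ho * Ho)" using sc_prod[of 2 Ho 2 Ho] by (simp add: sc_numeral)
  ultimately show ?thesis by (simp add: sc_simps(5) sc_numeral algebra_simps)
 qed
 \<comment> \<open>Only the mixed products p q and q p are brought to a common form; p p and q q
   occur identically on both sides.\<close>
 have e1: "?A * ?B * (?B * ?A) = ?A * ?A * (?B * ?B) + 2 * (?A * ?B)"
 proof -
  have "?A * ?B * (?B * ?A) = ?A * (?B * ?B * ?A)" by (simp only: mult.assoc)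
  thus ?thesis by (simp only: B2A) (simp add: algebra_simps mult_2)
 qed
 have e2: "?B * ?A * (?A * ?B) = ?A * ?A * (?B * ?B) + 2 * (?A * ?B)"
 proof -
  have "?B * ?A * (?A * ?B) = ?B * (?A * ?A) * ?B" by (simp only: mult.assoc)
  thus ?thesis by (simp only: BA2) (simp add: algebra_simps mult_2)
 qed
 have four: "4 * F = F + F + F + F" for F :: "'e op"
 proof -
  have "(4 :: 'e op) = 1 + 1 + 1 + 1" by simp
  thus ?thesis by (simp only: distrib_right mult_1_left)
 qed
 have s1: "(p - q + 2) * (p - q + 2) = p * p - p * q - q * p + q * q + 4 * p - 4 * q + 4" for p q :: "'e op"
  by (simp add: algebra_simps mult_2 mult_2_right four)
 have s2: "(p + q) * (p + q) = p * p + p * q + q * p + q * q" for p q :: "'e op" by (simp add: algebra_simps)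
 have "sc 4 * ((Do - Pho) * (Do - Pho)) = sc 4 * (Om + 1)"
  unfolding 4 Dirac_half distrib_left Om4 Ys_Xs[symmetric] Xs_Xs[symmetric] Ys_Ys[symmetric] s1 s2 e1 e2 l4
  by (simp add: sc_numeral algebra_simps mult_2 mult_2_right four e1[unfolded mult.assoc] e2[unfolded mult.assoc])
 thus ?thesis by (rule op_cancel[rotated]) simp
qed

end

section \<open>Symbols\<close>

subsection \<open>Calculus in two groups of variables\<close>

lemma pd_dd:
 fixes a u :: "'a::euclidean_space"
 assumes a: "a ~= 0" and u: "u \<bullet> a = 0"
 shows "pd u (dd a f) = dd a (pd u f)"
proof (rule sym, rule ddI[OF a])
 have "rf a u = u" using u by (simp add: rf_def)
 hence "pd u (lin a * dd a f) = pd u f - sub (rf a) (pd u f)" unfolding lin_dd[OF a] by (simp add: pd_sub linear_rf)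
 thus "lin a * pd u (dd a f) = pd u f - sub (rf a) (pd u f)" using u by (simp add: pd_mult const_simps)
qed

lemma dd_lin_mult: "a ~= 0 ==> dd a (lin u * f) = const (of_real (2 * (u \<bullet> a) / (a \<bullet> a))) * f + lin (rf a u) * dd a f"
 using dd_mult[of a f "lin u"] by (simp add: dd_lin sub_rf_lin mult_ac add_ac)

lemma dd_lin_orth: "a ~= 0 ==> u \<bullet> a = 0 ==> dd a (lin u * f) = lin u * dd a f"
 by (subst dd_lin_mult) (simp_all add: const_simps rf_def)

lemma dd_dd:
 fixes a b :: "'a::euclidean_space"
 assumes a: "a ~= 0" and b: "b ~= 0" and ab: "a \<bullet> b = 0"
 shows "dd a (dd b f) = dd b (dd a f)"
proof (rule sym, rule ddI[OF b])
 have ba: "b \<bullet> a = 0" using ab by (simp add: inner_commute)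
 have ra: "rf b a = a" using ab by (simp add: rf_def)
 have c: "dd a (sub (rf b) f) = sub (rf b) (dd a f)" using rf_conj[OF rf_orth[of b], of a] ra
  by (intro dd_sub_conj[OF a linear_rf _ _ a]) (simp_all add: sub_rf_lin)
 have "lin b * dd a (dd b f) = dd a (f - sub (rf b) f)" unfolding lin_dd[OF b, symmetric] by (rule dd_lin_orth[OF a ba, symmetric])
 also have "... = dd a f - sub (rf b) (dd a f)"
  using dd_add[OF a, of f "- sub (rf b) f"] dd_cmult[OF a, of "-1" "sub (rf b) f"] c by (simp add: const_simps)
 finally show "lin b * dd a (dd b f) = dd a f - sub (rf b) (dd a f)" .
qed

definition s1 :: "real => 'e::euclidean_space \<times> 'e => 'e \<times> 'e" where "s1 t = (%(x, \<xi>). (t *\<^sub>R x, \<xi>))"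
definition s2 :: "real => 'e::euclidean_space \<times> 'e => 'e \<times> 'e" where "s2 t = (%(x, \<xi>). (x, t *\<^sub>R \<xi>))"

lemma linear_s: "linear (s1 t)" "linear (s2 t)" by (auto intro!: linearI simp: s1_def s2_def scaleR_add_right scaleR_left_commute)

lemma sub_s_lin1: "sub (s1 t) (lin (u, 0)) = const (of_real t) * lin (u, 0)" "sub (s1 t) (lin (0, u)) = lin (0, u)"
 "sub (s2 t) (lin (u, 0)) = lin (u, 0)" "sub (s2 t) (lin (0, u)) = const (of_real t) * lin (0, u)"
 by (auto intro!: pf_eqI simp: ev_sub linear_s) (auto simp: s1_def s2_def)

lemma sub_s_fs: "linear g ==> sub (s1 t) (sub (fs g) f) = sub (fs g) (sub (s1 t) f)"
 "linear g ==> sub (s2 t) (sub (fs g) f) = sub (fs g) (sub (s2 t) f)"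
 by (auto simp: sub_sub linear_s linear_fs intro!: arg_cong2[of _ _ _ _ sub])
  (auto simp: s1_def s2_def fs_def linear_scale)

text \<open>A division-free form of the statement that the divided difference lowers the degree by one.\<close>

lemma s1_dd:
 assumes a: "a ~= 0" and f: "sub (s1 t) f = const k * f"
 shows "const (of_real t) * sub (s1 t) (dd (a, 0) f) = const k * dd (a, 0) f"
proof -
 have a0: "(a, 0::'a) ~= 0" using a by (simp add: zero_prod_def)
 have c: "sub (s1 t) (sub (rf (a, 0)) f) = sub (rf (a, 0)) (sub (s1 t) f)" unfolding rf_fst by (rule sub_s_fs) (rule linear_rf)
 have "lin (a, 0) * (const (of_real t) * sub (s1 t) (dd (a, 0) f)) = sub (s1 t) (lin (a, 0) * dd (a, 0) f)"
  by (simp add: sub_simps linear_s sub_s_lin1 mult_ac)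
 also have "... = const k * (f - sub (rf (a, 0)) f)"
  unfolding lin_dd[OF a0] by (simp add: sub_simps linear_s linear_rf c f right_diff_distrib)
 also have "... = lin (a, 0) * (const k * dd (a, 0) f)" unfolding lin_dd[OF a0, symmetric] by (simp add: mult_ac)
 finally show ?thesis using a0 by (simp add: lin_eq_0_iff)
qed

lemma s2_dd: "a ~= 0 ==> sub (s2 t) (dd (a, 0) f) = dd (a, 0) (sub (s2 t) f)"
proof (rule dd_sub_conj[symmetric])
 show "rf (a, 0) (s2 t v) = s2 t (rf (a, 0) v)" for v :: "'a \<times> 'a" by (cases v) (simp add: rf_fst fs_def s2_def)
qed (auto simp: zero_prod_def linear_s sub_s_lin1)

lemma pd_s: "const (of_real t) * sub (s1 t) (pd (v, 0) f) = pd (v, 0) (sub (s1 t) f)"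
 "sub (s2 t) (pd (v, 0) f) = pd (v, 0) (sub (s2 t) f)"
proof -
 have "s1 t (v, 0) = t *\<^sub>R (v, 0)" "s2 t (v, 0) = (v, 0)" by (simp_all add: s1_def s2_def)
 thus "const (of_real t) * sub (s1 t) (pd (v, 0) f) = pd (v, 0) (sub (s1 t) f)"
  "sub (s2 t) (pd (v, 0) f) = pd (v, 0) (sub (s2 t) f)" by (simp_all only: pd_sub linear_s pd_vec_scale sub_simps(2,3)[OF linear_s(1)])
qed

context cherednik
begin

lemma comp_rf_W [simp]: "a : Ph ==> w : W ==> rf a o w : W" "a : Ph ==> w : W ==> w o rf a : W"
 unfolding W_eq by (rule WG_rf, assumption, assumption) (rule WG_comp, assumption, rule WG_single, assumption)

lemma inv_W [simp]: "w : W ==> ivf w : W"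
proof -
 assume "w : W"
 then obtain v where "v : W" "v o w = id" "w o v = id" unfolding W_eq using cx.WG_inv by blast
 thus ?thesis using inv_unique_comp[of w v] by simp
qed

subsection \<open>Homogeneity\<close>

text \<open>Among the generators only the shift term of y involves xi, and it raises the level and
  the degree in xi together. So the level of a symbol is its degree in xi.\<close>

lemma sy_s2: "z : carrier HH ==> \<forall>k w. w : W --> sub (s2 t) (sy z k w) = const (of_real t ^ k) * sy z k w"
proof (induction z rule: HH_induct)
 case one
 show ?case by (simp add: sy_one sub_simps linear_s const_simps)
next
 case (add z z')
 thus ?case by (simp add: sy_simps sub_simps linear_s distrib_left)
next
 case (smult a z)
 thus ?case by (simp add: sy_simps sub_simps linear_s mult_ac)
next
 case (X u z)
 thus ?case by (simp add: sy_Xe sub_simps linear_s mult_ac sub_s_lin1)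
next
 case (Y v z)
 show ?case
 proof (intro allI impI)
  fix k w assume w: "w : W"
  have p: "sub (s2 t) (if k = 0 then 0 else lin (0, ivf w v) * sy z (k - 1) w) = const (of_real t ^ k) * (if k = 0 then 0 else lin (0, ivf w v) * sy z (k - 1) w)"
   using Y(2) w by (cases k) (simp_all add: sub_simps linear_s sub_s_lin1 const_simps mult_ac)
  have q: "sub (s2 t) (\<Sum>a\<in>Ph. const (h a * of_real (a \<bullet> v)) * dd (a, 0) (sy z k (rf a o w)))
    = const (of_real t ^ k) * (\<Sum>a\<in>Ph. const (h a * of_real (a \<bullet> v)) * dd (a, 0) (sy z k (rf a o w)))"
   unfolding sub_sum[OF linear_s(2)] sum_distrib_left
  proof (rule sum.cong[OF HOL.refl])
   fix a assume a: "a : Ph"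
   have "sub (s2 t) (dd (a, 0) (sy z k (rf a o w))) = const (of_real t ^ k) * dd (a, 0) (sy z k (rf a o w))"
    unfolding s2_dd[OF nzE(3)[OF a]] Y(2)[rule_format, OF comp_rf_W(1)[OF a w]] by (rule dd_cmult[OF nzE(1)[OF a]])
   thus "sub (s2 t) (const (h a * of_real (a \<bullet> v)) * dd (a, 0) (sy z k (rf a o w)))
    = const (of_real t ^ k) * (const (h a * of_real (a \<bullet> v)) * dd (a, 0) (sy z k (rf a o w)))"
    by (simp only: sub_simps[OF linear_s(2)] mult.left_commute)
  qed
  show "sub (s2 t) (sy (Ye v \<star> z) k w) = const (of_real t ^ k) * sy (Ye v \<star> z) k w"
   unfolding sy_Ye[OF Y(1) w] sub_simps[OF linear_s(2)] p q distrib_left using Y(2) w by (simp add: pd_s)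
 qed
next
 case (W g z)
 have o: "orth (ivf g)" by (intro orth_inv W_orth W(2))
 show ?case
 proof (intro allI impI)
  fix k w assume "w : W"
  hence giw: "ivf g o w : W" using W(2) by (intro comp_W inv_W)
  show "sub (s2 t) (sy (We g \<star> z) k w) = const (of_real t ^ k) * sy (We g \<star> z) k w"
   unfolding sy_We[OF W(1,2)] sub_s_fs(2)[OF orth_linear[OF o]] W(3)[rule_format, OF giw]
   by (simp add: sub_simps linear_fs orth_linear o)
 qed
qed

text \<open>Homogeneity of degree 0, used with the scaling factor 0: the symbol at level 0 does not
  depend on xi.\<close>

lemma sy_level0:
 assumes "z : carrier HH" "w : W"
 shows "pd (0, u) (sy z 0 w) = 0" "a : Ph ==> dd (0, a) (sy z 0 w) = 0"
proof -
 have e: "sub (s2 0) (sy z 0 w) = sy z 0 w" using sy_s2[OF assms(1), of 0] assms(2) by (simp add: const_simps)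
 have "pd (0, u) (sub (s2 0) (sy z 0 w)) = 0"
 proof -
  have "s2 0 (0 :: 'e, u) = 0" by (simp add: s2_def zero_prod_def)
  thus ?thesis by (simp add: pd_sub linear_s sub_simps)
 qed
 thus "pd (0, u) (sy z 0 w) = 0" by (simp add: e)
 assume a: "a : Ph"
 have "sub (rf (0, a)) (sub (s2 0) (sy z 0 w)) = sub (s2 0) (sy z 0 w)"
 proof -
  have "s2 0 o rf (0, a) = s2 0" by (auto simp: s2_def rf_snd)
  thus ?thesis by (simp add: sub_sub linear_s linear_rf)
 qed
 thus "dd (0, a) (sy z 0 w) = 0" using nzE(2)[OF a] by (intro ddI) (simp_all add: e)
qed

subsection \<open>Right multiplication\<close>

definition Te :: "'e => (nat => ('e => 'e) => ('e \<times> 'e) pf) => nat => ('e => 'e) => ('e \<times> 'e) pf" where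
 "Te v f k w = pd (v, 0) (f k w) + (if k = 0 then 0 else lin (0, ivf w v) * f (k - 1) w)
   + (\<Sum>a\<in>Ph. const (h a * of_real (a \<bullet> v)) * dd (a, 0) (f k (rf a o w)))"

text \<open>Right multiplication of p(x) w q(y) by x_u. Moving x_u to the left past q yields a
  derivative and a Dunkl term in xi, both lowering the degree, hence \<open>Suc k\<close>; the
  reflection now multiplies w from the right. Passing w turns u into w u.\<close>

definition Ru :: "'e => (nat => ('e => 'e) => ('e \<times> 'e) pf) => nat => ('e => 'e) => ('e \<times> 'e) pf" where
 "Ru u f k w = lin (w u, 0) * f k w + pd (0, u) (f (Suc k) w)
   + (\<Sum>a\<in>Ph. const (h a * of_real (u \<bullet> a)) * dd (0, a) (f (Suc k) (w o rf a)))"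

lemma sy_Te: "z : carrier HH ==> w : W ==> sy (Ye v \<star> z) k w = Te v (sy z) k w" by (simp add: sy_Ye Te_def)

lemma rf_conj_comp: "w : W ==> rf (w a) o w = w o rf a" using rf_conj[OF W_orth, of w a] by (auto simp: fun_eq_iff)

text \<open>Associativity in coordinates. That \<open>Ru\<close> is right multiplication is not yet
  known here, so the commutation with left multiplication is verified by expansion: derivatives and
  divided differences in x commute with those in xi, and the terms arising from the two linear forms
  match.\<close>

lemma Te_Ru:
 assumes w: "w : W" and p0: "\<And>w. w : W ==> pd (0, u) (f 0 w) = 0"
  and d0: "\<And>w a. w : W ==> a : Ph ==> dd (0, a) (f 0 w) = 0"
 shows "Te v (Ru u f) k w = Ru u (Te v f) k w"
proof -
 have o: "orth w" using w by (rule W_orth)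
 have ro: "orth (rf a)" for a :: 'e by (rule rf_orth)
 have riv: "ivf (rf a) = rf a" for a :: 'e by (rule Hilbert_Choice.inv_equality) simp_all
 let ?kv = "%a. const (h a * of_real (a \<bullet> v)) :: ('e \<times> 'e) pf" and ?ku = "%a. const (h a * of_real (u \<bullet> a)) :: ('e \<times> 'e) pf"
 let ?l = "lin (w u, 0) :: ('e \<times> 'e) pf" and ?m = "lin (0, ivf w v) :: ('e \<times> 'e) pf"
 let ?S1 = "\<Sum>a\<in>Ph. ?kv a * dd (a, 0) (f k (rf a o w))"
 let ?S2 = "\<Sum>a\<in>Ph. ?ku a * dd (0, a) (f k (w o rf a))"
 let ?C = "\<Sum>a\<in>Ph. ?kv a * (const (of_real (2 * (rf a (w u) \<bullet> a) / (a \<bullet> a))) * f k (rf a o w))"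
 let ?D = "\<Sum>a\<in>Ph. ?ku a * (const (of_real (2 * (rf a (ivf w v) \<bullet> a) / (a \<bullet> a))) * f k (w o rf a))"
 let ?DD = "\<Sum>a\<in>Ph. \<Sum>b\<in>Ph. ?kv a * (?ku b * dd (a, 0) (dd (0, b) (f (Suc k) (rf a o w o rf b))))"
 have i0: "(v, 0) \<bullet> (0::'e, a) = 0" "(0, a) \<bullet> (v, 0::'e) = 0" for a v :: 'e by simp_all
 have A1: "pd (v, 0) (Ru u f k w) = ?l * pd (v, 0) (f k w) + const (of_real (v \<bullet> w u)) * f k w
   + pd (v, 0) (pd (0, u) (f (Suc k) w)) + (\<Sum>a\<in>Ph. ?ku a * pd (v, 0) (dd (0, a) (f (Suc k) (w o rf a))))"
  by (simp add: Ru_def pd_mult pd_sum)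
 \<comment> \<open>At level 0 there is no predecessor, so the last two terms have to vanish on their
   own; this is what \<open>p0\<close> and \<open>d0\<close> provide.\<close>
 have A2: "(if k = 0 then 0 else ?m * Ru u f (k - 1) w)
  = (if k = 0 then 0 else ?m * (?l * f (k - 1) w)) + ?m * pd (0, u) (f k w) + ?m * ?S2"
 proof (cases k)
  case 0
  have "?S2 = 0" by (rule sum.neutral) (use 0 d0 w in simp)
  thus ?thesis using 0 p0 w by simp
 next
  case (Suc k')
  thus ?thesis by (simp add: Ru_def distrib_left)
 qed
 have A3: "(\<Sum>a\<in>Ph. ?kv a * dd (a, 0) (Ru u f k (rf a o w)))
  = ?C + ?l * ?S1 + (\<Sum>a\<in>Ph. ?kv a * dd (a, 0) (pd (0, u) (f (Suc k) (rf a o w)))) + ?DD"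
 proof -
  have "?kv a * dd (a, 0) (Ru u f k (rf a o w)) = ?kv a * (const (of_real (2 * (rf a (w u) \<bullet> a) / (a \<bullet> a))) * f k (rf a o w))
   + ?l * (?kv a * dd (a, 0) (f k (rf a o w))) + ?kv a * dd (a, 0) (pd (0, u) (f (Suc k) (rf a o w)))
   + (\<Sum>b\<in>Ph. ?kv a * (?ku b * dd (a, 0) (dd (0, b) (f (Suc k) (rf a o w o rf b)))))" if a: "a : Ph" for a
  proof -
   have a0: "(a, 0::'e) ~= 0" using nzE[OF a] by blast
   have "dd (a, 0) (lin ((rf a o w) u, 0) * f k (rf a o w)) = const (of_real (2 * (rf a (w u) \<bullet> a) / (a \<bullet> a))) * f k (rf a o w)
    + ?l * dd (a, 0) (f k (rf a o w))" by (subst dd_lin_mult[OF a0]) (simp add: rf_fst fs_def)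
   thus ?thesis unfolding Ru_def dd_add[OF a0] dd_sum[OF a0] dd_cmult[OF a0] by (simp add: distrib_left sum_distrib_left mult_ac)
  qed
  thus ?thesis by (simp add: sum.distrib sum_distrib_left)
 qed
 have B1: "?l * Te v f k w = ?l * pd (v, 0) (f k w) + (if k = 0 then 0 else ?l * (?m * f (k - 1) w)) + ?l * ?S1"
  by (simp add: Te_def distrib_left)
 have B2: "pd (0, u) (Te v f (Suc k) w) = pd (0, u) (pd (v, 0) (f (Suc k) w))
   + (?m * pd (0, u) (f k w) + const (of_real (u \<bullet> ivf w v)) * f k w) + (\<Sum>a\<in>Ph. ?kv a * pd (0, u) (dd (a, 0) (f (Suc k) (rf a o w))))"
  by (simp add: Te_def pd_mult pd_sum)
 have B3: "(\<Sum>a\<in>Ph. ?ku a * dd (0, a) (Te v f (Suc k) (w o rf a)))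
  = (\<Sum>a\<in>Ph. ?ku a * dd (0, a) (pd (v, 0) (f (Suc k) (w o rf a)))) + ?D + ?m * ?S2
   + (\<Sum>a\<in>Ph. \<Sum>b\<in>Ph. ?ku a * (?kv b * dd (0, a) (dd (b, 0) (f (Suc k) (rf b o (w o rf a))))))"
 proof -
  have "?ku a * dd (0, a) (Te v f (Suc k) (w o rf a)) = ?ku a * dd (0, a) (pd (v, 0) (f (Suc k) (w o rf a)))
   + ?ku a * (const (of_real (2 * (rf a (ivf w v) \<bullet> a) / (a \<bullet> a))) * f k (w o rf a)) + ?m * (?ku a * dd (0, a) (f k (w o rf a)))
   + (\<Sum>b\<in>Ph. ?ku a * (?kv b * dd (0, a) (dd (b, 0) (f (Suc k) (rf b o (w o rf a))))))" if a: "a : Ph" for a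
  proof -
   have a0: "(0::'e, a) ~= 0" using nzE[OF a] by blast
   have iv: "ivf (w o rf a) v = rf a (ivf w v)" using orth_inv_comp[OF o ro[of a]] by (simp add: riv)
   have "dd (0, a) (lin (0, ivf (w o rf a) v) * f k (w o rf a)) = const (of_real (2 * (rf a (ivf w v) \<bullet> a) / (a \<bullet> a))) * f k (w o rf a)
    + ?m * dd (0, a) (f k (w o rf a))" unfolding iv by (subst dd_lin_mult[OF a0]) (simp add: rf_snd)
   thus ?thesis unfolding Te_def dd_add[OF a0] dd_sum[OF a0] dd_cmult[OF a0] by (simp add: distrib_left sum_distrib_left mult_ac add_ac)
  qed
  thus ?thesis by (simp add: sum.distrib sum_distrib_left)
 qed
 have c1: "(\<Sum>a\<in>Ph. ?ku a * pd (v, 0) (dd (0, a) (f (Suc k) (w o rf a)))) = (\<Sum>a\<in>Ph. ?ku a * dd (0, a) (pd (v, 0) (f (Suc k) (w o rf a))))"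
  by (rule sum.cong[OF HOL.refl]) (use nzE in \<open>simp add: pd_dd\<close>)
 have c2: "(\<Sum>a\<in>Ph. ?kv a * dd (a, 0) (pd (0, u) (f (Suc k) (rf a o w)))) = (\<Sum>a\<in>Ph. ?kv a * pd (0, u) (dd (a, 0) (f (Suc k) (rf a o w))))"
  by (rule sum.cong[OF HOL.refl]) (use nzE in \<open>simp add: pd_dd\<close>)
 have c3: "?DD = (\<Sum>a\<in>Ph. \<Sum>b\<in>Ph. ?ku a * (?kv b * dd (0, a) (dd (b, 0) (f (Suc k) (rf b o (w o rf a))))))"
  by (subst sum.swap, intro sum.cong[OF HOL.refl]) (use nzE in \<open>simp add: dd_dd o_assoc mult_ac\<close>)
 \<comment> \<open>These terms arise when a divided difference hits the linear form of the other
   multiplication. Substituting w a for a identifies them, because s_(w a) w = w s_a and h is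
   invariant.\<close>
 have c4: "?C = ?D"
 proof -
  have inj: "inj_on w Ph" using orthogonal_transformation_inj[OF o] by (rule inj_on_subset) simp
  have im: "w ` Ph = Ph" and hw: "\<And>a. a : Ph ==> h (w a) = h a" using W_symm[OF w] by (auto simp: symm_def)
  show ?thesis
  proof (rule sum.reindex_cong[OF inj im[symmetric]])
   fix a assume a: "a : Ph"
   have ii: "w s \<bullet> w t = s \<bullet> t" for s t using o by (simp add: orthogonal_transformation_def)
   have e1: "rf (w a) (w u) \<bullet> w a = - (u \<bullet> a)"
    using rf_conj[OF o, of a u] rf_inner[of a u a] rf_self[OF nzE(3)[OF a]] by (simp add: ii)
   have e2: "rf a (ivf w v) \<bullet> a = - (w a \<bullet> v)"
    using rf_inner[of a "ivf w v" a] rf_self[OF nzE(3)[OF a]] orth_inv_inner[OF o, of v a] by (simp add: inner_commute)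
   have fk: "f k (rf (w a) o w) = f k (w o rf a)" by (simp only: rf_conj_comp[OF w])
   have cc: "const s * (const t * p) = const (s * t) * p" for s t and p :: "('e \<times> 'e) pf" by (simp add: const_simps mult.assoc)
   have num: "h a * complex_of_real (w a \<bullet> v) * complex_of_real (2 * - (u \<bullet> a) / (a \<bullet> a))
    = h a * complex_of_real (u \<bullet> a) * complex_of_real (2 * - (w a \<bullet> v) / (a \<bullet> a))" by simp
   show "?kv (w a) * (const (of_real (2 * (rf (w a) (w u) \<bullet> w a) / (w a \<bullet> w a))) * f k (rf (w a) o w))
    = ?ku a * (const (of_real (2 * (rf a (ivf w v) \<bullet> a) / (a \<bullet> a))) * f k (w o rf a))"
    by (simp only: e1 e2 ii hw[OF a] cc num fk)
  qed
 qed
 have c5: "v \<bullet> w u = u \<bullet> ivf w v" using orth_inv_inner[OF o, of v u] by (simp add: inner_commute)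
 have ac: "(a + b + c + d) + (e + f + g) + (p + q + r + s) = (a + e + q) + (c + (f + b) + r) + (d + p + g + s)"
  for a b c d e f g p q r s :: "('e \<times> 'e) pf" by (simp only: add_ac)
 have "Te v (Ru u f) k w = pd (v, 0) (Ru u f k w) + (if k = 0 then 0 else ?m * Ru u f (k - 1) w) + (\<Sum>a\<in>Ph. ?kv a * dd (a, 0) (Ru u f k (rf a o w)))"
  by (simp only: Te_def)
 also have "... = ?l * Te v f k w + pd (0, u) (Te v f (Suc k) w) + (\<Sum>a\<in>Ph. ?ku a * dd (0, a) (Te v f (Suc k) (w o rf a)))"
  unfolding A1 A2 A3 B1 B2 B3 c1 c2 c3 c4 c5 pd_commute[of "(v, 0)" "(0, u)"] mult.left_commute[of ?m ?l] by (rule ac)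
 also have "... = Ru u (Te v f) k w" by (simp only: Ru_def)
 finally show ?thesis .
qed

lemma Te_cong: "w : W ==> (\<And>k w. w : W ==> f k w = g k w) ==> Te v f k w = Te v g k w" by (simp add: Te_def cong: sum.cong)

lemma Ru_cong: "w : W ==> (\<And>k w. w : W ==> f k w = g k w) ==> Ru v f k w = Ru v g k w" by (simp add: Ru_def cong: sum.cong)

text \<open>Both sides commute with left multiplication by generators, so the case of 1 decides; for
  y this commutation is \<open>Te_Ru\<close>.\<close>

lemma sy_right_Xe: "z : carrier HH ==> \<forall>k w. w : W --> sy (z \<star> Xe \<xi>) k w = Ru (riesz \<xi>) (sy z) k w"
proof (induction z rule: HH_induct)
 case one
 have "dd (0, a) (sy \<one>\<^bsub>HH\<^esub> (Suc k) (w o rf a)) = 0" if "a : Ph" for k a w using nzE[OF that] by (simp add: sy_one)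
 thus ?case using sy_Xe[OF HK.one_closed, of \<xi>] by (auto simp: Ru_def sy_one)
next
 case (add z z')
 show ?case using add by (simp add: HK.l_distr sy_simps Ru_def distrib_left sum.distrib dd_add nzE cong: sum.cong)
next
 case (smult a z)
 show ?case using smult by (simp add: HK.smult_mult_l sy_simps Ru_def distrib_left sum_distrib_left dd_cmult nzE mult_ac cong: sum.cong)
next
 case (X u z)
 have d: "dd (0, a) (lin (v, 0) * f) = lin (v, 0) * dd (0, a) f" if "a : Ph" for a v :: 'e and f
  using nzE[OF that] by (intro dd_lin_orth) auto
 show ?case using X by (simp add: HK.m_assoc sy_Xe Ru_def distrib_left sum_distrib_left d pd_mult const_simps mult_ac cong: sum.cong)
next
 case (Y v z)
 show ?case
 proof (intro allI impI)
  fix k w assume w: "w : W"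
  have "sy (Ye v \<star> z \<star> Xe \<xi>) k w = Te v (sy (z \<star> Xe \<xi>)) k w" using Y(1) w by (simp add: HK.m_assoc sy_Te)
  also have "... = Te v (Ru (riesz \<xi>) (sy z)) k w" using Y(2) w by (intro Te_cong) auto
  also have "... = Ru (riesz \<xi>) (Te v (sy z)) k w" by (rule Te_Ru[OF w]) (use sy_level0[OF Y(1)] in auto)
  also have "... = Ru (riesz \<xi>) (sy (Ye v \<star> z)) k w" by (rule Ru_cong[OF w]) (simp add: sy_Te Y(1))
  finally show "sy (Ye v \<star> z \<star> Xe \<xi>) k w = Ru (riesz \<xi>) (sy (Ye v \<star> z)) k w" .
 qed
next
 case (W g z)
 have o: "orth g" using W(2) by (rule W_orth)
 have l: "linear (fs (ivf g))" by (intro linear_fs orth_linear orth_inv o)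
 let ?s = "sub (fs (ivf g))"
 show ?case
 proof (intro allI impI)
  fix k w assume w: "w : W"
  have d: "dd (0, a) (?s p) = ?s (dd (0, a) p)" if "a : Ph" for a p
  proof (rule dd_sub_conj)
   show "(0::'e, a) ~= 0" "(0::'e, a) ~= 0" using nzE[OF that] by auto
   show "?s (lin (0, a)) = lin (0, a)" using sub_fs_lin1[OF o, of 0 a] linear_0[OF orth_linear[OF o]] by simp
   show "rf (0, a) (fs (ivf g) v) = fs (ivf g) (rf (0, a) v)" for v by (cases v) (simp add: fs_def rf_snd)
  qed (rule l)
  have p: "pd (0, u) (?s p) = ?s (pd (0, u) p)" for u p
   unfolding pd_sub[OF l] using linear_0[OF orth_linear[OF orth_inv[OF o]]] by (simp add: fs_def)
  have li: "?s (lin ((ivf g o w) u, 0)) = lin (w u, 0)" for u by (simp add: sub_fs_lin1 o)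
  have giw: "ivf g o w : W" using W(2) w by (intro comp_W inv_W)
  have "sy (We g \<star> z \<star> Xe \<xi>) k w = ?s (sy (z \<star> Xe \<xi>) k (ivf g o w))" using W by (simp add: HK.m_assoc sy_We)
  also have "... = ?s (Ru (riesz \<xi>) (sy z) k (ivf g o w))" by (simp only: W(3)[rule_format, OF giw])
  also have "... = Ru (riesz \<xi>) (sy (We g \<star> z)) k w" unfolding Ru_def sub_simps[OF l] sub_sum[OF l] li sy_We[OF W(1,2)] p
   by (simp add: d o_assoc cong: sum.cong)
  finally show "sy (We g \<star> z \<star> Xe \<xi>) k w = Ru (riesz \<xi>) (sy (We g \<star> z)) k w" .
 qed
qed

text \<open>In the chosen order y stands rightmost, so right multiplication by it is plain
  multiplication by a form in xi and a step up in level.\<close>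

lemma sy_right_Ye: "z : carrier HH ==> \<forall>k w. w : W --> sy (z \<star> Ye v) k w = (if k = 0 then 0 else lin (0, v) * sy z (k - 1) w)"
proof (induction z rule: HH_induct)
 case one
 have d: "dd (a, 0) (sy \<one>\<^bsub>HH\<^esub> k (rf a o w)) = 0" if "a : Ph" for k a w using nzE[OF that] by (simp add: sy_one)
 show ?case
 proof (intro allI impI)
  fix k w assume "w : W"
  hence "sy (Ye v \<star> \<one>\<^bsub>HH\<^esub>) k w = (if k = 0 then 0 else lin (0, v) * sy \<one>\<^bsub>HH\<^esub> (k - 1) w)"
   unfolding sy_Te[OF HK.one_closed \<open>w : W\<close>] Te_def by (simp add: d) (auto simp: sy_one inv_id)
  thus "sy (\<one>\<^bsub>HH\<^esub> \<star> Ye v) k w = (if k = 0 then 0 else lin (0, v) * sy \<one>\<^bsub>HH\<^esub> (k - 1) w)" by simp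
 qed
next
 case (add z z')
 thus ?case by (simp add: HK.l_distr sy_simps distrib_left)
next
 case (smult a z)
 thus ?case by (simp add: HK.smult_mult_l sy_simps mult_ac)
next
 case (X u z)
 thus ?case by (simp add: HK.m_assoc sy_Xe mult_ac)
next
 case (Y v' z)
 show ?case
 proof (intro allI impI)
  fix k w assume w: "w : W"
  have d: "dd (a, 0) (lin (0, v) * p) = lin (0, v) * dd (a, 0) p" if "a : Ph" for a p using nzE[OF that] by (intro dd_lin_orth) auto
  have "sy (Ye v' \<star> z \<star> Ye v) k w = Te v' (sy (z \<star> Ye v)) k w" using Y(1) w by (simp add: HK.m_assoc sy_Te)
  also have "... = Te v' (%k w. if k = 0 then 0 else lin (0, v) * sy z (k - 1) w) k w" using Y(2) w by (intro Te_cong) auto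
  also have "... = (if k = 0 then 0 else lin (0, v) * Te v' (sy z) (k - 1) w)"
   by (cases k) (auto simp: Te_def d nzE pd_mult const_simps distrib_left sum_distrib_left mult_ac cong: sum.cong)
  finally show "sy (Ye v' \<star> z \<star> Ye v) k w = (if k = 0 then 0 else lin (0, v) * sy (Ye v' \<star> z) (k - 1) w)"
   by (simp add: sy_Te Y(1) w)
 qed
next
 case (W g z)
 have o: "orth g" using W(2) by (rule W_orth)
 have l: "linear (fs (ivf g))" by (intro linear_fs orth_linear orth_inv o)
 have "sub (fs (ivf g)) (lin (0, v)) = lin (0, v)" using sub_fs_lin1[OF o, of 0 v] linear_0[OF orth_linear[OF o]] by simp
 moreover have "ivf g o w : W" if "w : W" for w using W(2) that by (intro comp_W inv_W)
 ultimately show ?case using W by (simp add: HK.m_assoc sy_We sub_simps[OF l])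
qed

lemma sy_finite_level: "z : carrier HH ==> \<exists>m. \<forall>k w. m \<le> k --> w : W --> sy z k w = 0"
proof (induction z rule: HH_induct)
 case one
 show ?case by (intro exI[of _ 1]) (auto simp: sy_one)
next
 case (add z z')
 then obtain m m' where "\<forall>k w. m \<le> k --> w : W --> sy z k w = 0" "\<forall>k w. m' \<le> k --> w : W --> sy z' k w = 0" by blast
 thus ?case using add by (intro exI[of _ "max m m'"]) (simp add: sy_simps)
next
 case (smult a z)
 then obtain m where "\<forall>k w. m \<le> k --> w : W --> sy z k w = 0" by blast
 thus ?case using smult by (intro exI[of _ m]) (simp add: sy_simps)
next
 case (X u z)
 then obtain m where "\<forall>k w. m \<le> k --> w : W --> sy z k w = 0" by blast
 thus ?case using X by (intro exI[of _ m]) (simp add: sy_Xe)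
next
 case (Y v z)
 then obtain m where "\<forall>k w. m \<le> k --> w : W --> sy z k w = 0" by blast
 thus ?case using Y nzE by (intro exI[of _ "Suc m"]) (auto simp: sy_Te Te_def cong: sum.cong)
next
 case (W g z)
 then obtain m where "\<forall>k w. m \<le> k --> w : W --> sy z k w = 0" by blast
 moreover have "linear (fs (ivf g))" by (intro linear_fs orth_linear orth_inv W_orth W(2))
 ultimately show ?case using W by (intro exI[of _ m]) (simp add: sy_We sub_simps)
qed

end

section \<open>The centre of the angular momentum algebra\<close>

subsection \<open>Invariants of pairs of vectors\<close>

text \<open>Rotation by the angle t in the plane of orthonormal u and v, written as a correction to
  the identity so that the orthogonal complement is visibly fixed.\<close>

definition rotn :: "'e::euclidean_space => 'e => real => 'e => 'e" where
 "rotn u v t z = z + ((cos t - 1) * (z \<bullet> u) - sin t * (z \<bullet> v)) *\<^sub>R u + (sin t * (z \<bullet> u) + (cos t - 1) * (z \<bullet> v)) *\<^sub>R v"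

context
 fixes u v :: "'e::euclidean_space"
 assumes uv: "u \<bullet> u = 1" "v \<bullet> v = 1" "u \<bullet> v = 0"
begin

lemma rotn_inner_uv: "rotn u v t z \<bullet> u = cos t * (z \<bullet> u) - sin t * (z \<bullet> v)"
 "rotn u v t z \<bullet> v = sin t * (z \<bullet> u) + cos t * (z \<bullet> v)"
 using uv by (simp_all add: rotn_def inner_add_left inner_commute algebra_simps)

lemma rotn_inner: "rotn u v t z \<bullet> rotn u v t w = z \<bullet> w"
proof -
 have alg: "r + ((c - 1) * p - s * q) * p' + (s * p + (c - 1) * q) * q' + ((c - 1) * p' - s * q') * (c * p - s * q)
   + (s * p' + (c - 1) * q') * (s * p + c * q) = r + (c * c + s * s - 1) * (p * p' + q * q')" for r c s p q p' q' :: real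
  by (simp add: algebra_simps)
 have "rotn u v t z \<bullet> rotn u v t w = rotn u v t z \<bullet> w
   + ((cos t - 1) * (w \<bullet> u) - sin t * (w \<bullet> v)) * (rotn u v t z \<bullet> u)
   + (sin t * (w \<bullet> u) + (cos t - 1) * (w \<bullet> v)) * (rotn u v t z \<bullet> v)"
  by (subst (2) rotn_def) (simp add: inner_add_right)
 also have "rotn u v t z \<bullet> w = z \<bullet> w + ((cos t - 1) * (z \<bullet> u) - sin t * (z \<bullet> v)) * (w \<bullet> u)
   + (sin t * (z \<bullet> u) + (cos t - 1) * (z \<bullet> v)) * (w \<bullet> v)"
  unfolding rotn_def inner_add_left inner_scaleR_left inner_commute[of u w] inner_commute[of v w] ..
 also have "z \<bullet> w + ((cos t - 1) * (z \<bullet> u) - sin t * (z \<bullet> v)) * (w \<bullet> u) + (sin t * (z \<bullet> u) + (cos t - 1) * (z \<bullet> v)) * (w \<bullet> v)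
   + ((cos t - 1) * (w \<bullet> u) - sin t * (w \<bullet> v)) * (rotn u v t z \<bullet> u) + (sin t * (w \<bullet> u) + (cos t - 1) * (w \<bullet> v)) * (rotn u v t z \<bullet> v)
   = z \<bullet> w + (cos t * cos t + sin t * sin t - 1) * ((z \<bullet> u) * (w \<bullet> u) + (z \<bullet> v) * (w \<bullet> v))"
  unfolding rotn_inner_uv by (rule alg)
 finally have e: "rotn u v t z \<bullet> rotn u v t w = ..." .
 have "cos t * cos t + sin t * sin t = 1" using sin_cos_squared_add2[of t] by (simp add: power2_eq_square)
 thus ?thesis unfolding e by simp
qed

lemma rotn_deriv: "((%t. rotn u v t z) has_vector_derivative (rotn u v t z \<bullet> u) *\<^sub>R v - (rotn u v t z \<bullet> v) *\<^sub>R u) (at t)"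
proof -
 have "((%t. rotn u v t z) has_vector_derivative
   (- sin t * (z \<bullet> u) - cos t * (z \<bullet> v)) *\<^sub>R u + (cos t * (z \<bullet> u) + - sin t * (z \<bullet> v)) *\<^sub>R v) (at t)"
  unfolding rotn_def by (auto intro!: derivative_eq_intros simp: has_real_derivative_iff_has_vector_derivative[symmetric])
 thus ?thesis unfolding rotn_inner_uv by (simp add: algebra_simps)
qed

end

lemma unit_orth_exists:
 assumes "DIM('e) \<ge> 3"
 obtains d :: "'e::euclidean_space" where "d \<bullet> d = 1" "d \<bullet> a = 0" "d \<bullet> b = 0"
proof -
 have "dim {a, b} < DIM('e)" using dim_le_card'[of "{a, b}"] card_insert_le_m1[of 2 "{b}" a] assms by simp
 then obtain d where d: "d ~= 0" "\<And>z. z : span {a, b} ==> orthogonal d z" by (metis orthogonal_to_subspace_exists)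
 have "d \<bullet> a = 0" "d \<bullet> b = 0" using d(2)[of a] d(2)[of b] by (simp_all add: span_base orthogonal_def)
 thus ?thesis using d(1) by (intro that[of "(1 / norm d) *\<^sub>R d"]) (simp_all add: dot_square_norm power2_eq_square)
qed

text \<open>Rotate in the plane of a and b, which is orthogonal to c. If b is a multiple of a the
  plane is not determined, and dimension three supplies a second direction orthogonal to both a and
  c.\<close>

lemma rotn_transitive:
 fixes a b c :: "'e::euclidean_space"
 assumes dim: "DIM('e) \<ge> 3" and ab: "a \<bullet> a = 1" "b \<bullet> b = 1" and ac: "a \<bullet> c = 0" "b \<bullet> c = 0"
 shows "\<exists>v t. v \<bullet> v = 1 & a \<bullet> v = 0 & rotn a v t a = b & rotn a v t c = c"
proof -
 define d where "d = b - (b \<bullet> a) *\<^sub>R a"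
 have da: "d \<bullet> a = 0" and dc: "d \<bullet> c = 0" using ab ac by (simp_all add: d_def inner_diff_left)
 obtain v where v: "v \<bullet> v = 1" "v \<bullet> a = 0" "v \<bullet> c = 0" "d = norm d *\<^sub>R v"
 proof (cases "d = 0")
  case True
  thus ?thesis using unit_orth_exists[OF dim, of a c] that by (metis norm_zero scaleR_zero_left)
 next
  case False
  thus ?thesis using da dc by (intro that[of "(1 / norm d) *\<^sub>R d"]) (simp_all add: dot_square_norm power2_eq_square)
 qed
 have b: "b = (b \<bullet> a) *\<^sub>R a + norm d *\<^sub>R v" unfolding v(4)[symmetric] by (simp add: d_def)
 have "b \<bullet> b = (b \<bullet> a)\<^sup>2 + (norm d)\<^sup>2"
 proof -
  have "(r *\<^sub>R a + s *\<^sub>R v) \<bullet> (r *\<^sub>R a + s *\<^sub>R v) = r\<^sup>2 + s\<^sup>2" for r s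
   by (simp add: inner_add_left inner_add_right v(1,2) ab inner_commute[of a v] power2_eq_square)
  thus ?thesis using b by metis
 qed
 then obtain t where t: "b \<bullet> a = cos t" "norm d = sin t" using ab sincos_total_2pi by metis
 have av: "a \<bullet> v = 0" using v(2) by (simp add: inner_commute)
 have "rotn a v t a = cos t *\<^sub>R a + sin t *\<^sub>R v" by (simp add: rotn_def ab av algebra_simps)
 also have "... = b" using b t by simp
 finally show ?thesis using v ac av by (intro exI[of _ v] exI[of _ t]) (simp add: rotn_def inner_commute)
qed

text \<open>For a unit vector eta choose a unit vector xi orthogonal to eta and to w eta. The
  identity shrinks to (w eta.eta)(w xi.xi) = 1, and equality in Cauchy-Schwarz gives w eta = eta or
  - eta. By linearity the sign is the same for all vectors.\<close>

lemma pm_id: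
 fixes w :: "'e::euclidean_space => 'e"
 assumes dim: "DIM('e) \<ge> 3" and o: "orth w"
  and e: "\<And>\<eta> \<xi> u v. (\<xi> \<bullet> v) * (\<eta> \<bullet> u) - (\<xi> \<bullet> u) * (\<eta> \<bullet> v) = (w \<eta> \<bullet> u) * (w \<xi> \<bullet> v) - (w \<eta> \<bullet> v) * (w \<xi> \<bullet> u)"
 shows "w = id \<or> w = uminus"
proof -
 have l: "linear w" and nw: "norm (w z) = norm z" for z using o by (auto simp: orthogonal_transformation)
 have unit: "w \<eta> = \<eta> \<or> w \<eta> = - \<eta>" if n: "norm \<eta> = 1" for \<eta>
 proof -
  obtain \<xi> where x: "\<xi> \<bullet> \<xi> = 1" "\<xi> \<bullet> \<eta> = 0" "\<xi> \<bullet> w \<eta> = 0" using unit_orth_exists[OF dim] by blast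
  have nx: "norm \<xi> = 1" using x(1) by (simp add: norm_eq_sqrt_inner)
  have "(w \<eta> \<bullet> \<eta>) * (w \<xi> \<bullet> \<xi>) = 1"
   using e[of \<xi> \<xi> \<eta> \<eta>] x n by (simp add: inner_commute dot_square_norm)
  hence "\<bar>w \<eta> \<bullet> \<eta>\<bar> * \<bar>w \<xi> \<bullet> \<xi>\<bar> = 1" by (simp add: abs_mult[symmetric])
  moreover have "\<bar>w \<eta> \<bullet> \<eta>\<bar> \<le> 1" "\<bar>w \<xi> \<bullet> \<xi>\<bar> \<le> 1"
   using Cauchy_Schwarz_ineq2[of "w \<eta>" \<eta>] Cauchy_Schwarz_ineq2[of "w \<xi>" \<xi>] n nx nw by simp_all
  ultimately have "\<bar>w \<eta> \<bullet> \<eta>\<bar> = 1" by (smt (verit) mult_left_le mult_nonneg_nonneg abs_ge_zero mult.commute)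
  hence "\<bar>w \<eta> \<bullet> \<eta>\<bar> = norm (w \<eta>) * norm \<eta>" using n nw by simp
  thus ?thesis unfolding norm_cauchy_schwarz_abs_eq using n nw by simp (metis minus_minus)
 qed
 have all: "w \<eta> = \<eta> \<or> w \<eta> = - \<eta>" for \<eta>
 proof (cases "\<eta> = 0")
  case True
  thus ?thesis using linear_0[OF l] by simp
 next
  case False
  hence "norm ((1 / norm \<eta>) *\<^sub>R \<eta>) = 1" by simp
  from unit[OF this] show ?thesis using False by (simp add: linear_scale[OF l] flip: scaleR_minus_right)
 qed
 show ?thesis
 proof (rule ccontr)
  assume "\<not> (w = id \<or> w = uminus)"
  then obtain a b where ab: "w a ~= a" "w b ~= - b" by (metis eq_id_iff ext)
  hence w: "w a = - a" "w b = b" "w (a + b) = - a + b" using all by (metis, metis) (metis all ab linear_add[OF l])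
  have a0: "a ~= 0" and b0: "b ~= 0" using ab linear_0[OF l] by auto
  from all[of "a + b"] show False unfolding w(3)
  proof
   assume "- a + b = a + b"
   hence "2 *\<^sub>R a = 0" by (simp add: scaleR_2 algebra_simps)
   thus False using a0 by simp
  next
   assume "- a + b = - (a + b)"
   hence "2 *\<^sub>R b = 0" by (simp add: scaleR_2 algebra_simps)
   thus False using b0 by simp
  qed
 qed
qed

context onb
begin

text \<open>The Gram determinant of the pair (x, xi) in coordinates; \<open>ev_Qf\<close> is its
  invariant form.\<close>

definition Qf :: "('e \<times> 'e) pf" where
 "Qf = (\<Sum>i\<in>{1..DIM('e)}. lin (y i, 0) * lin (y i, 0)) * (\<Sum>i\<in>{1..DIM('e)}. lin (0, y i) * lin (0, y i))
   - (\<Sum>i\<in>{1..DIM('e)}. lin (y i, 0) * lin (0, y i)) * (\<Sum>i\<in>{1..DIM('e)}. lin (y i, 0) * lin (0, y i))"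

lemma ev_Qf: "ev Qf (v, \<xi>) = of_real ((v \<bullet> v) * (\<xi> \<bullet> \<xi>) - (v \<bullet> \<xi>)\<^sup>2)"
 unfolding Qf_def y_parseval[of v v] y_parseval[of \<xi> \<xi>] y_parseval[of v \<xi>] by (simp add: ev_sum power2_eq_square)

text \<open>\<open>rot\<close> integrates to invariance under simultaneous rotations and
  \<open>sh\<close> to invariance under adding multiples of x to xi. So a pair may be made
  orthogonal, then orthonormal by homogeneity, and on orthonormal pairs F is a constant c. Hence F
  is c times the m-th power of the area, a polynomial expression only for even m.\<close>

lemma pair_invariant:
 fixes F :: "('e \<times> 'e) pf"
 assumes dim: "DIM('e) \<ge> 3"
  and hx: "\<And>t v \<xi>. ev F (t *\<^sub>R v, \<xi>) = of_real t ^ m * ev F (v, \<xi>)"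
  and h\<xi>: "\<And>t v \<xi>. ev F (v, t *\<^sub>R \<xi>) = of_real t ^ m * ev F (v, \<xi>)"
  and rot: "\<And>u v. lin (0, v) * pd (0, u) F - lin (0, u) * pd (0, v) F = lin (u, 0) * pd (v, 0) F - lin (v, 0) * pd (u, 0) F"
  and sh: "(\<Sum>i\<in>{1..DIM('e)}. lin (y i, 0) * pd (0, y i) F) = 0"
 shows "\<exists>k. F = (if even m then const k * Qf ^ (m div 2) else 0)"
proof -
 have R: "ev F (rotn u v t a, rotn u v t b) = ev F (a, b)" if uv: "u \<bullet> u = 1" "v \<bullet> v = 1" "u \<bullet> v = 0" for u v t a b
 proof -
  let ?g = "%t. (rotn u v t a, rotn u v t b)"
  let ?d = "%z. (z \<bullet> u) *\<^sub>R v - (z \<bullet> v) *\<^sub>R u"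
  have "ev F (?g t) = ev F (?g 0)"
  proof (rule ev_const_curve)
   show "(?g has_vector_derivative (?d (rotn u v t a), ?d (rotn u v t b))) (at t)" for t
    by (intro has_vector_derivative_Pair rotn_deriv uv)
   have "ev (pd (?d p, ?d q) F) (p, q) = 0" for p q
   proof -
    have "(?d p, ?d q) = (p \<bullet> u) *\<^sub>R (v, 0) + (- (p \<bullet> v)) *\<^sub>R (u, 0) + (q \<bullet> u) *\<^sub>R (0, v) + (- (q \<bullet> v)) *\<^sub>R (0, u)" by simp
    hence "ev (pd (?d p, ?d q) F) (p, q) = of_real (p \<bullet> u) * ev (pd (v, 0) F) (p, q) - of_real (p \<bullet> v) * ev (pd (u, 0) F) (p, q)
     + of_real (q \<bullet> u) * ev (pd (0, v) F) (p, q) - of_real (q \<bullet> v) * ev (pd (0, u) F) (p, q)"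
     by (simp only: pd_vec_add pd_vec_scale) simp
    also have "... = ev (lin (u, 0) * pd (v, 0) F - lin (v, 0) * pd (u, 0) F - (lin (0, v) * pd (0, u) F - lin (0, u) * pd (0, v) F)) (p, q)"
     by simp
    finally show ?thesis by (simp only: rot) simp
   qed
   thus "ev (pd (?d (rotn u v t a), ?d (rotn u v t b)) F) (?g t) = 0" for t .
  qed
  thus ?thesis by (simp add: rotn_def)
 qed
 have S: "ev F (v, \<xi> + s *\<^sub>R v) = ev F (v, \<xi>)" for v \<xi> s
 proof -
  have "ev F (v, \<xi> + s *\<^sub>R v) = ev F (v, \<xi> + 0 *\<^sub>R v)"
  proof (rule ev_const_curve)
   show "((%s. (v, \<xi> + s *\<^sub>R v)) has_vector_derivative (0, v)) (at t)" for t
    by (intro has_vector_derivative_Pair line_deriv) simp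
   fix t
   have "(0::'e, v) = (\<Sum>i\<in>{1..DIM('e)}. (v \<bullet> y i) *\<^sub>R (0, y i))"
    by (rule prod_eqI) (simp_all only: fst_sum snd_sum fst_scaleR snd_scaleR fst_conv snd_conv y_expand scaleR_zero_right sum.neutral_const)
   hence "ev (pd (0, v) F) p = (\<Sum>i\<in>{1..DIM('e)}. of_real (v \<bullet> y i) * ev (pd (0, y i) F) p)" for p
    by (simp only: pd_vec_sum pd_vec_scale ev_sum ev_simps)
   hence "ev (pd (0, v) F) (v, \<xi> + t *\<^sub>R v) = ev (\<Sum>i\<in>{1..DIM('e)}. lin (y i, 0) * pd (0, y i) F) (v, \<xi> + t *\<^sub>R v)"
    by (simp add: ev_sum)
   thus "ev (pd (0, v) F) (v, \<xi> + t *\<^sub>R v) = 0" by (simp only: sh) simp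
  qed
  thus ?thesis by simp
 qed
 have n12: "1 : {1..DIM('e)}" "2 : {1..DIM('e)}" using dim by auto
 define c where "c = ev F (y 1, y 2)"
 have pairs: "ev F (a, b) = c" if ab: "a \<bullet> a = 1" "b \<bullet> b = 1" "a \<bullet> b = 0" for a b
 proof -
  have y12: "y 1 \<bullet> y 1 = 1" "y 2 \<bullet> y 2 = 1" "y 1 \<bullet> y 2 = 0" "y 2 \<bullet> y 1 = 0"
   using y_inner[OF n12(1) n12(1)] y_inner[OF n12(2) n12(2)] y_inner[OF n12] y_inner[OF n12(2,1)] by simp_all
  obtain v t where v: "v \<bullet> v = 1" "a \<bullet> v = 0" "rotn a v t a = y 1"
   using rotn_transitive[OF dim ab(1) y12(1), of 0] by auto
  define b' where "b' = rotn a v t b"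
  have b': "b' \<bullet> b' = 1" "b' \<bullet> y 1 = 0"
   unfolding b'_def v(3)[symmetric] using rotn_inner[OF ab(1) v(1,2)] ab by (simp_all add: inner_commute)
  have 1: "ev F (y 1, b') = ev F (a, b)" unfolding b'_def v(3)[symmetric] by (rule R[OF ab(1) v(1,2)])
  obtain v' s where v': "v' \<bullet> v' = 1" "b' \<bullet> v' = 0" "rotn b' v' s b' = y 2" "rotn b' v' s (y 1) = y 1"
   using rotn_transitive[OF dim b'(1) y12(2) b'(2) y12(4)] by auto
  have "ev F (y 1, y 2) = ev F (y 1, b')" using R[OF b'(1) v'(1,2), of s "y 1" b'] v' by simp
  thus ?thesis using 1 by (simp add: c_def)
 qed
 have gen: "ev F (v, \<xi>) = (if even m then c * ev (Qf ^ (m div 2)) (v, \<xi>) else 0)" if m: "m > 0" for v \<xi>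
 proof -
  \<comment> \<open>Reversing one vector of an orthonormal pair gives another one, while F changes
    sign.\<close>
  have odd: "c = 0" if "odd m"
  proof -
   obtain e where e: "e \<bullet> e = 1" "e \<bullet> y 1 = 0" using unit_orth_exists[OF dim, of "y 1" "y 1"] by blast
   have y1: "y 1 \<bullet> y 1 = 1" using y_inner[OF n12(1) n12(1)] by simp
   have "c = ev F (y 1, (-1) *\<^sub>R e)" using e y1 by (intro pairs[symmetric]) (simp_all add: inner_commute)
   also have "... = - ev F (y 1, e)" using that by (simp only: h\<xi>) simp
   also have "ev F (y 1, e) = c" using e y1 by (intro pairs) (simp_all add: inner_commute)
   finally show ?thesis by simp
  qed
  show ?thesis
  proof (cases "v = 0")
   case True
   have "ev F (v, \<xi>) = 0" using hx[of 0 v \<xi>] m True by (simp add: zero_power)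
   moreover have "m div 2 > 0" if "even m" using m that by auto
   ultimately show ?thesis using True by (auto simp: ev_power ev_Qf)
  next
   case v0: False
   \<comment> \<open>The component of xi orthogonal to v, reached by a shear; its length times that
     of v is the area.\<close>
   define \<zeta> where "\<zeta> = \<xi> + (- (v \<bullet> \<xi>) / (v \<bullet> v)) *\<^sub>R v"
   have F\<zeta>: "ev F (v, \<xi>) = ev F (v, \<zeta>)" unfolding \<zeta>_def by (rule S[symmetric])
   have v\<zeta>: "v \<bullet> \<zeta> = 0" using v0 by (simp add: \<zeta>_def inner_add_right inner_diff_right)
   have Q: "(v \<bullet> v) * (\<xi> \<bullet> \<xi>) - (v \<bullet> \<xi>)\<^sup>2 = (norm v * norm \<zeta>)\<^sup>2"
   proof -
    have "(norm \<zeta>)\<^sup>2 = \<zeta> \<bullet> \<xi>"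
     unfolding power2_norm_eq_inner by (subst (2) \<zeta>_def) (simp add: inner_add_right inner_diff_right v\<zeta> v\<zeta>[unfolded inner_commute[of v]] inner_commute)
    also have "... = \<xi> \<bullet> \<xi> - (v \<bullet> \<xi>) * (v \<bullet> \<xi>) / (v \<bullet> v)" by (simp add: \<zeta>_def inner_add_left inner_diff_left)
    finally have z: "(norm \<zeta>)\<^sup>2 = ..." .
    show ?thesis unfolding power_mult_distrib z power2_norm_eq_inner[of v] using v0 by (simp add: right_diff_distrib power2_eq_square)
   qed
   show ?thesis
   proof (cases "\<zeta> = 0")
    case True
    have "ev F (v, \<xi>) = 0" unfolding F\<zeta> using h\<xi>[of v 0 \<zeta>] m True by (simp add: zero_power)
    moreover have "m div 2 > 0" if "even m" using m that by auto
    ultimately show ?thesis using True Q by (auto simp: ev_power ev_Qf)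
   next
    case False
    define e f where "e = (1 / norm v) *\<^sub>R v" and "f = (1 / norm \<zeta>) *\<^sub>R \<zeta>"
    have vz: "v = norm v *\<^sub>R e" "\<zeta> = norm \<zeta> *\<^sub>R f" using v0 False by (simp_all add: e_def f_def)
    have ef: "e \<bullet> e = 1" "f \<bullet> f = 1" "e \<bullet> f = 0" using v0 False v\<zeta> by (simp_all add: e_def f_def dot_square_norm power2_eq_square)
    have "ev F (v, \<xi>) = ev F (norm v *\<^sub>R e, norm \<zeta> *\<^sub>R f)" unfolding F\<zeta> using vz by simp
    also have "... = of_real (norm v) ^ m * (of_real (norm \<zeta>) ^ m * c)" by (simp only: hx h\<xi> pairs[OF ef] mult_ac)
    also have "... = c * of_real (norm v * norm \<zeta>) ^ m" by (simp add: power_mult_distrib mult_ac)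
    finally have E: "ev F (v, \<xi>) = c * of_real (norm v * norm \<zeta>) ^ m" .
    show ?thesis
    proof (cases "even m")
     case True
     hence "of_real (norm v * norm \<zeta>) ^ m = (of_real ((norm v * norm \<zeta>)\<^sup>2) :: complex) ^ (m div 2)"
      by (simp add: power_mult[symmetric] of_real_power)
     thus ?thesis using True by (simp only: E ev_power ev_Qf Q if_True)
    next
     case False
     thus ?thesis using odd by (simp add: E)
    qed
   qed
  qed
 qed
 show ?thesis
 \<comment> \<open>In degree 0 scaling both vectors by 0 shows that F is constant. The argument for
   positive degrees uses instead that F vanishes on degenerate pairs.\<close>
 proof (cases "m = 0")
  case True
  have "ev F (v, \<xi>) = ev F (0, 0)" for v \<xi> using hx[of 0 v \<xi>] h\<xi>[of 0 0 \<xi>] True by simp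
  hence "F = const (ev F (0, 0))" by (intro pf_eqI) auto
  thus ?thesis using True by (intro exI[of _ "ev F (0, 0)"]) simp
 next
  case False
  hence "F = (if even m then const c * Qf ^ (m div 2) else 0)" by (intro pf_eqI) (auto simp: gen)
  thus ?thesis by blast
 qed
qed

end

section \<open>The tensor product with the Clifford algebra: normal form, faithfulness and the Dirac
  element\<close>

section \<open>The angular momentum algebra with Clifford coefficients\<close>

lemma const_eq_0_iff: "const d = 0 \<longleftrightarrow> d = 0"
proof
 assume e: "const d = (0 :: 'a pf)"
 have "d = ev (const d) (0 :: 'a)" by simp
 also have "... = 0" unfolding e by simp
 finally show "d = 0" .
qed (simp add: const_simps)

context cherednik
begin

abbreviation "AA \<equiv> DAMA R Rp c y x"

definition gensA :: "'e cher set" where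
 "gensA = We ` W \<union> {M_elt R Rp c y x i j | i j. 1 \<le> i & i < j & j \<le> DIM('e)}"

lemma AA_eq: "AA = HH\<lparr>carrier := subalg_gen HH gensA\<rparr>" by (simp add: DAMA_def gensA_def We_def[abs_def])

lemma M_elt_eq: "M_elt R Rp c y x i j = Xe (x i) \<star> Ye (y j) \<ominus>\<^bsub>HH\<^esub> Xe (x j) \<star> Ye (y i)"
 by (simp add: M_elt_def Let_def Xe_def Ye_def)

lemma M_elt_closed [simp]: "M_elt R Rp c y x i j : carrier HH" by (simp add: M_elt_eq)

lemma gensA_closed: "gensA \<subseteq> carrier HH" by (auto simp: gensA_def)

lemma AA_sub: "is_subalg HH (carrier AA)" unfolding AA_eq using HK.is_subalg_gen(1)[OF gensA_closed] by simp

lemma AA_gens: "gensA \<subseteq> carrier AA" unfolding AA_eq using HK.is_subalg_gen(2)[OF gensA_closed] by simp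

lemma AA_least: "is_subalg HH S ==> (\<And>w. w : W ==> We w : S) ==>
 (\<And>i j. 1 \<le> i ==> i < j ==> j \<le> DIM('e) ==> M_elt R Rp c y x i j : S) ==> carrier AA \<subseteq> S"
 unfolding AA_eq by (simp, rule subalg_gen_least) (auto simp: gensA_def)

lemma AA_simps [simp]: "mult AA = mult HH" "one AA = one HH" "zero AA = zero HH" "add AA = add HH" "smult AA = smult HH"
 unfolding AA_eq by simp_all

lemma AA_HH [simp, intro]: "a : carrier AA ==> a : carrier HH" using AA_sub by (auto simp: is_subalg_def)

lemma kalg_AA: "kalg AA" using HK.kalg_subalg[OF AA_sub] unfolding AA_eq by simp

sublocale AK: kalg AA by (rule kalg_AA)
sublocale CK: kalg "Cliff :: (complex, 'e cliff \<times> 'e cliff) module" by (rule kalg_Cliff)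
sublocale TT: tensor AA "Cliff :: (complex, 'e cliff \<times> 'e cliff) module" ..

abbreviation (input) tt_mult (infixl "\<bowtie>" 70) where "a \<bowtie> b == a \<otimes>\<^bsub>TT.T\<^esub> b"

abbreviation (input) tt_add (infixl "\<uplus>" 65) where "a \<uplus> b == a \<oplus>\<^bsub>TT.T\<^esub> b"

abbreviation "TA \<equiv> A_Cliff R Rp c y x"

lemma TA_eq: "TA = tensor_alg AA Cliff" and pure_eq: "pure R Rp c y x = tens AA Cliff" by (simp_all add: A_Cliff_def pure_def fun_eq_iff)

lemma gens_AA [simp, intro]: "w : W ==> We w : carrier AA"
 "1 \<le> i ==> i < j ==> j \<le> DIM('e) ==> M_elt R Rp c y x i j : carrier AA" using AA_gens unfolding gensA_def by blast+

lemma pr_M: "i : {1..DIM('e)} ==> j : {1..DIM('e)} ==> pr (M_elt R Rp c y x i j) = Mm (y i) (y j)"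
 by (simp add: M_elt_eq pr_gens riesz_x Mm_def del: atLeastAtMost_iff)

lemma commute_subalg: "is_subalg HH {z : carrier HH. pr z * F = F * pr z}"
proof -
 have "pr a * pr b * F = F * (pr a * pr b)" if "pr a * F = F * pr a" "pr b * F = F * pr b" for a b
  using commute_prod[of F "pr a" "pr b"] that by simp
 thus ?thesis by (auto simp: is_subalg_def distrib_left distrib_right sc_left[of F] mult.assoc)
qed

lemma AA_commutes:
 assumes "\<And>w. w : W ==> Wo w * F = F * Wo w" "\<And>i j. Mm (y i) (y j) * F = F * Mm (y i) (y j)" and "z : carrier AA"
 shows "pr z * F = F * pr z"
proof -
 have "carrier AA \<subseteq> {z : carrier HH. pr z * F = F * pr z}" by (rule AA_least[OF commute_subalg]) (auto simp: pr_gens assms pr_M)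
 thus ?thesis using assms(3) by auto
qed

lemma pr_co: "z : carrier HH ==> pr z * co i = co i * pr z"
proof (induction z rule: HH_induct)
 case (smult a z)
 thus ?case by (simp add: sc_left[of "co i"] mult.assoc)
next
 case (X u z)
 thus ?case using commute_prod[of "co i" "Xo (riesz u)" "pr z"] by (simp add: pr_gens Mo_co)
next
 case (Y v z)
 thus ?case using commute_prod[of "co i" "To v" "pr z"] by (simp add: pr_gens To_co)
next
 case (W g z)
 thus ?case using commute_prod[of "co i" "Wo g" "pr z"] by (simp add: pr_gens Wo_co W_orth)
qed (simp_all add: distrib_left distrib_right)

lemma pr_vac_supp: "z : carrier HH ==> \<forall>k S w. S ~= {} --> app (pr z) vac k S w = 0"
proof (induction z rule: HH_induct)
 case one
 show ?case by (simp add: vac_def dl_def)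
next
 case (smult a z)
 thus ?case by (simp add: smv_def)
next
 case (X u z)
 thus ?case by (simp add: pr_gens)
next
 case (Y v z)
 thus ?case using nzE by (auto simp: pr_gens app_To)
next
 case (W g z)
 have "linear (fs (ivf g))" by (intro linear_fs orth_linear orth_inv W_orth W(2))
 thus ?case using W by (simp add: pr_gens app_Wo W_orth sub_simps)
qed simp_all

subsection \<open>Normal form in the tensor product\<close>

definition cop :: "nat list => 'e op" where "cop l = foldr (%i F. co i * F) l 1"

lemma kr_cw: "set l \<subseteq> {1..DIM('e)} ==> kr (cw l) = cop l"
 by (induction l) (simp_all add: cop_def kr_vec cv_y del: atLeastAtMost_iff)

text \<open>Applied to a vector supported at S = {}, an increasing word lands in the single
  component S = set l, up to a nonzero factor. Different words therefore never interfere.\<close>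

lemma cop_supp:
 "distinct l ==> \<exists>e. e ~= 0 & (\<forall>f. (\<forall>k S w. S ~= {} --> f k S w = 0) -->
   (\<forall>k S w. app (cop l) f k S w = (if S = set l then const e * f k {} w else 0)))"
proof (induction l)
 case Nil
 show ?case by (intro exI[of _ 1]) (auto simp: cop_def const_simps)
next
 case (Cons i l)
 then obtain e where e: "e ~= 0" "\<And>f k S w. (\<forall>k S w. S ~= {} --> f k S w = 0) ==>
   app (cop l) f k S w = (if S = set l then const e * f k {} w else 0)" by auto
 have s: "tog i S = set l \<longleftrightarrow> S = set (i # l)" for S using Cons.prems by (auto simp: tog_def split: if_splits)
 have z: "sg i (set (i # l)) ~= 0" by (simp add: sg_def)
 show ?case
 proof (rule exI[of _ "sg i (set (i # l)) * e"], intro conjI allI impI)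
  fix f :: "'e vv" and k S w assume f: "\<forall>k S w. S ~= {} --> f k S w = 0"
  have "app (cop (i # l)) f k S w = const (sg i S) * app (cop l) f k (tog i S) w" by (simp add: cop_def)
  also have "... = (if S = set (i # l) then const (sg i (set (i # l)) * e) * f k {} w else 0)"
   unfolding e(2)[OF f] s by (simp add: const_simps mult.assoc)
  finally show "app (cop (i # l)) f k S w = (if S = set (i # l) then const (sg i (set (i # l)) * e) * f k {} w else 0)" .
 qed (use e z in simp)
qed

lemma cx_closed [simp, intro]: "a : carrier CR ==> cx_incl CR a : carrier Cliff" by (simp add: cx_incl_def Cliff_def complexify_simps)

lemma cx_simps: "a : carrier CR ==> b : carrier CR ==>
  cx_incl CR (a \<ast> b) = cx_incl CR a \<otimes>\<^bsub>Cliff\<^esub> cx_incl CR b"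
 "a : carrier CR ==> b : carrier CR ==>
  cx_incl CR (a \<oplus>\<^bsub>CR\<^esub> b) = cx_incl CR a \<oplus>\<^bsub>Cliff\<^esub> cx_incl CR b"
 "a : carrier CR ==> cx_incl CR (r \<odot>\<^bsub>CR\<^esub> a) = of_real r \<odot>\<^bsub>Cliff\<^esub> cx_incl CR a"
 "cx_incl CR \<one>\<^bsub>CR\<^esub> = \<one>\<^bsub>Cliff\<^esub>" "cx_incl CR \<zero>\<^bsub>CR\<^esub> = \<zero>\<^bsub>Cliff\<^esub>"
 by (simp_all add: cx_incl_def Cliff_def complexify_simps a_minus_def)

abbreviation "ce l \<equiv> cx_incl CR (cw l)"

lemma Cliff_span: "carrier Cliff = lspan Cliff (ce ` srt)"
proof
 have S: "ce ` srt \<subseteq> carrier Cliff" by auto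
 show "lspan Cliff (ce ` srt) \<subseteq> carrier Cliff" using CK.lspan_closed[OF S] by blast
 have cwS: "cw ` srt \<subseteq> carrier CR" by auto
 have r: "cx_incl CR a : lspan Cliff (ce ` srt)" if "a : carrier CR" for a using that unfolding cliff_span
 proof (induction rule: lspan.induct)
  case zero
  thus ?case by (simp add: cx_simps lspan.zero)
 next
  case (step s t k)
  hence "s : carrier CR" "t : carrier CR" using cwS C.lspan_closed[OF cwS] by auto
  thus ?case using step by (auto simp: cx_simps intro!: lspan.step)
 qed
 show "carrier Cliff \<subseteq> lspan Cliff (ce ` srt)"
 proof
  fix p assume "p : carrier (Cliff :: (complex, 'e cliff \<times> 'e cliff) module)"
  then obtain a b where ab: "p = (a, b)" "a : carrier CR" "b : carrier CR" by (auto simp: Cliff_def complexify_simps)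
  have "p = cx_incl CR a \<oplus>\<^bsub>Cliff\<^esub> \<i> \<odot>\<^bsub>Cliff\<^esub> cx_incl CR b"
   using ab by (simp add: cx_incl_def Cliff_def complexify_simps a_minus_def)
  thus "p : lspan Cliff (ce ` srt)" using r ab S by (simp add: CK.lspan_add CK.lspan_smult)
 qed
qed

text \<open>Coefficients in the angular momentum algebra for each increasing Clifford word.
  \<open>NF_ex\<close> gives existence of this form; the coefficients are recovered by
  \<open>Th_NF\<close>.\<close>

definition NF :: "(nat list => 'e cher) => 'e dirac" where
 "NF a = (\<Oplus>\<^bsub>TT.T\<^esub>l\<in>srt. TT.tn (a l) (ce l))"

lemma NF_add: "a : srt \<rightarrow> carrier AA ==> b : srt \<rightarrow> carrier AA ==> NF a \<uplus> NF b = NF (%l. a l \<oplus>\<^bsub>AA\<^esub> b l)"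
proof -
 assume a: "a : srt \<rightarrow> carrier AA" and b: "b : srt \<rightarrow> carrier AA"
 have "NF (%l. a l \<oplus>\<^bsub>AA\<^esub> b l) = (\<Oplus>\<^bsub>TT.T\<^esub>l\<in>srt. TT.tn (a l) (ce l) \<uplus> TT.tn (b l) (ce l))"
  unfolding NF_def by (rule TT.T.finsum_cong') (use a b in \<open>auto simp: Pi_iff TT.tn_add_l simp del: AA_simps\<close>)
 also have "... = NF a \<uplus> NF b" unfolding NF_def by (rule TT.T.finsum_addf) (use a b in auto)
 finally show ?thesis by simp
qed

lemma NF_zero: "NF (%l. \<zero>\<^bsub>AA\<^esub>) = \<zero>\<^bsub>TT.T\<^esub>"
 unfolding NF_def by (subst TT.T.finsum_cong'[of srt srt "%l. \<zero>\<^bsub>TT.T\<^esub>"]) (auto simp del: AA_simps)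

lemma NF_ex: "t : carrier TT.T ==> \<exists>a\<in>srt \<rightarrow> carrier AA. t = NF a"
proof -
 have sm: "\<exists>b\<in>srt \<rightarrow> carrier AA. k \<odot>\<^bsub>TT.T\<^esub> NF a = NF b" if a: "a : srt \<rightarrow> carrier AA" for k a
 proof -
  have "k \<odot>\<^bsub>TT.T\<^esub> NF a = (\<Oplus>\<^bsub>TT.T\<^esub>l\<in>srt. k \<odot>\<^bsub>TT.T\<^esub> TT.tn (a l) (ce l))"
   unfolding NF_def by (rule TT.T.smult_finsum) (use a in auto)
  also have "... = NF (%l. k \<odot>\<^bsub>AA\<^esub> a l)"
   unfolding NF_def by (rule TT.T.finsum_cong') (use a in \<open>auto simp: Pi_iff TT.tn_smult_l simp del: AA_simps\<close>)
  finally show ?thesis using a by (intro bexI[of _ "%l. k \<odot>\<^bsub>AA\<^esub> a l"]) (auto simp del: AA_simps)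
 qed
 have ad: "\<exists>b\<in>srt \<rightarrow> carrier AA. s \<uplus> t = NF b" if "\<exists>a\<in>srt \<rightarrow> carrier AA. s = NF a" "\<exists>a\<in>srt \<rightarrow> carrier AA. t = NF a" for s t
 proof -
  from that obtain a b where ab: "a : srt \<rightarrow> carrier AA" "s = NF a" "b : srt \<rightarrow> carrier AA" "t = NF b" by (elim bexE)
  show ?thesis unfolding ab(2,4) NF_add[OF ab(1,3)] by (rule bexI[of _ "%l. a l \<oplus>\<^bsub>AA\<^esub> b l"]) (use ab in \<open>auto simp del: AA_simps\<close>)
 qed
 have z: "\<exists>b\<in>srt \<rightarrow> carrier AA. \<zero>\<^bsub>TT.T\<^esub> = NF b"
  by (rule bexI[of _ "%l. \<zero>\<^bsub>AA\<^esub>"]) (auto simp: NF_zero simp del: AA_simps)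
 have ceS: "ce ` srt \<subseteq> carrier Cliff" by auto
 have tn: "\<exists>n\<in>srt \<rightarrow> carrier AA. TT.tn a b = NF n" if a: "a : carrier AA" and b: "b : carrier Cliff" for a b
  using b unfolding Cliff_span
 proof (induction rule: lspan.induct)
  case zero
  have "TT.tn a \<zero>\<^bsub>Cliff\<^esub> = \<zero>\<^bsub>TT.T\<^esub>" using TT.tn_smult_r[OF a CK.zero_closed, of 0] a by simp
  thus ?case using z by simp
 next
  case (step s t k)
  then obtain l where l: "l : srt" "s = ce l" by auto
  have t: "t : carrier Cliff" using CK.lspan_closed[OF ceS step(2)] .
  define n where "n l' = (if l' = l then k \<odot>\<^bsub>AA\<^esub> a else \<zero>\<^bsub>AA\<^esub>)" for l'
  have n: "n : srt \<rightarrow> carrier AA" using a by (auto simp: n_def simp del: AA_simps)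
  have n0: "(\<Oplus>\<^bsub>TT.T\<^esub>l'\<in>srt - {l}. TT.tn (n l') (ce l')) = \<zero>\<^bsub>TT.T\<^esub>"
   by (subst TT.T.finsum_cong'[of "srt - {l}" "srt - {l}" "%l. \<zero>\<^bsub>TT.T\<^esub>"]) (auto simp: n_def simp del: AA_simps)
  have "NF n = (\<Oplus>\<^bsub>TT.T\<^esub>l'\<in>insert l (srt - {l}). TT.tn (n l') (ce l'))" unfolding NF_def using l by (simp add: insert_absorb)
  also have "... = TT.tn (n l) (ce l) \<uplus> (\<Oplus>\<^bsub>TT.T\<^esub>l'\<in>srt - {l}. TT.tn (n l') (ce l'))"
   by (rule TT.T.finsum_insert) (use finite_srt n l in auto)
  also have "... = k \<odot>\<^bsub>TT.T\<^esub> TT.tn a (ce l)"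
   unfolding n0 using a TT.tn_smult_l[OF a, of "ce l" k] by (simp add: n_def)
  finally have "NF n = TT.tn a (k \<odot>\<^bsub>Cliff\<^esub> s)" using a l by (simp add: TT.tn_smult_r)
  hence "TT.tn a (k \<odot>\<^bsub>Cliff\<^esub> s \<oplus>\<^bsub>Cliff\<^esub> t) = NF n \<uplus> TT.tn a t" using a l t by (simp add: TT.tn_add_r)
  thus ?case using ad[of "NF n" "TT.tn a t"] step(3) n by auto
 qed
 assume "t : carrier TT.T"
 thus ?thesis unfolding TT.tensor_span
 proof (induction rule: lspan.induct)
  case zero
  show ?case by (rule z)
 next
  case (step s t k)
  then obtain a b where ab: "s = TT.tn a b" "a : carrier AA" "b : carrier Cliff" by auto
  obtain n where n: "n : srt \<rightarrow> carrier AA" "TT.tn a b = NF n" using tn[OF ab(2,3)] by (elim bexE)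
  show ?case by (rule ad[OF _ step(3)]) (unfold ab(1) n(2), rule sm[OF n(1)])
 qed
qed

lemma prA_hom: "kalg_hom AA talg pr" by (rule kalg_homI[OF kalg_AA kalg_talg]) auto

lemma pr_kr: "z : carrier HH ==> \<eta> : carrier CR ==> pr z * kr \<eta> = kr \<eta> * pr z"
proof -
 assume z: "z : carrier HH" and e: "\<eta> : carrier CR"
 have cwS: "cw ` srt \<subseteq> carrier CR" by auto
 have c: "pr z * cop l = cop l * pr z" for l
 proof (induction l)
  case (Cons i l)
  thus ?case using commute_prod[of "pr z" "co i" "cop l"] pr_co[OF z] by (simp add: cop_def)
 qed (simp add: cop_def)
 show ?thesis using e unfolding cliff_span
 proof (induction rule: C.lspan_induct_closed[OF cwS, consumes 1])
  case (3 k s)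
  then obtain l where l: "l : srt" "s = cw l" by auto
  have "kr s = cop l" using l kr_cw[of l] by (simp add: srt_def)
  thus ?case using l c[of l] by (simp add: sc_left[of "pr z"] mult.assoc)
 qed (simp_all add: distrib_left distrib_right)
qed

lemma Th_ex: "\<exists>g. kalg_hom TT.T talg g & (\<forall>a\<in>carrier AA. \<forall>b\<in>carrier Cliff. g (TT.tn a b) = pr a \<otimes>\<^bsub>talg\<^esub> kc b)"
proof (rule TT.tensor_lift[OF prA_hom kc_hom])
 fix a b assume a: "a : carrier AA" and "b : carrier (Cliff :: (complex, 'e cliff \<times> 'e cliff) module)"
 then obtain p q where b: "b = (p, q)" "p : carrier CR" "q : carrier CR" by (auto simp: Cliff_def complexify_simps)
 show "pr a \<otimes>\<^bsub>talg\<^esub> kc b = kc b \<otimes>\<^bsub>talg\<^esub> pr a"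
  using a b by (simp add: kc_def distrib_left distrib_right sc_left[of "pr a"] mult.assoc pr_kr)
qed

definition Th :: "'e dirac => 'e op" where
 "Th = (SOME g. kalg_hom TT.T talg g & (\<forall>a\<in>carrier AA. \<forall>b\<in>carrier Cliff. g (TT.tn a b) = pr a \<otimes>\<^bsub>talg\<^esub> kc b))"

lemma Th_hom: "kalg_hom TT.T talg Th" and Th_tn: "a : carrier AA ==> b : carrier Cliff ==> Th (TT.tn a b) = pr a * kc b"
 using someI_ex[OF Th_ex] unfolding Th_def by auto

sublocale Th: kalg_hom TT.T talg Th by (rule Th_hom)

text \<open>The component S = set l of the image of the vacuum shows the symbol of the coefficient
  of l. The factor is exactly 1 for the empty word, which is needed to recognise that
  coefficient.\<close>

lemma Th_NF:
 assumes a: "a : srt \<rightarrow> carrier AA" and l: "l : srt"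
 shows "\<exists>e. e ~= 0 & (l = [] --> e = 1) & (\<forall>k w. app (Th (NF a)) vac k (set l) w = const e * sy (a l) k w)"
proof -
 have al: "a l : carrier AA" if "l : srt" for l using a that by auto
 have "Th (NF a) = (\<Sum>l\<in>srt. pr (a l) * cop l)" unfolding NF_def
 proof (subst Th.finsum)
  show "(%l. TT.tn (a l) (ce l)) : srt \<rightarrow> carrier TT.T" using a by auto
  show "(\<Oplus>\<^bsub>talg\<^esub>l\<in>srt. Th (TT.tn (a l) (ce l))) = (\<Sum>l\<in>srt. pr (a l) * cop l)" unfolding talg_finsum
  proof (rule sum.cong[OF HOL.refl])
   fix l assume l: "l : srt"
   hence "kr (cw l) = cop l" using kr_cw[of l] by (simp add: srt_def)
   thus "Th (TT.tn (a l) (ce l)) = pr (a l) * cop l" using l al by (simp add: Th_tn kc_cx)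
  qed
 qed
 also have "... = (\<Sum>l\<in>srt. cop l * pr (a l))"
 proof (rule sum.cong[OF HOL.refl])
  fix l assume "l : srt"
  thus "pr (a l) * cop l = cop l * pr (a l)" using pr_kr[OF AA_HH[OF al], of l "cw l"] kr_cw[of l] by (simp add: srt_def)
 qed
 finally have e: "app (Th (NF a)) vac k S w = (\<Sum>l\<in>srt. app (cop l) (app (pr (a l)) vac) k S w)" for k S w
  by (simp add: app_op_sum sum_vv)
 obtain e where e1: "e ~= 0" "l = [] --> e = 1" "\<And>f k S w. (\<forall>k S w. S ~= {} --> f k S w = 0) ==>
   app (cop l) f k S w = (if S = set l then const e * f k {} w else 0)"
 proof (cases "l = []")
  case True
  thus ?thesis by (intro that[of 1]) (auto simp: cop_def const_simps)
 next
  case False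
  have "distinct l" using l by (auto simp: srt_def strict_sorted_iff)
  from cop_supp[OF this] show ?thesis using that False by blast
 qed
 have "app (Th (NF a)) vac k (set l) w = const e * sy (a l) k w" for k w
 proof -
  have "app (Th (NF a)) vac k (set l) w = (\<Sum>l'\<in>srt. if l' = l then const e * sy (a l) k w else 0)" unfolding e
  proof (rule sum.cong[OF HOL.refl])
   fix l' assume l': "l' : srt"
   have s': "\<forall>k S w. S ~= {} --> app (pr (a l')) vac k S w = 0" using pr_vac_supp[OF AA_HH[OF al[OF l']]] .
   show "app (cop l') (app (pr (a l')) vac) k (set l) w = (if l' = l then const e * sy (a l) k w else 0)"
   proof (cases "l' = l")
    case True
    thus ?thesis using e1(3)[OF s'] by (simp add: sy_def)
   next
    case False
    have "distinct l'" using l' by (auto simp: srt_def strict_sorted_iff)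
    from cop_supp[OF this] obtain e' where "\<forall>k S w. app (cop l') (app (pr (a l')) vac) k S w = (if S = set l' then const e' * app (pr (a l')) vac k {} w else 0)"
     using s' by blast
    moreover have "set l ~= set l'" using l l' False by (auto simp: srt_def dest: strict_sorted_equal)
    ultimately show ?thesis using False by simp
   qed
  qed
  thus ?thesis using l finite_srt by simp
 qed
 thus ?thesis using e1 by blast
qed

text \<open>Symbols separate the coefficients of the normal form, so identities in the abstract
  tensor product may be checked on operators.\<close>

lemma Th_inj:
 assumes t: "t : carrier TT.T" "t' : carrier TT.T" and e: "Th t = Th t'"
 shows "t = t'"
proof -
 have "t \<ominus>\<^bsub>TT.T\<^esub> t' : carrier TT.T" using t by simp
 then obtain a where a: "a : srt \<rightarrow> carrier AA" "t \<ominus>\<^bsub>TT.T\<^esub> t' = NF a" using NF_ex by (elim bexE[OF NF_ex])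
 have z: "Th (NF a) = 0" unfolding a(2)[symmetric] using t e by simp
 have "a l = \<zero>\<^bsub>HH\<^esub>" if l: "l : srt" for l
 proof -
  obtain d where "d ~= 0" "\<And>k w. app (Th (NF a)) vac k (set l) w = const d * sy (a l) k w" using Th_NF[OF a(1) l] by blast
  hence d: "d ~= 0" "const d * sy (a l) k w = 0" for k w by (simp_all add: z)
  have "const d ~= (0 :: ('e \<times> 'e) pf)" using d(1) by (simp add: const_eq_0_iff)
  hence "sy (a l) k w = 0" for k w using d(2) by simp
  thus ?thesis using a l by (intro sy_zero) auto
 qed
 hence "NF a = NF (%l. \<zero>\<^bsub>AA\<^esub>)"
  unfolding NF_def by (intro TT.T.finsum_cong') (auto simp: AA_simps(3)[symmetric] simp del: AA_simps)
 hence "t \<ominus>\<^bsub>TT.T\<^esub> t' = \<zero>\<^bsub>TT.T\<^esub>" by (simp only: a(2) NF_zero)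
 thus ?thesis using t by (simp add: TT.T.minus_eq_zero)
qed

end

subsection \<open>The square of the Dirac element\<close>

context cherednik
begin

abbreviation "Oe \<equiv> Omega_sl2 R Rp c y x"
abbreviation "phe \<equiv> phi_elt R Rp c"

lemma pr_finsum: "(\<And>i. i : I ==> f i : carrier HH) ==> pr (finsum HH f I) = (\<Sum>i\<in>I. pr (f i))"
 by (subst pr.finsum) (auto simp: talg_finsum)

lemma Oe_closed [simp]: "Oe : carrier HH" and pr_Oe: "pr Oe = Om"
proof -
 let ?N = "{1..DIM('e)}"
 let ?H = "\<Oplus>\<^bsub>HH\<^esub>i\<in>?N. (Xe (x i) \<star> Ye (y i)) \<oplus>\<^bsub>HH\<^esub> (Ye (y i) \<star> Xe (x i))"
 let ?X = "\<Oplus>\<^bsub>HH\<^esub>i\<in>?N. Xe (x i) \<star> Xe (x i)"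
 let ?Y = "\<Oplus>\<^bsub>HH\<^esub>i\<in>?N. Ye (y i) \<star> Ye (y i)"
 have Oe: "Oe = (((1/2) \<cdot> ?H) \<star> ((1/2) \<cdot> ?H)) \<oplus>\<^bsub>HH\<^esub> (2 \<cdot> ((((-1/2) \<cdot> ?X) \<star> ((1/2) \<cdot> ?Y)) \<oplus>\<^bsub>HH\<^esub> (((1/2) \<cdot> ?Y) \<star> ((-1/2) \<cdot> ?X))))"
  by (simp only: Omega_sl2_def Let_def Xe_def Ye_def)
 have c: "?H : carrier HH" "?X : carrier HH" "?Y : carrier HH" by (intro HK.finsum_closed Pi_I HK.a_closed HK.m_closed gens_closed)+
 show "Oe : carrier HH" unfolding Oe using c by (intro HK.a_closed HK.m_closed HK.smult_closed)
 have p: "pr ?H = (\<Sum>i\<in>?N. xi i * ti i + ti i * xi i)" "pr ?X = r2" "pr ?Y = la" unfolding r2_def la_def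
  by (subst pr_finsum; simp add: pr_gens riesz_x del: atLeastAtMost_iff)+
 show "pr Oe = Om" unfolding Oe Om_def Ho_def
  using c by (simp only: pr.add pr.mult pr.smult HK.a_closed HK.m_closed HK.smult_closed p talg_simps)
qed

lemma phe_AA [simp]: "phe : carrier AA" and pr_phe: "pr phe = Pho"
proof -
 let ?Z = "\<Oplus>\<^bsub>HH\<^esub>\<alpha>\<in>Rp. c \<alpha> \<cdot> We (Defs.refl \<alpha>)"
 have e: "phe = (1/2) \<cdot> ((2 \<cdot> ?Z) \<oplus>\<^bsub>HH\<^esub> ((of_nat DIM('e) - 2) \<cdot> \<one>\<^bsub>HH\<^esub>))"
  by (simp only: phi_elt_def Let_def We_def)
 have Z: "?Z : carrier AA"
  using AK.finsum_closed[of "%\<alpha>. c \<alpha> \<cdot> We (Defs.refl \<alpha>)" Rp] HK.finsum_subalg[OF AA_sub, of "%\<alpha>. c \<alpha> \<cdot> We (Defs.refl \<alpha>)" Rp]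
   AK.smult_closed by (auto simp: Pi_iff)
 have one: "\<one>\<^bsub>HH\<^esub> : carrier AA" using AK.one_closed by simp
 show "phe : carrier AA" unfolding e using Z one AK.smult_closed AK.a_closed by simp
 have "pr ?Z = (\<Sum>\<alpha>\<in>Rp. sc (c \<alpha>) * Wo (rf (riesz \<alpha>)))"
  by (subst pr_finsum) (auto simp: pr_gens refl_eq[symmetric] intro!: sum.cong simp del: refl_eq)
 also have "... = Zo" unfolding Zo_def by (rule sum_Rp) simp
 finally have pZ: "pr ?Z = Zo" .
 have "pr phe = sc (1/2) * (sc 2 * Zo + sc (of_nat DIM('e) - 2))" unfolding e using Z one by (simp add: pZ)
 thus "pr phe = Pho" unfolding Pho_def by (simp only: distrib_left mult.assoc[symmetric] sc_simps(4)[symmetric]) (simp add: sc_simps(2))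
qed

lemma cof: "i : {1..DIM('e)} ==> kc (cx_incl CR (ci i)) = co i" by (simp only: kc_cx kr_vec cv_y)

abbreviation "Ddd \<equiv> AMA_Dirac R Rp c y x"
definition "Pe = Ddd \<ominus>\<^bsub>TT.T\<^esub> TT.tn phe \<one>\<^bsub>Cliff\<^esub>"

lemma Ddd_closed [simp]: "Ddd : carrier TT.T" and Th_Ddd: "Th Ddd = Do"
proof -
 let ?L = "{(i, j). 1 \<le> i & i < j & j \<le> DIM('e)}"
 let ?f = "%k. TT.tn (M_elt R Rp c y x (fst k) (snd k)) (cx_incl CR (ci (fst k)) \<otimes>\<^bsub>Cliff\<^esub> cx_incl CR (ci (snd k)))"
 have e: "Ddd = (\<Oplus>\<^bsub>TT.T\<^esub>k\<in>?L. ?f k)" by (simp only: AMA_Dirac_def Let_def TA_eq pure_eq)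
 have f: "?f : ?L \<rightarrow> carrier TT.T" by (auto intro!: TT.tn_closed CK.m_closed cx_closed gens_AA)
 show "Ddd : carrier TT.T" unfolding e by (rule TT.T.finsum_closed[OF f])
 show "Th Ddd = Do" unfolding e Do_def Th.finsum[OF f] talg_finsum
 proof (rule sum.cong[OF HOL.refl], clarify)
  fix i j assume ij: "1 \<le> i" "i < j" "j \<le> DIM('e)"
  hence m: "i : {1..DIM('e)}" "j : {1..DIM('e)}" by auto
  interpret kc: kalg_hom Cliff talg kc by (rule kc_hom)
  show "Th (?f (i, j)) = Mm (y i) (y j) * (co i * co j)"
   using ij m by (simp add: Th_tn CK.m_closed kc.mult cof pr_M del: atLeastAtMost_iff)
 qed
qed

lemma kc_one: "kc \<one>\<^bsub>Cliff\<^esub> = 1" using kalg_hom.one[OF kc_hom] by simp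

lemma Pe_closed [simp]: "Pe : carrier TT.T" and Th_Pe: "Th Pe = Do - Pho" by (simp_all add: Pe_def Th_Ddd Th_tn pr_phe kc_one)

text \<open>The square of the Dirac element lies in the tensor product and acts as Omega + 1. The
  coefficient of its normal form at the empty word belongs to the angular momentum algebra and has
  the symbol of Omega + 1, so it is Omega + 1; no expression of Omega in the M_ij is
  required.\<close>

lemma Oe_AA [simp]: "Oe : carrier AA"
proof -
 have "Pe \<bowtie> Pe : carrier TT.T" by simp
 from NF_ex[OF this] obtain a where a: "a : srt \<rightarrow> carrier AA" "Pe \<bowtie> Pe = NF a" by (elim bexE)
 have l: "[] : srt" by (simp add: srt_def)
 have Th: "Th (NF a) = pr (Oe \<oplus>\<^bsub>HH\<^esub> \<one>\<^bsub>HH\<^esub>)"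
  unfolding a(2)[symmetric] by (simp add: Th_Pe Dirac_square pr_Oe)
 have "sy (a []) k w = sy (Oe \<oplus>\<^bsub>HH\<^esub> \<one>\<^bsub>HH\<^esub>) k w" for k w
  using Th_NF[OF a(1) l] unfolding Th by (auto simp: sy_def const_simps)
 hence "a [] = Oe \<oplus>\<^bsub>HH\<^esub> \<one>\<^bsub>HH\<^esub>" using a l by (intro sy_eqI) auto
 moreover have "a [] : carrier AA" using a(1) l by (rule funcset_mem)
 ultimately have "Oe \<oplus>\<^bsub>HH\<^esub> \<one>\<^bsub>HH\<^esub> : carrier AA" by simp
 moreover have "\<one>\<^bsub>HH\<^esub> : carrier AA" using AK.one_closed by simp
 ultimately have "(Oe \<oplus>\<^bsub>HH\<^esub> \<one>\<^bsub>HH\<^esub>) \<ominus>\<^bsub>HH\<^esub> \<one>\<^bsub>HH\<^esub> : carrier AA" by (rule HK.minus_subalg[OF AA_sub])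
 thus ?thesis by (simp add: a_minus_def HK.a_assoc HK.r_neg)
qed

lemma Pe_square: "Pe \<bowtie> Pe = TT.tn Oe \<one>\<^bsub>Cliff\<^esub> \<uplus> \<one>\<^bsub>TT.T\<^esub>"
 by (rule Th_inj) (simp_all add: Th_Pe Dirac_square Th_tn pr_Oe kc_one)

lemma Oe_centre: "Oe : centre AA" unfolding centre_def
proof (intro CollectI conjI ballI)
 fix a assume a: "a : carrier AA"
 have "pr a * Om = Om * pr a" by (rule AA_commutes[OF Wo_Om Mm_Om a])
 thus "Oe \<otimes>\<^bsub>AA\<^esub> a = a \<otimes>\<^bsub>AA\<^esub> Oe" using a by (simp, intro pr_inj) (auto simp: pr_Oe)
qed simp

text \<open>-id changes the sign of both factors in every product of an x with a Dunkl operator, and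
  it commutes with all linear maps.\<close>

lemma um_centre:
 assumes u: "uminus : W"
 shows "We uminus : centre AA" unfolding centre_def
proof (intro CollectI conjI ballI)
 have o: "orth (uminus :: 'e => 'e)" and s: "symm uminus" using W_orth[OF u] W_symm[OF u] .
 fix a assume a: "a : carrier AA"
 have "pr a * Wo uminus = Wo uminus * pr a"
 proof (rule AA_commutes[OF _ _ a])
  fix w assume w: "w : W"
  have "uminus o w = w o uminus" using linear_neg[OF orth_linear[OF W_orth[OF w]]] by (simp add: fun_eq_iff)
  thus "Wo w * Wo uminus = Wo uminus * Wo w" by (simp add: Wo_Wo W_orth[OF w] o)
 next
  fix i j
  have "Wo uminus * (Xo u * To v) = (Xo u * To v) * Wo uminus" for u v
  proof -
   have "Wo uminus * (Xo u * To v) = - (Xo u * (Wo uminus * To v))" unfolding mult.assoc[symmetric] Wo_Xo[OF o] by (simp add: Xo_minus)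
   thus ?thesis unfolding Wo_To[OF s] by (simp add: To_minus mult.assoc)
  qed
  thus "Mm (y i) (y j) * Wo uminus = Wo uminus * Mm (y i) (y j)" by (simp add: Mm_def left_diff_distrib right_diff_distrib)
 qed
 thus "We uminus \<otimes>\<^bsub>AA\<^esub> a = a \<otimes>\<^bsub>AA\<^esub> We uminus" using a u by (simp, intro pr_inj) (auto simp: pr_gens)
qed (use u in simp)

subsection \<open>The homomorphism from the group algebra\<close>

abbreviation "Wh \<equiv> W_hat R D"

lemma Wh_carrier: "(\<eta>, s) : carrier Wh \<longleftrightarrow> \<eta> : Pin & pin_proj \<eta> : W & (s = id \<or> s = uminus & uminus : W)"
 by (auto simp: W_hat_def W_tilde_def longest_iff)

lemma Wh_ops: "(\<eta>, s) \<otimes>\<^bsub>Wh\<^esub> (\<eta>', s') = (\<eta> \<ast> \<eta>', s o s')" "\<one>\<^bsub>Wh\<^esub> = (\<one>\<^bsub>CR\<^esub>, id)"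
 by (simp_all add: W_hat_def W_tilde_def)

lemma uminus_comp: "uminus o uminus = (id :: 'e => 'e)" by (simp add: fun_eq_iff)

lemma monoid_Wh: "monoid Wh"
proof (rule monoidI)
 fix g g' assume "g : carrier Wh" "g' : carrier Wh"
 thus "g \<otimes>\<^bsub>Wh\<^esub> g' : carrier Wh"
  by (cases g, cases g') (auto simp: Wh_carrier Wh_ops Pin_mult pin_proj_mult uminus_comp comp_def[of uminus uminus])
next
 show "\<one>\<^bsub>Wh\<^esub> : carrier Wh" by (simp add: Wh_ops Wh_carrier Pin_one)
next
 fix g g' g'' assume "g : carrier Wh" "g' : carrier Wh" "g'' : carrier Wh"
 thus "g \<otimes>\<^bsub>Wh\<^esub> g' \<otimes>\<^bsub>Wh\<^esub> g'' = g \<otimes>\<^bsub>Wh\<^esub> (g' \<otimes>\<^bsub>Wh\<^esub> g'')"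
  by (cases g, cases g', cases g'') (simp add: Wh_carrier Wh_ops Pin_carrier C.m_assoc comp_assoc)
qed (auto simp: Wh_carrier Wh_ops Pin_carrier)

abbreviation "CW \<equiv> CW_hat R D"
abbreviation "rh \<equiv> rho R Rp c y x"
definition rg :: "'e cliff \<times> ('e => 'e) => 'e dirac" where
 "rg g = TT.tn (We (pin_proj (fst g) o snd g)) (cx_incl CR (fst g))"

lemma kalg_CW: "kalg CW" unfolding CW_hat_def by (rule monoid.kalg_monoid_alg[OF monoid_Wh])

sublocale CW: kalg CW by (rule kalg_CW)

lemma Wh_W: "(\<eta>, s) : carrier Wh ==> pin_proj \<eta> o s : W" by (auto simp: Wh_carrier intro: comp_W)

lemma rg_closed: "g : carrier Wh ==> rg g : carrier TT.T"
 using Wh_W[of "fst g" "snd g"] by (cases g) (auto simp: rg_def Wh_carrier Pin_carrier intro!: TT.tn_closed)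

lemma rh_eq: "rh = mext TT.T rg" by (rule ext) (simp only: rho_def Let_def TA_eq pure_eq mext_def rg_def We_def)

lemma rh_hom: "kalg_hom CW TT.T rh" unfolding rh_eq CW_hat_def
proof (rule kalg_hom_mext[OF monoid_Wh TT.kalg_T])
 show "g : carrier Wh ==> rg g : carrier TT.T" for g by (rule rg_closed)
 show "rg \<one>\<^bsub>Wh\<^esub> = \<one>\<^bsub>TT.T\<^esub>"
  unfolding Wh_ops rg_def fst_conv snd_conv Pin_one(2) comp_id We_id cx_simps(4) using TT.tn_one by simp
 fix g g' assume g: "g : carrier Wh" "g' : carrier Wh"
 obtain \<eta> s \<eta>' s' where gg: "g = (\<eta>, s)" "g' = (\<eta>', s')" by (cases g, cases g')
 have p: "\<eta> : Pin" "\<eta>' : Pin" "pin_proj \<eta> : W" "pin_proj \<eta>' : W" "s = id \<or> s = uminus" "s' = id \<or> s' = uminus"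
  and w: "pin_proj \<eta> o s : W" "pin_proj \<eta>' o s' : W" using g Wh_W by (auto simp: gg Wh_carrier)
 have l: "linear (pin_proj \<eta>')" using p by (intro orth_linear W_orth)
 have e: "(pin_proj \<eta> o s) o (pin_proj \<eta>' o s') = pin_proj (\<eta> \<ast> \<eta>') o (s o s')"
  using p(5) linear_neg[OF l] unfolding pin_proj_mult[OF p(1,2)] by (auto simp: fun_eq_iff)
 show "rg (g \<otimes>\<^bsub>Wh\<^esub> g') = rg g \<bowtie> rg g'"
  unfolding gg Wh_ops rg_def fst_conv snd_conv e[symmetric] We_We[OF w, symmetric] cx_simps(1)[OF Pin_carrier[OF p(1)] Pin_carrier[OF p(2)]]
  using TT.tn_mult[OF gens_AA(1)[OF w(1)] gens_AA(1)[OF w(2)] cx_closed[OF Pin_carrier[OF p(1)]] cx_closed[OF Pin_carrier[OF p(2)]]]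
  by simp
qed

sublocale rh: kalg_hom CW TT.T rh by (rule rh_hom)

lemma rh_single: "g : carrier Wh ==> rh (single g) = rg g" unfolding rh_eq by (rule TT.T.mext_single) (rule rg_closed)

lemma slash_expand: "Xs = (\<Sum>i\<in>{1..DIM('e)}. Xo (y i) * cv (y i))" "Ys = (\<Sum>i\<in>{1..DIM('e)}. To (y i) * cv (y i))"
 unfolding Xs_def Ys_def by (auto intro!: sum.cong simp: cv_y simp del: atLeastAtMost_iff)

lemma cv_expand: "cv v = (\<Sum>i\<in>{1..DIM('e)}. sc (of_real (v \<bullet> y i)) * cv (y i))"
 by (subst cv_def, rule sum.cong[OF HOL.refl]) (simp only: cv_y)

text \<open>Moving a Pin element past the slashed x replaces it by its parity image, and moving that
  past the slashed Dunkl operator restores it. So it commutes with both products of the two, and D -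
  phi is built from these.\<close>

lemma rg_Pe: "g : carrier Wh ==> rg g \<bowtie> Pe = Pe \<bowtie> rg g"
proof (rule Th_inj)
 assume g: "g : carrier Wh"
 obtain \<eta> s where gg: "g = (\<eta>, s)" by (cases g)
 have p: "\<eta> : Pin" "pin_proj \<eta> : W" "s = id \<or> s = uminus" and w: "pin_proj \<eta> o s : W"
  using g Wh_W by (auto simp: gg Wh_carrier)
 let ?w = "pin_proj \<eta> o s" and ?p = "pin_proj \<eta>"
 have ec: "\<eta> : carrier CR" "cliff_eps \<eta> : carrier CR" using Pin_carrier[OF p(1)] by auto
 have o: "orth ?w" "symm ?w" "orth ?p" using W_orth W_symm w p by auto
 \<comment> \<open>The sign contributed by the factor of C_2. It appears once with x and once with
   the Dunkl operator, and cancels in the products.\<close>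
 define \<sigma> :: "'e op" where "\<sigma> = (if s = id then 1 else - 1)"
 have \<sigma>: "\<sigma> * \<sigma> = 1" "\<sigma> * F = F * \<sigma>" for F by (auto simp: \<sigma>_def)
 have wp: "Xo (?w u) = \<sigma> * Xo (?p u)" "To (?w u) = \<sigma> * To (?p u)" for u
  using p(3) linear_neg[OF orth_linear[OF o(3)]] by (auto simp: \<sigma>_def Xo_minus To_minus fun_eq_iff)
 have k1: "kr \<eta> * cv v = cv (?p v) * kr (cliff_eps \<eta>)" for v
  using arg_cong[OF pin_commute2[OF p(1), of v], of kr] ec by (simp add: kr_vec)
 have k2: "kr (cliff_eps \<eta>) * cv v = cv (?p v) * kr \<eta>" for v
  using arg_cong[OF pin_commute1[OF p(1), of v], of kr] ec by (simp add: kr_vec)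
 have Tc: "kr a * To v = To v * kr a" if "a : carrier CR" for a v using pr_kr[OF gens_closed(2) that, of v] by (simp add: pr_gens)
 have Xc: "kr a * Xo v = Xo v * kr a" if "a : carrier CR" for a v using pr_kr[OF gens_closed(1) that, of "blin v"] by (simp add: pr_gens)
 have Wc: "Wo ?w * cv v = cv v * Wo ?w" for v by (rule cv_commute) (rule Wo_co[OF o(1)])
 have t: "(Wo ?w * kr a) * (F u * cv u) = \<sigma> * ((F (?p u) * cv (?p u)) * (Wo ?w * kr b))"
  if ab: "\<And>v. kr a * cv v = cv (?p v) * kr b" and aF: "kr a * F u = F u * kr a" and wF: "Wo ?w * F u = F (?w u) * Wo ?w" and sF: "F (?w u) = \<sigma> * F (?p u)"
  for a b u and F :: "'e => 'e op"
 proof -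
  have "(Wo ?w * kr a) * (F u * cv u) = Wo ?w * (kr a * F u) * cv u" by (simp only: mult.assoc)
  also have "... = (Wo ?w * F u) * (kr a * cv u)" by (simp only: aF mult.assoc)
  also have "... = \<sigma> * F (?p u) * ((Wo ?w * cv (?p u)) * kr b)" by (simp only: ab wF sF mult.assoc)
  also have "... = \<sigma> * ((F (?p u) * cv (?p u)) * (Wo ?w * kr b))" by (simp only: Wc mult.assoc)
  finally show ?thesis .
 qed
 have X: "(Wo ?w * kr a) * Xs = \<sigma> * (Xs * (Wo ?w * kr b))" if "\<And>v. kr a * cv v = cv (?p v) * kr b" "a : carrier CR" for a b
 proof -
  have "(Wo ?w * kr a) * Xs = \<sigma> * ((\<Sum>i\<in>{1..DIM('e)}. Xo (?p (y i)) * cv (?p (y i))) * (Wo ?w * kr b))"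
   unfolding slash_expand sum_distrib_left sum_distrib_right
   by (rule sum.cong[OF HOL.refl], rule t[OF that(1) Xc[OF that(2)] Wo_Xo[OF o(1)] wp(1)])
  thus ?thesis unfolding orthonormal_sum_inv[OF o(3) Xo_expand cv_expand] slash_expand .
 qed
 have Y: "(Wo ?w * kr a) * Ys = \<sigma> * (Ys * (Wo ?w * kr b))" if "\<And>v. kr a * cv v = cv (?p v) * kr b" "a : carrier CR" for a b
 proof -
  have "(Wo ?w * kr a) * Ys = \<sigma> * ((\<Sum>i\<in>{1..DIM('e)}. To (?p (y i)) * cv (?p (y i))) * (Wo ?w * kr b))"
   unfolding slash_expand sum_distrib_left sum_distrib_right
   by (rule sum.cong[OF HOL.refl], rule t[OF that(1) Tc[OF that(2)] Wo_To[OF o(2)] wp(2)])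
  thus ?thesis unfolding orthonormal_sum_inv[OF o(3) To_expand cv_expand] slash_expand .
 qed
 let ?g = "Wo ?w * kr \<eta>" and ?g' = "Wo ?w * kr (cliff_eps \<eta>)"
 have ss: "\<sigma> * (P * (\<sigma> * F)) = P * F" for P F by (metis \<sigma> mult.assoc mult_1_left)
 have XY: "?g * (Xs * Ys) = (Xs * Ys) * ?g"
 proof -
  have "?g * (Xs * Ys) = \<sigma> * (Xs * (?g' * Ys))" by (simp only: mult.assoc[symmetric] X[OF k1 ec(1)])
  also have "... = \<sigma> * (Xs * (\<sigma> * (Ys * ?g)))" by (simp only: Y[OF k2 ec(2)])
  finally show ?thesis by (simp only: ss mult.assoc)
 qed
 have YX: "?g * (Ys * Xs) = (Ys * Xs) * ?g"
 proof -
  have "?g * (Ys * Xs) = \<sigma> * (Ys * (?g' * Xs))" by (simp only: mult.assoc[symmetric] Y[OF k1 ec(1)])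
  also have "... = \<sigma> * (Ys * (\<sigma> * (Xs * ?g)))" by (simp only: X[OF k2 ec(2)])
  finally show ?thesis by (simp only: ss mult.assoc)
 qed
 have "?g * (2 * (Do - Pho)) = (2 * (Do - Pho)) * ?g"
  unfolding Dirac_half by (simp only: distrib_left distrib_right left_diff_distrib right_diff_distrib XY YX mult_2 mult_2_right)
 hence "sc 2 * (?g * (Do - Pho)) = sc 2 * ((Do - Pho) * ?g)" by (simp only: sc_numeral mult_2 distrib_left distrib_right mult.assoc)
 hence "?g * (Do - Pho) = (Do - Pho) * ?g" by (rule op_cancel[rotated]) simp
 moreover have "Th (rg g) = ?g" unfolding gg rg_def fst_conv snd_conv using w ec by (simp add: Th_tn kc_cx pr_gens)
 ultimately show "Th (rg g \<bowtie> Pe) = Th (Pe \<bowtie> rg g)" using rg_closed[OF g] by (simp add: Th_Pe)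
qed (simp_all add: rg_closed)

lemma rh_Pe: "f : carrier CW ==> rh f \<bowtie> Pe = Pe \<bowtie> rh f" unfolding CW_hat_def
proof (induction rule: monoid.monoid_alg_induct[OF monoid_Wh, consumes 1])
 case 1
 show ?case unfolding CW_hat_def[symmetric] rh.zero by simp
next
 case (2 k u f)
 have c: "single u : carrier CW" "f : carrier CW" using 2 monoid.single_closed[OF monoid_Wh 2(1)] by (simp_all add: CW_hat_def)
 show ?case using 2(3) rg_Pe[OF 2(1)] rg_closed[OF 2(1)] c unfolding CW_hat_def[symmetric]
  by (simp add: rh_single[OF 2(1)] TT.T.l_distr TT.T.r_distr TT.T.smult_mult_l TT.T.smult_mult_r)
qed

end

subsection \<open>Leading symbols\<close>

context cherednik
begin

text \<open>F raises the highest level by at most d and acts on the top coefficients by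
  multiplication, diagonally in w. The reflection terms of a Dunkl operator do not raise the level
  and so do not enter.\<close>

definition lead :: "nat => (('e => 'e) => ('e \<times> 'e) pf) => 'e op => bool" where
 "lead d \<sigma> F \<longleftrightarrow> (\<forall>f m. (\<forall>k w. m < k --> w : W --> f k {} w = 0) -->
   (\<forall>k w. m + d < k --> w : W --> app F f k {} w = 0) & (\<forall>w\<in>W. app F f (m + d) {} w = \<sigma> w * f m {} w))"

lemma lead_mult: "lead d \<sigma> F ==> lead e \<tau> K ==> lead (d + e) (%w. \<sigma> w * \<tau> w) (F * K)"
proof -
 assume F: "lead d \<sigma> F" and K: "lead e \<tau> K"
 show ?thesis unfolding lead_def
 proof (intro allI impI)
  fix f :: "'e vv" and m assume f: "\<forall>k w. m < k --> w : W --> f k {} w = 0"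
  have k1: "\<forall>k w. m + e < k --> w : W --> app K f k {} w = 0" and k2: "\<forall>w\<in>W. app K f (m + e) {} w = \<tau> w * f m {} w"
   using K f unfolding lead_def by blast+
  have f1: "\<forall>k w. m + e + d < k --> w : W --> app F (app K f) k {} w = 0"
   and f2: "\<forall>w\<in>W. app F (app K f) (m + e + d) {} w = \<sigma> w * app K f (m + e) {} w"
   using F k1 unfolding lead_def by blast+
  have me: "m + (d + e) = m + e + d" by simp
  show "(\<forall>k w. m + (d + e) < k --> w : W --> app (F * K) f k {} w = 0) & (\<forall>w\<in>W. app (F * K) f (m + (d + e)) {} w = \<sigma> w * \<tau> w * f m {} w)"
   unfolding me using f1 f2 k2 by (simp add: mult.assoc)
 qed
qed

lemma lead_add: "lead d \<sigma> F ==> lead d \<tau> K ==> lead d (%w. \<sigma> w + \<tau> w) (F + K)"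
 unfolding lead_def by (simp add: distrib_right)

lemma lead_sum: "(\<And>i. i : I ==> lead d (\<sigma> i) (F i)) ==> lead d (%w. \<Sum>i\<in>I. \<sigma> i w) (\<Sum>i\<in>I. F i)"
proof (induction I rule: infinite_finite_induct)
 case (insert i I)
 thus ?case using lead_add[of d "\<sigma> i" "F i"] by simp
qed (simp_all add: lead_def)

lemma lead_sc: "lead 0 (%w. const k) (sc k)" by (simp add: lead_def smv_def)

lemma lead_Xo: "lead 0 (%w. lin (u, 0)) (Xo u)" by (simp add: lead_def)

lemma lead_To: "lead 1 (%w. lin (0, ivf w v)) (To v)" using nzE by (auto simp: lead_def app_To W_orth)

lemma lead_sc_mult: "lead d \<sigma> F ==> lead d (%w. const k * \<sigma> w) (sc k * F)"
 using lead_mult[OF lead_sc, of d \<sigma> F] by simp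

text \<open>The leading symbol of Omega at w, namely (x.w xi)^2 - |x|^2 |w xi|^2; at the identity it
  is \<open>- Qf\<close>.\<close>

definition omg :: "('e => 'e) => ('e \<times> 'e) pf" where
 "omg w = (\<Sum>i\<in>{1..DIM('e)}. lin (y i, 0) * lin (0, ivf w (y i))) * (\<Sum>i\<in>{1..DIM('e)}. lin (y i, 0) * lin (0, ivf w (y i)))
  - (\<Sum>i\<in>{1..DIM('e)}. lin (y i, 0) * lin (y i, 0)) * (\<Sum>i\<in>{1..DIM('e)}. lin (0, ivf w (y i)) * lin (0, ivf w (y i)))"

lemma lead_Om: "lead 2 omg Om"
proof -
 let ?N = "{1..DIM('e)}"
 let ?s = "%w. \<Sum>i\<in>?N. lin (y i, 0) * lin (0, ivf w (y i)) :: ('e \<times> 'e) pf"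
 let ?p = "%w. \<Sum>i\<in>?N. lin (y i, 0) * lin (y i, 0) :: ('e \<times> 'e) pf"
 let ?q = "%w. \<Sum>i\<in>?N. lin (0, ivf w (y i)) * lin (0, ivf w (y i)) :: ('e \<times> 'e) pf"
 have H: "lead 1 (%w. const (1/2) * (\<Sum>i\<in>?N. lin (y i, 0) * lin (0, ivf w (y i)) + lin (0, ivf w (y i)) * lin (y i, 0))) Ho"
  unfolding Ho_def by (intro lead_sc_mult lead_sum lead_add) (use lead_mult[OF lead_Xo lead_To] lead_mult[OF lead_To lead_Xo] in auto)
 have h: "const (1/2) * (\<Sum>i\<in>?N. lin (y i, 0) * lin (0, ivf w (y i)) + lin (0, ivf w (y i)) * lin (y i, 0)) = ?s w" for w :: "'e => 'e"
 proof -
  have "const (1/2) * (P + P) = (P :: ('e \<times> 'e) pf)" for P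
   unfolding distrib_left distrib_right[symmetric] const_simps(3)[symmetric] by (simp add: const_simps)
  thus ?thesis unfolding sum_distrib_left by (intro sum.cong[OF HOL.refl]) (simp add: mult.commute[of "lin (0, _)"])
 qed
 have R: "lead 0 ?p r2" unfolding r2_def by (intro lead_sum) (use lead_mult[OF lead_Xo lead_Xo] in auto)
 have L: "lead 2 ?q la" unfolding la_def
  by (intro lead_sum) (use lead_mult[OF lead_To lead_To] in \<open>auto simp: numeral_2_eq_2\<close>)
 have HH: "lead 2 (%w. ?s w * ?s w) (Ho * Ho)" using lead_mult[OF H H] unfolding h by (simp add: numeral_2_eq_2)
 have RL: "lead 2 (%w. (const (-1/2) * ?p w) * (const (1/2) * ?q w)) ((sc (-1/2) * r2) * (sc (1/2) * la))"
  using lead_mult[OF lead_sc_mult[OF R, where k = "-1/2"] lead_sc_mult[OF L, where k = "1/2"]] by (simp add: numeral_2_eq_2)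
 have LR: "lead 2 (%w. (const (1/2) * ?q w) * (const (-1/2) * ?p w)) ((sc (1/2) * la) * (sc (-1/2) * r2))"
  using lead_mult[OF lead_sc_mult[OF L, where k = "1/2"] lead_sc_mult[OF R, where k = "-1/2"]] by (simp add: numeral_2_eq_2)
 have O: "lead 2 (%w. ?s w * ?s w + const 2 * ((const (-1/2) * ?p w) * (const (1/2) * ?q w) + (const (1/2) * ?q w) * (const (-1/2) * ?p w))) Om"
  unfolding Om_def by (intro lead_add lead_sc_mult HH RL LR)
 have e: "const 2 * ((const (-1/2) * P) * (const (1/2) * Q) + (const (1/2) * Q) * (const (-1/2) * P)) = - (P * Q :: ('e \<times> 'e) pf)" for P Q
  by (rule pf_eqI) (simp only: ev_simps, simp add: field_simps)
 show ?thesis using O unfolding e omg_def[abs_def] diff_conv_add_uminus .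
qed

lemma sy_Oe:
 assumes z: "z : carrier HH" and b: "\<And>k w. m < k ==> w : W ==> sy z k w = 0"
 shows "\<And>k w. m + 2 < k ==> w : W ==> sy (Oe \<star> z) k w = 0"
  "\<And>w. w : W ==> sy (Oe \<star> z) (m + 2) w = omg w * sy z m w"
proof -
 have "\<forall>k w. m < k --> w : W --> app (pr z) vac k {} w = 0" using b by (simp add: sy_def)
 hence "(\<forall>k w. m + 2 < k --> w : W --> app Om (app (pr z) vac) k {} w = 0) & (\<forall>w\<in>W. app Om (app (pr z) vac) (m + 2) {} w = omg w * app (pr z) vac m {} w)"
  using lead_Om unfolding lead_def by blast
 moreover have "app (pr (Oe \<star> z)) vac = app Om (app (pr z) vac)" using z by (simp add: pr_Oe)
 ultimately show "\<And>k w. m + 2 < k ==> w : W ==> sy (Oe \<star> z) k w = 0"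
  "\<And>w. w : W ==> sy (Oe \<star> z) (m + 2) w = omg w * sy z m w" by (simp_all add: sy_def)
qed

lemma omg_id: "omg id = - Qf" by (simp add: omg_def Qf_def inv_id)

abbreviation "PO p \<equiv> peval HH Oe p"

text \<open>Each factor Omega raises the level by 2 and multiplies the top coefficient by
  \<open>- Qf\<close>, so p(Omega) reaches level 2 deg p with the leading coefficient of p.\<close>

lemma sy_PO: "p ~= 0 ==> (\<forall>k w. 2 * degree p < k --> w : W --> sy (PO p) k w = 0) &
  (\<forall>w\<in>W. sy (PO p) (2 * degree p) w = (if w = id then const (lead_coeff p) * (- Qf) ^ degree p else 0))"
proof (induction p)
 case (pCons a p)
 have e: "PO (pCons a p) = a \<cdot> \<one>\<^bsub>HH\<^esub> \<oplus>\<^bsub>HH\<^esub> Oe \<star> PO p" by (rule HK.peval_pCons) simp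
 have sp: "sy (PO (pCons a p)) k w = const a * (if k = 0 & w = id then 1 else 0) + sy (Oe \<star> PO p) k w" for k w
  unfolding e by (simp add: sy_simps(1) sy_simps(3)[OF HK.one_closed HK.one_closed] sy_one)
 show ?case
 proof (cases "p = 0")
  case True
  have "sy (Oe \<star> PO p) k w = 0" for k w using True by (simp add: sy_def)
  hence "sy (PO [:a:]) k w = const a * (if k = 0 & w = id then 1 else 0)" for k w using sp[of k w] True by simp
  thus ?thesis using True by (simp add: id_def)
 next
  case False
  hence IH: "\<And>k w. 2 * degree p < k ==> w : W ==> sy (PO p) k w = 0"
   "\<And>w. w : W ==> sy (PO p) (2 * degree p) w = (if w = id then const (lead_coeff p) * (- Qf) ^ degree p else 0)" using pCons by auto
  have c: "PO p : carrier HH" by simp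
  have d: "2 * degree (pCons a p) = 2 * degree p + 2" using False by simp
  show ?thesis unfolding d
  proof (intro conjI allI ballI impI)
   fix k w assume "2 * degree p + 2 < k" "w : W"
   thus "sy (PO (pCons a p)) k w = 0" unfolding sp using sy_Oe(1)[OF c IH(1)] by simp
  next
   fix w assume w: "w : W"
   show "sy (PO (pCons a p)) (2 * degree p + 2) w = (if w = id then const (lead_coeff (pCons a p)) * (- Qf) ^ degree (pCons a p) else 0)"
   proof -
    have o2: "sy (Oe \<star> PO p) (2 * degree p + 2) w = omg w * sy (PO p) (2 * degree p) w" by (rule sy_Oe(2)[OF c _ w]) (rule IH(1))
    have z: "(2 * degree p + 2 = 0 & w = id) = False" by simp
    have l: "lead_coeff (pCons a p) = lead_coeff p" "degree (pCons a p) = Suc (degree p)" using False by simp_all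
    show ?thesis unfolding sp o2 IH(2)[OF w] z l by (simp add: omg_id mult_ac)
   qed
  qed
 qed
qed simp

section \<open>Elements p(Omega) + w_0 q(Omega): symbols, products and centrality\<close>

lemma ivf_uminus: "ivf (uminus :: 'e => 'e) = uminus" by (rule Hilbert_Choice.inv_equality) simp_all

lemma uminus_comp_eq: "uminus o w = id \<longleftrightarrow> w = (uminus :: 'e => 'e)" by (auto simp: fun_eq_iff) (metis minus_minus)

lemma sub_Qf: "sub (fs uminus) Qf = Qf"
proof (rule pf_eqI)
 fix p
 have "linear (fs (uminus :: 'e => 'e))" by (intro linear_fs linear_uminus)
 thus "ev (sub (fs uminus) Qf) p = ev Qf p" by (cases p) (simp add: ev_sub fs_def ev_Qf)
qed

lemma linear_fsu: "linear (fs (uminus :: 'e => 'e))" by (intro linear_fs linear_uminus)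

lemma sub_power: "linear L ==> sub L (f ^ n) = sub L f ^ n" by (induction n) (simp_all add: sub_simps)

lemma sy_um: "uminus : W ==> z : carrier HH ==> sy (We uminus \<star> z) k w = sub (fs uminus) (sy z k (uminus o w))"
 by (simp add: sy_We ivf_uminus)

text \<open>Two slots are used in every case, so that statements are uniform; the second one counts
  only if -id belongs to the group.\<close>

definition cz :: "complex poly => complex poly => 'e cher" where
 "cz p q = (if uminus : W then PO p \<oplus>\<^bsub>HH\<^esub> We uminus \<star> PO q else PO p)"

lemma cz_closed [simp]: "cz p q : carrier HH" by (simp add: cz_def)

lemma Qf_nz: "DIM('e) \<ge> 2 ==> Qf ~= 0"
proof
 assume d: "DIM('e) \<ge> 2" and "Qf = 0"
 hence "ev Qf (y 1, y 2) = 0" by simp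
 moreover have "1 : {1..DIM('e)}" "2 : {1..DIM('e)}" using d by auto
 ultimately show False using y_inner[of 1 1] y_inner[of 2 2] y_inner[of 1 2] unfolding ev_Qf by simp
qed

lemma id_uminus: "(id :: 'e => 'e) ~= uminus"
proof
 assume e: "(id :: 'e => 'e) = uminus"
 have "1 : {1..DIM('e)}" by (simp add: Suc_leI)
 hence "y 1 \<bullet> y 1 = 1" using y_inner[of 1 1] by simp
 moreover have "y 1 = - y 1" using fun_cong[OF e, of "y 1"] by simp
 ultimately show False by (metis inner_minus_left minus_equation_iff one_neq_neg_one)
qed

lemma sy_PO0: "k > 2 * degree p ==> w : W ==> sy (PO p) k w = 0" by (cases "p = 0") (use sy_PO in \<open>auto simp: sy_def\<close>)

lemma sy_PO_coeff: "degree p \<le> d ==> w : W ==> sy (PO p) (2 * d) w = (if w = id then const (coeff p d) * (- Qf) ^ d else 0)"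
proof -
 assume d: "degree p \<le> d" and w: "w : W"
 show ?thesis
 proof (cases "degree p = d")
  case True
  show ?thesis
  proof (cases "p = 0")
   case True
   thus ?thesis by (simp add: sy_def const_simps)
  next
   case False
   thus ?thesis using sy_PO[OF False] w True by simp
  qed
 next
  case False
  hence "degree p < d" using d by simp
  thus ?thesis using sy_PO0[of p "2 * d" w] w by (simp add: coeff_eq_0 const_simps)
 qed
qed

lemma sy_cz:
 assumes d: "degree p \<le> d" "degree q \<le> d" and w: "w : W"
 shows "k > 2 * d ==> sy (cz p q) k w = 0"
  "sy (cz p q) (2 * d) w = (if w = id then const (coeff p d) * (- Qf) ^ d else if w = uminus then const (coeff q d) * (- Qf) ^ d else 0)"
proof -
 have uw: "uminus o w : W" if "uminus : W" using that w by (rule comp_W)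
 show "k > 2 * d ==> sy (cz p q) k w = 0" using d w uw by (auto simp: cz_def sy_simps sy_PO0 sy_um sub_simps linear_fsu)
 have "sub (fs uminus) (const a * (- Qf) ^ d) = const a * (- Qf) ^ d" for a by (simp add: sub_simps sub_power linear_fsu sub_Qf)
 thus "sy (cz p q) (2 * d) w = (if w = id then const (coeff p d) * (- Qf) ^ d else if w = uminus then const (coeff q d) * (- Qf) ^ d else 0)"
  using w uw d id_uminus by (auto simp: cz_def sy_simps sy_PO_coeff sy_um uminus_comp_eq sub_simps linear_fsu)
qed

text \<open>At the level given by the larger degree, the components at id and at -id show the
  coefficients of p and of q separately, times the power \<open>(- Qf) ^ m\<close>. This is nonzero
  in dimension at least two, or if m = 0.\<close>

lemma cz_inj0:
 assumes d: "DIM('e) \<ge> 2 \<or> degree p = 0 & degree q = 0" and z: "cz p q = \<zero>\<^bsub>HH\<^esub>" and q: "uminus \<notin> W ==> q = 0"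
 shows "p = 0 & q = 0"
proof -
 define m where "m = max (degree p) (degree q)"
 have "sy (cz p q) (2 * m) w = 0" for w by (simp add: z sy_def)
 hence s: "(if w = id then const (coeff p m) * (- Qf) ^ m else if w = uminus then const (coeff q m) * (- Qf) ^ m else 0) = 0" if "w : W" for w
  using sy_cz(2)[OF _ _ that, of p m q] by (simp add: m_def)
 have nz: "(- Qf) ^ m ~= (0 :: ('e \<times> 'e) pf)" using Qf_nz d by (cases "m = 0") (auto simp: m_def)
 have c0: "a = 0" if "const a * (- Qf) ^ m = (0 :: ('e \<times> 'e) pf)" for a using that nz by (metis mult_eq_0_iff const_eq_0_iff)
 have p0: "coeff p m = 0" by (rule c0) (use s[OF id_W] in \<open>simp only: simp_thms if_True\<close>)
 have q0: "coeff q m = 0"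
 proof (cases "uminus : W")
  case True
  show ?thesis by (rule c0) (use s[OF True] in \<open>simp only: simp_thms if_True if_False id_uminus[symmetric]\<close>)
 qed (use q in simp)
 show ?thesis
 proof (cases "degree p \<ge> degree q")
  case True
  hence "m = degree p" by (simp add: m_def)
  hence "p = 0" using p0 by (simp add: leading_coeff_0_iff)
  hence "m = 0" "p = 0" using \<open>m = degree p\<close> by auto
  moreover have "degree q = 0" using True \<open>p = 0\<close> by simp
  ultimately show ?thesis using q0 leading_coeff_0_iff[of q] by simp
 next
  case False
  hence "m = degree q" by (simp add: m_def)
  hence "q = 0" using q0 by (simp add: leading_coeff_0_iff)
  thus ?thesis using False by simp
 qed
qed

lemma cz_add: "cz p q \<oplus>\<^bsub>HH\<^esub> cz p' q' = cz (p + p') (q + q')" by (auto simp: cz_def HK.peval_add HK.r_distr HK.a_ac)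

lemma cz_smult: "a \<cdot> cz p q = cz (Polynomial.smult a p) (Polynomial.smult a q)"
 by (auto simp: cz_def HK.peval_smult HK.smult_r_distr HK.smult_mult_r)

lemma PO_um: "uminus : W ==> PO p \<star> We uminus = We uminus \<star> PO p"
proof -
 assume u: "uminus : W"
 have c: "Oe \<star> We uminus = We uminus \<star> Oe" using Oe_centre u by (auto simp: centre_def)
 show ?thesis
 proof (induction p)
  case (pCons a p)
  have "Oe \<star> PO p \<star> We uminus = We uminus \<star> (Oe \<star> PO p)"
   using u pCons(2) c by (metis HK.m_assoc Oe_closed HK.peval_closed gens_closed(3))
  thus ?case using u by (simp add: HK.peval_pCons HK.l_distr HK.r_distr HK.smult_mult_l HK.smult_mult_r)
 qed (use u in simp)
qed

text \<open>The product of the two second slots returns to the first because w_0 is a central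
  involution. The law agrees with \<open>zt_mult\<close>, which is what makes zeta
  multiplicative.\<close>

lemma cz_mult: "cz p q \<star> cz p' q' = cz (p * p' + (if uminus : W then q * q' else 0)) (p * q' + q * p')"
proof (cases "uminus : W")
 case True
 let ?g = "We uminus"
 have g: "?g : carrier HH" using True by simp
 have c: "PO r : carrier HH" for r by simp
 have gg: "?g \<star> ?g = \<one>\<^bsub>HH\<^esub>" using We_We[OF True True] by (simp add: uminus_comp We_id)
 have 1: "PO p \<star> (?g \<star> PO q') = ?g \<star> PO (p * q')"
  using PO_um[OF True, of p] g c by (simp add: HK.peval_mult HK.m_assoc[symmetric])
 have 2: "(?g \<star> PO q) \<star> PO p' = ?g \<star> PO (q * p')" using g c by (simp add: HK.peval_mult HK.m_assoc)
 have 3: "(?g \<star> PO q) \<star> (?g \<star> PO q') = PO (q * q')"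
 proof -
  have "(?g \<star> PO q) \<star> (?g \<star> PO q') = ?g \<star> (PO q \<star> ?g) \<star> PO q'" using g c by (simp add: HK.m_assoc)
  also have "... = (?g \<star> ?g) \<star> (PO q \<star> PO q')" unfolding PO_um[OF True] using g c by (simp add: HK.m_assoc)
  finally show ?thesis using c by (simp add: gg HK.peval_mult)
 qed
 show ?thesis using True g c by (simp add: cz_def HK.l_distr HK.r_distr 1 2 3 HK.peval_add HK.a_ac HK.peval_mult[symmetric])
qed (simp add: cz_def HK.peval_mult)

lemma centre_subalg: "is_subalg HH (centre AA)"
proof -
 have cl: "a \<oplus>\<^bsub>HH\<^esub> b : centre AA & a \<star> b : centre AA & k \<cdot> a : centre AA" if "a : centre AA" "b : centre AA" for a b k
 proof -
  have c: "a : carrier AA" "b : carrier AA" using that by (auto simp: centre_def)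
  have ad: "a \<otimes>\<^bsub>AA\<^esub> d = d \<otimes>\<^bsub>AA\<^esub> a" "b \<otimes>\<^bsub>AA\<^esub> d = d \<otimes>\<^bsub>AA\<^esub> b" if "d : carrier AA" for d
   using \<open>a : centre AA\<close> \<open>b : centre AA\<close> that unfolding centre_def by blast+
  have 1: "(a \<oplus>\<^bsub>AA\<^esub> b) \<otimes>\<^bsub>AA\<^esub> d = d \<otimes>\<^bsub>AA\<^esub> (a \<oplus>\<^bsub>AA\<^esub> b)" if d: "d : carrier AA" for d
   by (simp only: AK.l_distr[OF c d] AK.r_distr[OF c d] ad[OF d])
  have 2: "(k \<odot>\<^bsub>AA\<^esub> a) \<otimes>\<^bsub>AA\<^esub> d = d \<otimes>\<^bsub>AA\<^esub> (k \<odot>\<^bsub>AA\<^esub> a)" if d: "d : carrier AA" for d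
   by (simp only: AK.smult_mult_l[OF c(1) d] AK.smult_mult_r[OF d c(1)] ad[OF d])
  have 3: "(a \<otimes>\<^bsub>AA\<^esub> b) \<otimes>\<^bsub>AA\<^esub> d = d \<otimes>\<^bsub>AA\<^esub> (a \<otimes>\<^bsub>AA\<^esub> b)" if d: "d : carrier AA" for d
  proof -
   have "(a \<otimes>\<^bsub>AA\<^esub> b) \<otimes>\<^bsub>AA\<^esub> d = (a \<otimes>\<^bsub>AA\<^esub> d) \<otimes>\<^bsub>AA\<^esub> b"
    by (simp only: AK.m_assoc[OF c d] AK.m_assoc[OF c(1) d c(2)] ad(2)[OF d])
   thus ?thesis by (simp only: ad(1)[OF d] AK.m_assoc[OF d c])
  qed
  have "a \<oplus>\<^bsub>AA\<^esub> b : centre AA" unfolding centre_def by (intro CollectI conjI ballI AK.a_closed[OF c] 1)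
  moreover have "a \<otimes>\<^bsub>AA\<^esub> b : centre AA" unfolding centre_def by (intro CollectI conjI ballI AK.m_closed[OF c] 3)
  moreover have "k \<odot>\<^bsub>AA\<^esub> a : centre AA"
   unfolding centre_def by (intro CollectI conjI ballI AK.smult_closed[OF c(1)] 2)
  ultimately show ?thesis by (simp only: AA_simps)
 qed
 have "\<one>\<^bsub>AA\<^esub> : centre AA"
  unfolding centre_def by (intro CollectI conjI ballI AK.one_closed) (simp only: AK.l_one AK.r_one)
 hence one: "\<one>\<^bsub>HH\<^esub> : centre AA" by (simp only: AA_simps)
 have "centre AA \<subseteq> carrier HH" unfolding centre_def by blast
 thus ?thesis
  unfolding is_subalg_def using cl one by (intro conjI ballI allI) (assumption | (drule (1) cl, (erule conjE)+, assumption) | blast)+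
qed

lemma PO_in_centre: "PO p : centre AA"
proof (induction p)
 case 0
 show ?case using HK.zero_subalg[OF centre_subalg] by simp
next
 case (pCons a p)
 thus ?case using centre_subalg Oe_centre unfolding is_subalg_def by (simp add: HK.peval_pCons)
qed

lemma cz_centre: "cz p q : centre AA" using PO_in_centre um_centre centre_subalg unfolding cz_def is_subalg_def by auto

end

subsection \<open>Central elements\<close>

context cherednik
begin

lemma Mm_expand:
 "Mm u v = (\<Sum>i\<in>{1..DIM('e)}. sc (of_real (u \<bullet> y i)) * Mm (y i) v)"
 "Mm u v = (\<Sum>i\<in>{1..DIM('e)}. sc (of_real (v \<bullet> y i)) * Mm u (y i))"
proof -
 have e1: "Mm u v = (\<Sum>i\<in>{1..DIM('e)}. sc (of_real (u \<bullet> y i)) * Mm (y i) v)" for u v unfolding Mm_def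
  by (subst Xo_expand[of u], subst To_expand[of u])
   (simp only: sum_distrib_left sum_distrib_right sc_left[of "Xo v"] mult.assoc right_diff_distrib sum_subtractf)
 thus "Mm u v = (\<Sum>i\<in>{1..DIM('e)}. sc (of_real (u \<bullet> y i)) * Mm (y i) v)" .
 show "Mm u v = (\<Sum>i\<in>{1..DIM('e)}. sc (of_real (v \<bullet> y i)) * Mm u (y i))"
 proof -
  have m: "Mm a b = - Mm b a" for a b by (simp add: Mm_def)
  have "Mm u v = - (\<Sum>i\<in>{1..DIM('e)}. sc (of_real (v \<bullet> y i)) * Mm (y i) u)" using m[of u v] e1[of v u] by metis
  also have "... = (\<Sum>i\<in>{1..DIM('e)}. sc (of_real (v \<bullet> y i)) * Mm u (y i))"
   unfolding sum_negf[symmetric] by (rule sum.cong[OF HOL.refl]) (simp add: m[of "y _" u])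
  finally show ?thesis .
 qed
qed

text \<open>Centrality gives commutation with the generators for i < j; antisymmetry and bilinearity
  extend it to all planes, as needed for invariance under all rotations.\<close>

lemma centre_Mm:
 assumes z: "z : centre AA"
 shows "pr z * Mm u v = Mm u v * pr z"
proof -
 have zc: "z : carrier AA" using z by (simp add: centre_def)
 have lt: "pr z * Mm (y i) (y j) = Mm (y i) (y j) * pr z" if "1 \<le> i" "i < j" "j \<le> DIM('e)" for i j
 proof -
  have "z \<otimes>\<^bsub>AA\<^esub> M_elt R Rp c y x i j = M_elt R Rp c y x i j \<otimes>\<^bsub>AA\<^esub> z"
   using z gens_AA(2)[OF that] unfolding centre_def by blast
  from arg_cong[OF this, of pr] have "pr z * pr (M_elt R Rp c y x i j) = pr (M_elt R Rp c y x i j) * pr z" using zc by simp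
  thus ?thesis using that by (simp add: pr_M)
 qed
 have all: "pr z * Mm (y i) (y j) = Mm (y i) (y j) * pr z" if ij: "i : {1..DIM('e)}" "j : {1..DIM('e)}" for i j
 proof (cases i j rule: linorder_cases)
  case greater
  have m: "Mm (y i) (y j) = - Mm (y j) (y i)" by (simp add: Mm_def)
  show ?thesis unfolding m using lt[of j i] greater ij by simp
 qed (use lt ij in \<open>auto simp: Mm_def\<close>)
 have s: "pr z * (\<Sum>i\<in>{1..DIM('e)}. sc (a i) * F i) = (\<Sum>i\<in>{1..DIM('e)}. sc (a i) * F i) * pr z"
  if "\<And>i. i : {1..DIM('e)} ==> pr z * F i = F i * pr z" for a and F :: "nat => 'e op"
  unfolding sum_distrib_left sum_distrib_right by (rule sum.cong[OF HOL.refl]) (simp only: sc_left[of "pr z"] that mult.assoc)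
 have "pr z * Mm (y i) v = Mm (y i) v * pr z" if "i : {1..DIM('e)}" for i
  unfolding Mm_expand(2)[of "y i" v] by (rule s) (rule all[OF that])
 thus ?thesis unfolding Mm_expand(1)[of u v] by (rule s)
qed

lemma centre_r2: "z : centre AA ==> pr z * r2 = r2 * pr z" by (rule AA_commutes[OF Wo_r2 Mm_r2]) (auto simp: centre_def)

text \<open>Commutation with M_uv in coordinates: on the left side M is multiplied from the right,
  on the right side from the left. A rightmost y raises the level, so the equation at level k + 1
  involves \<open>Ru\<close> at level k.\<close>

lemma sy_rotation:
 assumes z: "z : carrier HH" and c: "\<And>u v. pr z * Mm u v = Mm u v * pr z" and w: "w : W"
 shows "lin (0, v) * Ru u (sy z) k w - lin (0, u) * Ru v (sy z) k w
  = lin (u, 0) * Te v (sy z) (Suc k) w - lin (v, 0) * Te u (sy z) (Suc k) w"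
proof -
 let ?M = "Xe (blin u) \<star> Ye v \<ominus>\<^bsub>HH\<^esub> Xe (blin v) \<star> Ye u"
 have "pr ?M = Mm u v" by (simp add: pr_gens Mm_def)
 hence "z \<star> ?M = ?M \<star> z" using z c by (intro pr_inj) simp_all
 moreover have "z \<star> ?M = z \<star> Xe (blin u) \<star> Ye v \<ominus>\<^bsub>HH\<^esub> z \<star> Xe (blin v) \<star> Ye u"
  using z by (simp add: a_minus_def HK.r_distr HK.r_minus HK.m_assoc)
 moreover have "?M \<star> z = Xe (blin u) \<star> (Ye v \<star> z) \<ominus>\<^bsub>HH\<^esub> Xe (blin v) \<star> (Ye u \<star> z)"
  using z by (simp add: a_minus_def HK.l_distr HK.l_minus HK.m_assoc)
 ultimately have "sy (z \<star> Xe (blin u) \<star> Ye v \<ominus>\<^bsub>HH\<^esub> z \<star> Xe (blin v) \<star> Ye u) (Suc k) w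
  = sy (Xe (blin u) \<star> (Ye v \<star> z) \<ominus>\<^bsub>HH\<^esub> Xe (blin v) \<star> (Ye u \<star> z)) (Suc k) w" by simp
 moreover have "sy (z \<star> Xe (blin u) \<star> Ye v) (Suc k) w = lin (0, v) * Ru u (sy z) k w" for u v
  using sy_right_Ye[of "z \<star> Xe (blin u)" v] sy_right_Xe[OF z, of "blin u"] z w by simp
 moreover have "sy (Xe (blin u) \<star> (Ye v \<star> z)) (Suc k) w = lin (u, 0) * Te v (sy z) (Suc k) w" for u v
  using z w by (simp add: sy_Xe sy_Te)
 ultimately show ?thesis using z by (simp add: sy_simps(2))
qed

lemma sy_r2:
 assumes z: "z : carrier HH" and c: "pr z * r2 = r2 * pr z" and w: "w : W"
 shows "(\<Sum>i\<in>{1..DIM('e)}. Ru (y i) (Ru (y i) (sy z)) k w) = (\<Sum>i\<in>{1..DIM('e)}. lin (y i, 0) * lin (y i, 0) * sy z k w)"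
proof -
 let ?e = "\<Oplus>\<^bsub>HH\<^esub>i\<in>{1..DIM('e)}. z \<star> Xe (blin (y i)) \<star> Xe (blin (y i))"
 let ?d = "\<Oplus>\<^bsub>HH\<^esub>i\<in>{1..DIM('e)}. Xe (blin (y i)) \<star> (Xe (blin (y i)) \<star> z)"
 have "pr ?e = pr z * r2" "pr ?d = r2 * pr z" unfolding r2_def sum_distrib_left sum_distrib_right
  by (subst pr_finsum; use z in \<open>simp add: pr_gens mult.assoc\<close>)+
 hence ed: "pr ?e = pr ?d" using c by simp
 have se: "sy (finsum HH g {1..DIM('e)}) k w = (\<Sum>i\<in>{1..DIM('e)}. sy (g i) k w)" if "\<And>i. g i : carrier HH" for g
  unfolding sy_def by (subst pr_finsum) (simp_all add: that app_op_sum sum_vv)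
 have "sy (z \<star> Xe (blin u) \<star> Xe (blin u)) k w = Ru u (Ru u (sy z)) k w" for u
 proof -
  have "sy (z \<star> Xe (blin u) \<star> Xe (blin u)) k w = Ru u (sy (z \<star> Xe (blin u))) k w"
   using sy_right_Xe[of "z \<star> Xe (blin u)" "blin u"] z w by simp
  also have "... = Ru u (Ru u (sy z)) k w" by (rule Ru_cong[OF w]) (use sy_right_Xe[OF z, of "blin u"] in simp)
  finally show ?thesis .
 qed
 hence "sy ?e k w = (\<Sum>i\<in>{1..DIM('e)}. Ru (y i) (Ru (y i) (sy z)) k w)" by (subst se) (use z in simp_all)
 moreover have "sy ?d k w = (\<Sum>i\<in>{1..DIM('e)}. lin (y i, 0) * lin (y i, 0) * sy z k w)"
  by (subst se) (use z in \<open>simp_all add: sy_Xe mult.assoc\<close>)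
 moreover have "sy ?e k w = sy ?d k w" unfolding sy_def ed ..
 ultimately show ?thesis by simp
qed

text \<open>Degree in x equal to the level. Together with \<open>sy_s2\<close> this gives symbols of
  elements of the angular momentum algebra equal degrees in x and xi.\<close>

definition xh :: "'e vv => bool" where
 "xh f \<longleftrightarrow> (\<forall>k w t. sub (s1 t) (f k {} w) = const (of_real t ^ k) * f k {} w)"

text \<open>A Dunkl operator either lowers the degree in x or raises the level, so it makes the
  degree in x one less than the level, and X restores the balance. Degrees are compared after
  multiplication by t, which keeps the equations free of division.\<close>

lemma xh_X_T: "xh f ==> xh (app (Xo u) (app (To v) f))"
proof -
 assume f: "xh f"
 have h: "sub (s1 t) (f k {} w) = const (of_real t ^ k) * f k {} w" for t k w using f by (simp add: xh_def)
 have "sub (s1 t) (app (Xo u) (app (To v) f) k {} w) = const (of_real t ^ k) * app (Xo u) (app (To v) f) k {} w" for t k w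
 proof -
  let ?i = "if k = 0 \<or> \<not> orth w then 0 else lin (0, ivf w v) * f (k - 1) {} w"
  have 1: "const (of_real t) * sub (s1 t) (pd (v, 0) (f k {} w)) = const (of_real t ^ k) * pd (v, 0) (f k {} w)"
   unfolding pd_s(1) h by simp
  have 2: "const (of_real t) * sub (s1 t) ?i = const (of_real t ^ k) * ?i"
   by (cases k) (simp_all add: sub_simps linear_s sub_s_lin1 h const_simps mult_ac)
  have 3: "const (of_real t) * sub (s1 t) (\<Sum>a\<in>Ph. const (h a * of_real (a \<bullet> v)) * dd (a, 0) (f k {} (rf a o w)))
   = const (of_real t ^ k) * (\<Sum>a\<in>Ph. const (h a * of_real (a \<bullet> v)) * dd (a, 0) (f k {} (rf a o w)))"
   unfolding sub_sum[OF linear_s(1)] sum_distrib_left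
  proof (rule sum.cong[OF HOL.refl])
   fix a assume a: "a : Ph"
   have e: "const (of_real t) * sub (s1 t) (dd (a, 0) (f k {} (rf a o w))) = const (of_real t ^ k) * dd (a, 0) (f k {} (rf a o w))"
    by (rule s1_dd[OF nzE(3)[OF a] h])
   show "const (of_real t) * sub (s1 t) (const (h a * of_real (a \<bullet> v)) * dd (a, 0) (f k {} (rf a o w)))
    = const (of_real t ^ k) * (const (h a * of_real (a \<bullet> v)) * dd (a, 0) (f k {} (rf a o w)))"
    unfolding sub_simps(2)[OF linear_s(1)] sub_simps(3)[OF linear_s(1)]
     mult.left_commute[of "const (of_real t)" "const (h a * of_real (a \<bullet> v))"] e by (rule mult.left_commute)
  qed
  have "sub (s1 t) (lin (u, 0) * P) = lin (u, 0) * (const (of_real t) * sub (s1 t) P)" for P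
   by (simp add: sub_simps linear_s sub_s_lin1 mult_ac)
  hence "sub (s1 t) (app (Xo u) (app (To v) f) k {} w) = lin (u, 0) * (const (of_real t) * sub (s1 t) (app (To v) f k {} w))" by simp
  also have "const (of_real t) * sub (s1 t) (app (To v) f k {} w) = const (of_real t ^ k) * app (To v) f k {} w"
   unfolding app_To sub_simps(1)[OF linear_s(1)] distrib_left 1 2 3 ..
  finally show ?thesis by (simp only: app_Mo mult.left_commute)
 qed
 thus ?thesis by (simp add: xh_def)
qed

lemma AA_xh: "z : carrier AA ==> xh (app (pr z) vac)"
proof -
 let ?T = "{z : carrier HH. \<forall>f. xh f --> xh (app (pr z) f)}"
 have ad: "xh (f + g)" if "xh f" "xh g" for f g using that by (simp add: xh_def sub_simps linear_s distrib_left)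
 have sm: "xh (smv a f)" if "xh f" for f a using that by (simp add: xh_def smv_def sub_simps linear_s mult_ac)
 have mi: "xh (f - g)" if "xh f" "xh g" for f g using that by (simp add: xh_def sub_simps linear_s right_diff_distrib)
 have "carrier AA \<subseteq> ?T"
 proof (rule AA_least)
  show "is_subalg HH ?T" by (auto simp: is_subalg_def ad sm)
  fix g assume g: "g : W"
  have "xh (app (Wo g) f)" if f: "xh f" for f
  proof -
   have o: "orth (ivf g)" by (intro orth_inv W_orth g)
   have "sub (s1 t) (sub (fs (ivf g)) (f k {} w)) = const (of_real t ^ k) * sub (fs (ivf g)) (f k {} w)" for t k w
    using f by (simp add: sub_s_fs orth_linear o xh_def sub_simps linear_fs)
   thus ?thesis by (simp add: xh_def app_Wo W_orth g)
  qed
  thus "We g : ?T" using g by (simp add: pr_gens)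
 next
  fix i j assume "1 \<le> i" "i < j" "j \<le> DIM('e)"
  hence ij: "i : {1..DIM('e)}" "j : {1..DIM('e)}" by auto
  have "xh (app (Mm u v) f)" if "xh f" for f u v unfolding Mm_def app_simps using that by (intro mi xh_X_T)
  thus "M_elt R Rp c y x i j : ?T" using pr_M[OF ij] by simp
 qed
 moreover have "xh vac" by (simp add: xh_def vac_def dl_def sub_simps linear_s const_simps)
 moreover assume "z : carrier AA"
 ultimately show ?thesis by auto
qed

text \<open>A reflection negates a and fixes a vector orthogonal to a, so its product with id or -id
  is neither of them. Hence at w = id or -id no reflection term sees a nonzero top
  coefficient.\<close>

lemma rf_not_pm:
 assumes d: "DIM('e) \<ge> 3" and a: "a : Ph" and w: "w = id \<or> w = uminus"
 shows "w o rf a ~= id" "w o rf a ~= uminus" "rf a o w ~= id" "rf a o w ~= uminus"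
proof -
 obtain e where e: "e \<bullet> e = 1" "e \<bullet> a = 0" using unit_orth_exists[OF d, of a a] by blast
 have e': "rf a e = e" "e ~= - e" using e by (auto simp: rf_def) (metis inner_minus_left minus_equation_iff one_neq_neg_one)
 have a': "rf a a = - a" "a ~= - a" using rf_self[OF nzE(3)[OF a]] nzE(3)[OF a] by (auto simp: eq_neg_iff_add_eq_0 scaleR_2[symmetric])
 have m: "rf a (- v) = - rf a v" for v by (rule linear_neg[OF linear_rf])
 show "w o rf a ~= id" "w o rf a ~= uminus" "rf a o w ~= id" "rf a o w ~= uminus"
  using w e' a' m unfolding fun_eq_iff o_apply id_apply by (metis minus_minus)+
qed

text \<open>At the top level commutation with M is an identity between products of linear forms
  times the top coefficient; it forces w = id or -id wherever this coefficient is nonzero. One level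
  below, it yields the rotation equation, and commutation with \<open>r2\<close> the shear equation
  of \<open>pair_invariant\<close>.\<close>

lemma centre_top:
 assumes d: "DIM('e) \<ge> 3" and z: "z : centre AA" and b: "\<And>k w. m < k ==> w : W ==> sy z k w = 0"
 shows "w : W ==> w ~= id ==> w ~= uminus ==> sy z m w = 0"
  and "w : W ==> w = id \<or> w = uminus ==> \<exists>k. sy z m w = (if even m then const k * Qf ^ (m div 2) else 0)"
proof -
 have zA: "z : carrier AA" using z by (simp add: centre_def)
 hence zc: "z : carrier HH" by simp
 have R1: "Ru u (sy z) m w = lin (w u, 0) * sy z m w" if "w : W" for u w using that b nzE by (simp add: Ru_def)
 have T1: "Te v (sy z) (Suc m) w = lin (0, ivf w v) * sy z m w" if "w : W" for v w using that b nzE by (simp add: Te_def)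
 have rot: "lin (0, v) * Ru u (sy z) k w - lin (0, u) * Ru v (sy z) k w
  = lin (u, 0) * Te v (sy z) (Suc k) w - lin (v, 0) * Te u (sy z) (Suc k) w" if "w : W" for u v k w
  by (rule sy_rotation[OF zc centre_Mm[OF z] that])
 show off: "sy z m w = 0" if w: "w : W" and ne: "w ~= id" "w ~= uminus" for w
 proof (rule ccontr)
  assume nz: "sy z m w ~= 0"
  have o: "orth w" by (rule W_orth[OF w])
  \<comment> \<open>The nonzero top coefficient is cancelled, since polynomial functions have no
    zero divisors.\<close>
  have B: "lin (0, v) * lin (w u, 0) - lin (0, u) * lin (w v, 0) - (lin (u, 0) * lin (0, ivf w v) - lin (v, 0) * lin (0, ivf w u)) = (0 :: ('e \<times> 'e) pf)" for u v
  proof -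
   have "(lin (0, v) * lin (w u, 0) - lin (0, u) * lin (w v, 0) - (lin (u, 0) * lin (0, ivf w v) - lin (v, 0) * lin (0, ivf w u))) * sy z m w = 0"
    using rot[OF w, of v u m] unfolding R1[OF w] T1[OF w] by (simp add: algebra_simps)
   thus ?thesis using nz by simp
  qed
  have "w = id \<or> w = uminus"
  proof (rule pm_id[OF d o])
   fix \<eta> \<xi> u v
   have ii: "w s \<bullet> w t = s \<bullet> t" for s t using o by (simp add: orthogonal_transformation_def)
   have iv: "\<xi> \<bullet> ivf w v = w \<xi> \<bullet> v" for v using orth_inv_inner[OF o, of v \<xi>] by (simp add: inner_commute)
   \<comment> \<open>Evaluation at (w eta, xi) turns the forms in w u and w^-1 v into the inner
     products required by \<open>pm_id\<close>.\<close>
   have "complex_of_real ((\<xi> \<bullet> v) * (\<eta> \<bullet> u) - (\<xi> \<bullet> u) * (\<eta> \<bullet> v) - ((w \<eta> \<bullet> u) * (w \<xi> \<bullet> v) - (w \<eta> \<bullet> v) * (w \<xi> \<bullet> u))) = 0"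
    using arg_cong[OF B[of v u], of "%p. ev p (w \<eta>, \<xi>)"] by (simp add: ii iv)
   thus "(\<xi> \<bullet> v) * (\<eta> \<bullet> u) - (\<xi> \<bullet> u) * (\<eta> \<bullet> v) = (w \<eta> \<bullet> u) * (w \<xi> \<bullet> v) - (w \<eta> \<bullet> v) * (w \<xi> \<bullet> u)"
    by (simp only: of_real_eq_0_iff right_minus_eq)
  qed
  thus False using ne by simp
 qed
 assume w: "w : W" and pm: "w = id \<or> w = uminus"
 let ?F = "sy z m w"
 have o: "orth w" by (rule W_orth[OF w])
 \<comment> \<open>The neighbours of w under a reflection are neither id nor -id, so their top
   coefficients already vanish and the Dunkl terms drop out.\<close>
 have z1: "sy z m (w o rf a) = 0" "sy z m (rf a o w) = 0" if "a : Ph" for a using off rf_not_pm[OF d that pm] w that by auto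
 \<comment> \<open>The sign by which w acts, so that both cases are treated at once.\<close>
 obtain \<sigma> :: complex where \<sigma>: "\<sigma> * \<sigma> = 1" "\<And>u. lin (w u, 0) = const \<sigma> * lin (u, 0 :: 'e)" "\<And>u. lin (0, ivf w u) = const \<sigma> * lin (0 :: 'e, u)"
 proof (cases "w = id")
  case True
  thus ?thesis by (intro that[of 1]) (simp_all add: const_simps inv_id)
 next
  case False
  hence u: "w = uminus" using pm by simp
  have "lin (- u, 0 :: 'e) = const (- 1) * lin (u, 0)" "lin (0 :: 'e, - u) = const (- 1) * lin (0, u)" for u :: 'e
   using lin_simps(4)[of "(u, 0 :: 'e)"] lin_simps(4)[of "(0 :: 'e, u)"] by (simp_all add: const_simps)
  thus ?thesis by (intro that[of "- 1"]) (simp_all add: u ivf_uminus)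
 qed
 have \<sigma>0: "\<sigma> ~= 0" using \<sigma>(1) by auto
 have c\<sigma>: "const \<sigma> * (const \<sigma> * P) = P" for P :: "('e \<times> 'e) pf"
  by (simp add: mult.assoc[symmetric] const_simps(4)[symmetric] \<sigma>(1) const_simps(2))
 have hx: "ev ?F (t *\<^sub>R v, \<xi>) = of_real t ^ m * ev ?F (v, \<xi>)" for t v \<xi>
 proof -
  have "sub (s1 t) ?F = const (of_real t ^ m) * ?F" using AA_xh[OF zA] by (simp add: xh_def sy_def)
  from arg_cong[OF this, of "%p. ev p (v, \<xi>)"] show ?thesis by (simp add: ev_sub linear_s) (simp add: s1_def)
 qed
 have h\<xi>: "ev ?F (v, t *\<^sub>R \<xi>) = of_real t ^ m * ev ?F (v, \<xi>)" for t v \<xi>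
 proof -
  have "sub (s2 t) ?F = const (of_real t ^ m) * ?F" using sy_s2[OF zc] w by simp
  from arg_cong[OF this, of "%p. ev p (v, \<xi>)"] show ?thesis by (simp add: ev_sub linear_s) (simp add: s2_def)
 qed
 show "\<exists>k. ?F = (if even m then const k * Qf ^ (m div 2) else 0)"
 proof (cases m)
  case 0
  have "ev ?F (v, \<xi>) = ev ?F (0, 0)" for v \<xi> using hx[of 0 v \<xi>] h\<xi>[of 0 0 \<xi>] 0 by simp
  hence "?F = const (ev ?F (0, 0))" by (intro pf_eqI) auto
  thus ?thesis using 0 by (intro exI[of _ "ev ?F (0, 0)"]) simp
 next
  case (Suc m')
  \<comment> \<open>The next lower coefficient is unknown; it enters both sides of each equation in
    the same way and cancels.\<close>
  let ?f = "sy z m' w"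
  have R0: "Ru u (sy z) m' w = const \<sigma> * lin (u, 0) * ?f + pd (0, u) ?F" for u
   unfolding Ru_def Suc[symmetric] \<sigma>(2) using nzE by (simp add: z1)
  have T0: "Te v (sy z) (Suc m') w = pd (v, 0) ?F + const \<sigma> * lin (0, v) * ?f" for v
   unfolding Te_def Suc[symmetric] \<sigma>(3) using nzE by (simp add: z1[unfolded Suc] Suc)
  show ?thesis
  proof (rule pair_invariant[OF d hx h\<xi>])
   fix u v
   show "lin (0, v) * pd (0, u) ?F - lin (0, u) * pd (0, v) ?F = lin (u, 0) * pd (v, 0) ?F - lin (v, 0) * pd (u, 0) ?F"
    using rot[OF w, of v u m'] unfolding R0 T0 by (simp add: algebra_simps)
  next
   \<comment> \<open>Applying \<open>Ru\<close> twice gives the square of the linear form on the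
     lower coefficient, and twice a cross term on the top one. Summed over the basis, the first part
     is what left multiplication by \<open>r2\<close> gives, so the cross terms add up to
     zero.\<close>
   have RR: "Ru u (Ru u (sy z)) m' w = lin (u, 0) * lin (u, 0) * ?f + const (2 * \<sigma>) * (lin (u, 0) * pd (0, u) ?F)" for u
   proof -
    have g: "const (2 * \<sigma>) * P = const \<sigma> * P + const \<sigma> * P" for P :: "('e \<times> 'e) pf"
     by (simp only: mult_2 const_simps(3) distrib_right)
    have "dd (0, a) (Ru u (sy z) m (w o rf a)) = 0" if "a : Ph" for a using nzE[OF that] w that by (simp add: R1 z1)
    hence "Ru u (Ru u (sy z)) m' w = const \<sigma> * lin (u, 0) * (const \<sigma> * lin (u, 0) * ?f + pd (0, u) ?F) + pd (0, u) (const \<sigma> * lin (u, 0) * ?F)"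
     unfolding Ru_def[of u "Ru u (sy z)"] Suc[symmetric] R0 R1[OF w] \<sigma>(2) by simp
    also have "const \<sigma> * lin (u, 0) * (const \<sigma> * lin (u, 0) * ?f + pd (0, u) ?F) = const \<sigma> * (const \<sigma> * (lin (u, 0) * lin (u, 0) * ?f)) + const \<sigma> * (lin (u, 0) * pd (0, u) ?F)"
     by (simp add: algebra_simps)
    also have "pd (0, u) (const \<sigma> * lin (u, 0) * ?F) = const \<sigma> * (lin (u, 0) * pd (0, u) ?F)"
     by (simp add: mult.assoc pd_mult const_simps)
    finally show ?thesis unfolding c\<sigma> g by (simp only: add.assoc)
   qed
   have ca: "P + Q = P ==> Q = 0" for P Q :: "('e \<times> 'e) pf" by simp
   have "(\<Sum>i\<in>{1..DIM('e)}. lin (y i, 0) * lin (y i, 0) * ?f) + (\<Sum>i\<in>{1..DIM('e)}. const (2 * \<sigma>) * (lin (y i, 0) * pd (0, y i) ?F))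
    = (\<Sum>i\<in>{1..DIM('e)}. lin (y i, 0) * lin (y i, 0) * ?f)"
    using sy_r2[OF zc centre_r2[OF z] w, of m'] unfolding RR sum.distrib .
   hence "const (2 * \<sigma>) * (\<Sum>i\<in>{1..DIM('e)}. lin (y i, 0) * pd (0, y i) ?F) = 0" unfolding sum_distrib_left by (rule ca)
   moreover have "const (2 * \<sigma>) ~= (0 :: ('e \<times> 'e) pf)" using \<sigma>0 by (simp add: const_eq_0_iff)
   ultimately show "(\<Sum>i\<in>{1..DIM('e)}. lin (y i, 0) * pd (0, y i) ?F) = 0" by (simp only: mult_eq_0_iff) blast
  qed
 qed
qed

text \<open>Induction on a bound for the level: a combination of powers of Omega with the same top
  coefficients at id and -id is subtracted, and the difference is central with a smaller
  bound.\<close>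

lemma centre_form3:
 assumes d: "DIM('e) \<ge> 3"
 shows "z : centre AA ==> (\<And>k w. m \<le> k ==> w : W ==> sy z k w = 0) ==> \<exists>p q. z = cz p q"
proof (induction m arbitrary: z)
 case 0
 have "z : carrier AA" using 0(1) by (simp add: centre_def)
 hence "z = \<zero>\<^bsub>HH\<^esub>" using 0(2) by (intro sy_zero) auto
 hence "z = cz 0 0" by (simp add: cz_def)
 thus ?case by blast
next
 case (Suc m)
 have zA: "z : carrier AA" using Suc(2) by (simp add: centre_def)
 have b: "sy z k w = 0" if "m < k" "w : W" for k w using Suc(3) that by simp
 have top1: "sy z m w = 0" if "w : W" "w ~= id" "w ~= uminus" for w using b that by (intro centre_top(1)[OF d Suc(2), of m w])
 have top2: "\<exists>k. sy z m w = (if even m then const k * Qf ^ (m div 2) else 0)" if "w : W" "w = id \<or> w = uminus" for w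
  using b that by (intro centre_top(2)[OF d Suc(2), of m w])
 have "\<exists>p q. \<forall>k w. m \<le> k --> w : W --> sy (cz p q) k w = sy z k w"
 proof (cases "even m")
  case False
  have "sy z m w = 0" if "w : W" for w using top1[OF that] top2[OF that] False by (cases "w = id \<or> w = uminus") auto
  hence "\<forall>k w. m \<le> k --> w : W --> sy (cz 0 0) k w = sy z k w" using b by (auto simp: cz_def sy_def le_less)
  thus ?thesis by blast
 next
  case True
  then obtain j where j: "m = 2 * j" by blast
  obtain k1 where k1: "sy z m id = const k1 * Qf ^ j" using top2[OF id_W] True j by auto
  obtain k2 where k2: "uminus : W ==> sy z m uminus = const k2 * Qf ^ j"
  proof (cases "uminus : W")
   case um: True
   thus ?thesis using top2[OF um] True j that by auto
  qed (use that in blast)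
  \<comment> \<open>The leading symbol of Omega^j is (-Qf)^j, whereas the classification yields
    multiples of Qf^j; the coefficient is corrected by (-1)^j.\<close>
  have pw: "const (a * (- 1) ^ j) * (- Qf) ^ j = const a * (Qf ^ j :: ('e \<times> 'e) pf)" for a
   by (rule pf_eqI) (simp add: ev_power power_mult_distrib[symmetric] mult.assoc)
  let ?p = "monom (k1 * (- 1) ^ j) j" and ?q = "monom (k2 * (- 1) ^ j) j"
  have dg: "degree ?p \<le> j" "degree ?q \<le> j" by (simp_all add: degree_monom_le)
  have "sy (cz ?p ?q) k w = sy z k w" if "m \<le> k" "w : W" for k w
  proof (cases "k = m")
   case True
   show ?thesis unfolding True j sy_cz(2)[OF dg that(2)] coeff_monom using k1 k2 top1[OF that(2)] that(2) by (auto simp: pw j)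
  next
   case False
   thus ?thesis using b that sy_cz(1)[OF dg that(2), of k] j by simp
  qed
  thus ?thesis by blast
 qed
 then obtain p q where pq: "\<And>k w. m \<le> k ==> w : W ==> sy (cz p q) k w = sy z k w" by blast
 let ?z = "z \<ominus>\<^bsub>HH\<^esub> cz p q"
 have "?z : centre AA" by (rule HK.minus_subalg[OF centre_subalg Suc(2) cz_centre])
 moreover have "sy ?z k w = 0" if "m \<le> k" "w : W" for k w using pq[OF that] zA by (simp add: sy_simps(2))
 ultimately obtain p' q' where "?z = cz p' q'" using Suc(1) by blast
 hence "z = cz p' q' \<oplus>\<^bsub>HH\<^esub> cz p q" using zA by (simp add: a_minus_def HK.a_assoc HK.l_neg flip: \<open>?z = cz p' q'\<close>)
 thus ?case unfolding cz_add by blast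
qed

end

section \<open>Unique form of central elements and construction of zeta\<close>

section \<open>The homomorphism between the centres\<close>

lemma orth_dim1:
 fixes w :: "'e::euclidean_space => 'e"
 assumes d: "DIM('e) = 1" and o: "orth w"
 shows "w = id \<or> w = uminus"
proof -
 have l: "linear w" and nw: "norm (w z) = norm z" for z using o by (auto simp: orthogonal_transformation)
 obtain b :: 'e where b: "(Basis :: 'e set) = {b}" using d card_1_singletonE by blast
 have bb: "b : (Basis :: 'e set)" unfolding b by (rule singletonI)
 have rep: "v = (v \<bullet> b) *\<^sub>R b" for v
 proof -
  have "(\<Sum>i\<in>{b}. (v \<bullet> i) *\<^sub>R i) = v" using euclidean_representation[of v] unfolding b .
  thus ?thesis by simp
 qed
 have "w b = (w b \<bullet> b) *\<^sub>R b" by (rule rep)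
 moreover have "\<bar>w b \<bullet> b\<bar> = 1" using nw[of b] arg_cong[OF rep[of "w b"], of norm] norm_Basis[OF bb] by simp
 ultimately have wb: "w b = b \<or> w b = - b" by (metis abs_eq_iff abs_one scaleR_one scaleR_minus1_left)
 have wv: "w v = (v \<bullet> b) *\<^sub>R w b" for v using linear_scale[OF l] rep[of v] by metis
 from wb show ?thesis
 proof
  assume "w b = b"
  hence "w v = id v" for v using wv[of v] rep[of v] by simp
  thus ?thesis by blast
 next
  assume "w b = - b"
  hence "w v = - v" for v using wv[of v] rep[of v] by (metis scaleR_minus_right)
  thus ?thesis by blast
 qed
qed

context cherednik
begin

definition okp :: "complex poly => complex poly => bool" where
 "okp p q \<longleftrightarrow> (uminus \<notin> W --> q = 0) & (DIM('e) = 1 --> degree p = 0 & degree q = 0)"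

lemma okp_closed:
 assumes "okp p q" "okp p' q'"
 shows "okp (p + p') (q + q')" "okp (Polynomial.smult a p) (Polynomial.smult a q)"
  "okp (p * p' + (if uminus : W then q * q' else 0)) (p * q' + q * p')" "okp (p - p') (q - q')"
proof -
 have c: "degree r = 0 & degree r' = 0 ==> degree (r + r') = 0 & degree (r * r') = 0 & degree (r - r') = 0" for r r' :: "complex poly"
  using degree_add_le[of r 0 r'] degree_mult_le[of r r'] degree_diff_le[of r 0 r'] by simp
 have c': "degree r = 0 ==> degree (Polynomial.smult a r) = 0" for r :: "complex poly" using degree_smult_le[of a r] by simp
 show "okp (p + p') (q + q')" "okp (Polynomial.smult a p) (Polynomial.smult a q)" "okp (p - p') (q - q')"
  using assms c c' by (auto simp: okp_def)
 show "okp (p * p' + (if uminus : W then q * q' else 0)) (p * q' + q * p')" unfolding okp_def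
 proof (intro conjI impI)
  assume "uminus \<notin> W"
  thus "p * q' + q * p' = 0" using assms by (simp add: okp_def)
 next
  assume "DIM('e) = 1"
  hence z: "degree p = 0" "degree q = 0" "degree p' = 0" "degree q' = 0" using assms by (auto simp: okp_def)
  thus "degree (p * p' + (if uminus : W then q * q' else 0)) = 0" "degree (p * q' + q * p') = 0"
   using c[of p p'] c[of q q'] c[of "p * p'" "q * q'"] c[of p q'] c[of q p'] c[of "p * q'" "q * p'"] by auto
 qed
qed

lemma cz_inj: "okp p q ==> okp p' q' ==> cz p q = cz p' q' ==> p = p' & q = q'"
proof -
 assume o: "okp p q" "okp p' q'" and e: "cz p q = cz p' q'"
 have "cz (p - p') (q - q') \<oplus>\<^bsub>HH\<^esub> cz p' q' = cz p q" unfolding cz_add by simp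
 hence "cz (p - p') (q - q') = \<zero>\<^bsub>HH\<^esub>" unfolding e by simp
 moreover have ok: "okp (p - p') (q - q')" by (rule okp_closed(4)[OF o])
 moreover have "DIM('e) \<ge> 2 \<or> DIM('e) = 1" using DIM_positive[where 'a = 'e] by linarith
 ultimately have "p - p' = 0 & q - q' = 0" by (intro cz_inj0) (auto simp: okp_def)
 thus ?thesis by simp
qed

lemma cz_ok: "DIM('e) ~= 1 ==> \<exists>p' q'. cz p q = cz p' q' & okp p' q'"
 by (rule exI[of _ p], rule exI[of _ "if uminus : W then q else 0"]) (auto simp: okp_def cz_def)

lemma cz_subalg: "is_subalg HH {z. \<exists>p q. z = cz p q & okp p q}"
proof -
 have "\<one>\<^bsub>HH\<^esub> = cz 1 0" by (simp add: cz_def HK.peval_1)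
 moreover have "okp 1 0" by (simp add: okp_def)
 ultimately show ?thesis unfolding is_subalg_def using cz_add cz_mult cz_smult okp_closed by (auto; metis)
qed

lemma cz_um: "uminus : W ==> We uminus = cz 0 1" by (simp add: cz_def HK.peval_1)

lemma cz_Oe: "Oe = cz [:0, 1:] 0" by (simp add: cz_def HK.peval_pCons)

text \<open>Dimension one is settled by generators, dimension two by the hypothesis, and higher
  dimensions by leading symbols.\<close>

lemma centre_form:
 assumes d2: "DIM('e) = 2 ==> centre_description R Rp D c y x" and z: "z : centre AA"
 shows "\<exists>p q. z = cz p q & okp p q"
proof -
 let ?S = "{z. \<exists>p q. z = cz p q & okp p q}"
 consider "DIM('e) = 1" | "DIM('e) = 2" | "DIM('e) \<ge> 3" using DIM_positive[where 'a = 'e] by linarith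
 thus ?thesis
 proof cases
  case 1
  \<comment> \<open>In dimension one there is no pair i < j, so the algebra is generated by the
    group, whose elements can only be id and -id.\<close>
  have "carrier AA \<subseteq> ?S"
  proof (rule AA_least[OF cz_subalg])
   fix w assume w: "w : W"
   show "We w : ?S"
   proof (cases "w = id")
    case True
    have "We id = cz 1 0" "okp 1 0" by (simp_all add: We_id cz_def okp_def HK.peval_1)
    thus ?thesis unfolding True by blast
   next
    case False
    hence "w = uminus" using orth_dim1[OF 1 W_orth[OF w]] by simp
    moreover have "okp 0 1" if "uminus : W" using that by (simp add: okp_def)
    ultimately show ?thesis using w cz_um by blast
   qed
  qed (use 1 in auto)
  thus ?thesis using z unfolding centre_def by blast
 next
  case 2
  have "centre AA = subalg_gen HH (insert Oe (if longest_element R D = uminus then {We uminus} else {}))"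
   using d2[OF 2] by (simp only: centre_description_def We_def)
  also have "... \<subseteq> ?S"
  proof (rule subalg_gen_least[OF cz_subalg])
   have "okp [:0, 1:] 0" "uminus : W ==> okp 0 1" using 2 by (simp_all add: okp_def)
   thus "insert Oe (if longest_element R D = uminus then {We uminus} else {}) \<subseteq> ?S" using cz_Oe cz_um longest_iff by auto
  qed
  finally show ?thesis using z by blast
 next
  case 3
  have "z : carrier HH" using z by (auto simp: centre_def)
  then obtain m where "\<And>k w. m \<le> k ==> w : W ==> sy z k w = 0" using sy_finite_level by blast
  then obtain p q where "z = cz p q" using centre_form3[OF 3 z] by blast
  moreover have "DIM('e) ~= 1" using 3 by simp
  ultimately show ?thesis using cz_ok by metis
 qed
qed

end

section \<open>Substitution of C^2 - 1 for Omega and the congruence modulo anticommutators\<close>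

locale dirac = cherednik y R Rp D c x for y :: "nat => 'e::euclidean_space" and R Rp D c x +
 fixes C :: "'e what_elt"
 assumes C: "C : centre (CW_hat R D)"
begin

definition DD :: "'e dirac" where "DD = Pe \<uplus> rh C"

lemma C_closed [simp]: "C : carrier CW"
 and C_comm: "f : carrier CW ==> C \<otimes>\<^bsub>CW\<^esub> f = f \<otimes>\<^bsub>CW\<^esub> C" using C by (auto simp: centre_def)

lemma DD_eq: "Dirac_C R Rp c y x C = DD" by (simp only: Dirac_C_def Let_def TA_eq pure_eq DD_def Pe_def)

lemma DD_closed [simp]: "DD : carrier TT.T" by (simp add: DD_def)

lemma rh_DD: "f : carrier CW ==> rh f \<bowtie> DD = DD \<bowtie> rh f"
proof -
 assume f: "f : carrier CW"
 have "rh f \<bowtie> rh C = rh C \<bowtie> rh f" using arg_cong[OF C_comm[OF f], of rh] f by simp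
 thus ?thesis using f by (simp add: DD_def TT.T.r_distr TT.T.l_distr rh_Pe)
qed

definition KC :: "'e what_elt" where "KC = C \<otimes>\<^bsub>CW\<^esub> C \<ominus>\<^bsub>CW\<^esub> \<one>\<^bsub>CW\<^esub>"
definition us :: "'e what_elt" where "us = single (\<one>\<^bsub>CR\<^esub>, uminus)"
text \<open>The value of zeta on the corresponding \<open>cz\<close>: C^2 - 1 is substituted for
  Omega and the generator of C_2 for w_0. It is central because both of these are.\<close>

definition zt :: "complex poly => complex poly => 'e what_elt" where
 "zt p q = (if uminus : W then peval CW KC p \<oplus>\<^bsub>CW\<^esub> us \<otimes>\<^bsub>CW\<^esub> peval CW KC q else peval CW KC p)"

definition good :: "'e cher => 'e what_elt => bool" where
 "good z k \<longleftrightarrow> z : centre AA & k : carrier CW & (\<exists>a\<in>carrier TT.T. TT.tn z \<one>\<^bsub>Cliff\<^esub> =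
   rh k \<uplus> (DD \<bowtie> a \<uplus> a \<bowtie> DD))"

lemma KC_closed [simp]: "KC : carrier CW" by (simp add: KC_def)

lemma KC_comm: "f : carrier CW ==> KC \<otimes>\<^bsub>CW\<^esub> f = f \<otimes>\<^bsub>CW\<^esub> KC"
proof -
 assume f: "f : carrier CW"
 have "C \<otimes>\<^bsub>CW\<^esub> C \<otimes>\<^bsub>CW\<^esub> f = C \<otimes>\<^bsub>CW\<^esub> (f \<otimes>\<^bsub>CW\<^esub> C)"
  unfolding C_comm[OF f, symmetric] by (rule CW.m_assoc[OF C_closed C_closed f])
 also have "... = (C \<otimes>\<^bsub>CW\<^esub> f) \<otimes>\<^bsub>CW\<^esub> C" by (rule CW.m_assoc[OF C_closed f C_closed, symmetric])
 also have "... = f \<otimes>\<^bsub>CW\<^esub> (C \<otimes>\<^bsub>CW\<^esub> C)" unfolding C_comm[OF f] by (rule CW.m_assoc[OF f C_closed C_closed])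
 finally show ?thesis using f by (simp add: KC_def a_minus_def CW.l_distr CW.r_distr CW.l_minus CW.r_minus)
qed

lemma um_Wh: "uminus : W ==> (\<one>\<^bsub>CR\<^esub>, uminus) : carrier Wh" by (simp add: Wh_carrier Pin_one)

lemma us_closed: "uminus : W ==> us : carrier CW" unfolding us_def CW_hat_def by (rule monoid.single_closed[OF monoid_Wh um_Wh])

lemma us_us: "uminus : W ==> us \<otimes>\<^bsub>CW\<^esub> us = \<one>\<^bsub>CW\<^esub>"
 unfolding us_def CW_hat_def monoid.single_mult[OF monoid_Wh] Wh_ops(1) monoid_alg_simps(2) Wh_ops(2)
 by (simp only: uminus_comp C.l_one C.one_closed)

lemma us_comm: "f : carrier CW ==> uminus : W ==> us \<otimes>\<^bsub>CW\<^esub> f = f \<otimes>\<^bsub>CW\<^esub> us" unfolding CW_hat_def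
proof (induction rule: monoid.monoid_alg_induct[OF monoid_Wh, consumes 1])
 case 1
 thus ?case using us_closed unfolding CW_hat_def[symmetric] by simp
next
 case (2 k g f)
 have c: "single g : carrier CW" "f : carrier CW" "us : carrier CW"
  using 2 monoid.single_closed[OF monoid_Wh 2(1)] us_closed by (simp_all add: CW_hat_def)
 obtain \<eta> s where g: "g = (\<eta>, s)" by (cases g)
 have e: "\<eta> : carrier CR" "s = id \<or> s = uminus" using 2(1) Pin_carrier by (auto simp: g Wh_carrier)
 have "us \<otimes>\<^bsub>CW\<^esub> single g = single g \<otimes>\<^bsub>CW\<^esub> us"
  unfolding us_def CW_hat_def monoid.single_mult[OF monoid_Wh] g Wh_ops(1) using e by auto
 thus ?case using 2(3)[OF 2(4)] c unfolding CW_hat_def[symmetric] by (simp add: CW.l_distr CW.r_distr CW.smult_mult_l CW.smult_mult_r)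
qed

lemma KC_peval_comm: "f : carrier CW ==> peval CW KC p \<otimes>\<^bsub>CW\<^esub> f = f \<otimes>\<^bsub>CW\<^esub> peval CW KC p"
proof (induction p)
 case (pCons a p)
 have "KC \<otimes>\<^bsub>CW\<^esub> peval CW KC p \<otimes>\<^bsub>CW\<^esub> f = f \<otimes>\<^bsub>CW\<^esub> (KC \<otimes>\<^bsub>CW\<^esub> peval CW KC p)"
 proof -
  have "KC \<otimes>\<^bsub>CW\<^esub> peval CW KC p \<otimes>\<^bsub>CW\<^esub> f = KC \<otimes>\<^bsub>CW\<^esub> f \<otimes>\<^bsub>CW\<^esub> peval CW KC p" using pCons by (simp add: CW.m_assoc)
  thus ?thesis using pCons by (simp add: KC_comm CW.m_assoc)
 qed
 thus ?case using pCons by (simp add: CW.peval_pCons CW.l_distr CW.r_distr CW.smult_mult_l CW.smult_mult_r)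
qed simp

lemma zt_closed [simp]: "zt p q : carrier CW" using us_closed by (simp add: zt_def)

lemma zt_centre: "zt p q : centre CW" unfolding centre_def
proof (intro CollectI conjI ballI)
 fix f assume f: "f : carrier CW"
 show "zt p q \<otimes>\<^bsub>CW\<^esub> f = f \<otimes>\<^bsub>CW\<^esub> zt p q"
 proof (cases "uminus : W")
  case True
  note u = us_closed[OF True]
  have "us \<otimes>\<^bsub>CW\<^esub> peval CW KC q \<otimes>\<^bsub>CW\<^esub> f = us \<otimes>\<^bsub>CW\<^esub> f \<otimes>\<^bsub>CW\<^esub> peval CW KC q"
   using f u by (simp add: CW.m_assoc KC_peval_comm)
  also have "... = f \<otimes>\<^bsub>CW\<^esub> (us \<otimes>\<^bsub>CW\<^esub> peval CW KC q)" using f u True by (simp add: us_comm CW.m_assoc)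
  finally show ?thesis using f u True by (simp add: zt_def CW.l_distr CW.r_distr KC_peval_comm)
 qed (simp add: zt_def KC_peval_comm f)
qed simp

lemma zt_add: "zt p q \<oplus>\<^bsub>CW\<^esub> zt p' q' = zt (p + p') (q + q')"
 using us_closed by (auto simp: zt_def CW.peval_add CW.r_distr CW.a_ac)

lemma zt_smult: "a \<odot>\<^bsub>CW\<^esub> zt p q = zt (Polynomial.smult a p) (Polynomial.smult a q)"
 using us_closed by (auto simp: zt_def CW.peval_smult CW.smult_r_distr CW.smult_mult_r)

lemma zt_mult: "zt p q \<otimes>\<^bsub>CW\<^esub> zt p' q' = zt (p * p' + (if uminus : W then q * q' else 0)) (p * q' + q * p')"
proof (cases "uminus : W")
 case True
 note g = us_closed[OF True]
 let ?P = "peval CW KC"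
 have c: "?P r : carrier CW" for r by simp
 have 1: "?P p \<otimes>\<^bsub>CW\<^esub> (us \<otimes>\<^bsub>CW\<^esub> ?P q') = us \<otimes>\<^bsub>CW\<^esub> ?P (p * q')"
  using KC_peval_comm[OF g, of p] g c by (simp add: CW.peval_mult CW.m_assoc[symmetric])
 have 2: "(us \<otimes>\<^bsub>CW\<^esub> ?P q) \<otimes>\<^bsub>CW\<^esub> ?P p' = us \<otimes>\<^bsub>CW\<^esub> ?P (q * p')"
  using g c by (simp add: CW.peval_mult CW.m_assoc)
 have 3: "(us \<otimes>\<^bsub>CW\<^esub> ?P q) \<otimes>\<^bsub>CW\<^esub> (us \<otimes>\<^bsub>CW\<^esub> ?P q') = ?P (q * q')"
 proof -
  have "(us \<otimes>\<^bsub>CW\<^esub> ?P q) \<otimes>\<^bsub>CW\<^esub> (us \<otimes>\<^bsub>CW\<^esub> ?P q') = us \<otimes>\<^bsub>CW\<^esub> (?P q \<otimes>\<^bsub>CW\<^esub> us) \<otimes>\<^bsub>CW\<^esub> ?P q'"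
   using g c by (simp add: CW.m_assoc)
  also have "... = (us \<otimes>\<^bsub>CW\<^esub> us) \<otimes>\<^bsub>CW\<^esub> (?P q \<otimes>\<^bsub>CW\<^esub> ?P q')"
   unfolding KC_peval_comm[OF g] using g c by (simp add: CW.m_assoc)
  finally show ?thesis using c by (simp add: us_us[OF True] CW.peval_mult)
 qed
 show ?thesis using True g c by (simp add: zt_def CW.l_distr CW.r_distr 1 2 3 CW.peval_add CW.a_ac CW.peval_mult[symmetric])
qed (simp add: zt_def CW.peval_mult)

lemma tn_central: "z : centre AA ==> t : carrier TT.T ==> TT.tn z \<one>\<^bsub>Cliff\<^esub> \<bowtie> t = t \<bowtie> TT.tn z \<one>\<^bsub>Cliff\<^esub>"
proof -
 assume z: "z : centre AA" and t: "t : carrier TT.T"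
 have zc: "z : carrier AA" using z by (simp add: centre_def)
 have S: "{TT.tn a b |a b. a : carrier AA & b : carrier Cliff} \<subseteq> carrier TT.T" by auto
 from t show ?thesis unfolding TT.tensor_span
 proof (induction rule: TT.T.lspan_induct_closed[OF S, consumes 1])
  case 1
  thus ?case using zc by simp
 next
  case (2 a b)
  thus ?case using zc by (simp add: TT.T.l_distr TT.T.r_distr)
 next
  case (3 k s)
  then obtain a b where s: "s = TT.tn a b" "a : carrier AA" "b : carrier Cliff" by auto
  have za: "z \<otimes>\<^bsub>AA\<^esub> a = a \<otimes>\<^bsub>AA\<^esub> z" using z s(2) unfolding centre_def by blast
  have "TT.tn z \<one>\<^bsub>Cliff\<^esub> \<bowtie> s = s \<bowtie> TT.tn z \<one>\<^bsub>Cliff\<^esub>"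
   unfolding s(1) TT.tn_mult[OF zc s(2) CK.one_closed s(3)] TT.tn_mult[OF s(2) zc s(3) CK.one_closed] za using s(3) by simp
  thus ?case using zc s by (simp add: TT.T.smult_mult_l TT.T.smult_mult_r)
 qed
qed

lemma good_add: "good z k ==> good z' k' ==> good (z \<oplus>\<^bsub>HH\<^esub> z') (k \<oplus>\<^bsub>CW\<^esub> k')"
proof -
 assume g: "good z k" "good z' k'"
 then obtain a a' where a: "a : carrier TT.T" "TT.tn z \<one>\<^bsub>Cliff\<^esub> = rh k \<uplus> (DD \<bowtie> a \<uplus> a \<bowtie> DD)"
  and a': "a' : carrier TT.T" "TT.tn z' \<one>\<^bsub>Cliff\<^esub> = rh k' \<uplus> (DD \<bowtie> a' \<uplus> a' \<bowtie> DD)"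
  unfolding good_def by blast
 have c: "z : centre AA" "z' : centre AA" "k : carrier CW" "k' : carrier CW" "z : carrier AA" "z' : carrier AA"
  using g by (auto simp: good_def centre_def)
 have "TT.tn (z \<oplus>\<^bsub>HH\<^esub> z') \<one>\<^bsub>Cliff\<^esub> = rh (k \<oplus>\<^bsub>CW\<^esub> k') \<uplus> (DD \<bowtie> (a \<uplus> a') \<uplus> (a \<uplus> a') \<bowtie> DD)"
  using TT.tn_add_l[OF c(5,6) CK.one_closed] a a' c(3,4) by (simp add: TT.T.l_distr TT.T.r_distr TT.T.a_ac)
 moreover have "z \<oplus>\<^bsub>HH\<^esub> z' : centre AA" using centre_subalg c unfolding is_subalg_def by blast
 ultimately show ?thesis unfolding good_def using a(1) a'(1) c by (intro conjI bexI[of _ "a \<uplus> a'"]) simp_all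
qed

lemma good_smult: "good z k ==> good (r \<cdot> z) (r \<odot>\<^bsub>CW\<^esub> k)"
proof -
 assume g: "good z k"
 then obtain a where a: "a : carrier TT.T" "TT.tn z \<one>\<^bsub>Cliff\<^esub> = rh k \<uplus> (DD \<bowtie> a \<uplus> a \<bowtie> DD)"
  unfolding good_def by blast
 have c: "z : centre AA" "k : carrier CW" "z : carrier AA" using g by (auto simp: good_def centre_def)
 have "TT.tn (r \<cdot> z) \<one>\<^bsub>Cliff\<^esub> = rh (r \<odot>\<^bsub>CW\<^esub> k) \<uplus> (DD \<bowtie> (r \<odot>\<^bsub>TT.T\<^esub> a) \<uplus> (r \<odot>\<^bsub>TT.T\<^esub> a) \<bowtie> DD)"
  using TT.tn_smult_l[OF c(3) CK.one_closed, of r] a c(2) by (simp add: TT.T.smult_r_distr TT.T.smult_mult_l TT.T.smult_mult_r)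
 moreover have "r \<cdot> z : centre AA" using centre_subalg c unfolding is_subalg_def by blast
 ultimately show ?thesis unfolding good_def using a(1) c by (intro conjI bexI[of _ "r \<odot>\<^bsub>TT.T\<^esub> a"]) simp_all
qed

text \<open>Both z (x) 1 and rho(k') commute with the element \<open>DD\<close>, so an
  anticommutator stays one after multiplication by either of them.\<close>

lemma good_mult: "good z k ==> good z' k' ==> good (z \<star> z') (k \<otimes>\<^bsub>CW\<^esub> k')"
proof -
 assume g: "good z k" "good z' k'"
 then obtain a a' where a: "a : carrier TT.T" "TT.tn z \<one>\<^bsub>Cliff\<^esub> = rh k \<uplus> (DD \<bowtie> a \<uplus> a \<bowtie> DD)"
  and a': "a' : carrier TT.T" "TT.tn z' \<one>\<^bsub>Cliff\<^esub> = rh k' \<uplus> (DD \<bowtie> a' \<uplus> a' \<bowtie> DD)"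
  unfolding good_def by blast
 have c: "z : centre AA" "z' : centre AA" "k : carrier CW" "k' : carrier CW" "z : carrier AA" "z' : carrier AA"
  using g by (auto simp: good_def centre_def)
 let ?Z = "TT.tn z \<one>\<^bsub>Cliff\<^esub>"
 \<comment> \<open>From z z' = z (rho(k') + {D, a'}) and z = rho(k) + {D, a}: the first summand
   absorbs {D, a'}, the second {D, a} rho(k').\<close>
 let ?b = "?Z \<bowtie> a' \<uplus> a \<bowtie> rh k'"
 have cl: "?Z : carrier TT.T" "rh k : carrier TT.T" "rh k' : carrier TT.T" using c by auto
 have ZD: "?Z \<bowtie> DD = DD \<bowtie> ?Z" using tn_central[OF c(1) DD_closed] .
 have kD: "rh k' \<bowtie> DD = DD \<bowtie> rh k'" by (rule rh_DD[OF c(4)])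
 have 1: "?Z \<bowtie> rh k' = rh (k \<otimes>\<^bsub>CW\<^esub> k') \<uplus> (DD \<bowtie> (a \<bowtie> rh k') \<uplus> (a \<bowtie> rh k') \<bowtie> DD)"
  unfolding a(2) using cl a(1) c by (simp add: TT.T.l_distr TT.T.m_assoc kD)
 have 2: "?Z \<bowtie> (DD \<bowtie> a') = DD \<bowtie> (?Z \<bowtie> a')"
  using ZD TT.T.m_assoc[OF cl(1) DD_closed a'(1)] TT.T.m_assoc[OF DD_closed cl(1) a'(1)] by simp
 have 3: "?Z \<bowtie> (a' \<bowtie> DD) = (?Z \<bowtie> a') \<bowtie> DD" using cl a' by (simp add: TT.T.m_assoc)
 have "TT.tn (z \<star> z') \<one>\<^bsub>Cliff\<^esub> = ?Z \<bowtie> TT.tn z' \<one>\<^bsub>Cliff\<^esub>"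
  using TT.tn_mult[OF c(5,6) CK.one_closed CK.one_closed] by simp
 also have "... = ?Z \<bowtie> rh k' \<uplus> (DD \<bowtie> (?Z \<bowtie> a') \<uplus> (?Z \<bowtie> a') \<bowtie> DD)"
  unfolding a'(2) 2[symmetric] 3[symmetric] using cl a'(1) by (simp only: TT.T.r_distr TT.T.a_closed TT.T.m_closed DD_closed)
 also have "... = rh (k \<otimes>\<^bsub>CW\<^esub> k') \<uplus> (DD \<bowtie> ?b \<uplus> ?b \<bowtie> DD)"
 proof -
  define Q where "Q = ?Z \<bowtie> a'"
  define S where "S = a \<bowtie> rh k'"
  have QS: "Q : carrier TT.T" "S : carrier TT.T" using cl a(1) a'(1) by (simp_all add: Q_def S_def)
  show ?thesis unfolding 1 Q_def[symmetric] S_def[symmetric] using QS c by (simp del: rh.mult add: TT.T.l_distr TT.T.r_distr TT.T.a_ac)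
 qed
 finally have "TT.tn (z \<star> z') \<one>\<^bsub>Cliff\<^esub> = ..." .
 moreover have "z \<star> z' : centre AA" using centre_subalg c unfolding is_subalg_def by blast
 ultimately show ?thesis unfolding good_def using a(1) a'(1) cl c by (intro conjI bexI[of _ ?b]) simp_all
qed

lemma good_one: "good \<one>\<^bsub>HH\<^esub> \<one>\<^bsub>CW\<^esub>"
proof -
 have "\<one>\<^bsub>HH\<^esub> : centre AA" using centre_subalg by (simp add: is_subalg_def)
 moreover have "TT.tn \<one>\<^bsub>HH\<^esub> \<one>\<^bsub>Cliff\<^esub> = \<one>\<^bsub>TT.T\<^esub>" using TT.tn_one by simp
 ultimately show ?thesis unfolding good_def by (intro conjI bexI[of _ "\<zero>\<^bsub>TT.T\<^esub>"]) simp_all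
qed

lemma good_um: "uminus : W ==> good (We uminus) us"
proof -
 assume u: "uminus : W"
 have "rh us = TT.tn (We uminus) \<one>\<^bsub>Cliff\<^esub>"
  unfolding us_def rh_single[OF um_Wh[OF u]] by (simp add: rg_def Pin_one cx_simps)
 thus ?thesis unfolding good_def using um_centre[OF u] us_closed[OF u] u by (intro conjI bexI[of _ "\<zero>\<^bsub>TT.T\<^esub>"]) simp_all
qed

text \<open>Since \<open>\<rho>(C)\<close> commutes with the Dirac element, completing the square shows
 \<open>\<Omega> = (C\<^sup>2 - 1) + \<DD>a + a\<DD>\<close> for \<open>a = \<DD>/2 - \<rho>(C)\<close>.\<close>

lemma good_Oe: "good Oe KC"
proof -
 let ?r = "rh C"
 have rc: "?r : carrier TT.T" by simp
 have DDr: "Pe = DD \<ominus>\<^bsub>TT.T\<^esub> ?r" by (simp add: DD_def a_minus_def TT.T.a_assoc TT.T.r_neg)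
 have rD: "?r \<bowtie> DD = DD \<bowtie> ?r" by (rule rh_DD) simp
 define a where "a = (1/2) \<odot>\<^bsub>TT.T\<^esub> DD \<ominus>\<^bsub>TT.T\<^esub> ?r"
 have ac: "a : carrier TT.T" by (simp add: a_def)
 have half: "(1/2) \<odot>\<^bsub>TT.T\<^esub> t \<uplus> (1/2) \<odot>\<^bsub>TT.T\<^esub> t = t" if "t : carrier TT.T" for t
  using TT.T.smult_l_distr[OF that, of "1/2" "1/2"] that by simp
 let ?D2 = "DD \<bowtie> DD" and ?Dr = "DD \<bowtie> ?r" and ?rr = "?r \<bowtie> ?r" and ?O = "TT.tn Oe \<one>\<^bsub>Cliff\<^esub>"
 have cl: "?D2 : carrier TT.T" "?Dr : carrier TT.T" "?rr : carrier TT.T" "?O : carrier TT.T" by simp_all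
 have Da: "DD \<bowtie> a = (1/2) \<odot>\<^bsub>TT.T\<^esub> ?D2 \<ominus>\<^bsub>TT.T\<^esub> ?Dr" "a \<bowtie> DD = (1/2) \<odot>\<^bsub>TT.T\<^esub> ?D2 \<ominus>\<^bsub>TT.T\<^esub> ?Dr"
  by (simp_all add: a_def a_minus_def TT.T.l_distr TT.T.r_distr TT.T.l_minus TT.T.r_minus TT.T.smult_mult_l TT.T.smult_mult_r rD)
 have "?O \<uplus> \<one>\<^bsub>TT.T\<^esub> = (DD \<ominus>\<^bsub>TT.T\<^esub> ?r) \<bowtie> (DD \<ominus>\<^bsub>TT.T\<^esub> ?r)"
  unfolding DDr[symmetric] by (rule Pe_square[symmetric])
 also have "... = ?D2 \<ominus>\<^bsub>TT.T\<^esub> ?Dr \<ominus>\<^bsub>TT.T\<^esub> ?Dr \<uplus> ?rr"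
  by (simp add: a_minus_def TT.T.l_distr TT.T.r_distr TT.T.l_minus TT.T.r_minus TT.T.minus_add rD TT.T.a_ac)
 finally have e: "?O \<uplus> \<one>\<^bsub>TT.T\<^esub> = ?D2 \<ominus>\<^bsub>TT.T\<^esub> ?Dr \<ominus>\<^bsub>TT.T\<^esub> ?Dr \<uplus> ?rr" .
 have "?O = ?O \<uplus> \<one>\<^bsub>TT.T\<^esub> \<ominus>\<^bsub>TT.T\<^esub> \<one>\<^bsub>TT.T\<^esub>"
  using cl by (simp add: a_minus_def TT.T.a_assoc TT.T.r_neg)
 also have "... = (?rr \<ominus>\<^bsub>TT.T\<^esub> \<one>\<^bsub>TT.T\<^esub>) \<uplus> ((((1/2) \<odot>\<^bsub>TT.T\<^esub> ?D2 \<uplus> (1/2) \<odot>\<^bsub>TT.T\<^esub> ?D2) \<ominus>\<^bsub>TT.T\<^esub> ?Dr) \<ominus>\<^bsub>TT.T\<^esub> ?Dr)"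
  unfolding e half[OF cl(1)] using cl by (simp add: a_minus_def TT.T.a_ac)
 also have "... = rh KC \<uplus> (DD \<bowtie> a \<uplus> a \<bowtie> DD)"
  unfolding Da KC_def using cl by (simp add: a_minus_def TT.T.a_ac)
 finally show ?thesis unfolding good_def using Oe_centre ac by auto
qed

lemma good_peval: "good (PO p) (peval CW KC p)"
proof (induction p)
 case 0
 show ?case using good_smult[OF good_one, of 0] by simp
next
 case (pCons a p)
 thus ?case using good_add[OF good_smult[OF good_one, of a] good_mult[OF good_Oe pCons(2)]] by (simp add: HK.peval_pCons CW.peval_pCons)
qed

lemma good_cz: "good (cz p q) (zt p q)" unfolding cz_def zt_def using good_peval good_add good_mult good_um by auto

text \<open>Uniqueness of normalised pairs makes \<open>cz p q\<close> |-> \<open>zt p q\<close> a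
  map; it is a homomorphism because sums, scalar multiples and products of both families follow the
  same formulas and preserve normalisation.\<close>

lemma centre_hom:
 assumes d2: "DIM('e) = 2 ==> centre_description R Rp D c y x"
 shows "\<exists>\<zeta>\<in>alg_hom (centre_alg AA) (centre_alg CW). \<forall>z\<in>centre AA. good z (\<zeta> z)"
proof -
 \<comment> \<open>A choice among presentations of z; \<open>cz_inj\<close> shows that the
   normalised presentation is the only one.\<close>
 define \<zeta> where "\<zeta> z = (SOME k. \<exists>p q. z = cz p q & okp p q & k = zt p q)" for z
 have \<zeta>: "\<exists>p q. z = cz p q & okp p q & \<zeta> z = zt p q" if z: "z : centre AA" for z
 proof -
  have "\<exists>p q. z = cz p q & okp p q" by (rule centre_form[OF _ z]) (rule d2)
  then obtain p q where "z = cz p q" "okp p q" by (elim exE conjE)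
  hence "\<exists>p' q'. z = cz p' q' & okp p' q' & zt p q = zt p' q'" by (intro exI[of _ p] exI[of _ q] conjI HOL.refl)
  thus ?thesis unfolding \<zeta>_def by (rule someI[where P = "%k. \<exists>p q. z = cz p q & okp p q & k = zt p q"])
 qed
 have \<zeta>c: "\<zeta> (cz p q) = zt p q" if "okp p q" for p q using \<zeta>[OF cz_centre, of p q] cz_inj that by metis
 have "\<zeta> : alg_hom (centre_alg AA) (centre_alg CW)" unfolding alg_hom_def ring_hom_def
 proof (intro CollectI conjI allI ballI impI Pi_I; (elim conjE)?)
  fix z assume "z : carrier (centre_alg AA)"
  hence "z : centre AA" by (simp add: centre_alg_def)
  from \<zeta>[OF this] obtain p q where z: "z = cz p q" "okp p q" by (elim exE conjE)
  show "\<zeta> z : carrier (centre_alg CW)" unfolding z(1) \<zeta>c[OF z(2)] by (simp add: centre_alg_def zt_centre)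
  show "\<zeta> (k \<odot>\<^bsub>centre_alg AA\<^esub> z) = k \<odot>\<^bsub>centre_alg CW\<^esub> \<zeta> z" for k
   using \<zeta>c[OF okp_closed(2)[OF z(2) z(2)], of k] \<zeta>c[OF z(2)] by (simp add: centre_alg_def z(1) cz_smult zt_smult)
  fix z' assume "z' : carrier (centre_alg AA)"
  hence "z' : centre AA" by (simp add: centre_alg_def)
  from \<zeta>[OF this] obtain p' q' where z': "z' = cz p' q'" "okp p' q'" by (elim exE conjE)
  show "\<zeta> (z \<oplus>\<^bsub>centre_alg AA\<^esub> z') = \<zeta> z \<oplus>\<^bsub>centre_alg CW\<^esub> \<zeta> z'"
   using \<zeta>c[OF okp_closed(1)[OF z(2) z'(2)]] \<zeta>c[OF z(2)] \<zeta>c[OF z'(2)]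
   by (simp add: centre_alg_def z(1) z'(1) cz_add zt_add)
  show "\<zeta> (z \<otimes>\<^bsub>centre_alg AA\<^esub> z') = \<zeta> z \<otimes>\<^bsub>centre_alg CW\<^esub> \<zeta> z'"
   using \<zeta>c[OF okp_closed(3)[OF z(2) z'(2)]] \<zeta>c[OF z(2)] \<zeta>c[OF z'(2)]
   by (simp add: centre_alg_def z(1) z'(1) cz_mult zt_mult)
 next
  have o: "okp 1 0" by (simp add: okp_def)
  have "\<one>\<^bsub>HH\<^esub> = cz 1 0" "\<one>\<^bsub>CW\<^esub> = zt 1 0"
   using us_closed by (simp_all add: cz_def zt_def HK.peval_1 CW.peval_1)
  thus "\<zeta> \<one>\<^bsub>centre_alg AA\<^esub> = \<one>\<^bsub>centre_alg CW\<^esub>" using \<zeta>c[OF o] by (simp add: centre_alg_def)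
 qed
 moreover have "good z (\<zeta> z)" if "z : centre AA" for z using \<zeta>[OF that] good_cz by auto
 ultimately show ?thesis by blast
qed

end

theorem theorem5p4:
  fixes R Rp D :: "('e::euclidean_space \<Rightarrow>\<^sub>L real) set"
    and c :: "('e \<Rightarrow>\<^sub>L real) \<Rightarrow> complex"
    and y :: "nat \<Rightarrow> 'e"
    and x :: "nat \<Rightarrow> 'e \<Rightarrow>\<^sub>L real"
    and C :: "'e what_elt"
  assumes "root_system R"
    and "positive_system R Rp D"
    and "W_invariant R Rp c"
    and "orthonormal_basis y"
    and "dual_basis y x"
    and "DIM('e) = 2 \<Longrightarrow> centre_description R Rp D c y x"
    and "admissible R D C"
  shows "\<exists>\<zeta> \<in> alg_hom (centre_alg (DAMA R Rp c y x)) (centre_alg (CW_hat R D)).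
    \<forall>z \<in> centre (DAMA R Rp c y x). \<exists>a \<in> carrier (A_Cliff R Rp c y x).
      pure R Rp c y x z \<one>\<^bsub>Cliff\<^esub> =
        rho R Rp c y x (\<zeta> z) \<oplus>\<^bsub>A_Cliff R Rp c y x\<^esub>
          ((Dirac_C R Rp c y x C \<otimes>\<^bsub>A_Cliff R Rp c y x\<^esub> a) \<oplus>\<^bsub>A_Cliff R Rp c y x\<^esub>
           (a \<otimes>\<^bsub>A_Cliff R Rp c y x\<^esub> Dirac_C R Rp c y x C))"
proof -
 interpret dirac y R Rp D c x C by unfold_locales (use assms in \<open>simp_all add: admissible_def\<close>)
 have "\<exists>\<zeta>\<in>alg_hom (centre_alg (DAMA R Rp c y x)) (centre_alg (CW_hat R D)). \<forall>z\<in>centre (DAMA R Rp c y x). good z (\<zeta> z)"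
  by (rule centre_hom) (rule assms(6))
 then obtain \<zeta> where \<zeta>: "\<zeta> : alg_hom (centre_alg (DAMA R Rp c y x)) (centre_alg (CW_hat R D))"
  "\<And>z. z : centre (DAMA R Rp c y x) ==> good z (\<zeta> z)" by blast
 show ?thesis unfolding TA_eq pure_eq DD_eq by (rule bexI[OF _ \<zeta>(1)]) (use \<zeta>(2) in \<open>auto simp: good_def\<close>)
qed

end
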